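(* Let $(b,c)$ be a uniformly transient (connected) graph over the countably infinite set $X$. Let $m$ be a measure on $X$ of full support with $m(X)<\infty$ and let $L=L_m^{(D)}$ be the operator associated to $Q_m^{(D)}$. Then the following statements hold: (a) The operators $e^{-tL}$, $t>0$, and $(L+\alpha)^{-1}$, $\alpha>0$, are trace class. (b) The spectrum of $L$ is purely discrete. (c) The infimum of the spectrum of $L$ is bounded below by $\dfrac{1}{C^2m(X)}$, where $C$ is a constant with $\|\varphi\|_\infty\le C\,\widetilde Q^{1/2}(\varphi)$ for all $\varphi\in C_c(X)$ (which exists by uniform transience). (d) The semigroups $e^{-tL}$, $t>0$, and the resolvents $(L+\alpha)^{-1}$, $\alpha>0$, are norm analytic and compact on all $\ell^p(X,m)$, $1\le p\le\infty$, and the spectra of the generators of $e^{-tL}$ on $\ell^p(X,m)$ agree for all $1\le p\le\infty$.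
   Context: $X$ is a countably infinite set, $C(X)$ the real-valued functions on $X$, $C_c(X)$ those with finite support, $\ell^\infty(X)$ the bounded ones, $\|f\|_\infty=\sup_X|f|$, and $C_0(X)$ is the closure of $C_c(X)$ with respect to $\|\cdot\|_\infty$. A graph $(b,c)$ over $X$ consists of a symmetric $b:X\times X\to[0,\infty)$ with zero diagonal and $\sum_{y}b(x,y)<\infty$ for all $x$, and an arbitrary $c:X\to[0,\infty)$. It is connected if for any two distinct $x,y\in X$ there are $x=x_0,\dots,x_n=y$ with $b(x_{i-1},x_i)>0$ for $i=1,\dots,n$. For $f\in C(X)$ put $\widetilde Q(f)=\frac12\sum_{x,y}b(x,y)|f(x)-f(y)|^2+\sum_x c(x)|f(x)|^2\in[0,\infty]$ and $\widetilde D=\{f\in C(X):\widetilde Q(f)<\infty\}$, with $\widetilde Q(f,g)$ the associated bilinear form on $\widetilde D$. For $o\in X$ put $\|f\|_o=(\widetilde Q(f)+|f(o)|^2)^{1/2}$; $\widetilde D_0$ is the closure of $C_c(X)$ in $\widetilde D$ with respect to $\|\cdot\|_o$ (independent of $o$ for connected graphs). A connected graph is uniformly transient if $\widetilde D_0\subseteq C_0(X)$; equivalently, there is $C\ge0$ with $\|\varphi\|_\infty\le C\widetilde Q^{1/2}(\varphi)$ for all $\varphi\in C_c(X)$. A measure $m$ of full support is given by $m:X\to(0,\infty)$ via $m(A)=\sum_{x\in A}m(x)$. $D(Q_m^{(D)})$ is the closure of $C_c(X)$ in $\widetilde D\cap\ell^2(X,m)$ with respect to $u\mapsto(\widetilde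 Q(u)+\|u\|_{\ell^2(X,m)}^2)^{1/2}$, and $Q_m^{(D)}$ is the restriction of $\widetilde Q$ to it. $L=L_m^{(D)}$ is the unique (non-negative) selfadjoint operator on $\ell^2(X,m)$ with $D(L)\subseteq D(Q_m^{(D)})$ and $\langle Lf,g\rangle=Q_m^{(D)}(f,g)$ for all $f\in D(L)$, $g\in D(Q_m^{(D)})$. The restrictions of $e^{-tL}$ and $(L+\alpha)^{-1}$ to $C_c(X)$ extend uniquely to bounded operators on $\ell^p(X,m)$, $1\le p<\infty$; on $\ell^\infty(X)$ (which is contained in $\ell^2(X,m)$ as $m(X)<\infty$) the operators are the restrictions of those on $\ell^2(X,m)$, equivalently the adjoints of those on $\ell^1(X,m)$, and the generator on $\ell^\infty$ is the adjoint of the generator on $\ell^1$. Purely discrete spectrum means that the spectrum consists of isolated eigenvalues of finite multiplicity. Norm analytic means analytic in the parameter ($t>0$, respectively $\alpha>0$) with respect to the operator norm. Spectra are taken after complexification. *)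

theory Defs
  imports "HOL-Analysis.Analysis"
begin

text \<open>
  The vertex set \<open>X\<close> is the universe of the type \<open>'a\<close>. Unbounded operators are represented by
  their graphs (sets of pairs); bounded operators on a space \<open>E\<close> are functions in \<open>E \<rightarrow>\<^sub>E E\<close>,
  i.e. fixed to be \<open>undefined\<close> off \<open>E\<close>, so that operators that agree on \<open>E\<close> are equal.
\<close>

section \<open>Function spaces\<close>

definition C_c :: "('a \<Rightarrow> real) set" where
  "C_c = {f. finite {x. f x \<noteq> 0}}"

definition closure_wrt ::
    "(('a \<Rightarrow> real) \<Rightarrow> real) \<Rightarrow> ('a \<Rightarrow> real) set \<Rightarrow> ('a \<Rightarrow> real) set \<Rightarrow> ('a \<Rightarrow> real) set" where
  "closure_wrt N V A = {f \<in> V. \<forall>\<epsilon>>0. \<exists>\<phi>\<in>A. N (\<lambda>x. f x - \<phi> x) < \<epsilon>}"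

definition linf :: "('a \<Rightarrow> 'k::real_normed_vector) set" where
  "linf = {f. bounded (range f)}"

definition sup_norm :: "('a \<Rightarrow> 'k::real_normed_vector) \<Rightarrow> real" where
  "sup_norm f = (SUP x. norm (f x))"

definition C_0 :: "('a \<Rightarrow> real) set" where
  "C_0 = closure_wrt sup_norm linf C_c"

text \<open>The spaces \<open>\<ell>\<^sup>p(X,m)\<close>, \<open>1 \<le> p \<le> \<infinity>\<close>, for real- as well as complex-valued functions.\<close>

definition lp :: "('a \<Rightarrow> real) \<Rightarrow> ennreal \<Rightarrow> ('a \<Rightarrow> 'k::real_normed_vector) set" where
  "lp m p = (if p = \<infinity> then linf
             else {f. (\<lambda>x. norm (f x) powr enn2real p * m x) summable_on UNIV})"

definition lp_norm :: "('a \<Rightarrow> real) \<Rightarrow> ennreal \<Rightarrow> ('a \<Rightarrow> 'k::real_normed_vector) \<Rightarrow> real" where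
  "lp_norm m p f = (if p = \<infinity> then sup_norm f
     else (\<Sum>\<^sub>\<infinity>x. norm (f x) powr enn2real p * m x) powr (1 / enn2real p))"

text \<open>The inner product of \<open>\<ell>\<^sup>2(X,m)\<close>, also the pairing between \<open>\<ell>\<^sup>1(X,m)\<close> and \<open>\<ell>\<^sup>\<infinity>(X)\<close>.\<close>

definition pairing :: "('a \<Rightarrow> real) \<Rightarrow> ('a \<Rightarrow> real) \<Rightarrow> ('a \<Rightarrow> real) \<Rightarrow> real" where
  "pairing m f g = (\<Sum>\<^sub>\<infinity>x. f x * g x * m x)"


section \<open>Graphs and their Dirichlet forms\<close>

definition weighted_graph :: "('a \<Rightarrow> 'a \<Rightarrow> real) \<Rightarrow> ('a \<Rightarrow> real) \<Rightarrow> bool" where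
  "weighted_graph b c \<longleftrightarrow>
     (\<forall>x y. 0 \<le> b x y) \<and> (\<forall>x y. b x y = b y x) \<and> (\<forall>x. b x x = 0) \<and>
     (\<forall>x. b x summable_on UNIV) \<and> (\<forall>x. 0 \<le> c x)"

definition graph_connected :: "('a \<Rightarrow> 'a \<Rightarrow> real) \<Rightarrow> bool" where
  "graph_connected b \<longleftrightarrow> (\<forall>x y. (\<lambda>u v. 0 < b u v)\<^sup>*\<^sup>* x y)"

definition energy :: "('a \<Rightarrow> 'a \<Rightarrow> real) \<Rightarrow> ('a \<Rightarrow> real) \<Rightarrow> ('a \<Rightarrow> real) \<Rightarrow> ennreal" where
  "energy b c f = (\<Sum>\<^sub>\<infinity>(x, y). ennreal (b x y * \<bar>f x - f y\<bar>\<^sup>2)) / 2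
                  + (\<Sum>\<^sub>\<infinity>x. ennreal (c x * \<bar>f x\<bar>\<^sup>2))"

definition energy_space :: "('a \<Rightarrow> 'a \<Rightarrow> real) \<Rightarrow> ('a \<Rightarrow> real) \<Rightarrow> ('a \<Rightarrow> real) set" where
  "energy_space b c = {f. energy b c f < \<infinity>}"

text \<open>Only meaningful on \<open>energy_space b c\<close>, where all the sums converge absolutely.\<close>

definition energy_form ::
    "('a \<Rightarrow> 'a \<Rightarrow> real) \<Rightarrow> ('a \<Rightarrow> real) \<Rightarrow> ('a \<Rightarrow> real) \<Rightarrow> ('a \<Rightarrow> real) \<Rightarrow> real" where
  "energy_form b c f g = (\<Sum>\<^sub>\<infinity>(x, y). b x y * (f x - f y) * (g x - g y)) / 2
                         + (\<Sum>\<^sub>\<infinity>x. c x * f x * g x)"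

definition energy_norm_at ::
    "('a \<Rightarrow> 'a \<Rightarrow> real) \<Rightarrow> ('a \<Rightarrow> real) \<Rightarrow> 'a \<Rightarrow> ('a \<Rightarrow> real) \<Rightarrow> real" where
  "energy_norm_at b c r f = sqrt (enn2real (energy b c f) + \<bar>f r\<bar>\<^sup>2)"

definition energy_space_0 ::
    "('a \<Rightarrow> 'a \<Rightarrow> real) \<Rightarrow> ('a \<Rightarrow> real) \<Rightarrow> 'a \<Rightarrow> ('a \<Rightarrow> real) set" where
  "energy_space_0 b c r = closure_wrt (energy_norm_at b c r) (energy_space b c) C_c"

text \<open>For a connected graph \<open>energy_space_0 b c r\<close> does not depend on the reference vertex \<open>r\<close>.\<close>

definition uniformly_transient :: "('a \<Rightarrow> 'a \<Rightarrow> real) \<Rightarrow> ('a \<Rightarrow> real) \<Rightarrow> bool" where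
  "uniformly_transient b c \<longleftrightarrow> graph_connected b \<and> (\<exists>r. energy_space_0 b c r \<subseteq> C_0)"

definition sup_energy_bound :: "('a \<Rightarrow> 'a \<Rightarrow> real) \<Rightarrow> ('a \<Rightarrow> real) \<Rightarrow> real \<Rightarrow> bool" where
  "sup_energy_bound b c C \<longleftrightarrow>
     0 \<le> C \<and> (\<forall>\<phi>\<in>C_c. sup_norm \<phi> \<le> C * sqrt (enn2real (energy b c \<phi>)))"

definition form_norm ::
    "('a \<Rightarrow> 'a \<Rightarrow> real) \<Rightarrow> ('a \<Rightarrow> real) \<Rightarrow> ('a \<Rightarrow> real) \<Rightarrow> ('a \<Rightarrow> real) \<Rightarrow> real" where
  "form_norm b c m u = sqrt (enn2real (energy b c u) + (lp_norm m 2 u)\<^sup>2)"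

text \<open>The domain of \<open>Q\<^sub>m\<^sup>(\<^sup>D\<^sup>)\<close>; the form itself is the restriction of \<open>energy_form b c\<close>.\<close>

definition dirichlet_form_domain ::
    "('a \<Rightarrow> 'a \<Rightarrow> real) \<Rightarrow> ('a \<Rightarrow> real) \<Rightarrow> ('a \<Rightarrow> real) \<Rightarrow> ('a \<Rightarrow> real) set" where
  "dirichlet_form_domain b c m =
     closure_wrt (form_norm b c m) (energy_space b c \<inter> lp m 2) C_c"


section \<open>Unbounded operators\<close>

text \<open>The graph of a (not necessarily bounded or closed) linear operator in \<open>\<ell>\<^sup>p(X,m)\<close>.\<close>

definition linear_operator ::
    "('a \<Rightarrow> real) \<Rightarrow> ennreal \<Rightarrow> (('a \<Rightarrow> real) \<times> ('a \<Rightarrow> real)) set \<Rightarrow> bool" where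
  "linear_operator m p A \<longleftrightarrow>
     A \<subseteq> lp m p \<times> lp m p \<and> single_valued A \<and> (\<lambda>x. 0, \<lambda>x. 0) \<in> A \<and>
     (\<forall>(f, g)\<in>A. \<forall>(f', g')\<in>A. \<forall>r s.
        (\<lambda>x. r * f x + s * f' x, \<lambda>x. r * g x + s * g' x) \<in> A)"

text \<open>
  The adjoint as an operator in \<open>\<ell>\<^sup>q(X,m)\<close>; used for operators in \<open>\<ell>\<^sup>2\<close> with \<open>q = 2\<close> and
  for operators in \<open>\<ell>\<^sup>1\<close> with \<open>q = \<infinity>\<close>.
\<close>

definition adjoint_operator ::
    "('a \<Rightarrow> real) \<Rightarrow> ennreal \<Rightarrow> (('a \<Rightarrow> real) \<times> ('a \<Rightarrow> real)) set
     \<Rightarrow> (('a \<Rightarrow> real) \<times> ('a \<Rightarrow> real)) set" where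
  "adjoint_operator m q A =
     {(f, g). f \<in> lp m q \<and> g \<in> lp m q \<and> (\<forall>(u, v)\<in>A. pairing m f v = pairing m g u)}"

definition selfadjoint ::
    "('a \<Rightarrow> real) \<Rightarrow> (('a \<Rightarrow> real) \<times> ('a \<Rightarrow> real)) set \<Rightarrow> bool" where
  "selfadjoint m A \<longleftrightarrow>
     linear_operator m 2 A \<and> closure_wrt (lp_norm m 2) (lp m 2) (Domain A) = lp m 2 \<and>
     adjoint_operator m 2 A = A"

definition dirichlet_operator ::
    "('a \<Rightarrow> 'a \<Rightarrow> real) \<Rightarrow> ('a \<Rightarrow> real) \<Rightarrow> ('a \<Rightarrow> real)
     \<Rightarrow> (('a \<Rightarrow> real) \<times> ('a \<Rightarrow> real)) set" where
  "dirichlet_operator b c m = (THE L.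
     selfadjoint m L \<and> (\<forall>(f, g)\<in>L. 0 \<le> pairing m g f) \<and>
     Domain L \<subseteq> dirichlet_form_domain b c m \<and>
     (\<forall>(f, g)\<in>L. \<forall>h\<in>dirichlet_form_domain b c m. pairing m g h = energy_form b c f h))"

definition complexification ::
    "(('a \<Rightarrow> real) \<times> ('a \<Rightarrow> real)) set \<Rightarrow> (('a \<Rightarrow> complex) \<times> ('a \<Rightarrow> complex)) set" where
  "complexification A = {(f, g). (Re \<circ> f, Re \<circ> g) \<in> A \<and> (Im \<circ> f, Im \<circ> g) \<in> A}"

text \<open>\<open>z\<close> is in the resolvent set iff \<open>z - A\<close> is a bijection from the domain of \<open>A\<close> onto
  \<open>\<ell>\<^sup>p(X,m)\<close> with bounded inverse.\<close>

definition resolvent_set ::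
    "('a \<Rightarrow> real) \<Rightarrow> ennreal \<Rightarrow> (('a \<Rightarrow> complex) \<times> ('a \<Rightarrow> complex)) set \<Rightarrow> complex set" where
  "resolvent_set m p A =
     {z. (\<forall>h\<in>lp m p. \<exists>!u. u \<in> A \<and> (\<lambda>x. z * fst u x - snd u x) = h) \<and>
         (\<exists>K. \<forall>(f, g)\<in>A. lp_norm m p f \<le> K * lp_norm m p (\<lambda>x. z * f x - g x))}"

text \<open>The spectrum of the complexification of an operator in the real space \<open>\<ell>\<^sup>p(X,m)\<close>.\<close>

definition spectrum ::
    "('a \<Rightarrow> real) \<Rightarrow> ennreal \<Rightarrow> (('a \<Rightarrow> real) \<times> ('a \<Rightarrow> real)) set \<Rightarrow> complex set" where
  "spectrum m p A = - resolvent_set m p (complexification A)"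

definition eigenspace ::
    "(('a \<Rightarrow> real) \<times> ('a \<Rightarrow> real)) set \<Rightarrow> complex \<Rightarrow> ('a \<Rightarrow> complex) set" where
  "eigenspace A z = {f. (f, \<lambda>x. z * f x) \<in> complexification A}"

definition purely_discrete_spectrum ::
    "('a \<Rightarrow> real) \<Rightarrow> ennreal \<Rightarrow> (('a \<Rightarrow> real) \<times> ('a \<Rightarrow> real)) set \<Rightarrow> bool" where
  "purely_discrete_spectrum m p A \<longleftrightarrow>
     (\<forall>z\<in>spectrum m p A.
        z isolated_in spectrum m p A \<and>
        (\<exists>f\<in>eigenspace A z. f \<noteq> (\<lambda>x. 0)) \<and>
        (\<exists>B. finite B \<and> (\<forall>f\<in>eigenspace A z. \<exists>k. f = (\<lambda>x. \<Sum>e\<in>B. k e * e x))))"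


section \<open>Bounded operators\<close>

definition bounded_operator ::
    "('a \<Rightarrow> real) \<Rightarrow> ennreal \<Rightarrow> (('a \<Rightarrow> real) \<Rightarrow> ('a \<Rightarrow> real)) \<Rightarrow> bool" where
  "bounded_operator m p T \<longleftrightarrow>
     T \<in> lp m p \<rightarrow>\<^sub>E lp m p \<and>
     (\<forall>f\<in>lp m p. \<forall>g\<in>lp m p. \<forall>r s.
        T (\<lambda>x. r * f x + s * g x) = (\<lambda>x. r * T f x + s * T g x)) \<and>
     (\<exists>K. \<forall>f\<in>lp m p. lp_norm m p (T f) \<le> K * lp_norm m p f)"

definition operator_norm ::
    "('a \<Rightarrow> real) \<Rightarrow> ennreal \<Rightarrow> (('a \<Rightarrow> real) \<Rightarrow> ('a \<Rightarrow> real)) \<Rightarrow> real" where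
  "operator_norm m p T = (SUP f\<in>{f \<in> lp m p. lp_norm m p f \<le> 1}. lp_norm m p (T f))"

definition compact_operator ::
    "('a \<Rightarrow> real) \<Rightarrow> ennreal \<Rightarrow> (('a \<Rightarrow> real) \<Rightarrow> ('a \<Rightarrow> real)) \<Rightarrow> bool" where
  "compact_operator m p T \<longleftrightarrow>
     bounded_operator m p T \<and>
     (\<forall>f :: nat \<Rightarrow> 'a \<Rightarrow> real.
        (\<forall>n. f n \<in> lp m p) \<and> (\<exists>K. \<forall>n. lp_norm m p (f n) \<le> K) \<longrightarrow>
        (\<exists>k g. strict_mono k \<and> g \<in> lp m p \<and>
           (\<lambda>n. lp_norm m p (\<lambda>x. T (f (k n)) x - g x)) \<longlonglongrightarrow> 0))"

text \<open>Local expansion into power series that converge in operator norm.\<close>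

definition norm_analytic_on ::
    "('a \<Rightarrow> real) \<Rightarrow> ennreal \<Rightarrow> real set \<Rightarrow> (real \<Rightarrow> ('a \<Rightarrow> real) \<Rightarrow> ('a \<Rightarrow> real)) \<Rightarrow> bool" where
  "norm_analytic_on m p I T \<longleftrightarrow>
     (\<forall>t\<in>I. bounded_operator m p (T t)) \<and>
     (\<forall>t\<in>I. \<exists>r>0. \<exists>A. (\<forall>n. bounded_operator m p (A n)) \<and>
        (\<forall>s\<in>I. \<bar>s - t\<bar> < r \<longrightarrow>
           (\<lambda>N. operator_norm m p (\<lambda>f x. T s f x - (\<Sum>n<N. (s - t) ^ n * A n f x)))
             \<longlonglongrightarrow> 0))"

definition orthonormal_basis :: "('a \<Rightarrow> real) \<Rightarrow> ('a \<Rightarrow> real) set \<Rightarrow> bool" where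
  "orthonormal_basis m E \<longleftrightarrow>
     E \<subseteq> lp m 2 \<and> (\<forall>e\<in>E. \<forall>e'\<in>E. pairing m e e' = (if e = e' then 1 else 0)) \<and>
     (\<forall>f\<in>lp m 2. (\<forall>e\<in>E. pairing m f e = 0) \<longrightarrow> f = (\<lambda>x. 0))"

definition positive_operator ::
    "('a \<Rightarrow> real) \<Rightarrow> (('a \<Rightarrow> real) \<Rightarrow> ('a \<Rightarrow> real)) \<Rightarrow> bool" where
  "positive_operator m T \<longleftrightarrow>
     bounded_operator m 2 T \<and>
     (\<forall>f\<in>lp m 2. \<forall>g\<in>lp m 2. pairing m (T f) g = pairing m f (T g)) \<and>
     (\<forall>f\<in>lp m 2. 0 \<le> pairing m (T f) f)"

text \<open>
  \<open>T\<close> is trace class iff \<open>\<bar>T\<bar>\<close> has finite trace, where \<open>\<bar>T\<bar>\<close> is the unique positive \<open>S\<close> with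
  \<open>S\<^sup>2 = T\<^sup>* T\<close>, i.e. \<open>\<langle>S f, S g\<rangle> = \<langle>T f, T g\<rangle>\<close> for all \<open>f, g\<close>. The trace of a positive operator
  does not depend on the orthonormal basis.
\<close>

definition trace_class ::
    "('a \<Rightarrow> real) \<Rightarrow> (('a \<Rightarrow> real) \<Rightarrow> ('a \<Rightarrow> real)) \<Rightarrow> bool" where
  "trace_class m T \<longleftrightarrow>
     bounded_operator m 2 T \<and>
     (\<exists>S. positive_operator m S \<and>
        (\<forall>f\<in>lp m 2. \<forall>g\<in>lp m 2. pairing m (S f) (S g) = pairing m (T f) (T g)) \<and>
        (\<exists>E. orthonormal_basis m E \<and> (\<lambda>e. pairing m (S e) e) summable_on E))"


section \<open>Semigroup, resolvents and their versions on \<open>\<ell>\<^sup>p\<close>\<close>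

definition c0_semigroup ::
    "('a \<Rightarrow> real) \<Rightarrow> ennreal \<Rightarrow> (real \<Rightarrow> ('a \<Rightarrow> real) \<Rightarrow> ('a \<Rightarrow> real)) \<Rightarrow> bool" where
  "c0_semigroup m p S \<longleftrightarrow>
     S \<in> extensional {0..} \<and>
     (\<forall>t\<ge>0. bounded_operator m p (S t)) \<and>
     (\<forall>f\<in>lp m p. S 0 f = f) \<and>
     (\<forall>s\<ge>0. \<forall>t\<ge>0. \<forall>f\<in>lp m p. S (s + t) f = S s (S t f)) \<and>
     (\<forall>f\<in>lp m p. ((\<lambda>t. lp_norm m p (\<lambda>x. S t f x - f x)) \<longlongrightarrow> 0) (at_right 0))"

definition generator ::
    "('a \<Rightarrow> real) \<Rightarrow> ennreal \<Rightarrow> (real \<Rightarrow> ('a \<Rightarrow> real) \<Rightarrow> ('a \<Rightarrow> real))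
     \<Rightarrow> (('a \<Rightarrow> real) \<times> ('a \<Rightarrow> real)) set" where
  "generator m p S =
     {(f, g). f \<in> lp m p \<and> g \<in> lp m p \<and>
        ((\<lambda>t. lp_norm m p (\<lambda>x. (S t f x - f x) / t - g x)) \<longlongrightarrow> 0) (at_right 0)}"

text \<open>\<open>exp_neg m L t\<close> is \<open>e\<^sup>-\<^sup>t\<^sup>L\<close> on \<open>\<ell>\<^sup>2(X,m)\<close>: the strongly continuous semigroup generated by
  \<open>-L\<close>.\<close>

definition exp_neg ::
    "('a \<Rightarrow> real) \<Rightarrow> (('a \<Rightarrow> real) \<times> ('a \<Rightarrow> real)) set
     \<Rightarrow> real \<Rightarrow> ('a \<Rightarrow> real) \<Rightarrow> ('a \<Rightarrow> real)" where
  "exp_neg m L =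
     (THE S. c0_semigroup m 2 S \<and> generator m 2 S = {(f, \<lambda>x. - g x) | f g. (f, g) \<in> L})"

text \<open>\<open>(L + \<alpha>)\<^sup>-\<^sup>1\<close> on \<open>\<ell>\<^sup>2(X,m)\<close>; the equation solved by \<open>f\<close> is \<open>L f + \<alpha> f = h\<close>.\<close>

definition resolvent ::
    "('a \<Rightarrow> real) \<Rightarrow> (('a \<Rightarrow> real) \<times> ('a \<Rightarrow> real)) set
     \<Rightarrow> real \<Rightarrow> ('a \<Rightarrow> real) \<Rightarrow> ('a \<Rightarrow> real)" where
  "resolvent m L \<alpha> = (\<lambda>h\<in>lp m 2. THE f. \<exists>g. (f, g) \<in> L \<and> (\<lambda>x. g x + \<alpha> * f x) = h)"

text \<open>The version on \<open>\<ell>\<^sup>p(X,m)\<close> of an operator on \<open>\<ell>\<^sup>2(X,m)\<close>, for finite \<open>m\<close>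
  (so that \<open>\<ell>\<^sup>\<infinity>\<close> is contained in \<open>\<ell>\<^sup>2\<close>).\<close>

definition on_lp ::
    "('a \<Rightarrow> real) \<Rightarrow> ennreal \<Rightarrow> (('a \<Rightarrow> real) \<Rightarrow> ('a \<Rightarrow> real))
     \<Rightarrow> ('a \<Rightarrow> real) \<Rightarrow> ('a \<Rightarrow> real)" where
  "on_lp m p T = (if p = \<infinity> then restrict T linf
                  else (THE S. bounded_operator m p S \<and> (\<forall>\<phi>\<in>C_c. S \<phi> = T \<phi>)))"

text \<open>On \<open>\<ell>\<^sup>\<infinity>\<close> the semigroup need not be strongly continuous, and its generator is by definition
  the adjoint of the generator on \<open>\<ell>\<^sup>1\<close>.\<close>

definition lp_generator ::
    "('a \<Rightarrow> real) \<Rightarrow> ennreal \<Rightarrow> (real \<Rightarrow> ('a \<Rightarrow> real) \<Rightarrow> ('a \<Rightarrow> real))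
     \<Rightarrow> (('a \<Rightarrow> real) \<times> ('a \<Rightarrow> real)) set" where
  "lp_generator m p S =
     (if p = \<infinity> then adjoint_operator m \<infinity> (generator m 1 (\<lambda>t. on_lp m 1 (S t)))
      else generator m p (\<lambda>t. on_lp m p (S t)))"

end

theory Submission
  imports Defs "HOL-Complex_Analysis.Great_Picard"
begin

text \<open>The inequality \<open>\<parallel>u\<parallel>\<^sub>\<infinity>\<^sup>2 \<le> C\<^sup>2 Q(u)\<close> extends to the form domain, and because \<open>m\<close> is finite it
  makes \<open>G = L\<^sup>-\<^sup>1\<close> a bounded map from \<open>\<ell>\<^sup>1\<close> to \<open>\<ell>\<^sup>\<infinity>\<close> whose norm is at most \<open>C\<^sup>2\<close>. If \<open>\<mu>\<^sub>e\<close> is the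
  eigenvalue of \<open>G\<close> at the normalized eigenfunction \<open>e\<close>, the same inequality applied to the finite
  sums \<open>\<Sum>\<^sub>e \<mu>\<^sub>e e(x) e\<close> gives \<open>\<Sum>\<^sub>e \<mu>\<^sub>e e(x)\<^sup>2 \<le> C\<^sup>2\<close>, and summing over \<open>x\<close> with weights \<open>m\<close> gives
  \<open>\<Sum>\<^sub>e \<mu>\<^sub>e \<le> C\<^sup>2 m(X)\<close>. So every function of \<open>L\<close> whose multiplier is bounded by a multiple of
  \<open>\<mu>\<close> (the semigroup and the resolvents among them) is trace class and has a bounded kernel. An
  operator with bounded kernel on a finite measure space is compact on all \<open>\<ell>\<^sup>p\<close> at once, with norms
  controlled by the bound of the kernel, which gives analyticity. As the semigroup is Markovian, it is
  strongly continuous on \<open>\<ell>\<^sup>p\<close> for finite \<open>p\<close>, with generator \<open>-G\<^sup>-\<^sup>1\<close>; its spectrum \<open>{-1/\<mu>\<^sub>e}\<close> does not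
  depend on \<open>p\<close> since all eigenfunctions are bounded.\<close>

text \<open>The analysis is reduced to numbers. Every \<open>lp m p\<close> with p >= 1 lies in
  \<open>L1\<close>, the eigenfunctions separate \<open>L1\<close>, and kernel operators map
  \<open>L1\<close> to bounded functions. So an operator identity on any of these spaces is checked
  one coefficient at a time, and a norm estimate becomes an estimate of a multiplier against \<mu>.
  The identity operator escapes this scheme, since its multiplier 1 is in general not bounded by a
  multiple of \<mu>: time 0 is set apart, powers and Riemann sums avoid it, and strong continuity at
  0 rests on the Markov property, which supplies the norm bounds that are uniform in time. The
  operator, its semigroup and their lp versions are definite descriptions, so each needs a
  uniqueness proof: an inclusion between selfadjoint operators is an equality, the generator
  determines the semigroup on the eigenfunctions, and a bounded operator is determined on a dense
  set. The resolvents precede L: minimization solves the weak equation for all \<alpha> >= 0 and all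
  right-hand sides in \<open>L1\<close>. Eigenfunctions are maximizers of a quadratic form,
  collected by Zorn's lemma.\<close>

section \<open>Dominated convergence and Fatou's lemma for unconditional sums\<close>

lemma summable_on_dominated:
  fixes f :: "'x \<Rightarrow> 'k::banach"
  assumes "h summable_on A" "\<And>x. x \<in> A \<Longrightarrow> norm (f x) \<le> h x"
  shows "f summable_on A" "(\<lambda>x. norm (f x)) summable_on A"
    "norm (infsum f A) \<le> infsum h A"
proof -
  show *: "(\<lambda>x. norm (f x)) summable_on A"
    by (rule Infinite_Sum.abs_summable_on_comparison_test'[OF assms])
  then show "f summable_on A" by (rule abs_summable_summable)
  then show "norm (infsum f A) \<le> infsum h A"
    using norm_infsum_le assms summable_iff_has_sum_infsum by metis
qed

text \<open>Outside a finite set carrying all but \<epsilon>/4 of the mass of \<open>h\<close> both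
  sums are small; on that set only a finite sum has to converge. The filter is arbitrary because the
  limits are taken along sequences, along \<open>at_right 0\<close> in time and along the finite
  subsets of the eigenbasis.\<close>

lemma infsum_dominated_tendsto:
  fixes f :: "'i \<Rightarrow> 'x \<Rightarrow> 'k::banach"
  assumes h: "h summable_on A"
    and dom: "eventually (\<lambda>i. \<forall>x\<in>A. norm (f i x) \<le> h x) F"
    and lim: "\<And>x. x \<in> A \<Longrightarrow> ((\<lambda>i. f i x) \<longlongrightarrow> g x) F"
  shows "((\<lambda>i. infsum (f i) A) \<longlongrightarrow> infsum g A) F"
\<comment> \<open>The bound on \<open>g\<close> is inherited from \<open>f\<close> through the
  limit, which requires a nontrivial filter; along \<open>bot\<close> everything converges.\<close>
proof (cases "F = bot")
  case False
  have g: "norm (g x) \<le> h x" if "x \<in> A" for x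
    by (rule tendsto_upperbound[OF tendsto_norm[OF lim[OF that]] _ False])
      (use dom that in \<open>auto elim: eventually_mono\<close>)
  show ?thesis
  proof (rule tendstoI)
    fix \<epsilon> :: real assume \<epsilon>: "0 < \<epsilon>"
    obtain S where S: "finite S" "S \<subseteq> A" "dist (sum h S) (infsum h A) \<le> \<epsilon> / 4"
      using infsum_finite_approximation[OF h, of "\<epsilon>/4"] \<epsilon> by auto
    have hS: "h summable_on S" "h summable_on (A - S)"
      using S h by (auto intro: summable_on_Diff)
    have tail: "infsum h (A - S) \<le> \<epsilon> / 4"
      using infsum_Diff[OF h hS(1) S(2)] S(1) order_trans[OF abs_ge_minus_self S(3)[unfolded dist_real_def]] by simp
    have split: "norm (infsum u A - sum u S) \<le> \<epsilon> / 4" if "\<forall>x\<in>A. norm (u x) \<le> h x" for u :: "'x \<Rightarrow> 'k"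
    proof -
      have u: "u summable_on A" by (rule summable_on_dominated(1)[OF h that[rule_format]])
      have "u summable_on S" using S by auto
      then have "infsum u (A - S) = infsum u A - sum u S"
        using infsum_Diff[OF u _ S(2)] S by simp
      moreover have "norm (infsum u (A - S)) \<le> infsum h (A - S)"
        by (rule summable_on_dominated(3)[OF hS(2) that[rule_format]]) simp
      ultimately show ?thesis using tail by simp
    qed
    have "((\<lambda>i. sum (f i) S) \<longlongrightarrow> sum g S) F"
      by (rule tendsto_sum) (use lim S in auto)
    then have "eventually (\<lambda>i. dist (sum (f i) S) (sum g S) < \<epsilon> / 4) F"
      using \<epsilon> by (auto dest!: tendstoD[where e = "\<epsilon>/4"])
    then show "eventually (\<lambda>i. dist (infsum (f i) A) (infsum g A) < \<epsilon>) F"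
      using dom
    proof eventually_elim
      case (elim i)
      have 1: "norm (infsum (f i) A - sum (f i) S) \<le> \<epsilon> / 4" by (rule split) (use elim in auto)
      have 2: "norm (infsum g A - sum g S) \<le> \<epsilon> / 4" by (rule split) (use g in auto)
      have "infsum (f i) A - infsum g A
          = (infsum (f i) A - sum (f i) S) + (sum (f i) S - sum g S) - (infsum g A - sum g S)"
        by simp
      moreover have "norm (u + v - w) \<le> norm u + norm v + norm w" for u v w :: 'k
        using norm_triangle_ineq4[of "u + v" w] norm_triangle_ineq[of u v] by linarith
      ultimately have "dist (infsum (f i) A) (infsum g A)
          \<le> norm (infsum (f i) A - sum (f i) S) + norm (sum (f i) S - sum g S) + norm (infsum g A - sum g S)"
        unfolding dist_norm by metis
      then show ?case using 1 2 elim \<epsilon> by (simp add: dist_norm)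
    qed
  qed
qed auto

lemma summable_on_finite_bound:
  fixes f :: "'x \<Rightarrow> real"
  assumes "\<And>x. x \<in> A \<Longrightarrow> 0 \<le> f x" "\<And>F. finite F \<Longrightarrow> F \<subseteq> A \<Longrightarrow> sum f F \<le> K"
  shows "f summable_on A" "infsum f A \<le> K"
proof -
  show s: "f summable_on A"
    by (rule nonneg_bdd_above_summable_on) (use assms in \<open>auto simp: bdd_above_def\<close>)
  show "infsum f A \<le> K"
    by (rule infsum_le_finite_sums[OF s]) (use assms in auto)
qed

text \<open>A finite partial sum of the limit is a limit of finite partial sums, each below the full
  sum. This is the source of the lower semicontinuity of the energy.\<close>

lemma summable_on_fatou:
  fixes f :: "nat \<Rightarrow> 'x \<Rightarrow> real"
  assumes nn: "\<And>n x. x \<in> A \<Longrightarrow> 0 \<le> f n x"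
    and sm: "\<And>n. f n summable_on A"
    and le: "eventually (\<lambda>n. infsum (f n) A \<le> K) sequentially"
    and lim: "\<And>x. x \<in> A \<Longrightarrow> (\<lambda>n. f n x) \<longlonglongrightarrow> g x"
  shows "g summable_on A" "infsum g A \<le> K"
proof -
  have nng: "0 \<le> g x" if "x \<in> A" for x
    by (rule LIMSEQ_le_const[OF lim[OF that]]) (use nn that in auto)
  have fin: "sum g F \<le> K" if F: "finite F" "F \<subseteq> A" for F
  proof (rule tendsto_upperbound)
    show "(\<lambda>n. sum (f n) F) \<longlonglongrightarrow> sum g F" by (rule tendsto_sum) (use lim F in auto)
    have "sum (f n) F \<le> infsum (f n) A" for n
      by (rule finite_sum_le_infsum) (use sm F nn in auto)
    then show "eventually (\<lambda>n. sum (f n) F \<le> K) sequentially"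
      using le by (auto elim!: eventually_mono intro: order_trans)
  qed auto
  show "g summable_on A" "infsum g A \<le> K"
    using summable_on_finite_bound[of A g K] nng fin by auto
qed

section \<open>Sequence spaces with finite total weight\<close>

lemma sup_norm_ge:
  assumes "f \<in> linf" shows "norm (f x) \<le> sup_norm f"
proof -
  have "bdd_above (range (\<lambda>x. norm (f x)))"
    using assms by (auto simp: linf_def bounded_iff bdd_above_def)
  then show ?thesis unfolding sup_norm_def by (rule cSUP_upper2) auto
qed

lemma sup_norm_le: "(\<And>x. norm (f x) \<le> K) \<Longrightarrow> sup_norm f \<le> K"
  unfolding sup_norm_def by (rule cSUP_least) auto

lemma linfI: "(\<And>x. norm (f x) \<le> K) \<Longrightarrow> f \<in> linf"
  by (auto simp: linf_def bounded_iff)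

lemma linfE: assumes "f \<in> linf" obtains K where "0 \<le> K" "\<And>x. norm (f x) \<le> K"
  using that[of "sup_norm f"] sup_norm_ge[OF assms] order_trans[OF norm_ge_zero sup_norm_ge[OF assms]]
  by blast

lemma one_le_2: "1 \<le> (2::ennreal)"
  by simp

locale finite_weights =
  fixes m :: "'a \<Rightarrow> real"
  assumes m_pos: "\<And>x. 0 < m x" and m_summable: "m summable_on UNIV"
begin

lemma m_nonneg [simp]: "0 \<le> m x"
  using m_pos[of x] by simp

definition total :: real where "total = infsum m UNIV"

lemma total_nonneg [simp]: "0 \<le> total"
  unfolding total_def by (rule infsum_nonneg) simp

text \<open>A \<open>powr\<close>-free form of \<open>lp m 1\<close> (see \<open>L1_lp1\<close>). As
  the total weight is finite, every \<open>lp m p\<close> with p >= 1 embeds into it, so one theory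
  of kernels and coefficients serves all exponents.\<close>

definition L1 :: "('a \<Rightarrow> 'k::real_normed_vector) set" where
  "L1 = {f. (\<lambda>x. norm (f x) * m x) summable_on UNIV}"

definition n1 :: "('a \<Rightarrow> 'k::real_normed_vector) \<Rightarrow> real" where
  "n1 f = (\<Sum>\<^sub>\<infinity>x. norm (f x) * m x)"

lemma n1_nonneg [simp]: "0 \<le> n1 f"
  unfolding n1_def by (rule infsum_nonneg) simp

lemma n1_point: "f \<in> L1 \<Longrightarrow> norm (f x) * m x \<le> n1 f"
  using finite_sum_le_infsum[of "\<lambda>x. norm (f x) * m x" UNIV "{x}"] by (simp add: L1_def n1_def)

lemma bounded_L1:
  assumes "\<And>x. norm (f x) \<le> K"
  shows "f \<in> L1" "n1 f \<le> K * total"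
proof -
  have s: "(\<lambda>x. K * m x) summable_on UNIV" by (intro summable_on_cmult_right m_summable)
  have "norm (norm (f x) * m x) \<le> K * m x" for x
    using assms[of x] by (simp add: mult_right_mono)
  note d = summable_on_dominated[OF s this]
  show "f \<in> L1" using d(1) by (simp add: L1_def)
  show "n1 f \<le> K * total"
    using d(3) by (simp add: n1_def total_def infsum_cmult_right' abs_le_iff)
qed

lemma linf_L1: "f \<in> linf \<Longrightarrow> f \<in> L1"
  by (metis linfE bounded_L1(1))

lemma L1_mono:
  assumes "g \<in> L1" "\<And>x. norm (f x) \<le> norm (g x)"
  shows "f \<in> L1" "n1 f \<le> n1 g"
proof -
  have "norm (norm (f x) * m x) \<le> norm (g x) * m x" for x
    using assms(2)[of x] by (simp add: mult_right_mono)
  note d = summable_on_dominated[OF assms(1)[unfolded L1_def mem_Collect_eq] this]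
  show "f \<in> L1" "n1 f \<le> n1 g"
    using d by (auto simp: L1_def n1_def abs_le_iff)
qed

lemma L1_add:
  assumes "f \<in> L1" "g \<in> L1"
  shows "(\<lambda>x. f x + g x) \<in> L1" "n1 (\<lambda>x. f x + g x) \<le> n1 f + n1 g"
proof -
  have s: "(\<lambda>x. norm (f x) * m x + norm (g x) * m x) summable_on UNIV"
    using assms by (auto simp: L1_def intro: summable_on_add)
  have "norm (norm (f x + g x) * m x) \<le> norm (f x) * m x + norm (g x) * m x" for x
    using norm_triangle_ineq[of "f x" "g x"]
    by (simp add: mult_right_mono flip: distrib_right)
  note d = summable_on_dominated[OF s this]
  show "(\<lambda>x. f x + g x) \<in> L1" using d(1) by (simp add: L1_def)
  show "n1 (\<lambda>x. f x + g x) \<le> n1 f + n1 g"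
    using d(3) assms by (simp add: n1_def L1_def infsum_add abs_le_iff)
qed

lemma L1_cmult:
  fixes f :: "'a \<Rightarrow> 'k::real_normed_field"
  assumes "f \<in> L1"
  shows "(\<lambda>x. a * f x) \<in> L1" "n1 (\<lambda>x. a * f x) = norm a * n1 f"
  using assms by (auto simp: L1_def n1_def norm_mult mult.assoc infsum_cmult_right'
      intro: summable_on_cmult_right)

lemma L1_diff:
  assumes "f \<in> L1" "g \<in> L1"
  shows "(\<lambda>x. f x - g x) \<in> L1" "n1 (\<lambda>x. f x - g x) \<le> n1 f + n1 g"
proof -
  have "(\<lambda>x. - g x) \<in> L1" "n1 (\<lambda>x. - g x) = n1 g"
    using assms by (simp_all add: L1_def n1_def)
  then show "(\<lambda>x. f x - g x) \<in> L1" "n1 (\<lambda>x. f x - g x) \<le> n1 f + n1 g"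
    using L1_add[of f "\<lambda>x. - g x"] assms by auto
qed

lemma lp_inf [simp]: "lp m top = linf" "lp_norm m top f = sup_norm f"
  by (simp_all add: lp_def lp_norm_def)

lemma lp_finite:
  assumes "p \<noteq> \<infinity>"
  shows "f \<in> lp m p \<longleftrightarrow> (\<lambda>x. norm (f x) powr enn2real p * m x) summable_on UNIV"
    "lp_norm m p f = (\<Sum>\<^sub>\<infinity>x. norm (f x) powr enn2real p * m x) powr (1 / enn2real p)"
  using assms by (auto simp: lp_def lp_norm_def)

lemma enn2real_ge_1: "1 \<le> p \<Longrightarrow> p \<noteq> \<infinity> \<Longrightarrow> 1 \<le> enn2real p"
  by (metis enn2real_1 enn2real_mono infinity_ennreal_def top.not_eq_extremum)

lemma sup_norm_nonneg: "f \<in> linf \<Longrightarrow> 0 \<le> sup_norm f"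
  by (rule order_trans[OF norm_ge_zero sup_norm_ge])

lemma lp_norm_nonneg: "f \<in> lp m p \<Longrightarrow> 0 \<le> lp_norm m p f"
  by (cases "p = \<infinity>") (auto simp: lp_finite sup_norm_nonneg)

lemma lp_norm_powr:
  assumes "1 \<le> p" "p \<noteq> \<infinity>"
  shows "lp_norm m p f powr enn2real p = (\<Sum>\<^sub>\<infinity>x. norm (f x) powr enn2real p * m x)"
proof -
  have "0 \<le> (\<Sum>\<^sub>\<infinity>x. norm (f x) powr enn2real p * m x)" by (rule infsum_nonneg) simp
  then show ?thesis
    using enn2real_ge_1[OF assms] by (simp add: lp_finite[OF assms(2)] powr_powr)
qed

lemma lp_norm_leI:
  assumes "1 \<le> p" "p \<noteq> \<infinity>" "0 \<le> K" "(\<Sum>\<^sub>\<infinity>x. norm (f x) powr enn2real p * m x) \<le> K powr enn2real p"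
  shows "lp_norm m p f \<le> K"
proof -
  have "0 \<le> (\<Sum>\<^sub>\<infinity>x. norm (f x) powr enn2real p * m x)" by (rule infsum_nonneg) simp
  then have "lp_norm m p f \<le> (K powr enn2real p) powr (1 / enn2real p)"
    unfolding lp_finite[OF assms(2)] by (intro powr_mono2) (use assms in auto)
  then show ?thesis using assms enn2real_ge_1[OF assms(1,2)] by (simp add: powr_powr)
qed

lemma lp_mono:
  assumes p: "1 \<le> p" and g: "g \<in> lp m p" and le: "\<And>x. norm (f x) \<le> norm (g x)"
  shows "f \<in> lp m p" "lp_norm m p f \<le> lp_norm m p g"
proof -
  have "f \<in> lp m p \<and> lp_norm m p f \<le> lp_norm m p g"
  proof (cases "p = \<infinity>")
    case True
    then have "norm (f x) \<le> sup_norm g" for x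
      using g le[of x] sup_norm_ge[of g x] by simp
    then show ?thesis using True by (auto intro: linfI sup_norm_le)
  next
    case False
    note p1 = enn2real_ge_1[OF p False]
    have "norm (norm (f x) powr enn2real p * m x) \<le> norm (g x) powr enn2real p * m x" for x
      using le[of x] p1 by (simp add: mult_right_mono powr_mono2)
    note d = summable_on_dominated[OF g[unfolded lp_finite[OF False]] this]
    have "(\<Sum>\<^sub>\<infinity>x. norm (f x) powr enn2real p * m x) \<le> lp_norm m p g powr enn2real p"
      unfolding lp_norm_powr[OF p False] using d(3) by (simp add: abs_le_iff)
    then have "lp_norm m p f \<le> lp_norm m p g"
      by (intro lp_norm_leI p False lp_norm_nonneg g)
    then show ?thesis using d(1) lp_finite(1)[OF False] by blast
  qed
  then show "f \<in> lp m p" "lp_norm m p f \<le> lp_norm m p g" by auto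
qed

lemma lp_norm_cong: "(\<And>x. norm (f x) = norm (g x)) \<Longrightarrow> lp_norm m p f = lp_norm m p g"
  by (simp add: lp_norm_def sup_norm_def)

text \<open>The factor \<open>total + 1\<close> works for all exponents: it is at least 1, which
  covers the supremum norm, and its r-th power dominates \<open>total\<close> for every r >=
  1.\<close>

lemma bounded_lp:
  assumes p: "1 \<le> p" and K: "\<And>x. norm (f x) \<le> K"
  shows "f \<in> lp m p" "lp_norm m p f \<le> (total + 1) * K"
proof -
  have K0: "0 \<le> K" by (rule order_trans[OF norm_ge_zero K])
  have "f \<in> lp m p \<and> lp_norm m p f \<le> (total + 1) * K"
  proof (cases "p = \<infinity>")
    case True
    have "sup_norm f \<le> K" by (rule sup_norm_le[OF K])
    also have "\<dots> \<le> (total + 1) * K" using K0 by (simp add: distrib_right)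
    finally show ?thesis using True linfI[OF K] by simp
  next
    case False
    note p1 = enn2real_ge_1[OF p False]
    have s: "(\<lambda>x. K powr enn2real p * m x) summable_on UNIV"
      by (intro summable_on_cmult_right m_summable)
    have "norm (norm (f x) powr enn2real p * m x) \<le> K powr enn2real p * m x" for x
      using K[of x] p1 by (simp add: mult_right_mono powr_mono2)
    note d = summable_on_dominated[OF s this]
    have t: "total \<le> (total + 1) powr enn2real p"
    proof -
      have "total \<le> (total + 1) powr 1" by simp
      also have "\<dots> \<le> (total + 1) powr enn2real p" by (rule powr_mono) (use p1 in auto)
      finally show ?thesis .
    qed
    have "(\<Sum>\<^sub>\<infinity>x. norm (f x) powr enn2real p * m x) \<le> K powr enn2real p * total"
      using d(3) by (simp add: abs_le_iff infsum_cmult_right' total_def)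
    also have "\<dots> \<le> ((total + 1) * K) powr enn2real p"
      using mult_right_mono[OF t, of "K powr enn2real p"] K0 by (simp add: powr_mult mult.commute)
    finally have "lp_norm m p f \<le> (total + 1) * K"
      by (intro lp_norm_leI p False) (use K0 in auto)
    then show ?thesis using d(1) lp_finite(1)[OF False] by blast
  qed
  then show "f \<in> lp m p" "lp_norm m p f \<le> (total + 1) * K" by auto
qed

lemma linf_lp: "1 \<le> p \<Longrightarrow> f \<in> linf \<Longrightarrow> f \<in> lp m p"
  by (metis linfE bounded_lp(1))

text \<open>If t exceeds s, then t = t^r t^(1-r) \<le> t^r s^(1-r). The free parameter s is tuned
  later: with s a norm the bound takes the role of Hoelder's inequality, with s a root of a kernel
  average that of Jensen's.\<close>

lemma le_add_powr:
  fixes s t r :: real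
  assumes "0 < s" "0 \<le> t" "1 \<le> r"
  shows "t \<le> s + t powr r * s powr (1 - r)"
proof (cases "t \<le> s")
  case True
  then show ?thesis by (smt (verit) powr_ge_zero mult_nonneg_nonneg)
next
  case False
  then have "s powr (r - 1) \<le> t powr (r - 1)" using assms by (intro powr_mono2) auto
  then have "t * s powr (r - 1) \<le> t powr r"
    using False assms by (simp add: powr_diff divide_simps mult.commute split: if_splits)
  then have "t \<le> t powr r * s powr (1 - r)"
    using assms by (simp add: powr_diff field_simps)
  then show ?thesis using assms by simp
qed

lemma lp_L1:
  assumes p: "1 \<le> p" and f: "f \<in> lp m p"
  shows "f \<in> L1" "n1 f \<le> (total + 1) * lp_norm m p f"
proof -
  have "f \<in> L1 \<and> n1 f \<le> (total + 1) * lp_norm m p f"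
  proof (cases "p = \<infinity>")
    case True
    then have "f \<in> linf" using f by simp
    then have "n1 f \<le> sup_norm f * total" "f \<in> L1"
      using bounded_L1[of f "sup_norm f"] sup_norm_ge[of f] by auto
    then show ?thesis
      using True sup_norm_nonneg[OF \<open>f \<in> linf\<close>] by (simp add: algebra_simps)
  next
    case False
    define r where "r = enn2real p"
    define N where "N = lp_norm m p f"
    have r: "1 \<le> r" using enn2real_ge_1[OF p False] by (simp add: r_def)
    have N0: "0 \<le> N" using lp_norm_nonneg[OF f] by (simp add: N_def)
    have S: "(\<lambda>x. norm (f x) powr r * m x) summable_on UNIV"
      using f lp_finite(1)[OF False] unfolding r_def by blast
    have Nr: "N powr r = (\<Sum>\<^sub>\<infinity>x. norm (f x) powr r * m x)"
      using lp_norm_powr[OF p False] by (simp add: r_def N_def)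
    show ?thesis
    proof (cases "N = 0")
      case True
      then have "(\<Sum>\<^sub>\<infinity>x. norm (f x) powr r * m x) \<le> 0" using Nr by simp
      then have "norm (f x) powr r * m x = 0" for x
        by (rule nonneg_infsum_le_0D[OF _ S]) auto
      then have "f x = 0" for x using m_pos[of x] by (metis less_irrefl mult_eq_0_iff norm_eq_zero powr_eq_0_iff)
      then show ?thesis using True by (simp add: L1_def n1_def N_def[symmetric])
    next
      case False
      then have N: "0 < N" using N0 by simp
      \<comment> \<open>The parameter of \<open>le_add_powr\<close> is the norm N itself; then the
        two parts of the majorant sum to N times \<open>total\<close> and to N^(1-r) N^r =
        N.\<close>
      have s: "(\<lambda>x. N * m x + N powr (1 - r) * (norm (f x) powr r * m x)) summable_on UNIV"
        by (intro summable_on_add summable_on_cmult_right m_summable S)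
      have "norm (norm (f x) * m x) \<le> N * m x + N powr (1 - r) * (norm (f x) powr r * m x)" for x
        using mult_right_mono[OF le_add_powr[OF N norm_ge_zero r, of "f x"] m_nonneg[of x]]
        by (simp add: algebra_simps)
      note d = summable_on_dominated[OF s this]
      have "infsum (\<lambda>x. N * m x + N powr (1 - r) * (norm (f x) powr r * m x)) UNIV
          = N * total + N powr (1 - r) * N powr r"
        using S m_summable
        by (simp add: infsum_add summable_on_cmult_right infsum_cmult_right' total_def Nr)
      also have "\<dots> = (total + 1) * N"
        using N by (simp add: distrib_right flip: powr_add)
      finally show ?thesis using d by (simp add: L1_def n1_def N_def abs_le_iff)
    qed
  qed
  then show "f \<in> L1" "n1 f \<le> (total + 1) * lp_norm m p f" by auto
qed

lemma lp_point:
  assumes "1 \<le> p" "f \<in> lp m p"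
  shows "norm (f x) \<le> (total + 1) / m x * lp_norm m p f"
proof -
  have "norm (f x) * m x \<le> (total + 1) * lp_norm m p f"
    by (rule order_trans[OF n1_point[OF lp_L1(1)[OF assms]] lp_L1(2)[OF assms]])
  then show ?thesis using m_pos[of x] by (simp add: field_simps)
qed

text \<open>The bound |a+b|^r \<le> (2 max(|a|,|b|))^r \<le> 2^r (|a|^r + |b|^r) costs one factor 2,
  and estimating both r-th powers by that of the sum of the norms costs another. A constant free of
  p is all that the limit arguments require.\<close>

lemma lp_add:
  assumes p: "1 \<le> p" and f: "f \<in> lp m p" and g: "g \<in> lp m p"
  shows "(\<lambda>x. f x + g x) \<in> lp m p"
    "lp_norm m p (\<lambda>x. f x + g x) \<le> 4 * (lp_norm m p f + lp_norm m p g)"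
proof -
  note nn = lp_norm_nonneg[OF f] lp_norm_nonneg[OF g]
  have "(\<lambda>x. f x + g x) \<in> lp m p \<and>
    lp_norm m p (\<lambda>x. f x + g x) \<le> 4 * (lp_norm m p f + lp_norm m p g)"
  proof (cases "p = \<infinity>")
    case True
    then have "norm (f x + g x) \<le> sup_norm f + sup_norm g" for x
      using f g norm_triangle_ineq[of "f x" "g x"] sup_norm_ge[of f x] sup_norm_ge[of g x] by simp
    note this[THEN linfI] sup_norm_le[of "\<lambda>x. f x + g x", OF this]
    then show ?thesis using True nn by simp
  next
    case False
    define r where "r = enn2real p"
    have r: "1 \<le> r" using enn2real_ge_1[OF p False] by (simp add: r_def)
    have S: "(\<lambda>x. norm (f x) powr r * m x) summable_on UNIV" "(\<lambda>x. norm (g x) powr r * m x) summable_on UNIV"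
      using f g lp_finite(1)[OF False] unfolding r_def by blast+
    define N where "N = lp_norm m p f + lp_norm m p g"
    have N0: "0 \<le> N" using nn by (simp add: N_def)
    have pw: "norm (a + b) powr r \<le> 2 powr r * (norm a powr r + norm b powr r)" for a b :: 'b
    proof -
      have "norm (a + b) \<le> 2 * max (norm a) (norm b)" using norm_triangle_ineq[of a b] by simp
      then have "norm (a + b) powr r \<le> (2 * max (norm a) (norm b)) powr r"
        using r by (intro powr_mono2) auto
      also have "\<dots> = 2 powr r * max (norm a) (norm b) powr r" by (simp add: powr_mult)
      also have "\<dots> \<le> 2 powr r * (norm a powr r + norm b powr r)"
        by (intro mult_left_mono) (auto simp: max_def)
      finally show ?thesis .
    qed
    have s: "(\<lambda>x. 2 powr r * (norm (f x) powr r * m x + norm (g x) powr r * m x)) summable_on UNIV"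
      by (intro summable_on_add summable_on_cmult_right S)
    have "norm (norm (f x + g x) powr r * m x)
        \<le> 2 powr r * (norm (f x) powr r * m x + norm (g x) powr r * m x)" for x
      using mult_right_mono[OF pw[of "f x" "g x"] m_nonneg[of x]] by (simp add: algebra_simps)
    note d = summable_on_dominated[OF s this]
    have "infsum (\<lambda>x. 2 powr r * (norm (f x) powr r * m x + norm (g x) powr r * m x)) UNIV
        = 2 powr r * (lp_norm m p f powr r + lp_norm m p g powr r)"
      using S lp_norm_powr[OF p False, of f] lp_norm_powr[OF p False, of g]
      by (simp add: infsum_add infsum_cmult_right' r_def)
    also have "\<dots> \<le> 2 powr r * (N powr r + N powr r)"
      unfolding N_def using nn r by (intro mult_left_mono add_mono powr_mono2) auto
    also have "\<dots> = 2 powr r * (2 powr 1 * N powr r)" by simp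
    also have "\<dots> \<le> 2 powr r * (2 powr r * N powr r)"
      by (intro mult_left_mono mult_right_mono powr_mono r) auto
    also have "\<dots> = (4 * N) powr r"
      using N0 powr_mult[of 2 2 r] by (simp add: powr_mult)
    finally have "lp_norm m p (\<lambda>x. f x + g x) \<le> 4 * N"
      using d(3) N0 by (intro lp_norm_leI p False) (auto simp: r_def abs_le_iff)
    then show ?thesis using d(1) lp_finite(1)[OF False] by (auto simp: N_def r_def)
  qed
  then show "(\<lambda>x. f x + g x) \<in> lp m p"
    "lp_norm m p (\<lambda>x. f x + g x) \<le> 4 * (lp_norm m p f + lp_norm m p g)" by auto
qed

lemma lp_cmult:
  fixes f :: "'a \<Rightarrow> 'k::real_normed_field"
  assumes p: "1 \<le> p" and f: "f \<in> lp m p"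
  shows "(\<lambda>x. a * f x) \<in> lp m p" "lp_norm m p (\<lambda>x. a * f x) = norm a * lp_norm m p f"
proof -
  have *: "(\<lambda>x. a * f x) \<in> lp m p \<and> lp_norm m p (\<lambda>x. a * f x) \<le> norm a * lp_norm m p f"
    if f: "f \<in> lp m p" for a and f :: "'a \<Rightarrow> 'k"
  proof (cases "p = \<infinity>")
    case True
    then have "norm (a * f x) \<le> norm a * sup_norm f" for x
      using f sup_norm_ge[of f x] by (simp add: norm_mult mult_left_mono)
    note this[THEN linfI] sup_norm_le[of "\<lambda>x. a * f x", OF this]
    then show ?thesis using True by simp
  next
    case False
    have eq: "norm (a * f x) powr enn2real p * m x = norm a powr enn2real p * (norm (f x) powr enn2real p * m x)" for x
      by (simp add: norm_mult powr_mult)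
    have "lp_norm m p (\<lambda>x. a * f x) \<le> norm a * lp_norm m p f"
      by (rule lp_norm_leI[OF p False])
        (use lp_norm_powr[OF p False, of f] lp_norm_nonneg[OF f] in \<open>auto simp: eq infsum_cmult_right' powr_mult\<close>)
    moreover have "(\<lambda>x. a * f x) \<in> lp m p"
      using f unfolding lp_finite[OF False] eq by (intro summable_on_cmult_right)
    ultimately show ?thesis by simp
  qed
  show 1: "(\<lambda>x. a * f x) \<in> lp m p" using *[OF f] by simp
  show "lp_norm m p (\<lambda>x. a * f x) = norm a * lp_norm m p f"
  proof (cases "a = 0")
    case True
    have "norm (0::'k) \<le> 0" by simp
    then have "lp_norm m p (\<lambda>x::'a. 0::'k) \<le> (total + 1) * 0" "(\<lambda>x::'a. 0::'k) \<in> lp m p"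
      using bounded_lp[OF p, of "\<lambda>x. 0::'k" 0] by auto
    then show ?thesis using True lp_norm_nonneg[of "\<lambda>x::'a. 0::'k" p] by simp
  next
    case False
    \<comment> \<open>The reverse inequality is the one already proved, for the factor
      \<open>inverse a\<close> and the function a f.\<close>
    have "lp_norm m p f \<le> norm (inverse a) * lp_norm m p (\<lambda>x. a * f x)"
      using *[OF 1, of "inverse a"] False by (simp flip: mult.assoc)
    then have "norm a * lp_norm m p f \<le> lp_norm m p (\<lambda>x. a * f x)"
      using False by (simp add: norm_divide field_simps)
    then show ?thesis using *[OF f, of a] by simp
  qed
qed

lemma lp_zero: "1 \<le> p \<Longrightarrow> (\<lambda>x. 0::'k::real_normed_field) \<in> lp m p"
  "1 \<le> p \<Longrightarrow> lp_norm m p (\<lambda>x. 0::'k) = 0"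
  using bounded_lp(1)[of p "\<lambda>x. 0::'k" 0] lp_cmult(2)[of p "\<lambda>x. 0::'k" 0] by auto

lemma lp_diff:
  fixes f :: "'a \<Rightarrow> 'k::real_normed_field"
  assumes p: "1 \<le> p" and f: "f \<in> lp m p" and g: "g \<in> lp m p"
  shows "(\<lambda>x. f x - g x) \<in> lp m p"
    "lp_norm m p (\<lambda>x. f x - g x) \<le> 4 * (lp_norm m p f + lp_norm m p g)"
  using lp_add[OF p f lp_cmult(1)[OF p g, of "-1"]] lp_cmult(2)[OF p g, of "-1"] by auto

lemma lp_comb:
  fixes f :: "'a \<Rightarrow> 'k::real_normed_field"
  assumes p: "1 \<le> p" and f: "f \<in> lp m p" and g: "g \<in> lp m p"
  shows "(\<lambda>x. r * f x + s * g x) \<in> lp m p"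
  by (intro lp_add lp_cmult assms)

lemma lp_sum:
  fixes f :: "'i \<Rightarrow> 'a \<Rightarrow> 'k::real_normed_field"
  assumes p: "1 \<le> p" and "\<And>i. i \<in> I \<Longrightarrow> f i \<in> lp m p"
  shows "(\<lambda>x. \<Sum>i\<in>I. f i x) \<in> lp m p"
  using assms(2) by (induction I rule: infinite_finite_induct) (auto simp: p lp_zero intro!: lp_add)

lemma lp_norm_sub_commute:
  fixes f :: "'a \<Rightarrow> 'k::real_normed_field"
  shows "lp_norm m p (\<lambda>x. f x - g x) = lp_norm m p (\<lambda>x. g x - f x)"
  by (rule lp_norm_cong) (simp add: norm_minus_commute)

text \<open>Constants are summable against a finite weight, so pointwise convergence under a uniform
  bound gives norm convergence for every finite exponent.\<close>

lemma lp_dominated: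
  fixes f :: "'i \<Rightarrow> 'a \<Rightarrow> 'k::real_normed_field"
  assumes p: "1 \<le> p" "p \<noteq> \<infinity>"
    and K: "eventually (\<lambda>i. \<forall>x. norm (f i x - g x) \<le> K) F"
    and lim: "\<And>x. ((\<lambda>i. f i x) \<longlongrightarrow> g x) F"
  shows "((\<lambda>i. lp_norm m p (\<lambda>x. f i x - g x)) \<longlongrightarrow> 0) F"
proof -
  define r where "r = enn2real p"
  have r: "1 \<le> r" using enn2real_ge_1[OF p] by (simp add: r_def)
  have s: "(\<lambda>x. K powr r * m x) summable_on UNIV"
    by (intro summable_on_cmult_right m_summable)
  have dom: "eventually (\<lambda>i. \<forall>x\<in>UNIV. norm (norm (f i x - g x) powr r * m x) \<le> K powr r * m x) F"
    using K by eventually_elim (use r in \<open>auto intro!: mult_right_mono powr_mono2\<close>)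
  have pw: "((\<lambda>i. norm (f i x - g x) powr r * m x) \<longlongrightarrow> 0 powr r * m x) F" for x
  proof (intro tendsto_mult tendsto_const tendsto_powr')
    show "((\<lambda>i. norm (f i x - g x)) \<longlongrightarrow> 0) F"
      using tendsto_norm[OF tendsto_diff[OF lim[of x] tendsto_const[of "g x"]]] by simp
    show "(0::real) \<noteq> 0 \<or> 0 < r \<and> (\<forall>\<^sub>F i in F. 0 \<le> norm (f i x - g x))" using r by auto
  qed
  have "((\<lambda>i. \<Sum>\<^sub>\<infinity>x. norm (f i x - g x) powr r * m x) \<longlongrightarrow> (\<Sum>\<^sub>\<infinity>x. 0 powr r * m x)) F"
    by (rule infsum_dominated_tendsto[OF s dom pw])
  then have "((\<lambda>i. \<Sum>\<^sub>\<infinity>x. norm (f i x - g x) powr r * m x) \<longlongrightarrow> 0) F" using r by simp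
  then have "((\<lambda>i. (\<Sum>\<^sub>\<infinity>x. norm (f i x - g x) powr r * m x) powr (1 / r)) \<longlongrightarrow> 0 powr (1/r)) F"
    using r by (intro tendsto_powr' tendsto_const) (auto intro!: always_eventually infsum_nonneg)
  then show ?thesis by (simp add: lp_finite[OF p(2)] r_def)
qed

lemma C_c_linf: "f \<in> C_c \<Longrightarrow> f \<in> linf"
proof -
  assume "f \<in> C_c"
  then have "finite (range f)"
    by (auto simp: C_c_def intro!: finite_subset[of "range f" "insert 0 (f ` {x. f x \<noteq> 0})"])
  then show ?thesis by (simp add: linf_def finite_imp_bounded)
qed

lemma C_c_lp: "1 \<le> p \<Longrightarrow> f \<in> C_c \<Longrightarrow> f \<in> lp m p"
  by (intro linf_lp C_c_linf)

lemma C_c_dense: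
  fixes f :: "'a \<Rightarrow> real"
  assumes p: "1 \<le> p" "p \<noteq> \<infinity>" and f: "f \<in> lp m p" and \<epsilon>: "0 < \<epsilon>"
  shows "\<exists>\<phi>\<in>C_c. lp_norm m p (\<lambda>x. f x - \<phi> x) < \<epsilon>"
proof -
  define r where "r = enn2real p"
  have r: "1 \<le> r" using enn2real_ge_1[OF p] by (simp add: r_def)
  define \<psi> where "\<psi> S x = (if x \<in> S then f x else 0)" for S x
  have S: "(\<lambda>x. norm (f x) powr r * m x) summable_on UNIV"
    using f lp_finite(1)[OF p(2)] unfolding r_def by blast
  have "((\<lambda>S. \<Sum>\<^sub>\<infinity>x. norm (f x - \<psi> S x) powr r * m x) \<longlongrightarrow> (\<Sum>\<^sub>\<infinity>x::'a. 0)) (finite_subsets_at_top UNIV)"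
  proof (rule infsum_dominated_tendsto[OF S])
    show "\<forall>\<^sub>F S in finite_subsets_at_top UNIV. \<forall>x\<in>UNIV. norm (norm (f x - \<psi> S x) powr r * m x) \<le> norm (f x) powr r * m x"
      using r by (auto simp: \<psi>_def intro!: always_eventually)
    fix x :: 'a
    have "eventually (\<lambda>S. {x} \<subseteq> S) (finite_subsets_at_top (UNIV::'a set))"
      unfolding eventually_finite_subsets_at_top by (rule exI[of _ "{x}"]) auto
    then have "eventually (\<lambda>S. norm (f x - \<psi> S x) powr r * m x = 0) (finite_subsets_at_top UNIV)"
      by eventually_elim (use r in \<open>auto simp: \<psi>_def\<close>)
    then show "((\<lambda>S. norm (f x - \<psi> S x) powr r * m x) \<longlongrightarrow> 0) (finite_subsets_at_top UNIV)"
      by (rule tendsto_eventually)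
  qed
  then have "((\<lambda>S. (\<Sum>\<^sub>\<infinity>x. norm (f x - \<psi> S x) powr r * m x) powr (1/r)) \<longlongrightarrow> 0 powr (1/r)) (finite_subsets_at_top UNIV)"
    using r by (intro tendsto_powr' tendsto_const) (auto intro!: always_eventually infsum_nonneg)
  then have "eventually (\<lambda>S. lp_norm m p (\<lambda>x. f x - \<psi> S x) < \<epsilon>) (finite_subsets_at_top UNIV)"
    using \<epsilon> by (auto simp: lp_finite[OF p(2)] r_def dest!: order_tendstoD(2))
  then obtain S where "finite S" "lp_norm m p (\<lambda>x. f x - \<psi> S x) < \<epsilon>"
    unfolding eventually_finite_subsets_at_top by blast
  moreover have "\<psi> S \<in> C_c" using \<open>finite S\<close> by (auto simp: C_c_def \<psi>_def intro: rev_finite_subset)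
  ultimately show ?thesis by blast
qed

lemma lp2:
  fixes f :: "'a \<Rightarrow> real"
  shows "f \<in> lp m 2 \<longleftrightarrow> (\<lambda>x. f x * f x * m x) summable_on UNIV"
    "f \<in> lp m 2 \<Longrightarrow> (lp_norm m 2 f)\<^sup>2 = pairing m f f"
proof -
  have sq: "norm (f x) powr enn2real 2 * m x = f x * f x * m x" for x
    by (simp add: power2_eq_square)
  have 2: "(2::ennreal) \<noteq> \<infinity>" by simp
  show "f \<in> lp m 2 \<longleftrightarrow> (\<lambda>x. f x * f x * m x) summable_on UNIV"
    unfolding lp_finite[OF 2] sq ..
  show "(lp_norm m 2 f)\<^sup>2 = pairing m f f"
  proof -
    have "0 \<le> pairing m f f" unfolding pairing_def by (rule infsum_nonneg) simp
    then show ?thesis unfolding lp_finite[OF 2] sq by (simp add: pairing_def powr_half_sqrt)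
  qed
qed

end

section \<open>Operators with bounded kernels\<close>

lemma summable_on_product:
  fixes f :: "'x \<Rightarrow> real" and g :: "'y \<Rightarrow> real"
  assumes "f summable_on A" "g summable_on B" "\<And>x. 0 \<le> f x" "\<And>y. 0 \<le> g y"
  shows "(\<lambda>(x, y). f x * g y) summable_on (A \<times> B)"
proof -
  have "(\<lambda>p. norm (case p of (x, y) \<Rightarrow> f x * g y)) summable_on (A \<times> B)"
    using assms
    by (intro Infinite_Sum.abs_summable_on_Sigma_iff[THEN iffD2])
      (auto simp: abs_mult infsum_cmult_right' intro!: summable_on_cmult_right summable_on_cmult_left infsum_nonneg)
  then show ?thesis by (rule abs_summable_summable)
qed

context finite_weights
begin

text \<open>Polymorphic in the scalars: the real instance gives the semigroup and the resolvents,
  the complex one inverts z - L on the complexified spaces.\<close>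

definition kernel_op :: "('a \<Rightarrow> 'a \<Rightarrow> 'k::{real_normed_field,banach}) \<Rightarrow> ('a \<Rightarrow> 'k) \<Rightarrow> 'a \<Rightarrow> 'k" where
  "kernel_op k f x = (\<Sum>\<^sub>\<infinity>y. k x y * f y * of_real (m y))"

definition kernel_bound :: "real \<Rightarrow> ('a \<Rightarrow> 'a \<Rightarrow> 'k::{real_normed_field,banach}) \<Rightarrow> bool" where
  "kernel_bound K k \<longleftrightarrow> (\<forall>x y. norm (k x y) \<le> K)"

lemma kernel_boundD: "kernel_bound K k \<Longrightarrow> norm (k x y) \<le> K"
  by (simp add: kernel_bound_def)

lemma kernel_bound_nonneg: "kernel_bound K k \<Longrightarrow> 0 \<le> K"
  by (rule order_trans[OF norm_ge_zero kernel_boundD])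

lemma kernel_op_bound:
  assumes k: "kernel_bound K k" and f: "f \<in> L1"
  shows "(\<lambda>y. k x y * f y * of_real (m y)) summable_on UNIV" "norm (kernel_op k f x) \<le> K * n1 f"
proof -
  have s: "(\<lambda>y. K * (norm (f y) * m y)) summable_on UNIV"
    using f by (intro summable_on_cmult_right) (simp add: L1_def)
  have "norm (k x y * f y * of_real (m y)) \<le> K * (norm (f y) * m y)" for y
    using mult_right_mono[OF kernel_boundD[OF k, of x y], of "norm (f y) * m y"] by (simp add: norm_mult mult.assoc)
  note d = summable_on_dominated[OF s this]
  show "(\<lambda>y. k x y * f y * of_real (m y)) summable_on UNIV" by (rule d)
  show "norm (kernel_op k f x) \<le> K * n1 f"
    using d(3) by (simp add: kernel_op_def n1_def infsum_cmult_right')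
qed

lemma kernel_op_linf:
  assumes "kernel_bound K k" "f \<in> L1"
  shows "kernel_op k f \<in> linf"
  by (rule linfI[OF kernel_op_bound(2)[OF assms]])

lemma kernel_op_comb:
  assumes k: "kernel_bound K k" and f: "f \<in> L1" "g \<in> L1"
  shows "kernel_op k (\<lambda>y. r * f y + s * g y) x = r * kernel_op k f x + s * kernel_op k g x"
proof -
  have "kernel_op k (\<lambda>y. r * f y + s * g y) x =
      (\<Sum>\<^sub>\<infinity>y. r * (k x y * f y * of_real (m y)) + s * (k x y * g y * of_real (m y)))"
    unfolding kernel_op_def by (simp add: algebra_simps)
  then show ?thesis
    using kernel_op_bound(1)[OF k f(1)] kernel_op_bound(1)[OF k f(2)]
    by (simp add: infsum_add summable_on_cmult_right infsum_cmult_right' kernel_op_def)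
qed

lemma kernel_op_diff:
  assumes k: "kernel_bound K k" and f: "f \<in> L1" "g \<in> L1"
  shows "kernel_op k (\<lambda>y. f y - g y) x = kernel_op k f x - kernel_op k g x"
  using kernel_op_comb[OF assms, of 1 "-1"] by simp

lemma kernel_op_kernel_comb:
  assumes k: "kernel_bound K k" "kernel_bound K' l" and f: "f \<in> L1"
  shows "kernel_op (\<lambda>x y. r * k x y + s * l x y) f x = r * kernel_op k f x + s * kernel_op l f x"
proof -
  have "kernel_op (\<lambda>x y. r * k x y + s * l x y) f x =
      (\<Sum>\<^sub>\<infinity>y. r * (k x y * f y * of_real (m y)) + s * (l x y * f y * of_real (m y)))"
    unfolding kernel_op_def by (simp add: algebra_simps)
  then show ?thesis
    using kernel_op_bound(1)[OF k(1) f] kernel_op_bound(1)[OF k(2) f]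
    by (simp add: infsum_add summable_on_cmult_right infsum_cmult_right' kernel_op_def)
qed

text \<open>One factor \<open>total + 1\<close> is paid for passing from lp to \<open>L1\<close>,
  the other for passing from bounded functions back to lp.\<close>

lemma kernel_op_lp:
  assumes p: "1 \<le> p" and k: "kernel_bound K k" and f: "f \<in> lp m p"
  shows "kernel_op k f \<in> lp m p" "lp_norm m p (kernel_op k f) \<le> (total + 1)\<^sup>2 * K * lp_norm m p f"
proof -
  note f1 = lp_L1[OF p f]
  show "kernel_op k f \<in> lp m p" by (rule bounded_lp(1)[OF p kernel_op_bound(2)[OF k f1(1)]])
  have K: "0 \<le> K" by (rule kernel_bound_nonneg[OF k])
  have "lp_norm m p (kernel_op k f) \<le> (total + 1) * (K * n1 f)"
    by (rule bounded_lp(2)[OF p kernel_op_bound(2)[OF k f1(1)]])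
  also have "\<dots> \<le> (total + 1) * (K * ((total + 1) * lp_norm m p f))"
    by (intro mult_left_mono f1 K) simp
  finally show "lp_norm m p (kernel_op k f) \<le> (total + 1)\<^sup>2 * K * lp_norm m p f"
    by (simp add: power2_eq_square mult_ac)
qed

lemma bounded_operator_kernel_op:
  fixes k :: "'a \<Rightarrow> 'a \<Rightarrow> real"
  assumes p: "1 \<le> p" and k: "kernel_bound K k"
  shows "bounded_operator m p (restrict (kernel_op k) (lp m p))"
  unfolding bounded_operator_def
proof (intro conjI ballI allI)
  show "restrict (kernel_op k) (lp m p) \<in> lp m p \<rightarrow>\<^sub>E lp m p"
    using kernel_op_lp(1)[OF p k] by auto
  show "\<exists>K. \<forall>f\<in>lp m p. lp_norm m p (restrict (kernel_op k) (lp m p) f) \<le> K * lp_norm m p f"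
    using kernel_op_lp(2)[OF p k] by (auto intro!: exI[of _ "(total + 1)\<^sup>2 * K"])
  fix f g :: "'a \<Rightarrow> real" and r s :: real
  assume "f \<in> lp m p" "g \<in> lp m p"
  then show "restrict (kernel_op k) (lp m p) (\<lambda>x. r * f x + s * g x) =
      (\<lambda>x. r * restrict (kernel_op k) (lp m p) f x + s * restrict (kernel_op k) (lp m p) g x)"
    using kernel_op_comb[OF k lp_L1(1)[OF p] lp_L1(1)[OF p]] lp_comb[OF p, of f g] by (simp add: fun_eq_iff)
qed

text \<open>A real supremum is informative only for a set that is bounded above. The lower bound 0
  is there for squeezing the operator norms of remainders.\<close>

lemma operator_norm_bound:
  fixes T :: "('a \<Rightarrow> real) \<Rightarrow> 'a \<Rightarrow> real"
  assumes p: "1 \<le> p" and T: "\<And>f. f \<in> lp m p \<Longrightarrow> lp_norm m p (T f) \<le> B * lp_norm m p f" and B: "0 \<le> B"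
    and T': "\<And>f. f \<in> lp m p \<Longrightarrow> T f \<in> lp m p"
  shows "0 \<le> operator_norm m p T" "operator_norm m p T \<le> B"
proof -
  define U :: "('a \<Rightarrow> real) set" where "U = {f \<in> lp m p. lp_norm m p f \<le> 1}"
  have 0: "(\<lambda>x. 0) \<in> U" using lp_zero[OF p, where 'k = real] by (auto simp: U_def)
  have le: "lp_norm m p (T f) \<le> B" if "f \<in> U" for f
  proof -
    have "lp_norm m p (T f) \<le> B * lp_norm m p f" using that T by (auto simp: U_def)
    also have "\<dots> \<le> B * 1" using that B by (intro mult_left_mono) (auto simp: U_def)
    finally show ?thesis by simp
  qed
  show "operator_norm m p T \<le> B"
    unfolding operator_norm_def U_def[symmetric] by (rule cSUP_least) (use 0 le in auto)
  have "0 \<le> lp_norm m p (T (\<lambda>x. 0))" by (rule lp_norm_nonneg) (use T' 0 in \<open>auto simp: U_def\<close>)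
  also have "\<dots> \<le> operator_norm m p T"
    unfolding operator_norm_def U_def[symmetric]
    by (rule cSUP_upper[OF 0]) (use le in \<open>auto simp: bdd_above_def\<close>)
  finally show "0 \<le> operator_norm m p T" .
qed

lemma n1_dominated:
  fixes f :: "'i \<Rightarrow> 'a \<Rightarrow> 'k::banach"
  assumes "eventually (\<lambda>i. \<forall>x. norm (f i x - g x) \<le> K) F" "\<And>x. ((\<lambda>i. f i x) \<longlongrightarrow> g x) F"
  shows "((\<lambda>i. n1 (\<lambda>x. f i x - g x)) \<longlongrightarrow> 0) F"
proof -
  have s: "(\<lambda>x. K * m x) summable_on UNIV" by (intro summable_on_cmult_right m_summable)
  have "((\<lambda>i. n1 (\<lambda>x. f i x - g x)) \<longlongrightarrow> (\<Sum>\<^sub>\<infinity>x. norm (g x - g x) * m x)) F"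
    unfolding n1_def
  proof (rule infsum_dominated_tendsto[OF s])
    show "\<forall>\<^sub>F i in F. \<forall>x\<in>UNIV. norm (norm (f i x - g x) * m x) \<le> K * m x"
      using assms(1) by eventually_elim (auto intro: mult_right_mono)
  qed (intro tendsto_intros assms)
  then show ?thesis by simp
qed

text \<open>For finite \<open>p\<close> the images have a subsequence that converges pointwise and boundedly. For \<open>p = \<infinity>\<close>
  the bounded arguments themselves have a subsequence converging in \<open>\<ell>\<^sup>1\<close>, which the operator maps
  into \<open>\<ell>\<^sup>\<infinity>\<close>.\<close>

lemma compact_operator_kernel_op:
  fixes k :: "'a \<Rightarrow> 'a \<Rightarrow> real"
  assumes X: "countable (UNIV :: 'a set)" and p: "1 \<le> p" and k: "kernel_bound K k"
  shows "compact_operator m p (restrict (kernel_op k) (lp m p))"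
  unfolding compact_operator_def
proof (intro conjI allI impI bounded_operator_kernel_op[OF p k])
  fix f :: "nat \<Rightarrow> 'a \<Rightarrow> real"
  assume "(\<forall>n. f n \<in> lp m p) \<and> (\<exists>B. \<forall>n. lp_norm m p (f n) \<le> B)"
  then obtain B where f: "\<And>n. f n \<in> lp m p" and B: "\<And>n. lp_norm m p (f n) \<le> B" by blast
  note f1 = lp_L1[OF p f]
  have K: "0 \<le> K" by (rule kernel_bound_nonneg[OF k])
  have "n1 (f n) \<le> (total + 1) * B" for n
    by (rule order_trans[OF f1(2)]) (intro mult_left_mono B, simp)
  then have kf: "norm (kernel_op k (f n) x) \<le> K * ((total + 1) * B)" for n x
    by (intro order_trans[OF kernel_op_bound(2)[OF k f1(1)]] mult_left_mono K)
  show "\<exists>j g. strict_mono j \<and> g \<in> lp m p \<and>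
      (\<lambda>n. lp_norm m p (\<lambda>x. restrict (kernel_op k) (lp m p) (f (j n)) x - g x)) \<longlonglongrightarrow> 0"
  proof (cases "p = \<infinity>")
    case False
    obtain j where j: "strict_mono j" "\<And>x. \<exists>l. (\<lambda>n. kernel_op k (f (j n)) x) \<longlonglongrightarrow> l"
      using function_convergent_subsequence[OF X, of "\<lambda>n. kernel_op k (f n)"] kf by (metis UNIV_I)
    then obtain g where g: "\<And>x. (\<lambda>n. kernel_op k (f (j n)) x) \<longlonglongrightarrow> g x" by metis
    have gb: "norm (g x) \<le> K * ((total + 1) * B)" for x
      by (rule tendsto_upperbound[OF tendsto_norm[OF g]]) (use kf in auto)
    have "\<forall>\<^sub>F n in sequentially. \<forall>x. norm (kernel_op k (f (j n)) x - g x)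
        \<le> K * ((total + 1) * B) + K * ((total + 1) * B)"
      by (intro always_eventually allI order_trans[OF norm_triangle_ineq4] add_mono kf gb)
    from lp_dominated[OF p False this g]
    have "(\<lambda>n. lp_norm m p (\<lambda>x. restrict (kernel_op k) (lp m p) (f (j n)) x - g x)) \<longlonglongrightarrow> 0"
      using f by simp
    with j(1) bounded_lp(1)[OF p gb] show ?thesis by (intro exI[of _ j] exI[of _ g] conjI)
  next
    case True
    have fb: "norm (f n x) \<le> B" for n x
      using sup_norm_ge[of "f n" x] f[of n] B[of n] True by simp
    obtain j where j: "strict_mono j" "\<And>x. \<exists>l. (\<lambda>n. f (j n) x) \<longlonglongrightarrow> l"
      using function_convergent_subsequence[OF X, of f] fb by (metis UNIV_I)
    then obtain h where h: "\<And>x. (\<lambda>n. f (j n) x) \<longlonglongrightarrow> h x" by metis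
    have hb: "norm (h x) \<le> B" for x
      by (rule tendsto_upperbound[OF tendsto_norm[OF h]]) (use fb in auto)
    have "\<forall>\<^sub>F n in sequentially. \<forall>x. norm (f (j n) x - h x) \<le> B + B"
      by (intro always_eventually allI order_trans[OF norm_triangle_ineq4] add_mono fb hb)
    from n1_dominated[OF this h] have lim: "(\<lambda>n. n1 (\<lambda>x. f (j n) x - h x)) \<longlonglongrightarrow> 0" .
    have h1: "h \<in> L1" by (rule bounded_L1[OF hb])
    have le: "norm (kernel_op k (f (j n)) x - kernel_op k h x) \<le> K * n1 (\<lambda>x. f (j n) x - h x)" for n x
      using kernel_op_bound(2)[OF k L1_diff(1)[OF f1(1) h1]] kernel_op_diff[OF k f1(1) h1] by metis
    have d: "(\<lambda>x. kernel_op k (f (j n)) x - kernel_op k h x) \<in> linf" for n by (rule linfI[OF le])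
    have "(\<lambda>n. sup_norm (\<lambda>x. kernel_op k (f (j n)) x - kernel_op k h x)) \<longlonglongrightarrow> 0"
    proof (rule tendsto_sandwich[OF _ _ tendsto_const])
      show "(\<lambda>n. K * n1 (\<lambda>x. f (j n) x - h x)) \<longlonglongrightarrow> 0" using tendsto_mult_right_zero[OF lim] .
    qed (auto intro!: always_eventually sup_norm_le le sup_norm_nonneg d)
    then have "(\<lambda>n. lp_norm m p (\<lambda>x. restrict (kernel_op k) (lp m p) (f (j n)) x - kernel_op k h x)) \<longlonglongrightarrow> 0"
      using f True by simp
    moreover have "kernel_op k h \<in> lp m p" using True kernel_op_linf[OF k h1] by simp
    ultimately show ?thesis using j(1) by (intro exI[of _ j] exI[of _ "kernel_op k h"] conjI)
  qed
qed

lemma kernel_op_fubini: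
  assumes k: "kernel_bound K k" and f: "f \<in> L1" and g: "g \<in> L1"
  shows "(\<Sum>\<^sub>\<infinity>x. kernel_op k f x * g x * of_real (m x)) = (\<Sum>\<^sub>\<infinity>y. f y * kernel_op (\<lambda>y x. k x y) g y * of_real (m y))"
proof -
  have s: "(\<lambda>(x, y). K * ((norm (g x) * m x) * (norm (f y) * m y))) summable_on (UNIV \<times> UNIV)"
    using summable_on_cmult_right[OF summable_on_product[of "\<lambda>x. norm (g x) * m x" UNIV "\<lambda>x. norm (f x) * m x" UNIV], of K]
      f g by (simp add: L1_def case_prod_unfold)
  have "norm (case p of (x, y) \<Rightarrow> k x y * f y * of_real (m y) * (g x * of_real (m x)))
      \<le> (case p of (x, y) \<Rightarrow> K * ((norm (g x) * m x) * (norm (f y) * m y)))" for p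
    using mult_right_mono[OF kernel_boundD[OF k, of "fst p" "snd p"], of "(norm (g (fst p)) * m (fst p)) * (norm (f (snd p)) * m (snd p))"]
    by (simp add: case_prod_unfold norm_mult mult_ac)
  note d = summable_on_dominated(1)[OF s this]
  have "(\<Sum>\<^sub>\<infinity>x. kernel_op k f x * g x * of_real (m x))
      = (\<Sum>\<^sub>\<infinity>x. \<Sum>\<^sub>\<infinity>y. k x y * f y * of_real (m y) * (g x * of_real (m x)))"
    unfolding kernel_op_def infsum_cmult_left' mult.assoc[of _ "g _"] ..
  also have "\<dots> = (\<Sum>\<^sub>\<infinity>y. \<Sum>\<^sub>\<infinity>x. k x y * f y * of_real (m y) * (g x * of_real (m x)))"
    by (rule infsum_swap_banach[OF d])
  also have "\<dots> = (\<Sum>\<^sub>\<infinity>y. \<Sum>\<^sub>\<infinity>x. (f y * of_real (m y)) * (k x y * g x * of_real (m x)))"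
    by (simp add: mult_ac)
  finally show ?thesis
    unfolding infsum_cmult_right' kernel_op_def by (simp add: mult.assoc mult.left_commute mult.commute[of "of_real _"])
qed

text \<open>Phrased through the action on functions with values in [0,1], not through the entries of
  the kernel, because this form passes directly to compositions, averages and pointwise
  limits.\<close>

definition markov :: "('a \<Rightarrow> 'a \<Rightarrow> real) \<Rightarrow> bool" where
  "markov k \<longleftrightarrow> (\<forall>f x. (\<forall>y. 0 \<le> f y \<and> f y \<le> 1) \<longrightarrow> 0 \<le> kernel_op k f x \<and> kernel_op k f x \<le> 1)"

lemma markov_kernel:
  assumes "markov k"
  shows "0 \<le> k x y" "kernel_op k (\<lambda>y. 1) x \<le> 1"
proof -
  have "kernel_op k (\<lambda>z. if z = y then 1 else 0) x = (\<Sum>\<^sub>\<infinity>z\<in>{y}. k x z * m z)"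
    unfolding kernel_op_def by (rule infsum_cong_neutral) auto
  moreover have "0 \<le> kernel_op k (\<lambda>z. if z = y then 1 else 0) x"
    using assms by (auto simp: markov_def)
  ultimately have "0 \<le> k x y * m y" by simp
  then show "0 \<le> k x y" using m_pos[of y] by (simp add: zero_le_mult_iff)
  show "kernel_op k (\<lambda>y. 1) x \<le> 1" using assms by (auto simp: markov_def)
qed

lemma markov_sup:
  assumes mk: "markov k" and f: "\<And>y. \<bar>f y\<bar> \<le> B" and k: "kernel_bound K k"
  shows "\<bar>kernel_op k f x\<bar> \<le> B"
proof -
  have s: "(\<lambda>y. B * (k x y * 1 * m y)) summable_on UNIV"
    using kernel_op_bound(1)[OF k, of "\<lambda>y. 1" x] bounded_L1[of "\<lambda>y::'a. 1::real" 1]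
    by (intro summable_on_cmult_right) simp
  have "norm (k x y * f y * m y) \<le> B * (k x y * 1 * m y)" for y
    using mult_right_mono[OF f[of y], of "k x y * m y"] markov_kernel(1)[OF mk, of x y]
    by (simp add: abs_mult mult_ac)
  from summable_on_dominated(3)[OF s this]
  have "\<bar>kernel_op k f x\<bar> \<le> B * kernel_op k (\<lambda>y. 1) x" by (simp add: kernel_op_def infsum_cmult_right')
  also have "\<dots> \<le> B * 1"
    using f[of x] by (intro mult_left_mono markov_kernel[OF mk]) linarith
  finally show ?thesis by simp
qed

text \<open>The constant is not optimal (Jensen's inequality gives \<open>1\<close>), but it only has to be
  independent of \<open>k\<close>.\<close>

lemma markov_lp:
  assumes mk: "markov k" and sym: "\<And>x y. k x y = k y x" and k: "kernel_bound K k"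
    and p: "1 \<le> p" and f: "f \<in> lp m p"
  shows "lp_norm m p (kernel_op k f) \<le> 2 * lp_norm m p f"
proof (cases "p = \<infinity>")
  case True
  then have "\<bar>f x\<bar> \<le> sup_norm f" for x using sup_norm_ge[of f x] f by simp
  from markov_sup[OF mk this k] have "sup_norm (kernel_op k f) \<le> sup_norm f" by (intro sup_norm_le) simp
  then show ?thesis using True sup_norm_nonneg[of f] f by simp
next
  case False
  define r where "r = enn2real p"
  have r: "1 \<le> r" using enn2real_ge_1[OF p False] by (simp add: r_def)
  define F where "F x = \<bar>f x\<bar> powr r" for x
  have F: "F \<in> L1" "0 \<le> F x" for x
    using f lp_finite(1)[OF False, of f] by (simp_all add: L1_def F_def r_def)
  have F1: "n1 F = lp_norm m p f powr r"
    using lp_norm_powr[OF p False, of f] by (simp add: n1_def F_def r_def)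
  note kn = markov_kernel(1)[OF mk]
  have one: "(\<lambda>y. 1::real) \<in> L1" using bounded_L1[of "\<lambda>y::'a. 1::real" 1] by simp
  have fL1: "f \<in> L1" by (rule lp_L1(1)[OF p f])
  have afL1: "(\<lambda>x. \<bar>f x\<bar>) \<in> L1" by (rule L1_mono[OF fL1]) simp
  have pt: "\<bar>kernel_op k f x\<bar> powr r \<le> 2 powr r * kernel_op k F x" for x
  proof -
    define A where "A = kernel_op k (\<lambda>x. \<bar>f x\<bar>) x"
    define B where "B = kernel_op k F x"
    have A0: "0 \<le> A" "0 \<le> B" unfolding A_def B_def kernel_op_def using kn F by (auto intro!: infsum_nonneg)
    have "norm (k x y * f y * m y) \<le> k x y * \<bar>f y\<bar> * m y" for y
      using kn[of x y] by (simp add: abs_mult)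
    from summable_on_dominated(3)[OF kernel_op_bound(1)[OF k afL1, of x, simplified] this]
    have fA: "\<bar>kernel_op k f x\<bar> \<le> A" by (simp add: kernel_op_def A_def)
    have AB: "A \<le> s + s powr (1 - r) * B" if s: "0 < s" for s
    proof -
      have "A \<le> kernel_op k (\<lambda>y. s * 1 + s powr (1 - r) * F y) x"
        unfolding A_def kernel_op_def
      proof (rule infsum_mono)
        have "(\<lambda>y. s * 1 + s powr (1 - r) * F y) \<in> L1"
          by (intro L1_add(1) L1_cmult(1) one F)
        from kernel_op_bound(1)[OF k this]
        show "(\<lambda>y. k x y * (s * 1 + s powr (1 - r) * F y) * of_real (m y)) summable_on UNIV" .
        show "(\<lambda>y. k x y * \<bar>f y\<bar> * of_real (m y)) summable_on UNIV" by (rule kernel_op_bound(1)[OF k afL1])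
        fix y
        have "\<bar>f y\<bar> \<le> s * 1 + s powr (1 - r) * F y"
          using le_add_powr[OF s _ r, of "\<bar>f y\<bar>"] by (simp add: F_def mult.commute)
        then show "k x y * \<bar>f y\<bar> * of_real (m y) \<le> k x y * (s * 1 + s powr (1 - r) * F y) * of_real (m y)"
          using kn by (simp add: mult_right_mono mult_left_mono)
      qed
      also have "\<dots> = s * kernel_op k (\<lambda>y. 1) x + s powr (1 - r) * B"
        unfolding B_def by (rule kernel_op_comb[OF k one F(1)])
      also have "\<dots> \<le> s * 1 + s powr (1 - r) * B"
        using s by (intro add_right_mono mult_left_mono markov_kernel[OF mk]) simp
      finally show ?thesis by simp
    qed
    \<comment> \<open>At s = B^(1/r) both terms of the bound \<open>AB\<close> equal B^(1/r). If B =
      0, then A \<le> s for all s > 0.\<close>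
    have "A \<le> 2 * B powr (1 / r)"
    proof (cases "B = 0")
      case True
      then have "A \<le> s" if "0 < s" for s using AB[OF that] by simp
      then show ?thesis using True by (meson dense_ge order_trans mult_nonneg_nonneg powr_ge_zero zero_le_numeral)
    next
      case False
      then have B: "0 < B" using A0 by simp
      then have "(B powr (1/r)) powr (1 - r) * B = B powr ((1/r) * (1 - r) + 1)"
        unfolding powr_powr by (simp add: powr_add)
      also have "(1/r) * (1 - r) + 1 = 1 / r" using r by (simp add: field_simps)
      finally show ?thesis using AB[of "B powr (1/r)"] B by simp
    qed
    then have "\<bar>kernel_op k f x\<bar> powr r \<le> (2 * B powr (1 / r)) powr r"
      using fA r by (intro powr_mono2) auto
    also have "\<dots> = 2 powr r * B" using A0 r by (simp add: powr_mult powr_powr)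
    finally show ?thesis by (simp add: B_def)
  qed
  have kF: "kernel_op k F \<in> L1" by (rule linf_L1[OF kernel_op_linf[OF k F(1)]])
  have kF0: "0 \<le> kernel_op k F x" for x unfolding kernel_op_def using kn F by (auto intro!: infsum_nonneg)
  \<comment> \<open>By symmetry the kernel can be moved from \<open>F\<close> to the constant 1,
    where it is at most 1; so applying it does not increase the mass of \<open>F\<close>.\<close>
  have "(\<Sum>\<^sub>\<infinity>x. kernel_op k F x * m x) = (\<Sum>\<^sub>\<infinity>x. F x * kernel_op k (\<lambda>y. 1) x * m x)"
    using kernel_op_fubini[OF k F(1) one] sym by simp
  also have "\<dots> \<le> (\<Sum>\<^sub>\<infinity>x. F x * m x)"
  proof (rule infsum_mono)
    have le: "F x * kernel_op k (\<lambda>y. 1) x \<le> F x" for x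
      using mult_left_mono[OF markov_kernel(2)[OF mk, of x] F(2)[of x]] by simp
    have nn: "0 \<le> kernel_op k (\<lambda>y. 1) x" for x using mk by (auto simp: markov_def)
    show s: "(\<lambda>x. F x * m x) summable_on UNIV" using F by (simp add: L1_def)
    show le': "F x * kernel_op k (\<lambda>y. 1) x * m x \<le> F x * m x" for x by (rule mult_right_mono[OF le]) simp
    show "(\<lambda>x. F x * kernel_op k (\<lambda>y. 1) x * m x) summable_on UNIV"
      by (rule summable_on_dominated(1)[OF s]) (use le' nn F in simp)
  qed
  also have "\<dots> = lp_norm m p f powr r" using F1 F by (simp add: n1_def)
  finally have S: "(\<Sum>\<^sub>\<infinity>x. kernel_op k F x * m x) \<le> lp_norm m p f powr r" .
  show ?thesis
  proof (rule lp_norm_leI[OF p False])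
    show "0 \<le> 2 * lp_norm m p f" using lp_norm_nonneg[OF f] by simp
    have s: "(\<lambda>x. 2 powr r * (kernel_op k F x * m x)) summable_on UNIV"
      using kF kF0 by (intro summable_on_cmult_right) (simp add: L1_def)
    have "norm (norm (kernel_op k f x) powr r * m x) \<le> 2 powr r * (kernel_op k F x * m x)" for x
      using mult_right_mono[OF pt[of x] m_nonneg[of x]] by (simp add: mult.assoc)
    from summable_on_dominated(3)[OF s this]
    have "(\<Sum>\<^sub>\<infinity>x. norm (kernel_op k f x) powr r * m x) \<le> 2 powr r * (\<Sum>\<^sub>\<infinity>x. kernel_op k F x * m x)"
      by (simp add: infsum_cmult_right' abs_le_iff)
    also have "\<dots> \<le> 2 powr r * lp_norm m p f powr r" by (intro mult_left_mono S) simp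
    also have "\<dots> = (2 * lp_norm m p f) powr r" using lp_norm_nonneg[OF f] by (simp add: powr_mult)
    finally show "(\<Sum>\<^sub>\<infinity>x. norm (kernel_op k f x) powr enn2real p * m x) \<le> (2 * lp_norm m p f) powr enn2real p"
      by (simp add: r_def)
  qed
qed

end

section \<open>Functions of an operator with bounded eigenfunction expansion\<close>

lemma infsum_finite_sum:
  fixes f :: "'i \<Rightarrow> 'x \<Rightarrow> 'k::real_normed_vector"
  assumes "\<And>i. i \<in> I \<Longrightarrow> f i summable_on A"
  shows "(\<lambda>x. \<Sum>i\<in>I. f i x) summable_on A" "(\<Sum>\<^sub>\<infinity>x\<in>A. \<Sum>i\<in>I. f i x) = (\<Sum>i\<in>I. infsum (f i) A)"
proof -
  have "(\<lambda>x. \<Sum>i\<in>I. f i x) summable_on A \<and> (\<Sum>\<^sub>\<infinity>x\<in>A. \<Sum>i\<in>I. f i x) = (\<Sum>i\<in>I. infsum (f i) A)"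
    using assms
    by (induction I rule: infinite_finite_induct) (auto simp: infsum_add intro: summable_on_add)
  then show "(\<lambda>x. \<Sum>i\<in>I. f i x) summable_on A" "(\<Sum>\<^sub>\<infinity>x\<in>A. \<Sum>i\<in>I. f i x) = (\<Sum>i\<in>I. infsum (f i) A)"
    by auto
qed

text \<open>What the spectral part needs to know of the graph: \<open>E_bound\<close> says that the
  kernel of the Green operator has diagonal at most \<open>K0\<close>, and \<open>E_sep\<close> is
  completeness on \<open>L1\<close> instead of the Hilbert space, so that it applies to all
  exponents at once.\<close>

locale eigenbasis = finite_weights m for m :: "'a \<Rightarrow> real" +
  fixes E :: "('a \<Rightarrow> real) set" and \<mu> :: "('a \<Rightarrow> real) \<Rightarrow> real" and K0 :: real
  assumes X_countable: "countable (UNIV :: 'a set)"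
    and mu_pos: "\<And>e. e \<in> E \<Longrightarrow> 0 < \<mu> e"
    and E_linf: "\<And>e. e \<in> E \<Longrightarrow> e \<in> linf"
    and E_orth: "\<And>e e'. e \<in> E \<Longrightarrow> e' \<in> E \<Longrightarrow> pairing m e e' = (if e = e' then 1 else 0)"
    and E_bound: "\<And>F x. finite F \<Longrightarrow> F \<subseteq> E \<Longrightarrow> (\<Sum>e\<in>F. \<mu> e * (e x)\<^sup>2) \<le> K0"
    and E_sep: "\<And>f. f \<in> L1 \<Longrightarrow> (\<And>e. e \<in> E \<Longrightarrow> pairing m f e = 0) \<Longrightarrow> f = (\<lambda>x. 0)"
begin

lemma K0_nonneg: "0 \<le> K0"
  using E_bound[of "{}" undefined] by simp

text \<open>The elements of \<open>E\<close> are the eigenfunctions and \<open>\<mu>\<close> the eigenvalues of \<open>L\<^sup>-\<^sup>1\<close>. A function \<open>\<psi>(L)\<close>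
  is represented by the multiplier \<open>\<phi> e = \<psi> (1 / \<mu> e)\<close>.\<close>

definition mult_bound :: "real \<Rightarrow> (('a \<Rightarrow> real) \<Rightarrow> 'k::real_normed_vector) \<Rightarrow> bool" where
  "mult_bound K \<phi> \<longleftrightarrow> 0 \<le> K \<and> (\<forall>e\<in>E. norm (\<phi> e) \<le> K * \<mu> e)"

definition ker :: "(('a \<Rightarrow> real) \<Rightarrow> 'k::{real_normed_field,banach}) \<Rightarrow> 'a \<Rightarrow> 'a \<Rightarrow> 'k" where
  "ker \<phi> x y = (\<Sum>\<^sub>\<infinity>e\<in>E. \<phi> e * of_real (e x * e y))"

text \<open>Extends \<open>pairing\<close> to complex functions, which are tested against the same
  real eigenfunctions.\<close>

definition coef :: "('a \<Rightarrow> 'k::{real_normed_field,banach}) \<Rightarrow> ('a \<Rightarrow> real) \<Rightarrow> 'k" where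
  "coef f e = (\<Sum>\<^sub>\<infinity>x. f x * of_real (e x) * of_real (m x))"

lemma coef_pairing: "coef f e = pairing m f e"
  by (simp add: coef_def pairing_def)

abbreviation T :: "(('a \<Rightarrow> real) \<Rightarrow> 'k::{real_normed_field,banach}) \<Rightarrow> ('a \<Rightarrow> 'k) \<Rightarrow> 'a \<Rightarrow> 'k" where
  "T \<phi> \<equiv> kernel_op (ker \<phi>)"

abbreviation G :: "('a \<Rightarrow> real) \<Rightarrow> 'a \<Rightarrow> real" where
  "G \<equiv> T \<mu>"

lemma abs_mult_le: "\<bar>a * b\<bar> \<le> (a\<^sup>2 + b\<^sup>2) / 2" for a b :: real
  using sum_squares_bound[of "\<bar>a\<bar>" "\<bar>b\<bar>"] by (simp add: abs_mult)

text \<open>The means of squares bound the products e(x) e(y), so the off-diagonal values of the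
  kernels are controlled by \<open>E_bound\<close> at the two diagonal points.\<close>

lemma weight_summable:
  "(\<lambda>e. \<mu> e * ((e x)\<^sup>2 + (e y)\<^sup>2) / 2) summable_on E"
  "(\<Sum>\<^sub>\<infinity>e\<in>E. \<mu> e * ((e x)\<^sup>2 + (e y)\<^sup>2) / 2) \<le> K0"
proof -
  have nn: "0 \<le> \<mu> e * ((e x)\<^sup>2 + (e y)\<^sup>2) / 2" if "e \<in> E" for e
    using mu_pos[OF that] by simp
  have le: "(\<Sum>e\<in>F. \<mu> e * ((e x)\<^sup>2 + (e y)\<^sup>2) / 2) \<le> K0" if F: "finite F" "F \<subseteq> E" for F
  proof -
    have "(\<Sum>e\<in>F. \<mu> e * ((e x)\<^sup>2 + (e y)\<^sup>2) / 2)
        = ((\<Sum>e\<in>F. \<mu> e * (e x)\<^sup>2) + (\<Sum>e\<in>F. \<mu> e * (e y)\<^sup>2)) / 2"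
      by (simp add: sum.distrib[symmetric] sum_divide_distrib distrib_left)
    then show ?thesis using E_bound[OF F, of x] E_bound[OF F, of y] by simp
  qed
  show "(\<lambda>e. \<mu> e * ((e x)\<^sup>2 + (e y)\<^sup>2) / 2) summable_on E"
    by (rule summable_on_finite_bound(1)[OF nn le])
  show "(\<Sum>\<^sub>\<infinity>e\<in>E. \<mu> e * ((e x)\<^sup>2 + (e y)\<^sup>2) / 2) \<le> K0"
    by (rule summable_on_finite_bound(2)[OF nn le])
qed

lemma ker_term:
  fixes \<phi> :: "('a \<Rightarrow> real) \<Rightarrow> 'k::real_normed_field"
  assumes \<phi>: "mult_bound K \<phi>" and e: "e \<in> E"
  shows "norm (\<phi> e * of_real (e x * e y)) \<le> K * (\<mu> e * ((e x)\<^sup>2 + (e y)\<^sup>2) / 2)"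
proof -
  have "norm (\<phi> e * of_real (e x * e y)) = norm (\<phi> e) * \<bar>e x * e y\<bar>" by (simp add: norm_mult abs_mult)
  also have "\<dots> \<le> (K * \<mu> e) * (((e x)\<^sup>2 + (e y)\<^sup>2) / 2)"
    using \<phi> e mu_pos[OF e] by (intro mult_mono abs_mult_le) (auto simp: mult_bound_def)
  finally show ?thesis by (simp add: mult.assoc)
qed

lemma ker_bound:
  fixes \<phi> :: "('a \<Rightarrow> real) \<Rightarrow> 'k::{real_normed_field,banach}"
  assumes \<phi>: "mult_bound K \<phi>"
  shows "(\<lambda>e. \<phi> e * of_real (e x * e y)) summable_on E"
    "(\<lambda>e. norm (\<phi> e * of_real (e x * e y))) summable_on E"
    "(\<Sum>\<^sub>\<infinity>e\<in>E. norm (\<phi> e * of_real (e x * e y))) \<le> K * K0"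
    "norm (ker \<phi> x y) \<le> K * K0"
proof -
  have s: "(\<lambda>e. K * (\<mu> e * ((e x)\<^sup>2 + (e y)\<^sup>2) / 2)) summable_on E"
    by (intro summable_on_cmult_right weight_summable)
  have le: "(\<Sum>\<^sub>\<infinity>e\<in>E. K * (\<mu> e * ((e x)\<^sup>2 + (e y)\<^sup>2) / 2)) \<le> K * K0"
    unfolding infsum_cmult_right' using \<phi> by (intro mult_left_mono weight_summable) (simp add: mult_bound_def)
  note d = summable_on_dominated[OF s ker_term[OF \<phi>, of _ x y]]
  have "norm (norm (\<phi> e * of_real (e x * e y))) \<le> K * (\<mu> e * ((e x)\<^sup>2 + (e y)\<^sup>2) / 2)" if "e \<in> E" for e
    using ker_term[OF \<phi> that] by simp
  note d' = summable_on_dominated(3)[OF s this]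
  show "(\<lambda>e. \<phi> e * of_real (e x * e y)) summable_on E" by (rule d(1))
  show "(\<lambda>e. norm (\<phi> e * of_real (e x * e y))) summable_on E" by (rule d(2))
  show "norm (ker \<phi> x y) \<le> K * K0" unfolding ker_def by (rule order_trans[OF d(3) le])
  show "(\<Sum>\<^sub>\<infinity>e\<in>E. norm (\<phi> e * of_real (e x * e y))) \<le> K * K0"
    using order_trans[OF d' le] by (simp add: abs_le_iff)
qed

lemma ker_kernel_bound: "mult_bound K \<phi> \<Longrightarrow> kernel_bound (K * K0) (ker \<phi>)"
  using ker_bound(4) by (auto simp: kernel_bound_def)

lemma ker_sym: "ker \<phi> x y = ker \<phi> y x"
  by (simp add: ker_def mult.commute)

lemma ker_comb:
  assumes "mult_bound K \<phi>" "mult_bound K' \<psi>"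
  shows "ker (\<lambda>e. r * \<phi> e + s * \<psi> e) x y = r * ker \<phi> x y + s * ker \<psi> x y"
proof -
  have "ker (\<lambda>e. r * \<phi> e + s * \<psi> e) x y
      = (\<Sum>\<^sub>\<infinity>e\<in>E. r * (\<phi> e * of_real (e x * e y)) + s * (\<psi> e * of_real (e x * e y)))"
    by (simp only: ker_def distrib_right mult.assoc)
  also have "\<dots> = r * ker \<phi> x y + s * ker \<psi> x y"
    unfolding ker_def
    by (simp only: infsum_add[OF summable_on_cmult_right summable_on_cmult_right]
        ker_bound(1)[OF assms(1)] ker_bound(1)[OF assms(2)] infsum_cmult_right')
  finally show ?thesis .
qed

lemma T_linf: "mult_bound K \<phi> \<Longrightarrow> f \<in> L1 \<Longrightarrow> T \<phi> f \<in> linf"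
  using kernel_op_linf[OF ker_kernel_bound] .

lemma T_L1: "mult_bound K \<phi> \<Longrightarrow> f \<in> L1 \<Longrightarrow> T \<phi> f \<in> L1"
  using linf_L1[OF T_linf] .

text \<open>One constant \<open>K\<close> for the whole family dominates twice: over the eigenbasis
  inside the kernel, then over the vertices in the operator.\<close>

lemma T_tendsto:
  fixes f :: "'a \<Rightarrow> 'k::{real_normed_field,banach}"
  assumes \<phi>: "eventually (\<lambda>i. mult_bound K (\<phi> i)) F" and lim: "\<And>e. e \<in> E \<Longrightarrow> ((\<lambda>i. \<phi> i e) \<longlongrightarrow> \<psi> e) F"
    and f: "f \<in> L1"
  shows "((\<lambda>i. T (\<phi> i) f x) \<longlongrightarrow> T \<psi> f x) F"
proof -
  have k: "((\<lambda>i. ker (\<phi> i) x y) \<longlongrightarrow> ker \<psi> x y) F" for x y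
    unfolding ker_def
  proof (rule infsum_dominated_tendsto)
    show "(\<lambda>e. K * (\<mu> e * ((e x)\<^sup>2 + (e y)\<^sup>2) / 2)) summable_on E"
      by (intro summable_on_cmult_right weight_summable)
    show "\<forall>\<^sub>F i in F. \<forall>e\<in>E. norm (\<phi> i e * of_real (e x * e y)) \<le> K * (\<mu> e * ((e x)\<^sup>2 + (e y)\<^sup>2) / 2)"
      using \<phi> by eventually_elim (use ker_term in blast)
  qed (intro tendsto_intros lim)
  show ?thesis
    unfolding kernel_op_def
  proof (rule infsum_dominated_tendsto)
    show "(\<lambda>y. K * K0 * (norm (f y) * m y)) summable_on UNIV"
      using f by (intro summable_on_cmult_right) (simp add: L1_def)
    show "\<forall>\<^sub>F i in F. \<forall>y\<in>UNIV. norm (ker (\<phi> i) x y * f y * of_real (m y)) \<le> K * K0 * (norm (f y) * m y)"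
      using \<phi>
    proof eventually_elim
      case (elim i)
      show ?case
      proof
        fix y
        show "norm (ker (\<phi> i) x y * f y * of_real (m y)) \<le> K * K0 * (norm (f y) * m y)"
          using mult_right_mono[OF ker_bound(4)[OF elim, of x y], of "norm (f y) * m y"]
          by (simp add: norm_mult mult.assoc)
      qed
    qed
  qed (intro tendsto_intros k)
qed

lemma of_real_L1: "e \<in> E \<Longrightarrow> (\<lambda>x. of_real (e x) :: 'k::real_normed_field) \<in> L1"
  using linf_L1[OF E_linf] by (simp add: L1_def)

lemma coef_summable:
  assumes f: "f \<in> L1" and e: "e \<in> linf"
  shows "(\<lambda>x. f x * of_real (e x) * of_real (m x)) summable_on UNIV"
    "norm (coef f e) \<le> sup_norm e * n1 f"
proof -
  have s: "(\<lambda>x. sup_norm e * (norm (f x) * m x)) summable_on UNIV"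
    using f by (intro summable_on_cmult_right) (simp add: L1_def)
  have "norm (f x * of_real (e x) * of_real (m x)) \<le> sup_norm e * (norm (f x) * m x)" for x
    using mult_right_mono[OF sup_norm_ge[OF e, of x], of "norm (f x) * m x"]
    by (simp add: norm_mult mult_ac)
  note d = summable_on_dominated[OF s this]
  show "(\<lambda>x. f x * of_real (e x) * of_real (m x)) summable_on UNIV" by (rule d)
  show "norm (coef f e) \<le> sup_norm e * n1 f"
    using d(3) by (simp add: coef_def n1_def infsum_cmult_right')
qed

lemma coef_comb:
  assumes "f \<in> L1" "g \<in> L1" "e \<in> linf"
  shows "coef (\<lambda>x. r * f x + s * g x) e = r * coef f e + s * coef g e"
proof -
  have "coef (\<lambda>x. r * f x + s * g x) e = (\<Sum>\<^sub>\<infinity>x. r * (f x * of_real (e x) * of_real (m x)) + s * (g x * of_real (e x) * of_real (m x)))"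
    by (simp add: coef_def algebra_simps)
  also have "\<dots> = r * coef f e + s * coef g e"
    unfolding coef_def
    by (simp only: infsum_add[OF summable_on_cmult_right summable_on_cmult_right]
        coef_summable(1)[OF assms(1,3)] coef_summable(1)[OF assms(2,3)] infsum_cmult_right')
  finally show ?thesis .
qed

lemma coef_cmult: "f \<in> L1 \<Longrightarrow> e \<in> linf \<Longrightarrow> coef (\<lambda>x. r * f x) e = r * coef f e"
  using coef_comb[of f f e r 0] by simp

lemma coef_diff: "f \<in> L1 \<Longrightarrow> g \<in> L1 \<Longrightarrow> e \<in> linf \<Longrightarrow> coef (\<lambda>x. f x - g x) e = coef f e - coef g e"
  using coef_comb[of f g e 1 "-1"] by simp

lemma coef_basis:
  assumes "e \<in> E" "e' \<in> E"
  shows "coef (\<lambda>x. of_real (e x) :: 'k::{real_normed_field,banach}) e' = (if e = e' then 1 else 0)"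
proof -
  have "(\<lambda>x. e x * e' x * m x) summable_on UNIV"
    using coef_summable(1)[OF linf_L1[OF E_linf[OF assms(1)]] E_linf[OF assms(2)]] by simp
  then have "((\<lambda>x. e x * e' x * m x) has_sum (if e = e' then 1 else 0)) UNIV"
    using has_sum_infsum E_orth[OF assms] unfolding pairing_def by fastforce
  from has_sum_of_real[OF this, where ?'a = 'k]
  have "((\<lambda>x. of_real (e x) * of_real (e' x) * of_real (m x)) has_sum (if e = e' then 1 else 0 :: 'k)) UNIV"
    by (simp split: if_splits)
  then show ?thesis unfolding coef_def by (rule infsumI)
qed

lemma T_eigen:
  fixes \<phi> :: "('a \<Rightarrow> real) \<Rightarrow> 'k::{real_normed_field,banach}"
  assumes \<phi>: "mult_bound K \<phi>" and e: "e \<in> E"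
  shows "T \<phi> (\<lambda>x. of_real (e x)) x = \<phi> e * of_real (e x)"
proof -
  define B where "B = sup_norm e"
  have B: "\<bar>e y\<bar> \<le> B" for y using sup_norm_ge[OF E_linf[OF e], of y] by (simp add: B_def)
  define t where "t y e' = \<phi> e' * of_real (e' x * e' y) * (of_real (e y) * of_real (m y))" for y e'
  have n: "norm (t y e') = norm (\<phi> e' * of_real (e' x * e' y)) * (\<bar>e y\<bar> * m y)" for y e'
    by (simp add: t_def norm_mult)
  have s: "(\<lambda>y. K * K0 * B * m y) summable_on UNIV" by (intro summable_on_cmult_right m_summable)
  have le: "norm (\<Sum>\<^sub>\<infinity>e'\<in>E. norm (t y e')) \<le> K * K0 * B * m y" for y
  proof -
    have "(\<Sum>\<^sub>\<infinity>e'\<in>E. norm (t y e')) = (\<Sum>\<^sub>\<infinity>e'\<in>E. norm (\<phi> e' * of_real (e' x * e' y))) * (\<bar>e y\<bar> * m y)"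
      unfolding n by (rule infsum_cmult_left')
    also have "\<dots> \<le> (K * K0) * (B * m y)"
      using \<phi> K0_nonneg order_trans[OF abs_ge_zero B]
      by (intro mult_mono mult_right_mono ker_bound(3)[OF \<phi>] B) (auto simp: mult_bound_def)
    finally show ?thesis by (simp add: infsum_nonneg mult.assoc)
  qed
  \<comment> \<open>Absolute summability over vertices and eigenfunctions, for the interchange
    below: the inner sums over \<open>E\<close> are at most K K0 B m(y).\<close>
  have "(\<lambda>p. norm (case p of (y, e') \<Rightarrow> t y e')) summable_on (UNIV \<times> E)"
  proof (intro Infinite_Sum.abs_summable_on_Sigma_iff[THEN iffD2] conjI ballI)
    fix y
    show "(\<lambda>e'. norm (case (y, e') of (y, e') \<Rightarrow> t y e')) summable_on E"
      unfolding prod.case n by (intro summable_on_cmult_left ker_bound[OF \<phi>])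
    show "(\<lambda>y. norm (\<Sum>\<^sub>\<infinity>e'\<in>E. norm (case (y, e') of (y, e') \<Rightarrow> t y e'))) summable_on UNIV"
      unfolding prod.case by (rule summable_on_dominated(2)[OF s le])
  qed
  then have sum: "(\<lambda>(y, e'). t y e') summable_on (UNIV \<times> E)" by (rule abs_summable_summable)
  have "T \<phi> (\<lambda>x. of_real (e x)) x = (\<Sum>\<^sub>\<infinity>y. \<Sum>\<^sub>\<infinity>e'\<in>E. t y e')"
    unfolding kernel_op_def ker_def t_def infsum_cmult_left' by (simp add: mult.assoc)
  also have "\<dots> = (\<Sum>\<^sub>\<infinity>e'\<in>E. \<Sum>\<^sub>\<infinity>y. t y e')" by (rule infsum_swap_banach[OF sum])
  also have "\<dots> = (\<Sum>\<^sub>\<infinity>e'\<in>E. \<phi> e' * of_real (e' x) * coef (\<lambda>y. of_real (e' y)) e)"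
    unfolding coef_def infsum_cmult_right'[symmetric] by (simp add: t_def mult_ac)
  also have "\<dots> = (\<Sum>\<^sub>\<infinity>e'\<in>{e}. \<phi> e' * of_real (e' x))"
    by (rule infsum_cong_neutral) (use e coef_basis[OF _ e, where 'k = 'k] in auto)
  finally show ?thesis by simp
qed

text \<open>The kernel is symmetric, so the operator can be moved onto the eigenfunction, where
  \<open>T_eigen\<close> applies. Together with \<open>coef_eqI\<close> this turns every later
  identity between operators into an identity between multipliers.\<close>

lemma coef_T:
  fixes f :: "'a \<Rightarrow> 'k::{real_normed_field,banach}"
  assumes \<phi>: "mult_bound K \<phi>" and f: "f \<in> L1" and e: "e \<in> E"
  shows "coef (T \<phi> f) e = \<phi> e * coef f e"
proof -
  have "coef (T \<phi> f) e = (\<Sum>\<^sub>\<infinity>y. f y * kernel_op (\<lambda>y x. ker \<phi> x y) (\<lambda>x. of_real (e x)) y * of_real (m y))"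
    unfolding coef_def by (rule kernel_op_fubini[OF ker_kernel_bound[OF \<phi>] f of_real_L1[OF e]])
  also have "(\<Sum>\<^sub>\<infinity>y. f y * kernel_op (\<lambda>y x. ker \<phi> x y) (\<lambda>x. of_real (e x)) y * of_real (m y))
      = (\<Sum>\<^sub>\<infinity>y. f y * T \<phi> (\<lambda>x. of_real (e x)) y * of_real (m y))"
    by (simp add: kernel_op_def ker_sym[of \<phi>])
  also have "(\<Sum>\<^sub>\<infinity>y. f y * T \<phi> (\<lambda>x. of_real (e x)) y * of_real (m y)) = \<phi> e * coef f e"
    unfolding T_eigen[OF \<phi> e] coef_def infsum_cmult_right'[symmetric] by (simp add: mult_ac)
  finally show ?thesis .
qed

lemma coef_eqI:
  fixes f g :: "'a \<Rightarrow> real"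
  assumes "f \<in> L1" "g \<in> L1" "\<And>e. e \<in> E \<Longrightarrow> coef f e = coef g e"
  shows "f = g"
proof -
  have "(\<lambda>x. f x - g x) = (\<lambda>x. 0)"
    using assms coef_diff[OF assms(1,2) E_linf] L1_diff[OF assms(1,2)]
    by (intro E_sep) (simp_all flip: coef_pairing)
  then show ?thesis by (simp add: fun_eq_iff)
qed

lemma coef_Re_Im:
  fixes f :: "'a \<Rightarrow> complex"
  assumes "f \<in> L1" "e \<in> linf"
  shows "coef (\<lambda>x. Re (f x)) e = Re (coef f e)" "coef (\<lambda>x. Im (f x)) e = Im (coef f e)"
  unfolding coef_def infsum_Re[OF coef_summable(1)[OF assms], symmetric]
    infsum_Im[OF coef_summable(1)[OF assms], symmetric] by simp_all

lemma L1_Re_Im: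
  fixes f :: "'a \<Rightarrow> complex"
  assumes "f \<in> L1"
  shows "(\<lambda>x. Re (f x)) \<in> L1" "(\<lambda>x. Im (f x)) \<in> L1"
  by (auto intro!: L1_mono(1)[OF assms] abs_Re_le_cmod abs_Im_le_cmod)

lemma coef_eqI_complex:
  fixes f g :: "'a \<Rightarrow> complex"
  assumes "f \<in> L1" "g \<in> L1" "\<And>e. e \<in> E \<Longrightarrow> coef f e = coef g e"
  shows "f = g"
proof -
  have "(\<lambda>x. Re (f x)) = (\<lambda>x. Re (g x))" "(\<lambda>x. Im (f x)) = (\<lambda>x. Im (g x))"
    using assms by (auto intro!: coef_eqI L1_Re_Im simp: coef_Re_Im E_linf)
  then show ?thesis by (auto simp: fun_eq_iff complex_eq_iff)
qed

lemma T_eqI: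
  fixes f g :: "'a \<Rightarrow> real"
  assumes "mult_bound K \<phi>" "f \<in> L1" "g \<in> L1" "\<And>e. e \<in> E \<Longrightarrow> coef g e = \<phi> e * coef f e"
  shows "T \<phi> f = g"
  using assms by (intro coef_eqI T_L1) (auto simp: coef_T)

lemma T_eqI_complex:
  fixes f g :: "'a \<Rightarrow> complex"
  assumes "mult_bound K \<phi>" "f \<in> L1" "g \<in> L1" "\<And>e. e \<in> E \<Longrightarrow> coef g e = \<phi> e * coef f e"
  shows "T \<phi> f = g"
  using assms by (intro coef_eqI_complex T_L1) (auto simp: coef_T)

lemma T_mult:
  fixes f :: "'a \<Rightarrow> real"
  assumes "mult_bound K \<phi>" "mult_bound K' \<psi>" "mult_bound K'' (\<lambda>e. \<phi> e * \<psi> e)" "f \<in> L1"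
  shows "T \<phi> (T \<psi> f) = T (\<lambda>e. \<phi> e * \<psi> e) f"
proof (rule T_eqI[symmetric, OF assms(3,4)])
  note L = T_L1[OF assms(2,4)]
  show "T \<phi> (T \<psi> f) \<in> L1" by (rule T_L1[OF assms(1) L])
  show "coef (T \<phi> (T \<psi> f)) e = \<phi> e * \<psi> e * coef f e" if "e \<in> E" for e
    using coef_T[OF assms(1) L that] coef_T[OF assms(2,4) that] by simp
qed

lemma mult_bound_mu: "mult_bound 1 \<mu>"
  using mu_pos by (auto simp: mult_bound_def less_imp_le)

section \<open>Summable eigenvalues, finite truncations and trace class\<close>

lemma mu_sum:
  assumes F: "finite F" "F \<subseteq> E"
  shows "(\<Sum>e\<in>F. \<mu> e) \<le> K0 * total"
proof -
  have s: "(\<lambda>x. \<mu> e * (e x * e x * m x)) summable_on UNIV" if "e \<in> F" for e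
    using coef_summable(1)[OF linf_L1[OF E_linf] E_linf, of e e] that F
    by (intro summable_on_cmult_right) auto
  have "(\<Sum>e\<in>F. \<mu> e) = (\<Sum>e\<in>F. \<Sum>\<^sub>\<infinity>x. \<mu> e * (e x * e x * m x))"
    using F E_orth by (intro sum.cong refl) (auto simp: infsum_cmult_right' pairing_def subset_eq)
  also have "\<dots> = (\<Sum>\<^sub>\<infinity>x. \<Sum>e\<in>F. \<mu> e * (e x * e x * m x))"
    using infsum_finite_sum(2)[of F "\<lambda>e x. \<mu> e * (e x * e x * m x)" UNIV] s by simp
  also have "\<dots> \<le> (\<Sum>\<^sub>\<infinity>x. K0 * m x)"
  proof (rule infsum_mono)
    fix x
    show "(\<Sum>e\<in>F. \<mu> e * (e x * e x * m x)) \<le> K0 * m x"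
      using mult_right_mono[OF E_bound[OF F, of x] m_nonneg[of x]]
      by (simp add: sum_distrib_right sum_distrib_left power2_eq_square mult_ac)
    show "(\<lambda>x. \<Sum>e\<in>F. \<mu> e * (e x * e x * m x)) summable_on UNIV" by (rule infsum_finite_sum(1)[OF s])
    show "(\<lambda>x. K0 * m x) summable_on UNIV" by (rule summable_on_cmult_right[OF m_summable])
  qed
  finally show ?thesis by (simp add: infsum_cmult_right' total_def)
qed

lemma mu_le: "e \<in> E \<Longrightarrow> \<mu> e \<le> K0 * total"
  using mu_sum[of "{e}"] by simp

lemma mu_summable: "\<mu> summable_on E"
  by (rule summable_on_finite_bound(1)[OF _ mu_sum]) (use mu_pos in \<open>auto intro: less_imp_le\<close>)

text \<open>More than K0 \<open>total\<close> / \<delta> eigenvalues above \<delta> would violate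
  \<open>mu_sum\<close>. This is the source of the isolation of the spectral values and of the
  finite multiplicities.\<close>

lemma finite_mu_ge:
  assumes "0 < \<delta>" shows "finite {e \<in> E. \<delta> \<le> \<mu> e}"
proof (rule ccontr)
  assume "infinite {e \<in> E. \<delta> \<le> \<mu> e}"
  moreover obtain n :: nat where n: "K0 * total / \<delta> < real n" using reals_Archimedean2 by blast
  ultimately obtain F where F: "F \<subseteq> {e \<in> E. \<delta> \<le> \<mu> e}" "finite F" "card F = n"
    using infinite_arbitrarily_large by meson
  have "real n * \<delta> \<le> (\<Sum>e\<in>F. \<mu> e)"
    using sum_bounded_below[of F \<delta> \<mu>] F by auto
  also have "\<dots> \<le> K0 * total" using F by (intro mu_sum) auto
  finally show False using n assms by (simp add: field_simps)
qed

lemma T_symmetric: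
  fixes f g :: "'a \<Rightarrow> real"
  assumes "mult_bound K \<phi>" "f \<in> L1" "g \<in> L1"
  shows "pairing m (T \<phi> f) g = pairing m f (T \<phi> g)"
  using kernel_op_fubini[OF ker_kernel_bound[OF assms(1)] assms(2,3)] by (simp add: pairing_def ker_sym[of \<phi>])

lemma T_trunc:
  fixes \<phi> :: "('a \<Rightarrow> real) \<Rightarrow> real"
  assumes "mult_bound K \<phi>" "f \<in> L1" and F: "finite F" "F \<subseteq> E"
  shows "T (\<lambda>e. if e \<in> F then \<phi> e else 0) f = (\<lambda>x. \<Sum>e\<in>F. \<phi> e * coef f e * e x)"
proof (rule T_eqI[where K = K])
  show "mult_bound K (\<lambda>e. if e \<in> F then \<phi> e else 0)"
    using assms(1) mu_pos by (auto simp: mult_bound_def less_imp_le)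
  have *: "(\<lambda>x. \<Sum>e\<in>F'. \<phi> e * coef f e * e x) \<in> L1 \<and>
      (\<forall>e'\<in>E. coef (\<lambda>x. \<Sum>e\<in>F'. \<phi> e * coef f e * e x) e' = (if e' \<in> F' then \<phi> e' * coef f e' else 0))"
    if "finite F'" "F' \<subseteq> E" for F'
    using that
  proof (induction F' rule: finite_induct)
    case empty
    then show ?case using bounded_L1(1)[of "\<lambda>x. 0::real" 0] by (simp add: coef_def)
  next
    case (insert e F')
    have eL: "e \<in> L1" using linf_L1[OF E_linf] insert by auto
    have IH: "(\<lambda>x. \<Sum>e\<in>F'. \<phi> e * coef f e * e x) \<in> L1" using insert by auto
    have "coef (\<lambda>x. \<phi> e * coef f e * e x + 1 * (\<Sum>e\<in>F'. \<phi> e * coef f e * e x)) e'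
        = \<phi> e * coef f e * coef e e' + 1 * coef (\<lambda>x. \<Sum>e\<in>F'. \<phi> e * coef f e * e x) e'" if "e' \<in> E" for e'
      by (rule coef_comb[OF eL IH E_linf[OF that]])
    moreover have "coef e e' = (if e = e' then 1 else 0)" if "e' \<in> E" for e'
      using E_orth[of e e'] that insert by (simp add: coef_pairing)
    ultimately show ?case
      using insert by (auto intro!: L1_add(1) L1_cmult(1) eL)
  qed
  show "(\<lambda>x. \<Sum>e\<in>F. \<phi> e * coef f e * e x) \<in> L1" using *[OF F] by blast
  show "coef (\<lambda>x. \<Sum>e\<in>F. \<phi> e * coef f e * e x) e' = (if e' \<in> F then \<phi> e' else 0) * coef f e'" if "e' \<in> E" for e'
    using *[OF F] that by auto
qed (rule assms)

text \<open>Truncating a multiplier preserves its bound, so the eigenfunction expansion converges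
  pointwise for every \<open>f\<close> in \<open>L1\<close>, square summable or not.\<close>

lemma T_trunc_tendsto:
  fixes \<phi> :: "('a \<Rightarrow> real) \<Rightarrow> real"
  assumes "mult_bound K \<phi>" "f \<in> L1"
  shows "((\<lambda>F. \<Sum>e\<in>F. \<phi> e * coef f e * e x) \<longlongrightarrow> T \<phi> f x) (finite_subsets_at_top E)"
proof (rule Lim_transform_eventually)
  show "((\<lambda>F. T (\<lambda>e. if e \<in> F then \<phi> e else 0) f x) \<longlongrightarrow> T \<phi> f x) (finite_subsets_at_top E)"
  proof (rule T_tendsto[OF _ _ assms(2)])
    show "\<forall>\<^sub>F F in finite_subsets_at_top E. mult_bound K (\<lambda>e. if e \<in> F then \<phi> e else 0)"
      using assms(1) mu_pos by (intro always_eventually) (auto simp: mult_bound_def less_imp_le)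
    fix e assume "e \<in> E"
    then have "eventually (\<lambda>F. {e} \<subseteq> F) (finite_subsets_at_top E)"
      unfolding eventually_finite_subsets_at_top by (intro exI[of _ "{e}"]) auto
    then have "eventually (\<lambda>F. (if e \<in> F then \<phi> e else 0) = \<phi> e) (finite_subsets_at_top E)"
      by eventually_elim simp
    then show "((\<lambda>F. if e \<in> F then \<phi> e else 0) \<longlongrightarrow> \<phi> e) (finite_subsets_at_top E)"
      by (rule tendsto_eventually)
  qed
  show "\<forall>\<^sub>F F in finite_subsets_at_top E. T (\<lambda>e. if e \<in> F then \<phi> e else 0) f x = (\<Sum>e\<in>F. \<phi> e * coef f e * e x)"
    by (rule eventually_finite_subsets_at_top_weakI) (use T_trunc[OF assms] in \<open>simp add: fun_eq_iff\<close>)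
qed

lemma trunc_bound:
  fixes \<phi> :: "('a \<Rightarrow> real) \<Rightarrow> real"
  assumes "mult_bound K \<phi>" "f \<in> L1" "finite F" "F \<subseteq> E"
  shows "\<bar>\<Sum>e\<in>F. \<phi> e * coef f e * e x\<bar> \<le> K * K0 * n1 f"
proof -
  have "mult_bound K (\<lambda>e. if e \<in> F then \<phi> e else 0)"
    using assms(1) mu_pos by (auto simp: mult_bound_def less_imp_le)
  from kernel_op_bound(2)[OF ker_kernel_bound[OF this] assms(2), of x] show ?thesis
    using T_trunc[OF assms] by simp
qed

text \<open>For a truncated multiplier the form is the finite sum of \<phi>(e) times the squared
  coefficients; by \<open>trunc_bound\<close> the limit can be taken under the outer sum.\<close>

lemma T_nonneg:
  fixes \<phi> :: "('a \<Rightarrow> real) \<Rightarrow> real"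
  assumes \<phi>: "mult_bound K \<phi>" and f: "f \<in> L1" and nn: "\<And>e. e \<in> E \<Longrightarrow> 0 \<le> \<phi> e"
  shows "0 \<le> pairing m (T \<phi> f) f"
proof (rule tendsto_lowerbound)
  show "((\<lambda>F. \<Sum>\<^sub>\<infinity>x. (\<Sum>e\<in>F. \<phi> e * coef f e * e x) * f x * m x) \<longlongrightarrow> pairing m (T \<phi> f) f) (finite_subsets_at_top E)"
    unfolding pairing_def
  proof (rule infsum_dominated_tendsto)
    show "(\<lambda>x. K * K0 * n1 f * (norm (f x) * m x)) summable_on UNIV"
      using f by (intro summable_on_cmult_right) (simp add: L1_def)
    show "\<forall>\<^sub>F F in finite_subsets_at_top E. \<forall>x\<in>UNIV. norm ((\<Sum>e\<in>F. \<phi> e * coef f e * e x) * f x * m x)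
        \<le> K * K0 * n1 f * (norm (f x) * m x)"
    proof (intro eventually_finite_subsets_at_top_weakI ballI)
      fix F x assume "finite F" "F \<subseteq> E"
      from mult_right_mono[OF trunc_bound[OF \<phi> f this, of x], of "norm (f x) * m x"]
      show "norm ((\<Sum>e\<in>F. \<phi> e * coef f e * e x) * f x * m x) \<le> K * K0 * n1 f * (norm (f x) * m x)"
        by (simp add: abs_mult mult.assoc)
    qed
  qed (intro tendsto_intros T_trunc_tendsto[OF \<phi> f])
  show "\<forall>\<^sub>F F in finite_subsets_at_top E. 0 \<le> (\<Sum>\<^sub>\<infinity>x. (\<Sum>e\<in>F. \<phi> e * coef f e * e x) * f x * m x)"
  proof (rule eventually_finite_subsets_at_top_weakI)
    fix F assume F: "finite F" "F \<subseteq> E"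
    have s: "(\<lambda>x. \<phi> e * coef f e * (f x * e x * m x)) summable_on UNIV" if "e \<in> F" for e
      using coef_summable(1)[OF f E_linf, of e] that F by (intro summable_on_cmult_right) auto
    have "(\<Sum>\<^sub>\<infinity>x. (\<Sum>e\<in>F. \<phi> e * coef f e * e x) * f x * m x)
        = (\<Sum>\<^sub>\<infinity>x. \<Sum>e\<in>F. \<phi> e * coef f e * (f x * e x * m x))"
      by (simp add: sum_distrib_right sum_distrib_left mult_ac)
    also have "\<dots> = (\<Sum>e\<in>F. \<phi> e * coef f e * coef f e)"
      using infsum_finite_sum(2)[of F "\<lambda>e x. \<phi> e * coef f e * (f x * e x * m x)" UNIV] s
      by (simp add: infsum_cmult_right' coef_def)
    also have "\<dots> \<ge> 0" using nn F by (intro sum_nonneg) (auto simp: mult.assoc)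
    finally show "0 \<le> (\<Sum>\<^sub>\<infinity>x. (\<Sum>e\<in>F. \<phi> e * coef f e * e x) * f x * m x)" .
  qed
qed simp

text \<open>A nonnegative multiplier gives a positive operator, which is its own absolute value. Its
  diagonal entries on \<open>E\<close> are the values \<phi>(e), dominated by the summable
  \<open>K * \<mu> e\<close>.\<close>

lemma trace_class_T:
  fixes \<phi> :: "('a \<Rightarrow> real) \<Rightarrow> real"
  assumes \<phi>: "mult_bound K \<phi>" and nn: "\<And>e. e \<in> E \<Longrightarrow> 0 \<le> \<phi> e"
  shows "trace_class m (restrict (T \<phi>) (lp m 2))"
proof -
  note b = bounded_operator_kernel_op[OF one_le_2 ker_kernel_bound[OF \<phi>]]
  note L = lp_L1(1)[OF one_le_2]
  have E2: "E \<subseteq> lp m 2" using linf_lp[OF one_le_2] E_linf by auto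
  have "positive_operator m (restrict (T \<phi>) (lp m 2))"
    unfolding positive_operator_def using b T_symmetric[OF \<phi> L L] T_nonneg[OF \<phi> L nn] by simp
  moreover have "orthonormal_basis m E"
    unfolding orthonormal_basis_def using E2 E_orth E_sep[OF L] by blast
  moreover have "(\<lambda>e. pairing m (restrict (T \<phi>) (lp m 2) e) e) summable_on E"
  proof (rule summable_on_dominated(1))
    show "(\<lambda>e. K * \<mu> e) summable_on E" by (intro summable_on_cmult_right mu_summable)
    fix e assume e: "e \<in> E"
    have "pairing m (T \<phi> e) e = \<phi> e"
      using coef_T[OF \<phi> linf_L1[OF E_linf[OF e]] e] E_orth[OF e e] by (simp add: coef_pairing)
    then show "norm (pairing m (restrict (T \<phi>) (lp m 2) e) e) \<le> K * \<mu> e"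
      using e E2 \<phi> by (auto simp: mult_bound_def)
  qed
  ultimately show ?thesis using b unfolding trace_class_def by blast
qed

section \<open>Norm analyticity from power series of multipliers\<close>

text \<open>Both claims share one induction, since splitting off the last summand of the operator
  uses a multiplier bound for the sum of the others.\<close>

lemma kernel_op_sum_kernel:
  fixes f :: "'a \<Rightarrow> real" and N :: nat
  assumes "\<And>n. n < N \<Longrightarrow> \<exists>K. mult_bound K (a n)" "f \<in> L1"
  shows "(\<exists>K. mult_bound K (\<lambda>e. \<Sum>n<N. w n * a n e)) \<and> T (\<lambda>e. \<Sum>n<N. w n * a n e) f x = (\<Sum>n<N. w n * T (a n) f x)"
  using assms(1)
proof (induction N)
  case 0
  then show ?case by (auto simp: mult_bound_def ker_def kernel_op_def intro!: exI[of _ 0])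
next
  case (Suc N)
  then obtain K K' where K: "mult_bound K (\<lambda>e. \<Sum>n<N. w n * a n e)" and K': "mult_bound K' (a N)" by force
  have "T (\<lambda>e. 1 * (\<Sum>n<N. w n * a n e) + w N * a N e) f x
      = kernel_op (\<lambda>x y. 1 * ker (\<lambda>e. \<Sum>n<N. w n * a n e) x y + w N * ker (a N) x y) f x"
    by (intro arg_cong[where f = "\<lambda>k. kernel_op k f x"] ext ker_comb[OF K K'])
  also have "\<dots> = 1 * T (\<lambda>e. \<Sum>n<N. w n * a n e) f x + w N * T (a N) f x"
    by (rule kernel_op_kernel_comb[OF ker_kernel_bound[OF K] ker_kernel_bound[OF K'] assms(2)])
  moreover have "mult_bound (K + \<bar>w N\<bar> * K') (\<lambda>e. 1 * (\<Sum>n<N. w n * a n e) + w N * a N e)"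
    using K K' unfolding mult_bound_def
  proof (intro conjI ballI)
    fix e assume "e \<in> E"
    then have "norm (\<Sum>n<N. w n * a n e) \<le> K * \<mu> e" "\<bar>w N\<bar> * norm (a N e) \<le> \<bar>w N\<bar> * (K' * \<mu> e)"
      using K K' by (auto simp: mult_bound_def intro: mult_left_mono)
    then show "norm (1 * (\<Sum>n<N. w n * a n e) + w N * a N e) \<le> (K + \<bar>w N\<bar> * K') * \<mu> e"
      using norm_triangle_ineq[of "1 * (\<Sum>n<N. w n * a n e)" "w N * a N e"]
      by (simp add: abs_mult algebra_simps)
  qed auto
  ultimately show ?case using Suc by auto
qed

text \<open>The operator norm is controlled by the multiplier bound on every lp, so it suffices to
  expand each multiplier in a scalar power series whose N-th remainder is at most
  \<open>\<epsilon> t s N\<close> times \<mu>, uniformly over the eigenbasis.\<close>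

lemma norm_analytic_T:
  fixes \<Phi> :: "real \<Rightarrow> ('a \<Rightarrow> real) \<Rightarrow> real"
  assumes p: "1 \<le> p" and \<Phi>: "\<And>t. t \<in> I \<Longrightarrow> \<exists>K. mult_bound K (\<Phi> t)"
    and r: "\<And>t. t \<in> I \<Longrightarrow> 0 < r t" and a: "\<And>t n. t \<in> I \<Longrightarrow> \<exists>K. mult_bound K (a t n)"
    and lim: "\<And>t s. t \<in> I \<Longrightarrow> s \<in> I \<Longrightarrow> \<bar>s - t\<bar> < r t \<Longrightarrow> \<epsilon> t s \<longlonglongrightarrow> 0"
    and rem: "\<And>t s N. t \<in> I \<Longrightarrow> s \<in> I \<Longrightarrow> \<bar>s - t\<bar> < r t \<Longrightarrow>
      mult_bound (\<epsilon> t s N) (\<lambda>e. \<Phi> s e - (\<Sum>n<N. (s - t) ^ n * a t n e))"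
  shows "norm_analytic_on m p I (\<lambda>t. restrict (T (\<Phi> t)) (lp m p))"
  unfolding norm_analytic_on_def
proof (intro conjI ballI)
  fix t assume t: "t \<in> I"
  show "bounded_operator m p (restrict (T (\<Phi> t)) (lp m p))"
    using \<Phi>[OF t] bounded_operator_kernel_op[OF p ker_kernel_bound] by blast
  show "\<exists>r>0. \<exists>A. (\<forall>n. bounded_operator m p (A n)) \<and> (\<forall>s\<in>I. \<bar>s - t\<bar> < r \<longrightarrow>
      (\<lambda>N. operator_norm m p (\<lambda>f x. restrict (T (\<Phi> s)) (lp m p) f x - (\<Sum>n<N. (s - t) ^ n * A n f x))) \<longlonglongrightarrow> 0)"
  proof (intro exI[of _ "r t"] exI[of _ "\<lambda>n. restrict (T (a t n)) (lp m p)"] conjI allI ballI impI r[OF t])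
    show "bounded_operator m p (restrict (T (a t n)) (lp m p))" for n
      using a[OF t] bounded_operator_kernel_op[OF p ker_kernel_bound] by blast
    fix s assume s: "s \<in> I" "\<bar>s - t\<bar> < r t"
    define D where "D N f x = restrict (T (\<Phi> s)) (lp m p) f x - (\<Sum>n<N. (s - t) ^ n * restrict (T (a t n)) (lp m p) f x)" for N f x
    have D: "D N f = T (\<lambda>e. \<Phi> s e - (\<Sum>n<N. (s - t) ^ n * a t n e)) f" if f: "f \<in> lp m p" for N f
    proof
      fix x
      note f1 = lp_L1(1)[OF p f]
      obtain K where K: "mult_bound K (\<Phi> s)" using \<Phi> s by blast
      have ks: "\<exists>K. mult_bound K (\<lambda>e. \<Sum>n<N. (s - t) ^ n * a t n e)"
        "T (\<lambda>e. \<Sum>n<N. (s - t) ^ n * a t n e) f x = (\<Sum>n<N. (s - t) ^ n * T (a t n) f x)"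
        using kernel_op_sum_kernel[of N "a t" f "\<lambda>n. (s - t) ^ n" x] a[OF t] f1 by auto
      then obtain K' where K': "mult_bound K' (\<lambda>e. \<Sum>n<N. (s - t) ^ n * a t n e)" by blast
      have "T (\<lambda>e. 1 * \<Phi> s e + (- 1) * (\<Sum>n<N. (s - t) ^ n * a t n e)) f x
          = kernel_op (\<lambda>x y. 1 * ker (\<Phi> s) x y + (-1) * ker (\<lambda>e. \<Sum>n<N. (s - t) ^ n * a t n e) x y) f x"
        by (intro arg_cong[where f = "\<lambda>k. kernel_op k f x"] ext ker_comb[OF K K'])
      also have "\<dots> = 1 * T (\<Phi> s) f x + (-1) * T (\<lambda>e. \<Sum>n<N. (s - t) ^ n * a t n e) f x"
        by (rule kernel_op_kernel_comb[OF ker_kernel_bound[OF K] ker_kernel_bound[OF K'] f1])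
      finally show "D N f x = T (\<lambda>e. \<Phi> s e - (\<Sum>n<N. (s - t) ^ n * a t n e)) f x"
        using f ks(2) by (simp add: D_def)
    qed
    have e0: "0 \<le> \<epsilon> t s N" for N using rem[OF t s, of N] by (simp add: mult_bound_def)
    note kb = ker_kernel_bound[OF rem[OF t s]]
    have b: "0 \<le> operator_norm m p (D N) \<and> operator_norm m p (D N) \<le> (total + 1)\<^sup>2 * (\<epsilon> t s N * K0)" for N
      using operator_norm_bound[OF p, of "D N" "(total + 1)\<^sup>2 * (\<epsilon> t s N * K0)"]
        kernel_op_lp[OF p kb] D e0 K0_nonneg by simp
    show "(\<lambda>N. operator_norm m p (\<lambda>f x. restrict (T (\<Phi> s)) (lp m p) f x
        - (\<Sum>n<N. (s - t) ^ n * restrict (T (a t n)) (lp m p) f x))) \<longlonglongrightarrow> 0"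
      unfolding D_def[symmetric]
    proof (rule tendsto_sandwich[OF _ _ tendsto_const])
      show "(\<lambda>N. (total + 1)\<^sup>2 * (\<epsilon> t s N * K0)) \<longlonglongrightarrow> 0"
        by (intro tendsto_mult_right_zero tendsto_mult_left_zero lim[OF t s])
    qed (use b in auto)
  qed
qed

definition exp_mult :: "real \<Rightarrow> ('a \<Rightarrow> real) \<Rightarrow> real" where
  "exp_mult t e = exp (- (t / \<mu> e))"

text \<open>This is 1/(\<lambda> + \<alpha>) at the eigenvalue \<lambda> = 1/\<mu>(e) of L, written
  so that the bound by \<mu>(e) is visible.\<close>

definition res_mult :: "real \<Rightarrow> ('a \<Rightarrow> real) \<Rightarrow> real" where
  "res_mult \<alpha> e = \<mu> e / (1 + \<alpha> * \<mu> e)"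

text \<open>At x = t/\<mu>(e) this becomes \<open>exp_mult t e \<le> \<mu> e / t\<close>, the bound
  that brings the semigroup under the kernel theory.\<close>

lemma exp_minus_le: "0 < x \<Longrightarrow> exp (- x) \<le> 1 / x" for x :: real
  using less_imp_le[OF less_le_trans[OF less_add_one exp_ge_add_one_self[of x, unfolded add.commute[of 1]]]]
  by (simp add: exp_minus field_simps)

lemma mult_bound_exp_mult: "0 < t \<Longrightarrow> mult_bound (1 / t) (exp_mult t)"
  unfolding mult_bound_def exp_mult_def using mu_pos exp_minus_le[of "t / \<mu> _"] by simp

lemma mult_bound_res_mult: "0 < \<alpha> \<Longrightarrow> mult_bound 1 (res_mult \<alpha>)"
  unfolding mult_bound_def res_mult_def
proof (intro conjI ballI)
  fix e assume "0 < \<alpha>" "e \<in> E"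
  then have "0 < \<mu> e" "0 < \<alpha> * \<mu> e" using mu_pos by auto
  then show "norm (\<mu> e / (1 + \<alpha> * \<mu> e)) \<le> 1 * \<mu> e" by (simp add: divide_le_eq)
qed simp

text \<open>The Neumann series around t: with ratio q = -(s-t) \<open>res_mult t e\<close> the
  multiplier at s is the geometric sum of \<open>res_mult t e * q ^ n\<close>, and the remainder is
  q^N \<open>res_mult s e\<close>. Since \<open>res_mult t e\<close> is at most 1/t, the radius t
  works for all e at once.\<close>

lemma norm_analytic_res_mult:
  assumes p: "1 \<le> p"
  shows "norm_analytic_on m p {0<..} (\<lambda>\<alpha>. restrict (T (res_mult \<alpha>)) (lp m p))"
proof (rule norm_analytic_T[where r = "\<lambda>t. t" and a = "\<lambda>t n e. (- 1) ^ n * res_mult t e ^ Suc n"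
      and \<epsilon> = "\<lambda>t s N. (\<bar>s - t\<bar> / t) ^ N", OF p])
  have r: "0 < res_mult t e" "res_mult t e \<le> 1 / t" "res_mult t e \<le> \<mu> e" if "0 < t" "e \<in> E" for t e
  proof -
    have "0 < \<mu> e" "0 < t * \<mu> e" using that mu_pos by auto
    moreover from this have "0 < 1 + t * \<mu> e" by simp
    ultimately show "0 < res_mult t e" "res_mult t e \<le> 1 / t" using that
      by (auto simp: res_mult_def divide_simps intro: add_pos_pos)
    show "res_mult t e \<le> \<mu> e" using mult_bound_res_mult[OF that(1)] that(2) by (auto simp: mult_bound_def)
  qed
  show "\<exists>K. mult_bound K (res_mult t)" if "t \<in> {0<..}" for t using mult_bound_res_mult that by auto
  show "\<exists>K. mult_bound K (\<lambda>e. (- 1) ^ n * res_mult t e ^ Suc n)" if "t \<in> {0<..}" for t n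
  proof (intro exI[of _ "(1 / t) ^ n"], unfold mult_bound_def, intro conjI ballI)
    fix e assume e: "e \<in> E"
    have "res_mult t e ^ n * res_mult t e \<le> (1 / t) ^ n * \<mu> e"
      using r[of t e] e that by (intro mult_mono power_mono) (auto simp: less_imp_le)
    then show "norm ((- 1) ^ n * res_mult t e ^ Suc n) \<le> (1 / t) ^ n * \<mu> e"
      using r[of t e] e that by (simp add: abs_mult power_abs mult.commute)
  qed (use that in auto)
  fix t s :: real assume ts: "t \<in> {0<..}" "s \<in> {0<..}" "\<bar>s - t\<bar> < t"
  show "(\<lambda>N. (\<bar>s - t\<bar> / t) ^ N) \<longlonglongrightarrow> 0" by (rule LIMSEQ_realpow_zero) (use ts in auto)
  fix N
  show "mult_bound ((\<bar>s - t\<bar> / t) ^ N) (\<lambda>e. res_mult s e - (\<Sum>n<N. (s - t) ^ n * ((- 1) ^ n * res_mult t e ^ Suc n)))"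
    unfolding mult_bound_def
  proof (intro conjI ballI)
    fix e assume e: "e \<in> E"
    define q where "q = - 1 * ((s - t) * res_mult t e)"
    have pos: "0 < \<mu> e" "0 < 1 + s * \<mu> e" "0 < 1 + t * \<mu> e"
      using mu_pos[OF e] ts by (auto intro: add_pos_pos)
    have q1: "1 - q = (1 + s * \<mu> e) / (1 + t * \<mu> e)"
      using pos by (simp add: q_def res_mult_def field_simps)
    then have q1': "q \<noteq> 1" using pos by auto
    have "(\<Sum>n<N. (s - t) ^ n * ((- 1) ^ n * res_mult t e ^ Suc n)) = res_mult t e * (\<Sum>n<N. q ^ n)"
      unfolding q_def sum_distrib_left
      by (intro sum.cong refl) (simp only: power_mult_distrib power_Suc mult_ac)
    also have "\<dots> = res_mult t e * ((1 - q ^ N) / (1 - q))" using q1' by (simp add: sum_gp_strict)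
    also have "\<dots> = res_mult t e / ((1 + s * \<mu> e) / (1 + t * \<mu> e)) * (1 - q ^ N)" unfolding q1 by simp
    also have "res_mult t e / ((1 + s * \<mu> e) / (1 + t * \<mu> e)) = res_mult s e" using pos by (simp add: res_mult_def)
    finally have eq: "res_mult s e - (\<Sum>n<N. (s - t) ^ n * ((- 1) ^ n * res_mult t e ^ Suc n)) = q ^ N * res_mult s e"
      by (simp add: algebra_simps)
    have "\<bar>q\<bar> \<le> \<bar>s - t\<bar> / t"
      using mult_left_mono[OF r(2)[of t e], of "\<bar>s - t\<bar>"] r(1)[of t e] ts e by (simp add: q_def abs_mult)
    then have "\<bar>q\<bar> ^ N * res_mult s e \<le> (\<bar>s - t\<bar> / t) ^ N * \<mu> e"
      using r[of s e] ts e by (intro mult_mono power_mono) (auto simp: less_imp_le)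
    then show "norm (res_mult s e - (\<Sum>n<N. (s - t) ^ n * ((- 1) ^ n * res_mult t e ^ Suc n))) \<le> (\<bar>s - t\<bar> / t) ^ N * \<mu> e"
      unfolding eq using r[of s e] ts e by (simp add: abs_mult power_abs)
  qed (use ts in auto)
qed auto

text \<open>The remainder has to be controlled for eigenvalues l of arbitrary size. Writing d^n =
  (d/r)^n r^n gains the geometric factor (d/r)^N at the price of exp(r l), and that growth is later
  absorbed by the decay of \<open>exp_mult\<close>.\<close>

lemma exp_taylor_remainder:
  fixes d r l :: real
  assumes "0 \<le> d" "d < r" "0 \<le> l" "\<bar>h\<bar> = d"
  shows "\<bar>exp (h * l) - (\<Sum>n<N. h ^ n * (l ^ n / fact n))\<bar> \<le> (d / r) ^ N * exp (r * l)"
proof -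
  have s: "(\<lambda>n. (h * l) ^ n /\<^sub>R fact n) sums exp (h * l)" by (rule exp_converges)
  have s': "(\<lambda>n. (r * l) ^ n /\<^sub>R fact n) sums exp (r * l)" by (rule exp_converges)
  have r: "0 < r" using assms by simp
  have tail: "exp (h * l) - (\<Sum>n<N. h ^ n * (l ^ n / fact n)) = (\<Sum>n. (h * l) ^ (n + N) /\<^sub>R fact (n + N))"
    using suminf_minus_initial_segment[OF sums_summable[OF s], of N] sums_unique[OF s]
    by (simp add: power_mult_distrib divide_inverse mult_ac)
  have smr: "summable (\<lambda>n. (d / r) ^ N * ((r * l) ^ (n + N) /\<^sub>R fact (n + N)))"
    using s' by (intro summable_mult summable_ignore_initial_segment sums_summable)
  have le: "norm ((h * l) ^ (n + N) /\<^sub>R fact (n + N)) \<le> (d / r) ^ N * ((r * l) ^ (n + N) /\<^sub>R fact (n + N))" for n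
  proof -
    have "(d / r) ^ (n + N) \<le> (d / r) ^ N"
      by (rule power_decreasing) (use assms r in auto)
    then have 1: "(d / r) ^ (n + N) * ((r * l) ^ (n + N) / fact (n + N)) \<le> (d / r) ^ N * ((r * l) ^ (n + N) / fact (n + N))"
      using assms r by (intro mult_right_mono) auto
    moreover have 2: "(d / r) ^ (n + N) * ((r * l) ^ (n + N) / fact (n + N)) = (d * l) ^ (n + N) / fact (n + N)"
      using r by (simp add: power_mult_distrib power_divide)
    moreover have 3: "norm ((h * l) ^ (n + N) /\<^sub>R fact (n + N)) = (d * l) ^ (n + N) / fact (n + N)"
      using assms by (simp add: power_abs abs_mult divide_inverse mult.commute)
    moreover have 4: "(r * l) ^ (n + N) /\<^sub>R fact (n + N) = (r * l) ^ (n + N) / fact (n + N)"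
      by (simp add: divide_inverse mult.commute)
    ultimately show ?thesis by (simp only: 3 4 1[unfolded 2])
  qed
  have "\<bar>exp (h * l) - (\<Sum>n<N. h ^ n * (l ^ n / fact n))\<bar> \<le> (\<Sum>n. (d / r) ^ N * ((r * l) ^ (n + N) /\<^sub>R fact (n + N)))"
    unfolding tail real_norm_def[symmetric] by (rule norm_suminf_le[OF le smr])
  also have "\<dots> = (d / r) ^ N * (\<Sum>n. (r * l) ^ (n + N) /\<^sub>R fact (n + N))"
    by (intro suminf_mult summable_ignore_initial_segment sums_summable[OF s'])
  also have "\<dots> \<le> (d / r) ^ N * exp (r * l)"
  proof (rule mult_left_mono)
    have "(\<Sum>n. (r * l) ^ (n + N) /\<^sub>R fact (n + N)) = exp (r * l) - (\<Sum>n<N. (r * l) ^ n /\<^sub>R fact n)"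
      using suminf_minus_initial_segment[OF sums_summable[OF s'], of N] sums_unique[OF s'] by simp
    also have "\<dots> \<le> exp (r * l)" using assms r by (simp add: sum_nonneg)
    finally show "(\<Sum>n. (r * l) ^ (n + N) /\<^sub>R fact (n + N)) \<le> exp (r * l)" .
  qed (use assms r in auto)
  finally show ?thesis .
qed

text \<open>Half of the decay pays for the Taylor expansion: with r = t/2 the factor exp(r/\<mu>(e))
  times \<open>exp_mult t e\<close> is \<open>exp_mult (t / 2) e\<close>, still at most (2/t)
  \<mu>(e).\<close>

lemma norm_analytic_exp_mult:
  assumes p: "1 \<le> p"
  shows "norm_analytic_on m p {0<..} (\<lambda>t. restrict (T (exp_mult t)) (lp m p))"
proof (rule norm_analytic_T[where r = "\<lambda>t. t / 2" and a = "\<lambda>t n e. (- 1 / \<mu> e) ^ n / fact n * exp_mult t e"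
      and \<epsilon> = "\<lambda>t s N. (\<bar>s - t\<bar> / (t / 2)) ^ N * (2 / t)", OF p])
  show "\<exists>K. mult_bound K (exp_mult t)" if "t \<in> {0<..}" for t using mult_bound_exp_mult that by auto
  have half: "exp (t / 2 * (1 / \<mu> e)) * exp_mult t e = exp_mult (t / 2) e" for t e
    by (simp add: exp_mult_def flip: exp_add)
  show "\<exists>K. mult_bound K (\<lambda>e. (- 1 / \<mu> e) ^ n / fact n * exp_mult t e)" if "t \<in> {0<..}" for t n
  proof (intro exI[of _ "(2 / t) ^ n * (2 / t)"], unfold mult_bound_def, intro conjI ballI)
    fix e assume e: "e \<in> E"
    have m: "0 < \<mu> e" by (rule mu_pos[OF e])
    define y where "y = t / 2 * (1 / \<mu> e)"
    \<comment> \<open>A single term of the exponential series is below the whole series; this bounds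
      the n-th Taylor coefficient by (2/t)^n times \<open>exp_mult (t / 2) e\<close>.\<close>
    have "(\<Sum>k\<in>{n}. y ^ k /\<^sub>R fact k) \<le> exp y"
      unfolding exp_def by (rule sum_le_suminf[OF summable_exp_generic]) (use that m in \<open>auto simp: y_def\<close>)
    then have "y ^ n / fact n \<le> exp y" by (simp add: divide_inverse mult.commute)
    then have "y ^ n / fact n * exp_mult t e \<le> exp y * exp_mult t e"
      by (rule mult_right_mono) (simp add: exp_mult_def)
    then have "(t / 2 * (1 / \<mu> e)) ^ n / fact n * exp_mult t e \<le> exp_mult (t / 2) e"
      unfolding y_def half .
    also have "\<dots> \<le> 2 / t * \<mu> e" using mult_bound_exp_mult[of "t / 2"] that e by (auto simp: mult_bound_def)
    finally have "(2 / t) ^ n * ((t / 2 * (1 / \<mu> e)) ^ n / fact n * exp_mult t e) \<le> (2 / t) ^ n * (2 / t * \<mu> e)"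
      using that by (intro mult_left_mono) auto
    moreover have pw: "(2 / t) ^ n * (t / 2 * (1 / \<mu> e)) ^ n = (1 / \<mu> e) ^ n"
      unfolding power_mult_distrib[symmetric] using that by simp
    have "(2 / t) ^ n * ((t / 2 * (1 / \<mu> e)) ^ n / fact n * exp_mult t e) = (1 / \<mu> e) ^ n / fact n * exp_mult t e"
      unfolding pw[symmetric] by (simp only: times_divide_eq_right times_divide_eq_left mult.assoc)
    moreover have "norm ((- 1 / \<mu> e) ^ n / fact n * exp_mult t e) = (1 / \<mu> e) ^ n / fact n * exp_mult t e"
      using m by (simp add: abs_mult power_abs exp_mult_def)
    ultimately show "norm ((- 1 / \<mu> e) ^ n / fact n * exp_mult t e) \<le> (2 / t) ^ n * (2 / t) * \<mu> e"
      by (simp only: mult.assoc)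
  qed (use that in auto)
  fix t s :: real assume ts: "t \<in> {0<..}" "s \<in> {0<..}" "\<bar>s - t\<bar> < t / 2"
  show "(\<lambda>N. (\<bar>s - t\<bar> / (t / 2)) ^ N * (2 / t)) \<longlonglongrightarrow> 0"
    by (intro tendsto_mult_left_zero LIMSEQ_realpow_zero) (use ts in auto)
  fix N
  show "mult_bound ((\<bar>s - t\<bar> / (t / 2)) ^ N * (2 / t)) (\<lambda>e. exp_mult s e - (\<Sum>n<N. (s - t) ^ n * ((- 1 / \<mu> e) ^ n / fact n * exp_mult t e)))"
    unfolding mult_bound_def
  proof (intro conjI ballI)
    fix e assume e: "e \<in> E"
    have m: "0 < \<mu> e" by (rule mu_pos[OF e])
    have 1: "exp_mult s e = exp (- (s - t) * (1 / \<mu> e)) * exp_mult t e"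
      by (simp add: exp_mult_def diff_divide_distrib flip: exp_add)
    have reassoc: "u * (v / w * z) = (u * v) / w * z" "u * (v / w) * z = (u * v) / w * z" for u v w z :: real
      by simp_all
    have pw: "(s - t) ^ n * (- 1 / \<mu> e) ^ n = (- (s - t)) ^ n * (1 / \<mu> e) ^ n" for n
      unfolding power_mult_distrib[symmetric]
      by (intro arg_cong[where f = "\<lambda>q. q ^ n"]) (use m in \<open>simp add: field_simps\<close>)
    have "(\<Sum>n<N. (s - t) ^ n * ((- 1 / \<mu> e) ^ n / fact n * exp_mult t e)) = (\<Sum>n<N. (- (s - t)) ^ n * ((1 / \<mu> e) ^ n / fact n)) * exp_mult t e"
      unfolding sum_distrib_right
      by (intro sum.cong refl) (simp only: reassoc pw)
    then have "exp_mult s e - (\<Sum>n<N. (s - t) ^ n * ((- 1 / \<mu> e) ^ n / fact n * exp_mult t e))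
        = (exp (- (s - t) * (1 / \<mu> e)) - (\<Sum>n<N. (- (s - t)) ^ n * ((1 / \<mu> e) ^ n / fact n))) * exp_mult t e"
      using 1 by (simp add: left_diff_distrib)
    then have "norm (exp_mult s e - (\<Sum>n<N. (s - t) ^ n * ((- 1 / \<mu> e) ^ n / fact n * exp_mult t e)))
        = \<bar>exp (- (s - t) * (1 / \<mu> e)) - (\<Sum>n<N. (- (s - t)) ^ n * ((1 / \<mu> e) ^ n / fact n))\<bar> * exp_mult t e"
      by (simp add: abs_mult exp_mult_def)
    also have "\<dots> \<le> ((\<bar>s - t\<bar> / (t / 2)) ^ N * exp (t / 2 * (1 / \<mu> e))) * exp_mult t e"
      by (intro mult_right_mono exp_taylor_remainder) (use ts m in \<open>auto simp: exp_mult_def\<close>)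
    also have "\<dots> = (\<bar>s - t\<bar> / (t / 2)) ^ N * exp_mult (t / 2) e" by (simp only: mult.assoc half)
    also have "\<dots> \<le> (\<bar>s - t\<bar> / (t / 2)) ^ N * (2 / t * \<mu> e)"
      using mult_bound_exp_mult[of "t / 2"] ts e by (intro mult_left_mono) (auto simp: mult_bound_def)
    finally show "norm (exp_mult s e - (\<Sum>n<N. (s - t) ^ n * ((- 1 / \<mu> e) ^ n / fact n * exp_mult t e)))
        \<le> (\<bar>s - t\<bar> / (t / 2)) ^ N * (2 / t) * \<mu> e" by (simp add: mult.assoc)
  qed (use ts in auto)
qed auto

end

text \<open>No continuity of \<open>y\<close> is needed: \<open>y t\<close> arises from \<open>y 0\<close> by \<open>n\<close> factors \<open>1 + o(t/n)\<close>.\<close>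

lemma matrix_semigroup_constant:
  fixes a :: "real \<Rightarrow> 'i \<Rightarrow> 'i \<Rightarrow> real" and y :: "real \<Rightarrow> 'i \<Rightarrow> real"
  assumes B: "finite B"
    and y: "\<And>s h i. 0 \<le> s \<Longrightarrow> 0 < h \<Longrightarrow> i \<in> B \<Longrightarrow> y (s + h) i = (\<Sum>j\<in>B. a h i j * y s j)"
    and a: "\<And>i j. i \<in> B \<Longrightarrow> j \<in> B \<Longrightarrow> ((\<lambda>h. (a h i j - (if i = j then 1 else 0)) / h) \<longlongrightarrow> 0) (at_right 0)"
    and t: "0 < t" and i: "i \<in> B"
  shows "y t i = y 0 i"
proof -
  define \<delta> where "\<delta> i j = (if i = j then 1 else 0 :: real)" for i j :: 'i
  define d where "d h = (\<Sum>i\<in>B. \<Sum>j\<in>B. \<bar>a h i j - \<delta> i j\<bar>)" for h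
  define N where "N s = (\<Sum>i\<in>B. \<bar>y s i\<bar>)" for s
  define M where "M s s' = (\<Sum>i\<in>B. \<bar>y s i - y s' i\<bar>)" for s s'
  have d0: "0 \<le> d h" for h unfolding d_def by (intro sum_nonneg) simp
  have N0: "0 \<le> N s" for s unfolding N_def by (intro sum_nonneg) simp
  have step: "M (s + h) s \<le> d h * N s" if "0 \<le> s" "0 < h" for s h
  proof -
    have "\<bar>y (s + h) i - y s i\<bar> \<le> (\<Sum>j\<in>B. \<bar>a h i j - \<delta> i j\<bar>) * N s" if i: "i \<in> B" for i
    proof -
      have "y s i = (\<Sum>j\<in>B. \<delta> i j * y s j)"
        using B i by (simp add: \<delta>_def if_distrib[where f = "\<lambda>x. x * _"] cong: if_cong)
      then have "y (s + h) i - y s i = (\<Sum>j\<in>B. (a h i j - \<delta> i j) * y s j)"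
        using y[OF \<open>0 \<le> s\<close> \<open>0 < h\<close> i] by (simp add: left_diff_distrib sum_subtractf)
      also have "\<bar>\<dots>\<bar> \<le> (\<Sum>j\<in>B. \<bar>(a h i j - \<delta> i j) * y s j\<bar>)" by (rule sum_abs)
      also have "\<dots> \<le> (\<Sum>j\<in>B. \<bar>a h i j - \<delta> i j\<bar> * N s)"
      proof (rule sum_mono)
        fix j assume "j \<in> B"
        then have "\<bar>y s j\<bar> \<le> N s" unfolding N_def by (intro member_le_sum) (use B in auto)
        then show "\<bar>(a h i j - \<delta> i j) * y s j\<bar> \<le> \<bar>a h i j - \<delta> i j\<bar> * N s"
          by (simp add: abs_mult mult_left_mono)
      qed
      finally show ?thesis by (simp add: sum_distrib_right)
    qed
    then have "M (s + h) s \<le> (\<Sum>i\<in>B. (\<Sum>j\<in>B. \<bar>a h i j - \<delta> i j\<bar>) * N s)" unfolding M_def by (rule sum_mono)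
    then show ?thesis by (simp add: d_def sum_distrib_right)
  qed
  have tri: "M s s'' \<le> M s s' + M s' s''" for s s' s''
    unfolding M_def sum.distrib[symmetric] by (intro sum_mono) (simp add: abs_triangle_ineq4)
  have NM: "N s \<le> M s s' + N s'" for s s'
    unfolding M_def N_def sum.distrib[symmetric] by (intro sum_mono) simp
  \<comment> \<open>A discrete Gronwall estimate: each step of length h adds at most
    \<open>d h * N s\<close> to the distance from the initial vector, and \<open>N s\<close> is at
    most that distance plus \<open>N 0\<close>.\<close>
  have iter: "M (real k * h) 0 \<le> ((1 + d h) ^ k - 1) * N 0" if h: "0 < h" for h k
  proof (induction k)
    case 0
    then show ?case by (simp add: M_def)
  next
    case (Suc k)
    have "M (real (Suc k) * h) 0 \<le> M (real k * h + h) (real k * h) + M (real k * h) 0"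
      using tri[of "real (Suc k) * h" 0 "real k * h"] by (simp add: algebra_simps)
    also have "\<dots> \<le> d h * N (real k * h) + M (real k * h) 0"
      using step[of "real k * h" h] h by simp
    also have "\<dots> \<le> d h * (((1 + d h) ^ k - 1) * N 0 + N 0) + ((1 + d h) ^ k - 1) * N 0"
      by (intro add_mono mult_left_mono order_trans[OF NM[of _ 0]] add_right_mono Suc.IH d0)
    also have "\<dots> = ((1 + d h) ^ Suc k - 1) * N 0" by (simp add: algebra_simps)
    finally show ?case .
  qed
  have dh: "((\<lambda>h. d h / h) \<longlongrightarrow> 0) (at_right 0)"
  proof -
    have "((\<lambda>h. \<Sum>i\<in>B. \<Sum>j\<in>B. \<bar>(a h i j - \<delta> i j) / h\<bar>) \<longlongrightarrow> 0) (at_right 0)"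
      by (intro tendsto_null_sum tendsto_rabs_zero) (use a in \<open>simp add: \<delta>_def\<close>)
    moreover have "\<forall>\<^sub>F h in at_right 0. (\<Sum>i\<in>B. \<Sum>j\<in>B. \<bar>(a h i j - \<delta> i j) / h\<bar>) = d h / h"
      using eventually_at_right_less[of "0::real"]
      by (rule eventually_mono) (simp add: d_def sum_divide_distrib)
    ultimately show ?thesis by (rule Lim_transform_eventually)
  qed
  have lim0: "filterlim (\<lambda>n. t / real (Suc n)) (at_right 0) sequentially"
  proof (rule tendsto_imp_filterlim_at_right)
    show "(\<lambda>n. t / real (Suc n)) \<longlonglongrightarrow> 0"
      using tendsto_mult_right_zero[OF LIMSEQ_inverse_real_of_nat, of t] by (simp add: divide_inverse)
  qed (use t in simp)
  \<comment> \<open>Cut [0,t] into equal steps of length h. The accumulated factor is at most exp(t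
    d(h)/h), which tends to 1 as d(h)/h tends to 0.\<close>
  have "(\<lambda>n. exp (t * (d (t / real (Suc n)) / (t / real (Suc n)))) - 1) \<longlonglongrightarrow> exp (t * 0) - 1"
    by (intro tendsto_intros filterlim_compose[OF dh lim0])
  then have "(\<lambda>n. (exp (t * (d (t / real (Suc n)) / (t / real (Suc n)))) - 1) * N 0) \<longlonglongrightarrow> 0"
    using tendsto_mult_left_zero by fastforce
  moreover have "M t 0 \<le> (exp (t * (d (t / real (Suc n)) / (t / real (Suc n)))) - 1) * N 0" for n
  proof -
    let ?h = "t / real (Suc n)"
    have "(1 + d ?h) ^ Suc n \<le> exp (d ?h) ^ Suc n"
      by (rule power_mono[OF exp_ge_add_one_self]) (use d0 in simp)
    also have "\<dots> = exp (real (Suc n) * d ?h)" by (rule exp_of_nat_mult[symmetric])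
    also have "real (Suc n) * d ?h = t * (d ?h / ?h)" using t by (simp del: of_nat_Suc)
    finally have "((1 + d ?h) ^ Suc n - 1) * N 0 \<le> (exp (t * (d ?h / ?h)) - 1) * N 0"
      by (intro mult_right_mono N0) simp
    moreover have "M t 0 \<le> ((1 + d ?h) ^ Suc n - 1) * N 0"
      using iter[of ?h "Suc n"] t by (simp del: of_nat_Suc power_Suc)
    ultimately show ?thesis by linarith
  qed
  ultimately have "M t 0 \<le> 0" by (intro LIMSEQ_le_const) auto
  moreover have "\<bar>y t i - y 0 i\<bar> \<le> M t 0" unfolding M_def by (rule member_le_sum) (use B i in auto)
  ultimately show ?thesis by simp
qed

section \<open>Bounded operators determined on a dense set\<close>

context finite_weights
begin

lemma bounded_operatorD:
  assumes "bounded_operator m p S"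
  shows "f \<in> lp m p \<Longrightarrow> S f \<in> lp m p"
    "f \<in> lp m p \<Longrightarrow> g \<in> lp m p \<Longrightarrow> S (\<lambda>x. r * f x + s * g x) = (\<lambda>x. r * S f x + s * S g x)"
    "f \<notin> lp m p \<Longrightarrow> S f = undefined"
  using assms by (auto simp: bounded_operator_def PiE_def extensional_def)

lemma bounded_operator_bound:
  assumes "bounded_operator m p S"
  obtains K where "0 \<le> K" "\<And>f. f \<in> lp m p \<Longrightarrow> lp_norm m p (S f) \<le> K * lp_norm m p f"
proof -
  obtain K where "\<And>f. f \<in> lp m p \<Longrightarrow> lp_norm m p (S f) \<le> K * lp_norm m p f"
    using assms unfolding bounded_operator_def by blast
  then have "lp_norm m p (S f) \<le> max 0 K * lp_norm m p f" if "f \<in> lp m p" for f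
    using that lp_norm_nonneg[OF that] by (meson max.cobounded2 mult_right_mono order_trans)
  then show ?thesis using that[of "max 0 K"] by auto
qed

lemma bounded_operator_diff:
  assumes "bounded_operator m p S" "f \<in> lp m p" "g \<in> lp m p"
  shows "S (\<lambda>x. f x - g x) = (\<lambda>x. S f x - S g x)"
  using bounded_operatorD(2)[OF assms, of 1 "-1"] by simp

text \<open>Serves two uniqueness claims: that of \<open>on_lp\<close>, with the finitely supported
  functions as dense set, and that of \<open>exp_neg\<close>, with the span of the eigenfunctions.
  Off the space both operators are \<open>undefined\<close>.\<close>

lemma bounded_operator_unique:
  assumes p: "1 \<le> p" and S: "bounded_operator m p S" and S': "bounded_operator m p S'"
    and D: "D \<subseteq> lp m p" "\<And>f \<epsilon>. f \<in> lp m p \<Longrightarrow> 0 < \<epsilon> \<Longrightarrow> \<exists>\<phi>\<in>D. lp_norm m p (\<lambda>x. f x - \<phi> x) < \<epsilon>"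
    and eq: "\<And>\<phi>. \<phi> \<in> D \<Longrightarrow> S \<phi> = S' \<phi>"
  shows "S = S'"
proof
  fix f
  show "S f = S' f"
  proof (cases "f \<in> lp m p")
    case True
    obtain K where K: "0 \<le> K" "\<And>f. f \<in> lp m p \<Longrightarrow> lp_norm m p (S f) \<le> K * lp_norm m p f"
      using bounded_operator_bound[OF S] by blast
    obtain K' where K': "0 \<le> K'" "\<And>f. f \<in> lp m p \<Longrightarrow> lp_norm m p (S' f) \<le> K' * lp_norm m p f"
      using bounded_operator_bound[OF S'] by blast
    define w where "w x = S f x - S' f x" for x
    have w: "w \<in> lp m p" unfolding w_def by (intro lp_diff p bounded_operatorD[OF S] bounded_operatorD[OF S'] True)
    have le: "lp_norm m p w \<le> 4 * (K + K') * \<epsilon>" if \<epsilon>: "0 < \<epsilon>" for \<epsilon>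
    proof -
      obtain \<phi> where \<phi>: "\<phi> \<in> D" "lp_norm m p (\<lambda>x. f x - \<phi> x) < \<epsilon>" using D(2)[OF True \<epsilon>] by blast
      have \<phi>l: "\<phi> \<in> lp m p" using \<phi> D by auto
      define h where "h x = f x - \<phi> x" for x
      have h: "h \<in> lp m p" unfolding h_def by (intro lp_diff p True \<phi>l)
      have "w = (\<lambda>x. S h x - S' h x)"
        using bounded_operator_diff[OF S True \<phi>l] bounded_operator_diff[OF S' True \<phi>l] eq[OF \<phi>(1)]
        unfolding w_def h_def by simp
      then have "lp_norm m p w \<le> 4 * (lp_norm m p (S h) + lp_norm m p (S' h))"
        using lp_diff(2)[OF p bounded_operatorD(1)[OF S h] bounded_operatorD(1)[OF S' h]] by simp
      also have "\<dots> \<le> 4 * (K * \<epsilon> + K' * \<epsilon>)"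
      proof -
        have "K * lp_norm m p h \<le> K * \<epsilon>" "K' * lp_norm m p h \<le> K' * \<epsilon>"
          using \<phi>(2) K(1) K'(1) by (auto simp: h_def[abs_def] intro!: mult_left_mono)
        then show ?thesis using K(2)[OF h] K'(2)[OF h] by simp
      qed
      finally show ?thesis by (simp add: algebra_simps)
    qed
    have "lp_norm m p w \<le> 0 + \<epsilon>" if "0 < \<epsilon>" for \<epsilon>
    proof -
      have "lp_norm m p w \<le> 4 * (K + K') * (\<epsilon> / (4 * (K + K') + 1))"
        by (rule le) (use that K(1) K'(1) in simp)
      also have "\<dots> \<le> \<epsilon>" using that K(1) K'(1) by (simp add: field_simps)
      finally show ?thesis by simp
    qed
    then have "lp_norm m p w \<le> 0" by (rule field_le_epsilon)
    then have "lp_norm m p w = 0" using lp_norm_nonneg[OF w] by simp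
    then have "w x = 0" for x using lp_point[OF p w, of x] by simp
    then show ?thesis by (auto simp: w_def fun_eq_iff)
  qed (use bounded_operatorD(3)[OF S] bounded_operatorD(3)[OF S'] in auto)
qed

lemma bounded_operator_sum:
  assumes p: "1 \<le> p" and S: "bounded_operator m p S" and f: "\<And>i. i \<in> I \<Longrightarrow> f i \<in> lp m p"
  shows "S (\<lambda>x. \<Sum>i\<in>I. c i * f i x) = (\<lambda>x. \<Sum>i\<in>I. c i * S (f i) x)"
  using f
proof (induction I rule: infinite_finite_induct)
  case (insert i I)
  have "S (\<lambda>x. c i * f i x + 1 * (\<Sum>i\<in>I. c i * f i x)) = (\<lambda>x. c i * S (f i) x + 1 * S (\<lambda>x. \<Sum>i\<in>I. c i * f i x) x)"
    by (rule bounded_operatorD(2)[OF S]) (use insert p in \<open>auto intro!: lp_sum lp_cmult\<close>)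
  then show ?case using insert by simp
\<comment> \<open>For an empty and for an infinite index set both sums are 0; that \<open>S\<close>
  maps 0 to 0 is the linear relation with zero coefficients.\<close>
qed (use bounded_operatorD(2)[OF S lp_zero(1)[OF p] lp_zero(1)[OF p], of 0 0] in \<open>simp_all add: fun_eq_iff\<close>)

lemma L1_lp1: "L1 = lp m 1"
  using lp_finite(1)[of 1] by (auto simp: L1_def)

end

section \<open>Markovian semigroups\<close>

text \<open>Adds the two facts behind strong continuity on lp: the order property, which yields
  bounds uniform in time, and density of the range of \<open>G\<close> for every finite
  exponent.\<close>

locale markov_eigenbasis = eigenbasis +
  assumes res_markov: "\<And>\<alpha>. 0 < \<alpha> \<Longrightarrow> markov (ker (\<lambda>e. \<alpha> * res_mult \<alpha> e))"
    and G_dense: "\<And>p f \<epsilon>. 1 \<le> p \<Longrightarrow> p \<noteq> \<infinity> \<Longrightarrow> f \<in> lp m p \<Longrightarrow> 0 < \<epsilon> \<Longrightarrow>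
      \<exists>g\<in>linf. lp_norm m p (\<lambda>x. f x - G g x) < \<epsilon>"
begin

lemma markov_lim:
  assumes "\<And>n. markov (ker (\<phi> n))" "\<And>n. mult_bound K (\<phi> n)" "\<And>e. e \<in> E \<Longrightarrow> (\<lambda>n. \<phi> n e) \<longlonglongrightarrow> \<psi> e"
  shows "markov (ker \<psi>)"
  unfolding markov_def
proof (intro allI impI)
  fix f :: "'a \<Rightarrow> real" and x
  assume f: "\<forall>y. 0 \<le> f y \<and> f y \<le> 1"
  have "f \<in> L1" by (rule bounded_L1(1)[where K = 1]) (use f in auto)
  then have lim: "(\<lambda>n. T (\<phi> n) f x) \<longlonglongrightarrow> T \<psi> f x" by (intro T_tendsto[where K = K]) (use assms in auto)
  have "0 \<le> T (\<phi> n) f x \<and> T (\<phi> n) f x \<le> 1" for n using assms(1) f by (auto simp: markov_def)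
  then show "0 \<le> T \<psi> f x \<and> T \<psi> f x \<le> 1"
    by (intro conjI LIMSEQ_le_const[OF lim] LIMSEQ_le_const2[OF lim]) auto
qed

text \<open>Powers start at 1 because the constant multiplier 1 is in general not bounded by a
  multiple of \<mu>. The bound \<open>K\<close> is kept since the other factors are at most
  1.\<close>

lemma markov_power:
  assumes mk: "markov (ker \<phi>)" and \<phi>: "mult_bound K \<phi>" and le: "\<And>e. e \<in> E \<Longrightarrow> \<bar>\<phi> e\<bar> \<le> 1"
  shows "mult_bound K (\<lambda>e. \<phi> e ^ Suc n) \<and> markov (ker (\<lambda>e. \<phi> e ^ Suc n))"
proof (induction n)
  case 0
  then show ?case using mk \<phi> by simp
next
  case (Suc n)
  have b: "mult_bound K (\<lambda>e. \<phi> e * \<phi> e ^ Suc n)"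
    unfolding mult_bound_def
  proof (intro conjI ballI)
    fix e assume e: "e \<in> E"
    have "\<bar>\<phi> e\<bar> * \<bar>\<phi> e ^ Suc n\<bar> \<le> (K * \<mu> e) * 1"
      using \<phi> e le[OF e] by (intro mult_mono) (auto simp: mult_bound_def power_abs power_le_one simp del: power_Suc)
    then show "norm (\<phi> e * \<phi> e ^ Suc n) \<le> K * \<mu> e" by (simp add: abs_mult)
  qed (use \<phi> in \<open>auto simp: mult_bound_def\<close>)
  have "markov (ker (\<lambda>e. \<phi> e * \<phi> e ^ Suc n))"
    unfolding markov_def
  proof (intro allI impI)
    fix f :: "'a \<Rightarrow> real" and x
    assume f: "\<forall>y. 0 \<le> f y \<and> f y \<le> 1"
    have f1: "f \<in> L1" by (rule bounded_L1(1)[where K = 1]) (use f in auto)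
    have "T (\<lambda>e. \<phi> e * \<phi> e ^ Suc n) f = T \<phi> (T (\<lambda>e. \<phi> e ^ Suc n) f)"
      using T_mult[OF \<phi> _ b f1] Suc by metis
    then show "0 \<le> T (\<lambda>e. \<phi> e * \<phi> e ^ Suc n) f x \<and> T (\<lambda>e. \<phi> e * \<phi> e ^ Suc n) f x \<le> 1"
      using mk Suc f unfolding markov_def by simp
  qed
  then show ?case using b by simp
qed

lemma exp_mult_01: "e \<in> E \<Longrightarrow> 0 < t \<Longrightarrow> 0 < exp_mult t e \<and> exp_mult t e < 1"
  using mu_pos by (simp add: exp_mult_def)

text \<open>Euler's formula: the semigroup is the limit of the powers (\<alpha> R(\<alpha>))^(n+1)
  with \<alpha> = (n+1)/t, where R(\<alpha>) is the resolvent.\<close>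

lemma markov_exp_mult:
  assumes t: "0 < t" shows "markov (ker (exp_mult t))"
proof (rule markov_lim)
  define \<alpha> where "\<alpha> n = real (Suc n) / t" for n
  have \<alpha>: "0 < \<alpha> n" for n using t by (simp add: \<alpha>_def)
  have eq: "\<alpha> n * res_mult (\<alpha> n) e = inverse (1 + t / \<mu> e / real (Suc n))" if "e \<in> E" for n e
    using mu_pos[OF that] t \<alpha>[of n] by (simp add: res_mult_def \<alpha>_def divide_simps add_pos_pos del: of_nat_Suc) (simp add: algebra_simps)
  have le1: "\<bar>\<alpha> n * res_mult (\<alpha> n) e\<bar> \<le> 1" if "e \<in> E" for n e
  proof -
    have "1 \<le> 1 + t / \<mu> e / real (Suc n)" using mu_pos[OF that] t by simp
    from le_imp_inverse_le[OF this] this show ?thesis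
      unfolding eq[OF that] by (simp add: abs_of_pos del: of_nat_Suc)
  qed
  have "mult_bound (\<alpha> n) (\<lambda>e. \<alpha> n * res_mult (\<alpha> n) e)" for n
    using mult_bound_res_mult[OF \<alpha>[of n]] \<alpha>[of n] by (auto simp: mult_bound_def abs_mult)
  from markov_power[OF res_markov[OF \<alpha>] this le1]
  show "markov (ker (\<lambda>e. (\<alpha> n * res_mult (\<alpha> n) e) ^ Suc n))" for n by blast
  show "mult_bound (1 / t) (\<lambda>e. (\<alpha> n * res_mult (\<alpha> n) e) ^ Suc n)" for n
    unfolding mult_bound_def
  proof (intro conjI ballI)
    fix e assume e: "e \<in> E"
    have x: "0 < t / \<mu> e" using mu_pos[OF e] t by simp
    \<comment> \<open>Bernoulli's inequality gives (1 + x/(n+1))^(n+1) >= x for x = t/\<mu>(e),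
      hence a multiplier bound that is independent of n.\<close>
    have "t / \<mu> e \<le> 1 + real (Suc n) * (t / \<mu> e / real (Suc n))" by simp
    also have "\<dots> \<le> (1 + t / \<mu> e / real (Suc n)) ^ Suc n"
      by (rule Bernoulli_inequality) (rule order_trans[of _ 0], use mu_pos[OF e] t in simp_all)
    finally have "inverse ((1 + t / \<mu> e / real (Suc n)) ^ Suc n) \<le> inverse (t / \<mu> e)"
      by (rule le_imp_inverse_le[OF _ x])
    moreover have "0 \<le> inverse ((1 + t / \<mu> e / real (Suc n)) ^ Suc n)"
      using mu_pos[OF e] t by (intro inverse_nonnegative_iff_nonnegative[THEN iffD2] zero_le_power add_nonneg_nonneg) simp_all
    ultimately show "norm ((\<alpha> n * res_mult (\<alpha> n) e) ^ Suc n) \<le> 1 / t * \<mu> e"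
      unfolding eq[OF e] power_inverse real_norm_def by (simp del: power_Suc of_nat_Suc)
  qed (use t in auto)
  fix e assume e: "e \<in> E"
  have "(\<lambda>n. inverse ((1 + t / \<mu> e / real (Suc n)) ^ Suc n)) \<longlonglongrightarrow> inverse (exp (t / \<mu> e))"
    by (intro tendsto_inverse LIMSEQ_Suc[OF tendsto_exp_limit_sequentially]) simp
  then show "(\<lambda>n. (\<alpha> n * res_mult (\<alpha> n) e) ^ Suc n) \<longlonglongrightarrow> exp_mult t e"
    unfolding eq[OF e] power_inverse by (simp add: exp_mult_def exp_minus)
qed

text \<open>The multiplier of the mean \<open>1/t \<integral>\<^sub>0\<^sup>t e\<^sup>-\<^sup>s\<^sup>L ds\<close>; it is Markovian as a limit of Riemann sums.\<close>

definition mean_mult :: "real \<Rightarrow> ('a \<Rightarrow> real) \<Rightarrow> real" where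
  "mean_mult t e = (1 - exp_mult t e) * (\<mu> e / t)"

lemma mult_bound_mean_mult: "0 < t \<Longrightarrow> mult_bound (1 / t) (mean_mult t)"
  unfolding mult_bound_def
proof (intro conjI ballI)
  fix e assume t: "0 < t" and e: "e \<in> E"
  have "(1 - exp_mult t e) * (\<mu> e / t) \<le> 1 * (\<mu> e / t)"
    using exp_mult_01[OF e t] mu_pos[OF e] t by (intro mult_right_mono) auto
  then show "norm (mean_mult t e) \<le> 1 / t * \<mu> e"
    using exp_mult_01[OF e t] mu_pos[OF e] t by (simp add: mean_mult_def abs_mult)
qed simp

lemma markov_mean_mult:
  assumes t: "0 < t" shows "markov (ker (mean_mult t))"
proof (rule markov_lim)
  \<comment> \<open>Right endpoints of the partition: the left ones would include time 0, whose
    multiplier is 1.\<close>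
  define a where "a n k = exp_mult (real (Suc k) * (t / real (Suc n)))" for n k
  define avg where "avg n e = (\<Sum>k<Suc n. 1 / real (Suc n) * a n k e)" for n e
  have apos: "0 < real (Suc k) * (t / real (Suc n))" for n k using t by simp
  have ks: "T (avg n) f x = (\<Sum>k<Suc n. 1 / real (Suc n) * T (a n k) f x)" if "f \<in> L1" for n f x
    unfolding avg_def using kernel_op_sum_kernel[of "Suc n" "a n" f "\<lambda>k. 1 / real (Suc n)" x] that mult_bound_exp_mult[OF apos]
    unfolding a_def by blast
  show "markov (ker (avg n))" for n
    unfolding markov_def
  proof (intro allI impI)
    fix f :: "'a \<Rightarrow> real" and x
    assume f: "\<forall>y. 0 \<le> f y \<and> f y \<le> 1"
    have f1: "f \<in> L1" by (rule bounded_L1(1)[where K = 1]) (use f in auto)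
    have *: "0 \<le> T (a n k) f x \<and> T (a n k) f x \<le> 1" for k
      using markov_exp_mult[OF apos, of k n] f unfolding markov_def a_def by blast
    have "(\<Sum>k<Suc n. 1 / real (Suc n) * T (a n k) f x) \<le> (\<Sum>k<Suc n. 1 / real (Suc n) * 1)"
      by (intro sum_mono mult_left_mono) (use * in auto)
    moreover have "0 \<le> (\<Sum>k<Suc n. 1 / real (Suc n) * T (a n k) f x)"
      by (intro sum_nonneg mult_nonneg_nonneg) (use * in auto)
    ultimately show "0 \<le> T (avg n) f x \<and> T (avg n) f x \<le> 1" unfolding ks[OF f1] by simp
  qed
  \<comment> \<open>Summing the geometric series turns the Riemann sum into (1 -
    \<open>exp_mult t e\<close>) / \<open>D n e\<close>. Here \<open>D n e\<close> is at least
    t/\<mu>(e), which gives the uniform bound, and tends to it, which gives the limit.\<close>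
  define D where "D n e = real (Suc n) * (exp (t / \<mu> e / real (Suc n)) - 1)" for n e
  have closed: "avg n e = (1 - exp_mult t e) / D n e" if e: "e \<in> E" for n e
  proof -
    define q where "q = exp (- (t / \<mu> e / real (Suc n)))"
    have x: "0 < t / \<mu> e / real (Suc n)" using mu_pos[OF e] t by simp
    have q: "0 < q" "q < 1" using x by (auto simp: q_def)
    have "a n k e = q ^ Suc k" for k
      unfolding a_def exp_mult_def q_def exp_of_nat_mult[symmetric] by simp
    then have "avg n e = (\<Sum>k<Suc n. 1 / real (Suc n) * (q * q ^ k))"
      unfolding avg_def by (simp only: power_Suc)
    also have "\<dots> = 1 / real (Suc n) * (\<Sum>k<Suc n. q * q ^ k)"
      by (rule sum_distrib_left[symmetric])
    also have "(\<Sum>k<Suc n. q * q ^ k) = q * ((1 - q ^ Suc n) / (1 - q))"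
      unfolding sum_distrib_left[symmetric] using q by (simp add: sum_gp_strict del: sum.lessThan_Suc)
    also have "q ^ Suc n = exp_mult t e"
      unfolding q_def exp_of_nat_mult[symmetric] exp_mult_def by (simp del: of_nat_Suc)
    also have "1 / real (Suc n) * (q * ((1 - exp_mult t e) / (1 - q))) = (1 - exp_mult t e) / (real (Suc n) * ((1 - q) / q))"
      using q by simp
    also have "(1 - q) / q = exp (t / \<mu> e / real (Suc n)) - 1"
      using q by (simp add: diff_divide_distrib q_def exp_minus del: of_nat_Suc flip: inverse_eq_divide)
    finally show ?thesis by (simp add: D_def)
  qed
  have D_ge: "t / \<mu> e \<le> D n e" if e: "e \<in> E" for n e
  proof -
    have "t / \<mu> e / real (Suc n) \<le> exp (t / \<mu> e / real (Suc n)) - 1"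
      using exp_ge_add_one_self[of "t / \<mu> e / real (Suc n)"] by linarith
    from mult_left_mono[OF this, of "real (Suc n)"] show ?thesis
      unfolding D_def by (simp del: of_nat_Suc)
  qed
  have D_le: "D n e \<le> t / \<mu> e * exp (t / \<mu> e / real (Suc n))" for n e
  proof -
    define h where "h = t / \<mu> e / real (Suc n)"
    have "(1 - h) * exp h \<le> exp (- h) * exp h"
      using exp_ge_add_one_self[of "- h"] by (intro mult_right_mono) auto
    then have "exp h - 1 \<le> h * exp h" by (simp add: algebra_simps exp_minus_inverse)
    from mult_left_mono[OF this, of "real (Suc n)"] show ?thesis
      unfolding D_def h_def[symmetric] by (simp add: h_def del: of_nat_Suc)
  qed
  show "mult_bound (1 / t) (avg n)" for n
    unfolding mult_bound_def
  proof (intro conjI ballI)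
    fix e assume e: "e \<in> E"
    have x: "0 < t / \<mu> e" using mu_pos[OF e] t by simp
    have "(1 - exp_mult t e) / D n e \<le> 1 / (t / \<mu> e)"
      using exp_mult_01[OF e t] D_ge[OF e, of n] x by (intro frac_le) auto
    then show "norm (avg n e) \<le> 1 / t * \<mu> e"
      unfolding closed[OF e] using exp_mult_01[OF e t] D_ge[OF e, of n] x by simp
  qed (use t in auto)
  fix e assume e: "e \<in> E"
  have x: "0 < t / \<mu> e" using mu_pos[OF e] t by simp
  have "(\<lambda>n. D n e) \<longlonglongrightarrow> t / \<mu> e"
  proof (rule tendsto_sandwich[OF _ _ tendsto_const])
    have "(\<lambda>n. t / \<mu> e * exp (t / \<mu> e * inverse (real (Suc n)))) \<longlonglongrightarrow> t / \<mu> e * exp (t / \<mu> e * 0)"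
      by (intro tendsto_intros LIMSEQ_inverse_real_of_nat)
    then show "(\<lambda>n. t / \<mu> e * exp (t / \<mu> e / real (Suc n))) \<longlonglongrightarrow> t / \<mu> e"
      by (simp add: divide_inverse)
  qed (use D_ge[OF e] D_le in auto)
  then have "(\<lambda>n. (1 - exp_mult t e) / D n e) \<longlonglongrightarrow> (1 - exp_mult t e) / (t / \<mu> e)"
    using x by (intro tendsto_divide tendsto_const) auto
  then show "(\<lambda>n. avg n e) \<longlonglongrightarrow> mean_mult t e"
    unfolding closed[OF e] by (simp add: mean_mult_def)
qed

lemma exp_mult_derivative:
  assumes e: "e \<in> E" shows "((\<lambda>t. (exp_mult t e - 1) / t) \<longlongrightarrow> - (1 / \<mu> e)) (at_right 0)"
proof -
  have "((\<lambda>t. exp_mult t e) has_real_derivative - (1 / \<mu> e)) (at 0)"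
    unfolding exp_mult_def by (auto intro!: derivative_eq_intros simp: divide_inverse)
  then have "((\<lambda>t. (exp_mult t e - 1) / t) \<longlongrightarrow> - (1 / \<mu> e)) (at 0)"
    by (simp add: DERIV_def exp_mult_def)
  then show ?thesis by (rule tendsto_mono[OF at_le, rotated]) simp
qed

text \<open>The bounds of \<phi>(t) may blow up as t tends to 0. On the range of \<open>G\<close>
  the multiplier becomes \<phi>(t) \<mu>, bounded by \<mu> for all t, and dominated convergence
  applies; the constant 2 of \<open>markov_lp\<close> is independent of t and carries the limit over
  to the closure.\<close>

lemma strong_limit:
  fixes \<phi> :: "real \<Rightarrow> ('a \<Rightarrow> real) \<Rightarrow> real"
  assumes p: "1 \<le> p" "p \<noteq> \<infinity>" and f: "f \<in> lp m p"
    and mk: "\<And>t. 0 < t \<Longrightarrow> markov (ker (\<phi> t))" and \<phi>: "\<And>t. 0 < t \<Longrightarrow> \<exists>K. mult_bound K (\<phi> t)"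
    and le: "\<And>t e. 0 < t \<Longrightarrow> e \<in> E \<Longrightarrow> \<bar>\<phi> t e\<bar> \<le> 1"
    and lim: "\<And>e. e \<in> E \<Longrightarrow> ((\<lambda>t. \<phi> t e) \<longlongrightarrow> 1) (at_right 0)"
  shows "((\<lambda>t. lp_norm m p (\<lambda>x. T (\<phi> t) f x - f x)) \<longlongrightarrow> 0) (at_right 0)"
proof (rule tendstoI)
  fix \<epsilon> :: real assume \<epsilon>: "0 < \<epsilon>"
  \<comment> \<open>The share \<epsilon>/100 is small enough for the weak triangle inequalities: the
    terms below add up to at most 24 + 16 = 40 such shares.\<close>
  obtain g where g: "g \<in> linf" "lp_norm m p (\<lambda>x. f x - G g x) < \<epsilon> / 100"
    using G_dense[OF p f, of "\<epsilon> / 100"] \<epsilon> by auto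
  have g1: "g \<in> L1" by (rule linf_L1[OF g(1)])
  have Gg: "G g \<in> lp m p" by (rule linf_lp[OF p(1) T_linf[OF mult_bound_mu g1]])
  have pos: "eventually (\<lambda>t. 0 < t) (at_right (0::real))" by (simp add: eventually_at_right_less)
  have mb: "mult_bound 1 (\<lambda>e. \<phi> t e * \<mu> e)" if "0 < t" for t
    unfolding mult_bound_def
  proof (intro conjI ballI)
    fix e assume "e \<in> E"
    then show "norm (\<phi> t e * \<mu> e) \<le> 1 * \<mu> e"
      using mult_right_mono[OF le[OF that], of e "\<mu> e"] mu_pos[of e] by (simp add: abs_mult)
  qed simp
  have eq: "T (\<phi> t) (G g) = T (\<lambda>e. \<phi> t e * \<mu> e) g" if t: "0 < t" for t
    using \<phi>[OF t] T_mult[OF _ mult_bound_mu mb[OF t] g1] by blast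
  have "((\<lambda>t. lp_norm m p (\<lambda>x. T (\<lambda>e. \<phi> t e * \<mu> e) g x - G g x)) \<longlongrightarrow> 0) (at_right 0)"
  proof (rule lp_dominated[OF p, where K = "1 * K0 * n1 g + 1 * K0 * n1 g"])
    show "\<forall>\<^sub>F t in at_right 0. \<forall>x. norm (T (\<lambda>e. \<phi> t e * \<mu> e) g x - G g x) \<le> 1 * K0 * n1 g + 1 * K0 * n1 g"
      by (rule eventually_mono[OF pos])
        (intro allI order_trans[OF norm_triangle_ineq4] add_mono kernel_op_bound(2)[OF ker_kernel_bound[OF mb] g1] kernel_op_bound(2)[OF ker_kernel_bound[OF mult_bound_mu] g1])
    show "((\<lambda>t. T (\<lambda>e. \<phi> t e * \<mu> e) g x) \<longlongrightarrow> G g x) (at_right 0)" for x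
    proof (rule T_tendsto[OF _ _ g1])
      show "\<forall>\<^sub>F t in at_right 0. mult_bound 1 (\<lambda>e. \<phi> t e * \<mu> e)" using pos by eventually_elim (rule mb)
      show "((\<lambda>t. \<phi> t e * \<mu> e) \<longlongrightarrow> \<mu> e) (at_right 0)" if "e \<in> E" for e
        using tendsto_mult_right[OF lim[OF that], of "\<mu> e"] by simp
    qed
  qed
  then have "\<forall>\<^sub>F t in at_right 0. lp_norm m p (\<lambda>x. T (\<lambda>e. \<phi> t e * \<mu> e) g x - G g x) < \<epsilon> / 100"
    using \<epsilon> by (intro order_tendstoD(2)[of _ 0]) auto
  then show "\<forall>\<^sub>F t in at_right 0. dist (lp_norm m p (\<lambda>x. T (\<phi> t) f x - f x)) 0 < \<epsilon>"
    using pos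
  proof eventually_elim
    case (elim t)
    obtain K where K: "mult_bound K (\<phi> t)" using \<phi> elim by blast
    define h where "h x = f x - G g x" for x
    have h: "h \<in> lp m p" unfolding h_def by (rule lp_diff(1)[OF p(1) f Gg])
    note L = lp_L1(1)[OF p(1)]
    have Th: "T (\<phi> t) h \<in> lp m p" by (rule kernel_op_lp(1)[OF p(1) ker_kernel_bound[OF K] h])
    have TG: "T (\<phi> t) (G g) \<in> lp m p" by (rule kernel_op_lp(1)[OF p(1) ker_kernel_bound[OF K] Gg])
    have hle: "lp_norm m p h < \<epsilon> / 100" using g(2) by (simp add: h_def[abs_def])
    have B: "lp_norm m p (\<lambda>x. T (\<phi> t) (G g) x - G g x) < \<epsilon> / 100" using elim eq by simp
    have A: "lp_norm m p (T (\<phi> t) h) \<le> 2 * lp_norm m p h"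
      by (rule markov_lp[OF mk ker_sym ker_kernel_bound[OF K] p(1) h]) (use elim in simp)
    have "T (\<phi> t) f x - f x = T (\<phi> t) h x + ((T (\<phi> t) (G g) x - G g x) - h x)" for x
      using kernel_op_diff[OF ker_kernel_bound[OF K] L[OF f] L[OF Gg], of x] by (simp add: h_def[abs_def])
    then have "lp_norm m p (\<lambda>x. T (\<phi> t) f x - f x)
        = lp_norm m p (\<lambda>x. T (\<phi> t) h x + ((T (\<phi> t) (G g) x - G g x) - h x))" by simp
    also have "\<dots> \<le> 4 * (lp_norm m p (T (\<phi> t) h) + lp_norm m p (\<lambda>x. (T (\<phi> t) (G g) x - G g x) - h x))"
      by (intro lp_add(2) p(1) Th lp_diff(1) TG Gg h)
    finally have C: "lp_norm m p (\<lambda>x. T (\<phi> t) f x - f x) \<le>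
        4 * (lp_norm m p (T (\<phi> t) h) + lp_norm m p (\<lambda>x. (T (\<phi> t) (G g) x - G g x) - h x))" .
    have "lp_norm m p (\<lambda>x. (T (\<phi> t) (G g) x - G g x) - h x)
        \<le> 4 * (lp_norm m p (\<lambda>x. T (\<phi> t) (G g) x - G g x) + lp_norm m p h)"
      by (intro lp_diff(2) p(1) lp_diff(1) TG Gg h)
    moreover have "c < \<epsilon>" if "d \<le> 4 * (b + l)" "a \<le> 2 * l" "b < \<epsilon> / 100" "c \<le> 4 * (a + d)" "l < \<epsilon> / 100"
      for a b c d l using that \<epsilon> by (simp add: field_simps)
    ultimately have "lp_norm m p (\<lambda>x. T (\<phi> t) f x - f x) < \<epsilon>" using A B C hle by blast
    moreover have "0 \<le> lp_norm m p (\<lambda>x. T (\<phi> t) f x - f x)"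
      by (intro lp_norm_nonneg lp_diff(1) p(1) f kernel_op_lp(1)[OF p(1) ker_kernel_bound[OF K]])
    ultimately show ?case by simp
  qed
qed

lemma strong_limit_exp_mult:
  assumes "1 \<le> p" "p \<noteq> \<infinity>" "f \<in> lp m p"
  shows "((\<lambda>t. lp_norm m p (\<lambda>x. T (exp_mult t) f x - f x)) \<longlongrightarrow> 0) (at_right 0)"
proof (rule strong_limit[OF assms markov_exp_mult])
  show "\<exists>K. mult_bound K (exp_mult t)" if "0 < t" for t using mult_bound_exp_mult[OF that] by blast
  show "\<bar>exp_mult t e\<bar> \<le> 1" if "0 < t" "e \<in> E" for t e using exp_mult_01[OF that(2,1)] by simp
  show "((\<lambda>t. exp_mult t e) \<longlongrightarrow> 1) (at_right 0)" for e
  proof -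
    have "((\<lambda>t. exp_mult t e) \<longlongrightarrow> exp (- (0 / \<mu> e))) (at 0)"
      unfolding exp_mult_def divide_inverse by (intro tendsto_intros)
    then show ?thesis by (intro tendsto_mono[OF at_le, of "{0<..}" UNIV]) auto
  qed
qed auto

lemma strong_limit_mean_mult:
  assumes "1 \<le> p" "p \<noteq> \<infinity>" "f \<in> lp m p"
  shows "((\<lambda>t. lp_norm m p (\<lambda>x. T (mean_mult t) f x - f x)) \<longlongrightarrow> 0) (at_right 0)"
proof (rule strong_limit[OF assms markov_mean_mult])
  show "\<exists>K. mult_bound K (mean_mult t)" if "0 < t" for t using mult_bound_mean_mult[OF that] by blast
  show "\<bar>mean_mult t e\<bar> \<le> 1" if t: "0 < t" and e: "e \<in> E" for t e
  proof -
    have x: "0 < t / \<mu> e" using mu_pos[OF e] t by simp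
    have "1 - exp_mult t e \<le> t / \<mu> e" using exp_ge_add_one_self[of "- (t / \<mu> e)"] by (simp add: exp_mult_def)
    then have "mean_mult t e \<le> t / \<mu> e * (\<mu> e / t)"
      unfolding mean_mult_def by (rule mult_right_mono) (use mu_pos[OF e] t in simp)
    then show ?thesis using exp_mult_01[OF e t] mu_pos[OF e] t by (simp add: mean_mult_def)
  qed
  show "((\<lambda>t. mean_mult t e) \<longlongrightarrow> 1) (at_right 0)" if e: "e \<in> E" for e
  proof -
    have "((\<lambda>t. - \<mu> e * ((exp_mult t e - 1) / t)) \<longlongrightarrow> - \<mu> e * - (1 / \<mu> e)) (at_right 0)"
      by (intro tendsto_mult_left exp_mult_derivative[OF e])
    moreover have "- \<mu> e * ((exp_mult t e - 1) / t) = mean_mult t e" for t by (simp add: mean_mult_def divide_inverse algebra_simps)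
    ultimately show ?thesis using mu_pos[OF e] by simp
  qed
qed auto

end

section \<open>Spectra\<close>

context eigenbasis
begin

definition green_inv :: "real \<Rightarrow> ennreal \<Rightarrow> (('a \<Rightarrow> real) \<times> ('a \<Rightarrow> real)) set" where
  "green_inv \<sigma> p = {(G g, \<lambda>x. \<sigma> * g x) | g. g \<in> lp m p}"

abbreviation Gc :: "('a \<Rightarrow> complex) \<Rightarrow> 'a \<Rightarrow> complex" where
  "Gc \<equiv> T (\<lambda>e. of_real (\<mu> e))"

lemma mult_bound_mu_complex: "mult_bound 1 (\<lambda>e. of_real (\<mu> e) :: complex)"
  using mu_pos by (auto simp: mult_bound_def less_imp_le)

lemma Gc_Re_Im:
  assumes g: "g \<in> L1"
  shows "(\<lambda>x. Re (Gc g x)) = G (\<lambda>x. Re (g x))" "(\<lambda>x. Im (Gc g x)) = G (\<lambda>x. Im (g x))"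
proof -
  note L = L1_Re_Im[OF g] L1_Re_Im[OF T_L1[OF mult_bound_mu_complex g]]
  have c: "coef (Gc g) e = of_real (\<mu> e) * coef g e" if "e \<in> E" for e
    by (rule coef_T[OF mult_bound_mu_complex g that])
  show "(\<lambda>x. Re (Gc g x)) = G (\<lambda>x. Re (g x))"
    by (rule T_eqI[symmetric, OF mult_bound_mu L(1,3)]) (simp add: coef_Re_Im T_L1[OF mult_bound_mu_complex g] g E_linf c)
  show "(\<lambda>x. Im (Gc g x)) = G (\<lambda>x. Im (g x))"
    by (rule T_eqI[symmetric, OF mult_bound_mu L(2,4)]) (simp add: coef_Re_Im T_L1[OF mult_bound_mu_complex g] g E_linf c)
qed

lemma lp_Re_Im:
  assumes p: "1 \<le> p" and g: "g \<in> lp m p"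
  shows "(\<lambda>x. Re (g x)) \<in> lp m p" "(\<lambda>x. Im (g x)) \<in> lp m p"
  by (auto intro!: lp_mono(1)[OF p g] abs_Re_le_cmod abs_Im_le_cmod)

lemma lp_Complex:
  assumes p: "1 \<le> p" and g: "g \<in> lp m p" "h \<in> lp m p"
  shows "(\<lambda>x. Complex (g x) (h x)) \<in> lp m p"
proof -
  have "(\<lambda>x. complex_of_real (g x)) \<in> lp m p" "(\<lambda>x. complex_of_real (h x)) \<in> lp m p"
    by (rule lp_mono(1)[OF p g(1)], simp) (rule lp_mono(1)[OF p g(2)], simp)
  then have "(\<lambda>x. of_real (g x) + \<i> * of_real (h x)) \<in> lp m p" by (intro lp_add lp_cmult p)
  then show ?thesis by (simp add: Complex_eq)
qed

lemma complexification_green_inv: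
  assumes p: "1 \<le> p"
  shows "complexification (green_inv \<sigma> p) = {(Gc g, \<lambda>x. of_real \<sigma> * g x) | g. g \<in> lp m p}"
proof (intro equalityI subsetI)
  fix u assume "u \<in> complexification (green_inv \<sigma> p)"
  then obtain g h where gh: "g \<in> lp m p" "h \<in> lp m p" and
    u: "Re \<circ> fst u = G g" "Re \<circ> snd u = (\<lambda>x. \<sigma> * g x)" "Im \<circ> fst u = G h" "Im \<circ> snd u = (\<lambda>x. \<sigma> * h x)"
    by (auto simp: complexification_def green_inv_def)
  define k where "k x = Complex (g x) (h x)" for x
  have k: "k \<in> lp m p" unfolding k_def by (rule lp_Complex[OF p gh])
  note G' = Gc_Re_Im[OF lp_L1(1)[OF p k]]
  have "fst u = Gc k"
  proof
    fix x
    show "fst u x = Gc k x"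
      using u(1,3) G' by (simp add: fun_eq_iff complex_eq_iff k_def)
  qed
  moreover have "snd u = (\<lambda>x. of_real \<sigma> * k x)"
    using u(2,4) by (simp add: fun_eq_iff complex_eq_iff k_def)
  ultimately show "u \<in> {(Gc g, \<lambda>x. of_real \<sigma> * g x) | g. g \<in> lp m p}"
    using k by (metis (mono_tags, lifting) mem_Collect_eq surjective_pairing)
next
  fix u assume "u \<in> {(Gc g, \<lambda>x. of_real \<sigma> * g x) | g. g \<in> lp m p}"
  then obtain k where k: "k \<in> lp m p" and u: "u = (Gc k, \<lambda>x. of_real \<sigma> * k x)" by blast
  note G' = Gc_Re_Im[OF lp_L1(1)[OF p k]]
  have "(Re \<circ> Gc k, Re \<circ> (\<lambda>x. of_real \<sigma> * k x)) = (G (\<lambda>x. Re (k x)), \<lambda>x. \<sigma> * Re (k x))"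
    "(Im \<circ> Gc k, Im \<circ> (\<lambda>x. of_real \<sigma> * k x)) = (G (\<lambda>x. Im (k x)), \<lambda>x. \<sigma> * Im (k x))"
    using G' by (simp_all add: comp_def)
  then show "u \<in> complexification (green_inv \<sigma> p)"
    unfolding u complexification_def green_inv_def using lp_Re_Im[OF p k] by blast
qed

text \<open>Finitely many eigenvalues exceed \<delta>, and each of them contributes a finite value.
  For the others |z \<mu>(e)| is at most |s|/2 by the choice of \<delta>, so the denominator stays
  at distance |s|/2 from 0; the +1 in \<delta> covers z = 0.\<close>

lemma inverse_bound:
  fixes z s :: complex
  assumes s: "s \<noteq> 0" and z: "\<And>e. e \<in> E \<Longrightarrow> z * of_real (\<mu> e) \<noteq> s"
  obtains K where "0 \<le> K" "\<And>e. e \<in> E \<Longrightarrow> norm (inverse (z * of_real (\<mu> e) - s)) \<le> K"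
proof -
  define \<delta> where "\<delta> = norm s / (2 * (norm z + 1))"
  have \<delta>: "0 < \<delta>" using s by (simp add: \<delta>_def add_nonneg_pos)
  define F where "F = {e \<in> E. \<delta> \<le> \<mu> e}"
  have F: "finite F" unfolding F_def by (rule finite_mu_ge[OF \<delta>])
  define K where "K = 2 / norm s + (\<Sum>e\<in>F. norm (inverse (z * of_real (\<mu> e) - s)))"
  have "norm (inverse (z * of_real (\<mu> e) - s)) \<le> K" if e: "e \<in> E" for e
  proof (cases "e \<in> F")
    case True
    then have "norm (inverse (z * of_real (\<mu> e) - s)) \<le> (\<Sum>e\<in>F. norm (inverse (z * of_real (\<mu> e) - s)))"
      by (intro member_le_sum F) auto
    moreover have "0 \<le> 2 / norm s" by simp
    ultimately show ?thesis unfolding K_def by linarith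
  next
    case False
    then have mu: "\<mu> e \<le> \<delta>" "0 < \<mu> e" using e mu_pos by (auto simp: F_def)
    have "norm (z * of_real (\<mu> e)) \<le> norm z * \<delta>" using mu by (simp add: norm_mult mult_left_mono)
    also have "\<dots> \<le> norm s / 2"
    proof -
      have "0 < norm z + 1" by (simp add: add_nonneg_pos)
      then show ?thesis by (simp add: \<delta>_def field_simps)
    qed
    finally have "norm s / 2 \<le> norm (z * of_real (\<mu> e) - s)"
      using norm_triangle_ineq2[of s "z * of_real (\<mu> e)"] by (simp add: norm_minus_commute)
    then have "norm (inverse (z * of_real (\<mu> e) - s)) \<le> inverse (norm s / 2)"
      unfolding norm_inverse by (rule le_imp_inverse_le) (use s in simp)
    also have "inverse (norm s / 2) = 2 / norm s" by simp
    also have "\<dots> \<le> K"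
      unfolding K_def using sum_nonneg[of F "\<lambda>e. norm (inverse (z * of_real (\<mu> e) - s))"] by simp
    finally show ?thesis .
  qed
  moreover have "0 \<le> K" unfolding K_def by (intro add_nonneg_nonneg sum_nonneg) auto
  ultimately show ?thesis using that by blast
qed

text \<open>On coefficients, z - A acts on \<sigma> g over G g as multiplication of
  \<open>coef g e\<close> by z \<mu>(e) - \<sigma>. The eigenfunctions lie in every lp, and off
  their eigenvalues the inverse is a multiple of the identity plus a bounded-kernel operator, so p
  does not enter the answer.\<close>

lemma spectrum_green_inv:
  assumes p: "1 \<le> p" and \<sigma>: "\<sigma> = 1 \<or> \<sigma> = -1"
  shows "spectrum m p (green_inv \<sigma> p) = (\<lambda>e. of_real (\<sigma> / \<mu> e)) ` E"
proof -
  note C = complexification_green_inv[OF p, of \<sigma>]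
  let ?s = "complex_of_real \<sigma>"
  have s2: "?s * ?s = 1" and s0: "?s \<noteq> 0" using \<sigma> by auto
  note L = lp_L1(1)[OF p]
  have "z \<notin> resolvent_set m p (complexification (green_inv \<sigma> p))" if z: "z = of_real (\<sigma> / \<mu> e)" and e: "e \<in> E" for z e
  proof
    assume "z \<in> resolvent_set m p (complexification (green_inv \<sigma> p))"
    \<comment> \<open>Uniqueness fails already for the right-hand side 0, which both 0 and the
      eigenfunction solve.\<close>
    then have "\<exists>!u. u \<in> complexification (green_inv \<sigma> p) \<and> (\<lambda>x. z * fst u x - snd u x) = (\<lambda>x. 0)"
      using lp_zero(1)[OF p, where 'k = complex] unfolding resolvent_set_def by blast
    then obtain u0 where u0: "\<And>u. u \<in> complexification (green_inv \<sigma> p) \<Longrightarrow> (\<lambda>x. z * fst u x - snd u x) = (\<lambda>x. 0) \<Longrightarrow> u = u0"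
      by blast
    have eL: "(\<lambda>x. complex_of_real (e x)) \<in> lp m p"
      by (rule lp_mono(1)[OF p linf_lp[OF p E_linf[OF e]]]) simp
    have Ge: "Gc (\<lambda>x. complex_of_real (e x)) = (\<lambda>x. of_real (\<mu> e) * of_real (e x))"
      by (intro ext T_eigen[OF mult_bound_mu_complex e])
    have mu: "\<mu> e \<noteq> 0" using mu_pos[OF e] by simp
    have "(Gc (\<lambda>x. complex_of_real (e x)), \<lambda>x. ?s * complex_of_real (e x)) = u0"
    proof (rule u0)
      show "(Gc (\<lambda>x. complex_of_real (e x)), \<lambda>x. ?s * complex_of_real (e x)) \<in> complexification (green_inv \<sigma> p)"
        unfolding C using eL by blast
    qed (use mu in \<open>simp add: Ge z\<close>)
    moreover have "(Gc (\<lambda>x. 0), \<lambda>x. ?s * 0) = u0"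
      by (rule u0) (use lp_zero(1)[OF p, where 'k = complex] in \<open>auto simp: C kernel_op_def\<close>)
    ultimately have "(\<lambda>x. ?s * complex_of_real (e x)) = (\<lambda>x. ?s * 0)" by (metis prod.inject)
    then have "e = (\<lambda>x. 0)" using s0 by (simp add: fun_eq_iff)
    then show False using E_orth[OF e e] by (simp add: pairing_def)
  qed
  moreover have "z \<in> resolvent_set m p (complexification (green_inv \<sigma> p))"
    if z: "z \<notin> (\<lambda>e. of_real (\<sigma> / \<mu> e)) ` E" for z
  proof -
    define d where "d e = z * of_real (\<mu> e) - ?s" for e
    have d0: "d e \<noteq> 0" if e: "e \<in> E" for e
    proof
      assume "d e = 0"
      then have "z = of_real (\<sigma> / \<mu> e)" using mu_pos[OF e] by (simp add: d_def field_simps)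
      then show False using z e by blast
    qed
    have "z * of_real (\<mu> e) \<noteq> ?s" if "e \<in> E" for e using d0[OF that] by (simp add: d_def)
    from inverse_bound[OF s0 this]
    obtain K where K: "0 \<le> K" "\<And>e. e \<in> E \<Longrightarrow> norm (inverse (d e)) \<le> K"
      unfolding d_def by blast
    have mb: "mult_bound (norm w * K) (\<lambda>e. w * of_real (\<mu> e) * inverse (d e))" for w
      unfolding mult_bound_def
    proof (intro conjI ballI)
      fix e assume e: "e \<in> E"
      have "norm w * (\<mu> e * norm (inverse (d e))) \<le> norm w * (\<mu> e * K)"
        using K(2)[OF e] mu_pos[OF e] by (intro mult_left_mono) auto
      then show "norm (w * of_real (\<mu> e) * inverse (d e)) \<le> norm w * K * \<mu> e"
        using mu_pos[OF e] by (simp add: norm_mult mult_ac)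
    qed (use K in auto)
    have coefzG: "coef (\<lambda>x. z * Gc g x - ?s * g x) e = d e * coef g e" if g: "g \<in> lp m p" and e: "e \<in> E" for g e
    proof -
      have "coef (\<lambda>x. z * Gc g x + (- ?s) * g x) e = z * coef (Gc g) e + (- ?s) * coef g e"
        by (rule coef_comb[OF T_L1[OF mult_bound_mu_complex L[OF g]] L[OF g] E_linf[OF e]])
      then show ?thesis using coef_T[OF mult_bound_mu_complex L[OF g] e] by (simp add: d_def algebra_simps)
    qed
    have L1zG: "(\<lambda>x. z * Gc g x - ?s * g x) \<in> L1" if g: "g \<in> lp m p" for g
      by (intro L1_diff(1) L1_cmult(1) T_L1[OF mult_bound_mu_complex] L[OF g])
    show ?thesis
      unfolding resolvent_set_def mem_Collect_eq
    proof (intro conjI ballI)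
      fix h :: "'a \<Rightarrow> complex" assume h: "h \<in> lp m p"
      \<comment> \<open>The multiplier 1/d is in general not dominated by \<mu>, but 1/d = -\<sigma>
        + \<sigma> z \<mu>/d because \<sigma>^2 = 1. The first part is a multiple of the identity,
        and the second has a bounded kernel.\<close>
      let ?\<phi> = "\<lambda>e. ?s * z * of_real (\<mu> e) * inverse (d e)"
      define g where "g x = (- ?s) * h x + 1 * T ?\<phi> h x" for x
      have Th: "T ?\<phi> h \<in> L1" by (rule T_L1[OF mb L[OF h]])
      have g: "g \<in> lp m p"
        unfolding g_def by (intro lp_comb p h kernel_op_lp(1)[OF p ker_kernel_bound[OF mb]])
      have cg: "d e * coef g e = coef h e" if e: "e \<in> E" for e
      proof -
        have "coef g e = (- ?s) * coef h e + 1 * coef (T ?\<phi> h) e"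
          unfolding g_def by (rule coef_comb[OF L[OF h] Th E_linf[OF e]])
        also have "coef (T ?\<phi> h) e = ?\<phi> e * coef h e" by (rule coef_T[OF mb L[OF h] e])
        finally have "coef g e = - ?s * coef h e + ?s * z * of_real (\<mu> e) * coef h e / d e"
          by (simp only: divide_inverse mult_1 mult_ac)
        then have "d e * coef g e = (- ?s * d e + ?s * z * of_real (\<mu> e)) * coef h e"
          using d0[OF e] by (simp add: field_simps)
        also have "- ?s * d e + ?s * z * of_real (\<mu> e) = 1" using s2 by (simp add: d_def algebra_simps)
        finally show ?thesis by simp
      qed
      have sol: "(\<lambda>x. z * Gc g' x - ?s * g' x) = h \<longleftrightarrow> g' = g" if g': "g' \<in> lp m p" for g'
      proof
        assume eq: "(\<lambda>x. z * Gc g' x - ?s * g' x) = h"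
        show "g' = g"
        proof (rule coef_eqI_complex[OF L[OF g'] L[OF g]])
          fix e assume e: "e \<in> E"
          have "d e * coef g' e = d e * coef g e" using coefzG[OF g' e, unfolded eq] cg[OF e] by argo
          then show "coef g' e = coef g e" using d0[OF e] by simp
        qed
      next
        assume "g' = g"
        then show "(\<lambda>x. z * Gc g' x - ?s * g' x) = h"
          by (intro coef_eqI_complex L1zG L[OF h]) (use coefzG[OF g'] g' cg in \<open>simp_all\<close>)
      qed
      show "\<exists>!u. u \<in> complexification (green_inv \<sigma> p) \<and> (\<lambda>x. z * fst u x - snd u x) = h"
      proof (rule ex1I[of _ "(Gc g, \<lambda>x. ?s * g x)"])
        show "(Gc g, \<lambda>x. ?s * g x) \<in> complexification (green_inv \<sigma> p) \<and>
            (\<lambda>x. z * fst (Gc g, \<lambda>x. ?s * g x) x - snd (Gc g, \<lambda>x. ?s * g x) x) = h"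
          using g sol[OF g] by (auto simp: C)
        fix u assume u: "u \<in> complexification (green_inv \<sigma> p) \<and> (\<lambda>x. z * fst u x - snd u x) = h"
        then obtain g' where "g' \<in> lp m p" "u = (Gc g', \<lambda>x. ?s * g' x)" by (auto simp: C)
        then show "u = (Gc g, \<lambda>x. ?s * g x)" using u sol[of g'] by simp
      qed
    next
      \<comment> \<open>The bound concerns only the first component G g, which is recovered from the
        right-hand side by the multiplier \<mu>/d; this one is dominated by \<mu>.\<close>
      let ?\<psi> = "\<lambda>e. 1 * of_real (\<mu> e) * inverse (d e)"
      have "lp_norm m p (Gc g) \<le> (total + 1)\<^sup>2 * (norm (1::complex) * K * K0) * lp_norm m p (\<lambda>x. z * Gc g x - ?s * g x)"
        if g: "g \<in> lp m p" for g
      proof -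
        have H: "(\<lambda>x. z * Gc g x - ?s * g x) \<in> lp m p"
          by (intro lp_diff(1) lp_cmult(1) p g kernel_op_lp(1)[OF p ker_kernel_bound[OF mult_bound_mu_complex]])
        have "T ?\<psi> (\<lambda>x. z * Gc g x - ?s * g x) = Gc g"
        proof (rule T_eqI_complex[OF mb L1zG[OF g] T_L1[OF mult_bound_mu_complex L[OF g]]])
          fix e assume e: "e \<in> E"
          show "coef (Gc g) e = ?\<psi> e * coef (\<lambda>x. z * Gc g x - ?s * g x) e"
            unfolding coefzG[OF g e] coef_T[OF mult_bound_mu_complex L[OF g] e] using d0[OF e] by simp
        qed
        then show ?thesis using kernel_op_lp(2)[OF p ker_kernel_bound[OF mb[of 1]] H] by simp
      qed
      then show "\<exists>K. \<forall>(f, g)\<in>complexification (green_inv \<sigma> p). lp_norm m p f \<le> K * lp_norm m p (\<lambda>x. z * f x - g x)"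
        unfolding C by blast
    qed
  qed
  ultimately show ?thesis unfolding spectrum_def by blast
qed

lemma purely_discrete_green_inv: "purely_discrete_spectrum m 2 (green_inv 1 2)"
  unfolding purely_discrete_spectrum_def
proof
  note S = spectrum_green_inv[OF one_le_2, of 1]
  fix z assume "z \<in> spectrum m 2 (green_inv 1 2)"
  then obtain e where e: "e \<in> E" and z: "z = of_real (1 / \<mu> e)" using S by auto
  have mu: "0 < \<mu> e" by (rule mu_pos[OF e])
  \<comment> \<open>Contains every e' whose eigenvalue 1/\<mu>(e') has distance less than 1 from z.
    The same finite set yields both the isolation of z and a spanning set of its eigenspace.\<close>
  define N where "N = {e' \<in> E. 1 / (1 / \<mu> e + 1) \<le> \<mu> e'}"
  have N: "finite N" unfolding N_def by (rule finite_mu_ge) (use mu in \<open>simp add: add_pos_pos\<close>)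
  have inN: "e' \<in> N" if e': "e' \<in> E" and d: "dist (complex_of_real (1 / \<mu> e')) z < 1" for e'
  proof -
    have "\<bar>1 / \<mu> e' - 1 / \<mu> e\<bar> < 1"
      using d unfolding z dist_norm of_real_diff[symmetric] norm_of_real by simp
    then have "1 / \<mu> e' \<le> 1 / \<mu> e + 1" by linarith
    then have "inverse (1 / \<mu> e + 1) \<le> inverse (1 / \<mu> e')"
      by (rule le_imp_inverse_le) (use mu_pos[OF e'] in simp)
    then show ?thesis using e' by (simp add: N_def inverse_eq_divide)
  qed
  \<comment> \<open>The unit disc around z with the finitely many other spectral values in it
    removed.\<close>
  have "open (ball z 1 - ((\<lambda>e. complex_of_real (1 / \<mu> e)) ` N - {z}))"
    using N by (intro open_Diff finite_imp_closed) auto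
  moreover have "(ball z 1 - ((\<lambda>e. complex_of_real (1 / \<mu> e)) ` N - {z})) \<inter> spectrum m 2 (green_inv 1 2) = {z}"
    using e inN by (auto simp: S z dist_commute)
  ultimately have iso: "z isolated_in spectrum m 2 (green_inv 1 2)"
    using \<open>z \<in> spectrum m 2 (green_inv 1 2)\<close> unfolding isolated_in_def by blast
  note C = complexification_green_inv[OF one_le_2, of 1]
  have cE: "(\<lambda>x. complex_of_real (e' x)) \<in> lp m 2" if "e' \<in> E" for e'
    by (rule lp_mono(1)[OF one_le_2 linf_lp[OF one_le_2 E_linf[OF that]]]) simp
  define f0 where "f0 = (\<lambda>x. complex_of_real (e x))"
  have "(Gc (\<lambda>x. z * f0 x), \<lambda>x. complex_of_real 1 * (z * f0 x)) \<in> complexification (green_inv 1 2)"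
    unfolding C using lp_cmult(1)[OF one_le_2 cE[OF e], of z] by (auto simp: f0_def)
  moreover have "Gc (\<lambda>x. z * f0 x) = f0"
  proof
    fix x
    have "Gc (\<lambda>x. z * f0 x) x = Gc (\<lambda>x. z * f0 x + 0 * f0 x) x" by simp
    also have "\<dots> = z * Gc f0 x + 0 * Gc f0 x"
      unfolding f0_def by (intro kernel_op_comb[OF ker_kernel_bound[OF mult_bound_mu_complex]] of_real_L1 e)
    finally show "Gc (\<lambda>x. z * f0 x) x = f0 x"
      using T_eigen[OF mult_bound_mu_complex e, of x] mu by (simp add: f0_def z)
  qed
  ultimately have "f0 \<in> eigenspace (green_inv 1 2) z" by (simp add: eigenspace_def)
  moreover have "f0 \<noteq> (\<lambda>x. 0)"
  proof
    assume "f0 = (\<lambda>x. 0)"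
    then have "e = (\<lambda>x. 0)" by (simp add: f0_def fun_eq_iff)
    then show False using E_orth[OF e e] by (simp add: pairing_def)
  qed
  moreover have "\<exists>B. finite B \<and> (\<forall>f\<in>eigenspace (green_inv 1 2) z. \<exists>k. f = (\<lambda>x. \<Sum>e\<in>B. k e * e x))"
  proof (intro exI[of _ "(\<lambda>e x. complex_of_real (e x)) ` N"] conjI ballI)
    fix f assume "f \<in> eigenspace (green_inv 1 2) z"
    then obtain g where g: "g \<in> lp m 2" "f = Gc g" "(\<lambda>x. z * f x) = g"
      by (auto simp: eigenspace_def C)
    have f: "f \<in> lp m 2" unfolding g(2) by (rule kernel_op_lp(1)[OF one_le_2 ker_kernel_bound[OF mult_bound_mu_complex] g(1)])
    note L = lp_L1(1)[OF one_le_2]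
    have cf: "coef f e' = 0" if e': "e' \<in> E" "e' \<notin> N" for e'
    proof -
      have "coef f e' = of_real (\<mu> e') * coef g e'"
        unfolding g(2) by (rule coef_T[OF mult_bound_mu_complex L[OF g(1)] e'(1)])
      also have "coef g e' = z * coef f e'"
        unfolding g(3)[symmetric] by (rule coef_cmult[OF L[OF f] E_linf[OF e'(1)]])
      finally have "coef f e' * (1 - of_real (\<mu> e') * z) = 0" by (simp add: algebra_simps)
      moreover have "of_real (\<mu> e') * z \<noteq> 1"
      proof
        assume "of_real (\<mu> e') * z = 1"
        then have "z = of_real (1 / \<mu> e')" using mu_pos[OF e'(1)] by (simp add: field_simps)
        then show False using inN[OF e'(1)] e'(2) by simp
      qed
      ultimately show ?thesis by auto
    qed
    have NE: "N \<subseteq> E" by (auto simp: N_def)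
    define f1 where "f1 x = (\<Sum>e'\<in>N. coef f e' * of_real (e' x))" for x
    have f1: "f1 \<in> L1 \<and> (\<forall>e''\<in>E. coef f1 e'' = (if e'' \<in> N then coef f e'' else 0))"
    proof -
      have "(\<lambda>x. \<Sum>e'\<in>M. coef f e' * of_real (e' x)) \<in> L1 \<and>
        (\<forall>e''\<in>E. coef (\<lambda>x. \<Sum>e'\<in>M. coef f e' * of_real (e' x)) e'' = (if e'' \<in> M then coef f e'' else 0))"
        if "finite M" "M \<subseteq> E" for M
        using that
      proof (induction M rule: finite_induct)
        case empty
        then show ?case using bounded_L1(1)[of "\<lambda>x. 0::complex" 0] by (simp add: coef_def)
      next
        case (insert a M)
        have a: "a \<in> E" using insert by auto
        have IH: "(\<lambda>x. \<Sum>e'\<in>M. coef f e' * of_real (e' x)) \<in> L1" using insert by auto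
        have "coef (\<lambda>x. coef f a * of_real (a x) + 1 * (\<Sum>e'\<in>M. coef f e' * of_real (e' x))) e''
          = coef f a * coef (\<lambda>x. of_real (a x)) e'' + 1 * coef (\<lambda>x. \<Sum>e'\<in>M. coef f e' * of_real (e' x)) e''"
          if "e'' \<in> E" for e''
          by (rule coef_comb[OF of_real_L1[OF a] IH E_linf[OF that]])
        then show ?case
          using insert a coef_basis[OF a, where 'k = complex]
          by (auto intro!: L1_add(1) L1_cmult(1) of_real_L1)
      qed
      from this[OF N NE] show ?thesis by (simp add: f1_def[abs_def])
    qed
    have "f = f1"
      by (rule coef_eqI_complex[OF L[OF f]]) (use f1 cf in auto)
    moreover have "inj_on (\<lambda>e x. complex_of_real (e x)) N"
      by (auto simp: inj_on_def fun_eq_iff)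
    \<comment> \<open>The spanning functions are the complexified eigenfunctions; the real part
      recovers the index of the coefficient.\<close>
    ultimately show "\<exists>k. f = (\<lambda>x. \<Sum>e\<in>(\<lambda>e x. complex_of_real (e x)) ` N. k e * e x)"
      by (intro exI[of _ "\<lambda>e. coef f (\<lambda>x. Re (e x))"]) (simp add: sum.reindex f1_def[abs_def])
  qed (use N in simp)
  ultimately show "z isolated_in spectrum m 2 (green_inv 1 2) \<and> (\<exists>f\<in>eigenspace (green_inv 1 2) z. f \<noteq> (\<lambda>x. 0)) \<and>
      (\<exists>B. finite B \<and> (\<forall>f\<in>eigenspace (green_inv 1 2) z. \<exists>k. f = (\<lambda>x. \<Sum>e\<in>B. k e * e x)))"
    using iso by blast
qed

lemma spectrum_lower_bound:
  "ereal (1 / (K0 * total)) \<le> (INF z\<in>spectrum m 2 (green_inv 1 2). ereal (Re z))"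
proof (rule INF_greatest)
  fix z assume "z \<in> spectrum m 2 (green_inv 1 2)"
  then obtain e where e: "e \<in> E" and z: "z = of_real (1 / \<mu> e)" using spectrum_green_inv[OF one_le_2, of 1] by auto
  show "ereal (1 / (K0 * total)) \<le> ereal (Re z)"
    using mu_le[OF e] mu_pos[OF e] by (simp add: z frac_le)
qed

lemma resolvent_green_inv:
  assumes \<alpha>: "0 < \<alpha>"
  shows "resolvent m (green_inv 1 2) \<alpha> = restrict (T (res_mult \<alpha>)) (lp m 2)"
  unfolding resolvent_def
proof (rule restrict_ext)
  fix h :: "'a \<Rightarrow> real" assume h: "h \<in> lp m 2"
  note L = lp_L1(1)[OF one_le_2]
  note mr = mult_bound_res_mult[OF \<alpha>]
  have Th: "T (res_mult \<alpha>) h \<in> lp m 2" by (rule kernel_op_lp(1)[OF one_le_2 ker_kernel_bound[OF mr] h])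
  have r: "res_mult \<alpha> e = \<mu> e * (1 - \<alpha> * res_mult \<alpha> e)" if "e \<in> E" for e
  proof -
    have "0 < 1 + \<alpha> * \<mu> e" using mu_pos[OF that] \<alpha> by (simp add: add_pos_pos)
    then show ?thesis by (simp add: res_mult_def field_simps)
  qed
  show "(THE f. \<exists>g. (f, g) \<in> green_inv 1 2 \<and> (\<lambda>x. g x + \<alpha> * f x) = h) = T (res_mult \<alpha>) h"
  proof (rule the_equality)
    \<comment> \<open>If f is the resolvent applied to h, then L f has to be h - \<alpha> f.\<close>
    define g where "g x = 1 * h x + (- \<alpha>) * T (res_mult \<alpha>) h x" for x
    have g: "g \<in> lp m 2" unfolding g_def by (rule lp_comb[OF one_le_2 h Th])
    have "G g = T (res_mult \<alpha>) h"
    proof (rule T_eqI[OF mult_bound_mu L[OF g] L[OF Th]])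
      fix e assume e: "e \<in> E"
      have "coef g e = 1 * coef h e + (- \<alpha>) * coef (T (res_mult \<alpha>) h) e"
        unfolding g_def by (rule coef_comb[OF L[OF h] L[OF Th] E_linf[OF e]])
      then show "coef (T (res_mult \<alpha>) h) e = \<mu> e * coef g e"
        unfolding coef_T[OF mr L[OF h] e] using r[OF e] by (metis (no_types, opaque_lifting) diff_add_eq_diff_diff_swap left_diff_distrib mult.assoc mult_1 mult_minus_left add_uminus_conv_diff)
    qed
    moreover have "(\<lambda>x. 1 * g x + \<alpha> * T (res_mult \<alpha>) h x) = h" by (simp add: g_def)
    ultimately show "\<exists>g. (T (res_mult \<alpha>) h, g) \<in> green_inv 1 2 \<and> (\<lambda>x. g x + \<alpha> * T (res_mult \<alpha>) h x) = h"
      using g by (intro exI[of _ g]) (auto simp: green_inv_def)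
  next
    fix f assume "\<exists>g. (f, g) \<in> green_inv 1 2 \<and> (\<lambda>x. g x + \<alpha> * f x) = h"
    then obtain g where g: "g \<in> lp m 2" "f = G g" "(\<lambda>x. 1 * g x + \<alpha> * f x) = h" by (auto simp: green_inv_def)
    have f: "f \<in> lp m 2" unfolding g(2) by (rule kernel_op_lp(1)[OF one_le_2 ker_kernel_bound[OF mult_bound_mu] g(1)])
    show "f = T (res_mult \<alpha>) h"
    proof (rule T_eqI[symmetric, OF mr L[OF h] L[OF f]])
      fix e assume e: "e \<in> E"
      have "coef h e = 1 * coef g e + \<alpha> * coef f e"
        unfolding g(3)[symmetric] by (rule coef_comb[OF L[OF g(1)] L[OF f] E_linf[OF e]])
      moreover have "coef f e = \<mu> e * coef g e"
        unfolding g(2) by (rule coef_T[OF mult_bound_mu L[OF g(1)] e])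
      moreover have "0 < 1 + \<alpha> * \<mu> e" using mu_pos[OF e] \<alpha> by (simp add: add_pos_pos)
      ultimately show "coef f e = res_mult \<alpha> e * coef h e" by (simp add: res_mult_def field_simps)
    qed
  qed
qed

lemma on_lp_T:
  fixes \<phi> :: "('a \<Rightarrow> real) \<Rightarrow> real"
  assumes p: "1 \<le> p" and \<phi>: "mult_bound K \<phi>"
  shows "on_lp m p (restrict (T \<phi>) (lp m 2)) = restrict (T \<phi>) (lp m p)"
proof (cases "p = \<infinity>")
  case True
  have "restrict (restrict (T \<phi>) (lp m 2)) linf = restrict (T \<phi>) linf"
    using linf_lp[OF one_le_2] by (auto simp: restrict_def fun_eq_iff)
  then show ?thesis using True by (simp add: on_lp_def)
next
  case False
  note b = bounded_operator_kernel_op[OF p ker_kernel_bound[OF \<phi>]]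
  have "(THE S. bounded_operator m p S \<and> (\<forall>\<phi>'\<in>C_c. S \<phi>' = restrict (T \<phi>) (lp m 2) \<phi>')) = restrict (T \<phi>) (lp m p)"
  proof (rule the_equality)
    show "bounded_operator m p (restrict (T \<phi>) (lp m p)) \<and> (\<forall>\<phi>'\<in>C_c. restrict (T \<phi>) (lp m p) \<phi>' = restrict (T \<phi>) (lp m 2) \<phi>')"
      using b C_c_lp[OF p] C_c_lp[OF one_le_2] by simp
    fix S assume S: "bounded_operator m p S \<and> (\<forall>\<phi>'\<in>C_c. S \<phi>' = restrict (T \<phi>) (lp m 2) \<phi>')"
    show "S = restrict (T \<phi>) (lp m p)"
      by (rule bounded_operator_unique[OF p _ b _ C_c_dense[OF p False]])
        (use S C_c_lp[OF p] C_c_lp[OF one_le_2] in auto)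
  qed
  then show ?thesis using False by (simp add: on_lp_def)
qed

text \<open>Pairing an element of the adjoint with the eigenfunctions, which lie in
  \<open>L1\<close>, already determines its coefficients. The converse is the symmetry of
  \<open>G\<close> between \<open>L1\<close> and the bounded functions.\<close>

lemma adjoint_green_inv:
  "adjoint_operator m \<infinity> (green_inv (-1) 1) = green_inv (-1) \<infinity>"
proof (intro equalityI subsetI)
  fix u assume "u \<in> adjoint_operator m \<infinity> (green_inv (-1) 1)"
  then obtain f h where u: "u = (f, h)" and f: "f \<in> linf" and h: "h \<in> linf"
    and *: "\<And>g. g \<in> lp m 1 \<Longrightarrow> pairing m f (\<lambda>x. - g x) = pairing m h (G g)"
    by (force simp: adjoint_operator_def green_inv_def)
  have h': "(\<lambda>x. - h x) \<in> linf" using h by (auto simp: linf_def bounded_iff)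
  have "G (\<lambda>x. - h x) = f"
  proof (rule T_eqI[OF mult_bound_mu linf_L1[OF h'] linf_L1[OF f]])
    fix e assume e: "e \<in> E"
    note eL = linf_L1[OF E_linf[OF e]]
    have "coef f e = - pairing m f (\<lambda>x. - e x)" by (simp add: coef_pairing pairing_def infsum_uminus)
    also have "\<dots> = - pairing m h (G e)" using *[of e] eL by (simp add: L1_lp1)
    also have "G e = (\<lambda>x. \<mu> e * e x)" using T_eigen[OF mult_bound_mu e] by (simp add: fun_eq_iff)
    also have "pairing m h (\<lambda>x. \<mu> e * e x) = \<mu> e * coef h e"
      by (simp add: pairing_def coef_def infsum_cmult_right'[symmetric] mult_ac)
    also have "- (\<mu> e * coef h e) = \<mu> e * coef (\<lambda>x. - h x) e"
      by (simp add: coef_def infsum_uminus)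
    finally show "coef f e = \<mu> e * coef (\<lambda>x. - h x) e" .
  qed
  then show "u \<in> green_inv (-1) \<infinity>" unfolding u green_inv_def using h' by (auto intro!: exI[of _ "\<lambda>x. - h x"])
next
  fix u assume "u \<in> green_inv (-1) \<infinity>"
  then obtain h where h: "h \<in> linf" and u: "u = (G h, \<lambda>x. -1 * h x)" by (auto simp: green_inv_def)
  have "pairing m (G h) (\<lambda>x. - g x) = pairing m (\<lambda>x. - h x) (G g)" if "g \<in> L1" for g
    using T_symmetric[OF mult_bound_mu linf_L1[OF h] that] by (simp add: pairing_def infsum_uminus)
  moreover have "(\<lambda>x. - h x) \<in> linf" using h by (auto simp: linf_def bounded_iff)
  ultimately show "u \<in> adjoint_operator m \<infinity> (green_inv (-1) 1)"
    using T_linf[OF mult_bound_mu linf_L1[OF h]] unfolding u adjoint_operator_def green_inv_def by (auto simp: L1_lp1[symmetric])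
qed

end

section \<open>Generators on lp and uniqueness of the semigroup\<close>

context markov_eigenbasis
begin

text \<open>Norm convergence of difference quotients forces convergence of their coefficients,
  whence coef g = -coef f / \<mu>. Conversely the difference quotient of G g is minus the mean of
  the semigroup applied to g, and these means converge by
  \<open>strong_limit_mean_mult\<close>.\<close>

lemma generator_green_inv:
  assumes p: "1 \<le> p" "p \<noteq> \<infinity>" and U: "\<And>t f. 0 < t \<Longrightarrow> f \<in> lp m p \<Longrightarrow> U t f = T (exp_mult t) f"
  shows "generator m p U = green_inv (-1) p"
proof (intro equalityI subsetI)
  note L = lp_L1[OF p(1)]
  have pos: "eventually (\<lambda>t. 0 < t) (at_right (0::real))" by (simp add: eventually_at_right_less)
  fix u assume "u \<in> generator m p U"
  then obtain f g where u: "u = (f, g)" and f: "f \<in> lp m p" and g: "g \<in> lp m p"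
    and lim: "((\<lambda>t. lp_norm m p (\<lambda>x. (U t f x - f x) / t - g x)) \<longlongrightarrow> 0) (at_right 0)"
    by (auto simp: generator_def)
  have g': "(\<lambda>x. (-1) * g x) \<in> lp m p" by (rule lp_cmult(1)[OF p(1) g])
  have "G (\<lambda>x. (-1) * g x) = f"
  proof (rule T_eqI[OF mult_bound_mu L(1)[OF g'] L(1)[OF f]])
    fix e assume e: "e \<in> E"
    have eq: "(exp_mult t e - 1) / t * coef f e - coef g e = coef (\<lambda>x. (U t f x - f x) / t - g x) e
        \<and> \<bar>coef (\<lambda>x. (U t f x - f x) / t - g x) e\<bar> \<le> sup_norm e * ((total + 1) * lp_norm m p (\<lambda>x. (U t f x - f x) / t - g x))"
      if t: "0 < t" for t
    proof -
      have Tf: "T (exp_mult t) f \<in> lp m p" by (rule kernel_op_lp(1)[OF p(1) ker_kernel_bound[OF mult_bound_exp_mult[OF t]] f])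
      define w where "w x = 1 / t * T (exp_mult t) f x + (- (1 / t)) * f x" for x
      have w: "w \<in> lp m p" unfolding w_def by (rule lp_comb[OF p(1) Tf f])
      have eq: "(\<lambda>x. (U t f x - f x) / t - g x) = (\<lambda>x. w x - g x)"
        using U[OF t f] t by (simp add: w_def field_simps)
      have "coef w e = 1 / t * coef (T (exp_mult t) f) e + (- (1 / t)) * coef f e"
        unfolding w_def by (rule coef_comb[OF L(1)[OF Tf] L(1)[OF f] E_linf[OF e]])
      then have "coef w e = (exp_mult t e - 1) / t * coef f e"
        unfolding coef_T[OF mult_bound_exp_mult[OF t] L(1)[OF f] e] using t by (simp add: field_simps)
      moreover have "coef (\<lambda>x. w x - g x) e = coef w e - coef g e"
        by (rule coef_diff[OF L(1)[OF w] L(1)[OF g] E_linf[OF e]])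
      moreover have wg: "(\<lambda>x. w x - g x) \<in> lp m p" by (rule lp_diff(1)[OF p(1) w g])
      have "\<bar>coef (\<lambda>x. w x - g x) e\<bar> \<le> sup_norm e * n1 (\<lambda>x. w x - g x)"
        using coef_summable(2)[OF L(1)[OF wg] E_linf[OF e]] by simp
      moreover have "\<dots> \<le> sup_norm e * ((total + 1) * lp_norm m p (\<lambda>x. w x - g x))"
        by (intro mult_left_mono L(2)[OF wg] sup_norm_nonneg E_linf[OF e])
      ultimately show ?thesis unfolding eq by simp
    qed
    have "((\<lambda>t. coef (\<lambda>x. (U t f x - f x) / t - g x) e) \<longlongrightarrow> 0) (at_right 0)"
    proof (rule Lim_null_comparison)
      show "\<forall>\<^sub>F t in at_right 0. norm (coef (\<lambda>x. (U t f x - f x) / t - g x) e)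
          \<le> sup_norm e * ((total + 1) * lp_norm m p (\<lambda>x. (U t f x - f x) / t - g x))"
        using pos by (rule eventually_mono) (use eq in auto)
      show "((\<lambda>t. sup_norm e * ((total + 1) * lp_norm m p (\<lambda>x. (U t f x - f x) / t - g x))) \<longlongrightarrow> 0) (at_right 0)"
        by (intro tendsto_mult_right_zero lim)
    qed
    then have "((\<lambda>t. (exp_mult t e - 1) / t * coef f e - coef g e) \<longlongrightarrow> 0) (at_right 0)"
      by (rule Lim_transform_eventually) (use pos in \<open>rule eventually_mono\<close>, use eq in auto)
    moreover have "((\<lambda>t. (exp_mult t e - 1) / t * coef f e - coef g e) \<longlongrightarrow> - (1 / \<mu> e) * coef f e - coef g e) (at_right 0)"
      by (intro tendsto_intros exp_mult_derivative[OF e])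
    ultimately have "- (1 / \<mu> e) * coef f e - coef g e = 0"
      using tendsto_unique[OF trivial_limit_at_right_real] by blast
    then show "coef f e = \<mu> e * coef (\<lambda>x. (-1) * g x) e"
      unfolding coef_cmult[OF L(1)[OF g] E_linf[OF e]] using mu_pos[OF e] by (simp add: field_simps)
  qed
  then show "u \<in> green_inv (-1) p" unfolding u green_inv_def using g' by (auto intro!: exI[of _ "\<lambda>x. (-1) * g x"])
next
  note L = lp_L1[OF p(1)]
  have pos: "eventually (\<lambda>t. 0 < t) (at_right (0::real))" by (simp add: eventually_at_right_less)
  fix u assume "u \<in> green_inv (-1) p"
  then obtain g where g: "g \<in> lp m p" and u: "u = (G g, \<lambda>x. -1 * g x)" by (auto simp: green_inv_def)
  have Gg: "G g \<in> lp m p" by (rule kernel_op_lp(1)[OF p(1) ker_kernel_bound[OF mult_bound_mu] g])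
  have "lp_norm m p (\<lambda>x. T (mean_mult t) g x - g x) = lp_norm m p (\<lambda>x. (U t (G g) x - G g x) / t - (-1 * g x))" if t: "0 < t" for t
  proof -
    have TG: "T (exp_mult t) (G g) \<in> lp m p" by (rule kernel_op_lp(1)[OF p(1) ker_kernel_bound[OF mult_bound_exp_mult[OF t]] Gg])
    define w where "w x = 1 / t * G g x + (- (1 / t)) * T (exp_mult t) (G g) x" for x
    have w: "w \<in> lp m p" unfolding w_def by (rule lp_comb[OF p(1) Gg TG])
    have "T (mean_mult t) g = w"
    proof (rule T_eqI[OF mult_bound_mean_mult[OF t] L(1)[OF g] L(1)[OF w]])
      fix e assume e: "e \<in> E"
      have "coef w e = 1 / t * coef (G g) e + (- (1 / t)) * coef (T (exp_mult t) (G g)) e"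
        unfolding w_def by (rule coef_comb[OF L(1)[OF Gg] L(1)[OF TG] E_linf[OF e]])
      then show "coef w e = mean_mult t e * coef g e"
        unfolding coef_T[OF mult_bound_exp_mult[OF t] L(1)[OF Gg] e] coef_T[OF mult_bound_mu L(1)[OF g] e]
        using t by (simp add: mean_mult_def field_simps)
    qed
    moreover have "w x = - ((U t (G g) x - G g x) / t)" for x
      using t by (simp add: w_def U[OF t Gg] field_simps)
    ultimately have "T (mean_mult t) g x - g x = - ((U t (G g) x - G g x) / t - (-1 * g x))" for x by simp
    then show ?thesis by (intro lp_norm_cong) (simp only: norm_minus_cancel)
  qed
  then have "((\<lambda>t. lp_norm m p (\<lambda>x. (U t (G g) x - G g x) / t - (-1 * g x))) \<longlongrightarrow> 0) (at_right 0)"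
    by (intro Lim_transform_eventually[OF strong_limit_mean_mult[OF p g]] eventually_mono[OF pos])
  then show "u \<in> generator m p U"
    unfolding u generator_def using Gg lp_cmult(1)[OF p(1) g, of "-1"] by auto
qed

text \<open>Time 0 is separate, as the expansion with multiplier 1 need not converge to a kernel of
  the identity. Off the half-line the value is \<open>undefined\<close>, as
  \<open>c0_semigroup\<close> demands.\<close>

definition semigroup_op :: "real \<Rightarrow> ('a \<Rightarrow> real) \<Rightarrow> 'a \<Rightarrow> real" where
  "semigroup_op = (\<lambda>t\<in>{0..}. if t = 0 then \<lambda>f\<in>lp m 2. f else restrict (T (exp_mult t)) (lp m 2))"

lemma semigroup_op_pos: "0 < t \<Longrightarrow> semigroup_op t = restrict (T (exp_mult t)) (lp m 2)"
  by (simp add: semigroup_op_def)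

lemma semigroup_op_0: "semigroup_op 0 = (\<lambda>f\<in>lp m 2. f)"
  by (simp add: semigroup_op_def)

lemma bounded_semigroup_op: "0 \<le> t \<Longrightarrow> bounded_operator m 2 (semigroup_op t)"
proof (cases "t = 0")
  case True
  have "bounded_operator m 2 (\<lambda>f\<in>lp m 2. f)"
    unfolding bounded_operator_def using lp_comb[OF one_le_2] by (auto intro: exI[of _ 1])
  then show ?thesis using True by (simp add: semigroup_op_0)
next
  case False
  assume "0 \<le> t"
  then have "0 < t" using False by simp
  then show ?thesis using bounded_operator_kernel_op[OF one_le_2 ker_kernel_bound[OF mult_bound_exp_mult]] by (simp add: semigroup_op_pos)
qed

lemma c0_semigroup_op: "c0_semigroup m 2 semigroup_op"
  unfolding c0_semigroup_def
proof (intro conjI allI impI ballI)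
  show "semigroup_op \<in> extensional {0..}" by (simp add: semigroup_op_def)
  show "bounded_operator m 2 (semigroup_op t)" if "0 \<le> t" for t by (rule bounded_semigroup_op[OF that])
  show "semigroup_op 0 f = f" if "f \<in> lp m 2" for f :: "'a \<Rightarrow> real" using that by (simp add: semigroup_op_0)
  show "semigroup_op (s + t) f = semigroup_op s (semigroup_op t f)" if st: "0 \<le> s" "0 \<le> t" and f: "f \<in> lp m 2" for s t and f :: "'a \<Rightarrow> real"
  proof (cases "s = 0 \<or> t = 0")
    case True
    then show ?thesis using f bounded_operatorD(1)[OF bounded_semigroup_op[OF st(2)] f] by (auto simp: semigroup_op_0)
  next
    case False
    then have pos: "0 < s" "0 < t" using st by auto
    have eq: "(\<lambda>e. exp_mult s e * exp_mult t e) = exp_mult (s + t)"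
      by (simp add: fun_eq_iff exp_mult_def add_divide_distrib flip: exp_add)
    have "T (exp_mult s) (T (exp_mult t) f) = T (exp_mult (s + t)) f"
      using T_mult[OF mult_bound_exp_mult[OF pos(1)] mult_bound_exp_mult[OF pos(2)], of "1 / (s + t)" f] pos
        lp_L1(1)[OF one_le_2 f] mult_bound_exp_mult[of "s + t"] by (simp add: eq)
    then show ?thesis
      using pos f kernel_op_lp(1)[OF one_le_2 ker_kernel_bound[OF mult_bound_exp_mult[OF pos(2)]] f] by (simp add: semigroup_op_pos)
  qed
  fix f :: "'a \<Rightarrow> real" assume f: "f \<in> lp m 2"
  have pos: "eventually (\<lambda>t. 0 < t) (at_right (0::real))" by (simp add: eventually_at_right_less)
  show "((\<lambda>t. lp_norm m 2 (\<lambda>x. semigroup_op t f x - f x)) \<longlongrightarrow> 0) (at_right 0)"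
    by (rule Lim_transform_eventually[OF strong_limit_exp_mult[OF one_le_2 _ f] eventually_mono[OF pos]])
      (use f in \<open>simp_all add: semigroup_op_pos\<close>)
qed

lemma generator_semigroup_op: "generator m 2 semigroup_op = green_inv (-1) 2"
  by (rule generator_green_inv) (auto simp: semigroup_op_pos)

lemma coef_sum:
  fixes f :: "'i \<Rightarrow> 'a \<Rightarrow> real"
  assumes "\<And>i. i \<in> I \<Longrightarrow> f i \<in> lp m 2" "e \<in> linf"
  shows "coef (\<lambda>x. \<Sum>i\<in>I. c i * f i x) e = (\<Sum>i\<in>I. c i * coef (f i) e)"
  using assms(1)
proof (induction I rule: infinite_finite_induct)
  case (insert i I)
  note L = lp_L1(1)[OF one_le_2]
  have "(\<lambda>x. \<Sum>i\<in>I. c i * f i x) \<in> lp m 2"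
    by (intro lp_sum lp_cmult one_le_2) (use insert in auto)
  then have "coef (\<lambda>x. c i * f i x + 1 * (\<Sum>i\<in>I. c i * f i x)) e = c i * coef (f i) e + 1 * coef (\<lambda>x. \<Sum>i\<in>I. c i * f i x) e"
    by (intro coef_comb L assms(2)) (use insert in auto)
  then show ?case using insert by simp
qed (simp_all add: coef_def)

text \<open>The range of \<open>G\<close> is dense, and a function G g is approximated by its
  truncated expansion under a uniform bound. An infinite \<open>F\<close> only contributes the zero
  function, by the convention for \<open>sum\<close>.\<close>

lemma span_dense:
  assumes f: "f \<in> lp m 2" and \<epsilon>: "0 < \<epsilon>"
  shows "\<exists>\<phi>\<in>{\<lambda>x. \<Sum>e\<in>F. c e * e x | F c. F \<subseteq> E}. lp_norm m 2 (\<lambda>x. f x - \<phi> x) < \<epsilon>"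
proof -
  obtain g where g: "g \<in> linf" "lp_norm m 2 (\<lambda>x. f x - G g x) < \<epsilon> / 8"
    using G_dense[OF one_le_2 _ f, of "\<epsilon> / 8"] \<epsilon> by auto
  have g1: "g \<in> L1" by (rule linf_L1[OF g(1)])
  have Gg: "G g \<in> lp m 2" by (rule linf_lp[OF one_le_2 T_linf[OF mult_bound_mu g1]])
  define s where "s F x = (\<Sum>e\<in>F. \<mu> e * coef g e * e x)" for F x
  have "((\<lambda>F. lp_norm m 2 (\<lambda>x. s F x - G g x)) \<longlongrightarrow> 0) (finite_subsets_at_top E)"
  proof (rule lp_dominated[OF one_le_2, where K = "1 * K0 * n1 g + 1 * K0 * n1 g"])
    show "\<forall>\<^sub>F F in finite_subsets_at_top E. \<forall>x. norm (s F x - G g x) \<le> 1 * K0 * n1 g + 1 * K0 * n1 g"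
    proof (intro eventually_finite_subsets_at_top_weakI allI)
      fix F x assume F: "finite F" "F \<subseteq> E"
      have "norm (s F x) \<le> 1 * K0 * n1 g" unfolding s_def using trunc_bound[OF mult_bound_mu g1 F] by simp
      then show "norm (s F x - G g x) \<le> 1 * K0 * n1 g + 1 * K0 * n1 g"
        by (intro order_trans[OF norm_triangle_ineq4] add_mono kernel_op_bound(2)[OF ker_kernel_bound[OF mult_bound_mu] g1])
    qed
    show "((\<lambda>F. s F x) \<longlongrightarrow> G g x) (finite_subsets_at_top E)" for x
      unfolding s_def by (rule T_trunc_tendsto[OF mult_bound_mu g1])
  qed simp
  then have "eventually (\<lambda>F. lp_norm m 2 (\<lambda>x. s F x - G g x) < \<epsilon> / 8) (finite_subsets_at_top E)"
    using \<epsilon> by (intro order_tendstoD(2)[of _ 0]) auto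
  then obtain F where F: "finite F" "F \<subseteq> E" "lp_norm m 2 (\<lambda>x. s F x - G g x) < \<epsilon> / 8"
    unfolding eventually_finite_subsets_at_top by blast
  have sF: "s F \<in> lp m 2"
    unfolding s_def[abs_def] by (intro lp_sum lp_cmult one_le_2 linf_lp E_linf) (use F in auto)
  have "lp_norm m 2 (\<lambda>x. f x - s F x) = lp_norm m 2 (\<lambda>x. (f x - G g x) - (s F x - G g x))" by simp
  also have "\<dots> \<le> 4 * (lp_norm m 2 (\<lambda>x. f x - G g x) + lp_norm m 2 (\<lambda>x. s F x - G g x))"
    by (intro lp_diff one_le_2 f Gg sF)
  also have "\<dots> < 4 * (\<epsilon> / 8 + \<epsilon> / 8)" by (intro mult_strict_left_mono add_strict_mono g(2) F(3)) simp
  finally have "lp_norm m 2 (\<lambda>x. f x - s F x) < \<epsilon>" by simp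
  moreover have "s F \<in> {\<lambda>x. \<Sum>e\<in>F. c e * e x | F c. F \<subseteq> E}" 
    unfolding s_def[abs_def] using F(2) by (intro CollectI exI[of _ F] exI[of _ "\<lambda>e. \<mu> e * coef g e"]) simp
  ultimately show ?thesis by blast
qed

text \<open>An eigenfunction of L at 1/\<mu>(e) has zero coefficient at every j with \<mu>(j)
  different from \<mu>(e), so its expansion is a finite sum.\<close>

lemma eigenfunction_expand:
  assumes e: "e \<in> E" and v: "(v, \<lambda>x. - (1 / \<mu> e) * v x) \<in> green_inv (-1) 2"
  defines "B \<equiv> {e' \<in> E. \<mu> e' = \<mu> e}"
  shows "v \<in> lp m 2" "v = (\<lambda>x. \<Sum>j\<in>B. coef v j * j x)"
proof -
  have mu: "0 < \<mu> e" by (rule mu_pos[OF e])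
  obtain g where g: "g \<in> lp m 2" "v = G g" "(\<lambda>x. - (1 / \<mu> e) * v x) = (\<lambda>x. -1 * g x)"
    using v by (auto simp: green_inv_def)
  show v2: "v \<in> lp m 2" unfolding g(2) by (rule kernel_op_lp(1)[OF one_le_2 ker_kernel_bound[OF mult_bound_mu] g(1)])
  note L = lp_L1(1)[OF one_le_2]
  have g': "g = (\<lambda>x. 1 / \<mu> e * v x)" using g(3) by (simp add: fun_eq_iff)
  have cg: "coef g j = 1 / \<mu> e * coef v j" if "j \<in> E" for j
    unfolding g' by (rule coef_cmult[OF L[OF v2] E_linf[OF that]])
  have cv: "coef v j = \<mu> j / \<mu> e * coef v j" if "j \<in> E" for j
  proof -
    have "coef v j = \<mu> j * coef g j" unfolding g(2) by (rule coef_T[OF mult_bound_mu L[OF g(1)] that])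
    then show ?thesis by (simp add: cg[OF that])
  qed
  have B: "finite B" "B \<subseteq> E"
    by (rule finite_subset[OF _ finite_mu_ge[OF mu]]) (auto simp: B_def)
  have mb: "mult_bound 1 (\<lambda>j. if j \<in> B then \<mu> j else 0)" using mu_pos by (auto simp: mult_bound_def less_imp_le)
  have "T (\<lambda>j. if j \<in> B then \<mu> j else 0) g = v"
  proof (rule T_eqI[OF mb L[OF g(1)] L[OF v2]])
    fix j assume j: "j \<in> E"
    show "coef v j = (if j \<in> B then \<mu> j else 0) * coef g j"
    proof (cases "j \<in> B")
      case True
      then show ?thesis using mu by (simp add: cg[OF j] B_def)
    next
      case False
      have "(1 - \<mu> j / \<mu> e) * coef v j = 0" using cv[OF j] by (simp add: left_diff_distrib)
      moreover have "1 - \<mu> j / \<mu> e \<noteq> 0" using False j mu by (simp add: B_def)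
      ultimately have "coef v j = 0" by (metis mult_eq_0_iff)
      then show ?thesis using False by simp
    qed
  qed
  then have "v = (\<lambda>x. \<Sum>j\<in>B. \<mu> j * coef g j * j x)" using T_trunc[OF mult_bound_mu L[OF g(1)] B] by simp
  also have "\<dots> = (\<lambda>x. \<Sum>j\<in>B. coef v j * j x)"
    using mu B(2) by (intro ext sum.cong refl) (auto simp: cg B_def)
  finally show "v = (\<lambda>x. \<Sum>j\<in>B. coef v j * j x)" .
qed

text \<open>\<open>S t\<close> commutes with \<open>S h\<close> and is bounded, so it can be pulled
  out of the difference quotient and of the limit.\<close>

lemma generator_invariant:
  assumes S: "c0_semigroup m 2 S" and vw: "(v, w) \<in> generator m 2 S" and t: "0 \<le> t"
  shows "(S t v, S t w) \<in> generator m 2 S"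
proof -
  have b: "bounded_operator m 2 (S t)" if "0 \<le> t" for t using S that by (auto simp: c0_semigroup_def)
  have v: "v \<in> lp m 2" and w: "w \<in> lp m 2"
    and lim: "((\<lambda>h. lp_norm m 2 (\<lambda>x. (S h v x - v x) / h - w x)) \<longlongrightarrow> 0) (at_right 0)"
    using vw by (auto simp: generator_def)
  obtain K where K: "0 \<le> K" "\<And>f. f \<in> lp m 2 \<Longrightarrow> lp_norm m 2 (S t f) \<le> K * lp_norm m 2 f"
    using bounded_operator_bound[OF b[OF t]] by blast
  have q: "(\<lambda>x. (S h (S t v) x - S t v x) / h - S t w x) = S t (\<lambda>x. (S h v x - v x) / h - w x)
      \<and> (\<lambda>x. (S h v x - v x) / h - w x) \<in> lp m 2" if h: "0 < h" for h
  proof -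
    have Sh: "S h v \<in> lp m 2" using bounded_operatorD(1)[OF b v] h by simp
    define u where "u x = 1 / h * S h v x + (- (1 / h)) * v x" for x
    have u: "u \<in> lp m 2" unfolding u_def by (rule lp_comb[OF one_le_2 Sh v])
    have eq: "(\<lambda>x. (S h v x - v x) / h - w x) = (\<lambda>x. u x - w x)" by (simp add: u_def diff_divide_distrib)
    have "S t (S h v) = S h (S t v)"
      using S h t v unfolding c0_semigroup_def by (metis add.commute less_imp_le)
    then have "S t u = (\<lambda>x. 1 / h * S h (S t v) x + (- (1 / h)) * S t v x)"
      unfolding u_def using bounded_operatorD(2)[OF b[OF t] Sh v, of "1 / h" "- (1 / h)"] by (simp only:)
    moreover have "S t (\<lambda>x. u x - w x) = (\<lambda>x. S t u x - S t w x)"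
      by (rule bounded_operator_diff[OF b[OF t] u w])
    ultimately show ?thesis unfolding eq using lp_diff(1)[OF one_le_2 u w] by (simp add: diff_divide_distrib)
  qed
  have pos: "eventually (\<lambda>t. 0 < t) (at_right (0::real))" by (simp add: eventually_at_right_less)
  have "((\<lambda>h. lp_norm m 2 (\<lambda>x. (S h (S t v) x - S t v x) / h - S t w x)) \<longlongrightarrow> 0) (at_right 0)"
  proof (rule Lim_null_comparison)
    show "((\<lambda>h. K * lp_norm m 2 (\<lambda>x. (S h v x - v x) / h - w x)) \<longlongrightarrow> 0) (at_right 0)"
      by (intro tendsto_mult_right_zero lim)
    show "\<forall>\<^sub>F h in at_right 0. norm (lp_norm m 2 (\<lambda>x. (S h (S t v) x - S t v x) / h - S t w x))
        \<le> K * lp_norm m 2 (\<lambda>x. (S h v x - v x) / h - w x)"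
    proof (rule eventually_mono[OF pos])
      fix h :: real assume "0 < h"
      note q = q[OF this]
      show "norm (lp_norm m 2 (\<lambda>x. (S h (S t v) x - S t v x) / h - S t w x))
        \<le> K * lp_norm m 2 (\<lambda>x. (S h v x - v x) / h - w x)"
        unfolding conjunct1[OF q]
        using K(2)[OF conjunct2[OF q]] lp_norm_nonneg[OF bounded_operatorD(1)[OF b[OF t] conjunct2[OF q]]] by simp
    qed
  qed
  then show ?thesis
    using bounded_operatorD(1)[OF b[OF t]] v w by (auto simp: generator_def)
qed

text \<open>A semigroup with generator \<open>-L\<close> leaves the finite-dimensional eigenspaces of \<open>L\<close> invariant;
  this avoids any a priori bound on the norms of the semigroup near \<open>0\<close>.\<close>

lemma semigroup_eigenfunction:
  assumes S: "c0_semigroup m 2 S" and gen: "generator m 2 S = green_inv (-1) 2" and e: "e \<in> E" and t: "0 < t"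
  shows "S t e = (\<lambda>x. exp_mult t e * e x)"
proof -
  define \<kappa> where "\<kappa> = 1 / \<mu> e"
  define B where "B = {e' \<in> E. \<mu> e' = \<mu> e}"
  have mu: "0 < \<mu> e" by (rule mu_pos[OF e])
  have B: "finite B" "B \<subseteq> E" "e \<in> B"
    by (rule finite_subset[OF _ finite_mu_ge[OF mu]]) (use e in \<open>auto simp: B_def\<close>)
  have b: "bounded_operator m 2 (S t)" if "0 \<le> t" for t using S that by (auto simp: c0_semigroup_def)
  note L = lp_L1(1)[OF one_le_2]
  have E2: "j \<in> lp m 2" if "j \<in> E" for j using linf_lp[OF one_le_2 E_linf[OF that]] .
  have geneig: "(j, \<lambda>x. - \<kappa> * j x) \<in> generator m 2 S" if j: "j \<in> B" for j
  proof -
    have jE: "j \<in> E" and jm: "\<mu> j = \<mu> e" using j by (auto simp: B_def)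
    have g: "(\<lambda>x. \<kappa> * j x) \<in> lp m 2" by (intro lp_cmult one_le_2 E2 jE)
    have "G (\<lambda>x. \<kappa> * j x) = j"
    proof (rule T_eqI[OF mult_bound_mu L[OF g] L[OF E2[OF jE]]])
      fix i assume i: "i \<in> E"
      show "coef j i = \<mu> i * coef (\<lambda>x. \<kappa> * j x) i"
        unfolding coef_cmult[OF L[OF E2[OF jE]] E_linf[OF i]]
        using E_orth[OF jE i] jm mu by (auto simp: coef_pairing \<kappa>_def)
    qed
    then show ?thesis unfolding gen green_inv_def using g by (auto intro!: exI[of _ "\<lambda>x. \<kappa> * j x"])
  qed
  have expand: "S s j = (\<lambda>x. \<Sum>i\<in>B. coef (S s j) i * i x)" if "0 \<le> s" "j \<in> B" for s j
  proof -
    have "S s (\<lambda>x. - \<kappa> * j x + 0 * j x) = (\<lambda>x. - \<kappa> * S s j x + 0 * S s j x)"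
      by (rule bounded_operatorD(2)[OF b[OF that(1)]]) (use E2 B that in auto)
    then have "(S s j, \<lambda>x. - (1 / \<mu> e) * S s j x) \<in> green_inv (-1) 2"
      using generator_invariant[OF S geneig[OF that(2)] that(1)] gen by (simp add: \<kappa>_def)
    from eigenfunction_expand(2)[OF e this] show ?thesis by (simp add: B_def)
  qed
  have Sl: "S s j \<in> lp m 2" if "0 \<le> s" "j \<in> B" for s j
    using bounded_operatorD(1)[OF b[OF that(1)]] E2 B that by auto
  \<comment> \<open>The factor exp(\<kappa> s) cancels the expected decay, so that the coordinate
    matrices have derivative 0 at time 0 and the rescaled coordinates must be constant.\<close>
  define y where "y s i = exp (\<kappa> * s) * coef (S s e) i" for s i
  define a where "a h i j = exp (\<kappa> * h) * coef (S h j) i" for h i j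
  have yt: "y t i = y 0 i" if i: "i \<in> B" for i
  proof (rule matrix_semigroup_constant[OF B(1) _ _ t i, where a = a])
    fix s h :: real and i assume sh: "0 \<le> s" "0 < h" and i: "i \<in> B"
    have iE: "i \<in> linf" using i B E_linf by auto
    have "S (s + h) e = S h (S s e)"
      using S sh E2[OF e] unfolding c0_semigroup_def by (metis add.commute less_imp_le)
    also have "\<dots> = S h (\<lambda>x. \<Sum>j\<in>B. coef (S s e) j * j x)" using expand[OF sh(1) B(3)] by simp
    also have "\<dots> = (\<lambda>x. \<Sum>j\<in>B. coef (S s e) j * S h j x)"
      by (rule bounded_operator_sum[OF one_le_2 b]) (use sh B E2 in auto)
    finally have "coef (S (s + h) e) i = (\<Sum>j\<in>B. coef (S s e) j * coef (S h j) i)"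
      using coef_sum[of B "\<lambda>j. S h j" i "coef (S s e)"] Sl sh iE by simp
    then show "y (s + h) i = (\<Sum>j\<in>B. a h i j * y s j)"
      by (simp add: y_def a_def sum_distrib_left distrib_left exp_add mult_ac)
  next
    fix i j assume i: "i \<in> B" and j: "j \<in> B"
    define \<delta> where "\<delta> = (if i = j then 1 else 0 :: real)"
    have iE: "i \<in> linf" and jE: "j \<in> E" using i j B E_linf by auto
    have cj: "coef j i = \<delta>" using E_orth[OF jE, of i] i B by (auto simp: coef_pairing \<delta>_def)
    have lim: "((\<lambda>h. lp_norm m 2 (\<lambda>x. (S h j x - j x) / h - - \<kappa> * j x)) \<longlongrightarrow> 0) (at_right 0)"
      using geneig[OF j] by (auto simp: generator_def)
    have pos: "eventually (\<lambda>t. 0 < t) (at_right (0::real))" by (simp add: eventually_at_right_less)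
    have "((\<lambda>h. (coef (S h j) i - \<delta>) / h + \<kappa> * \<delta>) \<longlongrightarrow> 0) (at_right 0)"
    proof (rule Lim_null_comparison)
      show "((\<lambda>h. sup_norm i * ((total + 1) * lp_norm m 2 (\<lambda>x. (S h j x - j x) / h - - \<kappa> * j x))) \<longlongrightarrow> 0) (at_right 0)"
        by (intro tendsto_mult_right_zero lim)
      show "\<forall>\<^sub>F h in at_right 0. norm ((coef (S h j) i - \<delta>) / h + \<kappa> * \<delta>)
          \<le> sup_norm i * ((total + 1) * lp_norm m 2 (\<lambda>x. (S h j x - j x) / h - - \<kappa> * j x))"
      proof (rule eventually_mono[OF pos])
        fix h :: real assume h: "0 < h"
        have Sh: "S h j \<in> lp m 2" using Sl h j by simp
        define u where "u x = 1 / h * S h j x + (\<kappa> - 1 / h) * j x" for x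
        have u: "u \<in> lp m 2" unfolding u_def by (rule lp_comb[OF one_le_2 Sh E2[OF jE]])
        have "coef u i = 1 / h * coef (S h j) i + (\<kappa> - 1 / h) * coef j i"
          unfolding u_def by (rule coef_comb[OF L[OF Sh] L[OF E2[OF jE]] iE])
        then have "(coef (S h j) i - \<delta>) / h + \<kappa> * \<delta> = coef u i"
          unfolding cj by (simp add: algebra_simps diff_divide_distrib)
        moreover have "norm (coef u i) \<le> sup_norm i * ((total + 1) * lp_norm m 2 u)"
          by (intro order_trans[OF coef_summable(2)[OF L[OF u] iE]] mult_left_mono lp_L1(2)[OF one_le_2 u] sup_norm_nonneg iE)
        moreover have "(\<lambda>x. (S h j x - j x) / h - - \<kappa> * j x) = u"
          by (simp add: u_def fun_eq_iff algebra_simps diff_divide_distrib)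
        ultimately show "norm ((coef (S h j) i - \<delta>) / h + \<kappa> * \<delta>)
          \<le> sup_norm i * ((total + 1) * lp_norm m 2 (\<lambda>x. (S h j x - j x) / h - - \<kappa> * j x))" by simp
      qed
    qed
    from tendsto_diff[OF this tendsto_const[of "\<kappa> * \<delta>"]]
    have r: "((\<lambda>h. (coef (S h j) i - \<delta>) / h) \<longlongrightarrow> - \<kappa> * \<delta>) (at_right 0)" by simp
    have "((\<lambda>h. exp (\<kappa> * h)) has_real_derivative \<kappa>) (at 0)" by (auto intro!: derivative_eq_intros)
    then have "((\<lambda>h. (exp (\<kappa> * h) - 1) / h) \<longlongrightarrow> \<kappa>) (at 0)" by (simp add: DERIV_def)
    then have ex: "((\<lambda>h. (exp (\<kappa> * h) - 1) / h) \<longlongrightarrow> \<kappa>) (at_right 0)"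
      by (rule tendsto_mono[OF at_le, rotated]) simp
    have "((\<lambda>h. exp (\<kappa> * h)) \<longlongrightarrow> exp (\<kappa> * 0)) (at 0)" by (intro tendsto_intros)
    then have ex': "((\<lambda>h. exp (\<kappa> * h)) \<longlongrightarrow> exp (\<kappa> * 0)) (at_right 0)"
      by (rule tendsto_mono[OF at_le, rotated]) simp
    \<comment> \<open>Product rule for the rescaled matrix: the decay contributes -\<kappa> \<delta>
      and the exponential factor +\<kappa> \<delta>.\<close>
    have "((\<lambda>h. exp (\<kappa> * h) * ((coef (S h j) i - \<delta>) / h) + (exp (\<kappa> * h) - 1) / h * \<delta>)
        \<longlongrightarrow> exp (\<kappa> * 0) * (- \<kappa> * \<delta>) + \<kappa> * \<delta>) (at_right 0)"
      by (intro tendsto_intros r ex ex')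
    moreover have "exp (\<kappa> * h) * ((coef (S h j) i - \<delta>) / h) + (exp (\<kappa> * h) - 1) / h * \<delta> = (a h i j - \<delta>) / h" for h
      by (simp add: a_def diff_divide_distrib algebra_simps)
    ultimately show "((\<lambda>h. (a h i j - (if i = j then 1 else 0)) / h) \<longlongrightarrow> 0) (at_right 0)"
      by (simp add: \<delta>_def)
  qed
  have S0: "S 0 e = e" using S E2[OF e] by (simp add: c0_semigroup_def)
  have c: "coef (S t e) i = (if i = e then exp_mult t e else 0)" if i: "i \<in> B" for i
  proof -
    have "exp (\<kappa> * t) * coef (S t e) i = (if e = i then 1 else 0)"
      using yt[OF i] E_orth[OF e, of i] i B by (auto simp: y_def S0 coef_pairing)
    then have "exp_mult t e * (exp (\<kappa> * t) * coef (S t e) i) = exp_mult t e * (if e = i then 1 else 0)" by simp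
    moreover have "exp_mult t e * exp (\<kappa> * t) = 1" by (simp add: exp_mult_def \<kappa>_def flip: exp_add)
    ultimately show ?thesis by (auto simp flip: mult.assoc)
  qed
  have "S t e = (\<lambda>x. \<Sum>i\<in>B. coef (S t e) i * i x)" using expand[of t e] t B by simp
  also have "\<dots> = (\<lambda>x. \<Sum>i\<in>B. if i = e then exp_mult t e * e x else 0)"
    by (intro ext sum.cong refl) (auto simp: c)
  also have "\<dots> = (\<lambda>x. exp_mult t e * e x)" using B by (simp add: sum.delta)
  finally show ?thesis .
qed

text \<open>A competing semigroup agrees on the eigenfunctions by
  \<open>semigroup_eigenfunction\<close>, hence on the space by density; extensionality settles
  negative times and arguments outside the space.\<close>

lemma exp_neg_green_inv: "exp_neg m (green_inv 1 2) = semigroup_op"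
proof -
  have RGm: "{(f, \<lambda>x. - g x) | f g. (f, g) \<in> green_inv 1 2} = green_inv (-1) 2"
    by (auto simp: green_inv_def)
  show ?thesis
    unfolding exp_neg_def RGm
  proof (rule the_equality)
    show "c0_semigroup m 2 semigroup_op \<and> generator m 2 semigroup_op = green_inv (-1) 2" using c0_semigroup_op generator_semigroup_op by simp
    fix S assume "c0_semigroup m 2 S \<and> generator m 2 S = green_inv (-1) 2"
    then have S: "c0_semigroup m 2 S" and gen: "generator m 2 S = green_inv (-1) 2" by auto
    have b: "bounded_operator m 2 (S t)" if "0 \<le> t" for t using S that by (auto simp: c0_semigroup_def)
    have xt: "S \<in> extensional {0..}" "semigroup_op \<in> extensional {0..}" using S c0_semigroup_op by (auto simp: c0_semigroup_def)
    have E2: "j \<in> lp m 2" if "j \<in> E" for j using linf_lp[OF one_le_2 E_linf[OF that]] .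
    show "S = semigroup_op"
    proof (rule extensionalityI[OF xt])
      fix t :: real assume "t \<in> {0..}"
      then consider "t = 0" | "0 < t" by fastforce
      then show "S t = semigroup_op t"
      proof cases
        case 1
        have "S 0 f = semigroup_op 0 f" for f
          using S bounded_operatorD(3)[OF b, of 0 f] by (cases "f \<in> lp m 2") (auto simp: c0_semigroup_def semigroup_op_0)
        then show ?thesis using 1 by (simp add: fun_eq_iff)
      next
        case 2
        show ?thesis
        proof (rule bounded_operator_unique[OF one_le_2 b bounded_semigroup_op _ span_dense])
          show "{\<lambda>x. \<Sum>e\<in>F. c e * e x | F c. F \<subseteq> E} \<subseteq> lp m 2"
          proof clarify
            fix F and c :: "('a \<Rightarrow> real) \<Rightarrow> real" assume "F \<subseteq> E"
            then show "(\<lambda>x. \<Sum>e\<in>F. c e * e x) \<in> lp m 2"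
              by (intro lp_sum[OF one_le_2] lp_cmult(1)[OF one_le_2] E2) auto
          qed
          fix \<phi> assume "\<phi> \<in> {\<lambda>x. \<Sum>e\<in>F. c e * e x | F c. F \<subseteq> E}"
          then obtain F c where \<phi>: "\<phi> = (\<lambda>x. \<Sum>e\<in>F. c e * e x)" and F: "F \<subseteq> E" by blast
          have "S t \<phi> = (\<lambda>x. \<Sum>e\<in>F. c e * S t e x)"
            unfolding \<phi> by (rule bounded_operator_sum[OF one_le_2 b]) (use 2 F E2 in auto)
          also have "\<dots> = (\<lambda>x. \<Sum>e\<in>F. c e * semigroup_op t e x)"
          proof (intro ext sum.cong refl)
            fix x e assume "e \<in> F"
            then have e: "e \<in> E" using F by auto
            have "T (exp_mult t) e x = exp_mult t e * e x" using T_eigen[OF mult_bound_exp_mult[OF 2] e, of x] by simp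
            then show "c e * S t e x = c e * semigroup_op t e x"
              using semigroup_eigenfunction[OF S gen e 2] E2[OF e] by (simp add: semigroup_op_pos[OF 2])
          qed
          also have "\<dots> = semigroup_op t \<phi>"
            unfolding \<phi> by (rule bounded_operator_sum[OF one_le_2 bounded_semigroup_op, symmetric]) (use 2 F E2 in auto)
          finally show "S t \<phi> = semigroup_op t \<phi>" .
        qed (use 2 in auto)
      qed
    qed
  qed
qed

lemma lp_generator_green_inv:
  assumes p: "1 \<le> p" shows "lp_generator m p semigroup_op = green_inv (-1) p"
proof -
  have U: "on_lp m p (semigroup_op t) f = T (exp_mult t) f" if "1 \<le> p" "0 < t" "f \<in> lp m p" for p t f
    using on_lp_T[OF that(1) mult_bound_exp_mult[OF that(2)]] that by (simp add: semigroup_op_pos)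
  have "generator m p (\<lambda>t. on_lp m p (semigroup_op t)) = green_inv (-1) p" if "1 \<le> p" "p \<noteq> \<infinity>" for p
    by (rule generator_green_inv[OF that U[OF that(1)]])
  from this[of 1] this[of p] show ?thesis
    unfolding lp_generator_def using p adjoint_green_inv by (cases "p = \<infinity>") simp_all
qed

lemma spectral_statements:
  "((\<forall>t>0. trace_class m (exp_neg m (green_inv 1 2) t)) \<and> (\<forall>\<alpha>>0. trace_class m (resolvent m (green_inv 1 2) \<alpha>))) \<and>
   purely_discrete_spectrum m 2 (green_inv 1 2) \<and>
   ((\<forall>p\<ge>1.
       norm_analytic_on m p {0<..} (\<lambda>t. on_lp m p (exp_neg m (green_inv 1 2) t)) \<and>
       norm_analytic_on m p {0<..} (\<lambda>\<alpha>. on_lp m p (resolvent m (green_inv 1 2) \<alpha>)) \<and>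
       (\<forall>t>0. compact_operator m p (on_lp m p (exp_neg m (green_inv 1 2) t))) \<and>
       (\<forall>\<alpha>>0. compact_operator m p (on_lp m p (resolvent m (green_inv 1 2) \<alpha>)))) \<and>
    (\<forall>p\<ge>1. \<forall>q\<ge>1.
       spectrum m p (lp_generator m p (exp_neg m (green_inv 1 2))) =
       spectrum m q (lp_generator m q (exp_neg m (green_inv 1 2)))))"
  unfolding exp_neg_green_inv
proof (intro conjI allI impI)
  show "trace_class m (semigroup_op t)" if "0 < t" for t
    unfolding semigroup_op_pos[OF that] by (rule trace_class_T[OF mult_bound_exp_mult[OF that]]) (simp add: exp_mult_def)
  show "trace_class m (resolvent m (green_inv 1 2) \<alpha>)" if "0 < \<alpha>" for \<alpha>
    unfolding resolvent_green_inv[OF that]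
  proof (rule trace_class_T[OF mult_bound_res_mult[OF that]])
    fix e assume "e \<in> E"
    then have "0 < \<mu> e" by (rule mu_pos)
    then show "0 \<le> res_mult \<alpha> e" using that by (simp add: res_mult_def)
  qed
  show "purely_discrete_spectrum m 2 (green_inv 1 2)" by (rule purely_discrete_green_inv)
  show "spectrum m p (lp_generator m p semigroup_op) = spectrum m q (lp_generator m q semigroup_op)" if "1 \<le> p" "1 \<le> q" for p q
    using that spectrum_green_inv[of p "-1"] spectrum_green_inv[of q "-1"] by (simp add: lp_generator_green_inv)
  fix p :: ennreal assume p: "1 \<le> p"
  have on_semigroup_op: "on_lp m p (semigroup_op t) = restrict (T (exp_mult t)) (lp m p)" if "0 < t" for t
    unfolding semigroup_op_pos[OF that] by (rule on_lp_T[OF p mult_bound_exp_mult[OF that]])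
  have on_rs: "on_lp m p (resolvent m (green_inv 1 2) \<alpha>) = restrict (T (res_mult \<alpha>)) (lp m p)" if "0 < \<alpha>" for \<alpha>
    unfolding resolvent_green_inv[OF that] by (rule on_lp_T[OF p mult_bound_res_mult[OF that]])
  have cong: "norm_analytic_on m p {0<..} U"
    if "norm_analytic_on m p {0<..} V" "\<And>t. 0 < t \<Longrightarrow> U t = V t" for U V
    using that unfolding norm_analytic_on_def by simp
  show "norm_analytic_on m p {0<..} (\<lambda>t. on_lp m p (semigroup_op t))"
    by (rule cong[OF norm_analytic_exp_mult[OF p] on_semigroup_op])
  show "norm_analytic_on m p {0<..} (\<lambda>\<alpha>. on_lp m p (resolvent m (green_inv 1 2) \<alpha>))"
    by (rule cong[OF norm_analytic_res_mult[OF p] on_rs])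
  show "compact_operator m p (on_lp m p (semigroup_op t))" if "0 < t" for t
    unfolding on_semigroup_op[OF that] by (rule compact_operator_kernel_op[OF X_countable p ker_kernel_bound[OF mult_bound_exp_mult[OF that]]])
  show "compact_operator m p (on_lp m p (resolvent m (green_inv 1 2) \<alpha>))" if "0 < \<alpha>" for \<alpha>
    unfolding on_rs[OF that] by (rule compact_operator_kernel_op[OF X_countable p ker_kernel_bound[OF mult_bound_res_mult[OF that]]])
qed

end

section \<open>Forms and the energy of a graph\<close>

text \<open>Only semi-definite forms are assumed, because the form used to find eigenfunctions is
  degenerate exactly at them. The energy, the weighted pairing and the forms with parameter \<alpha>
  are the other instances.\<close>

locale ip_space =
  fixes V :: "('a \<Rightarrow> real) set" and B :: "('a \<Rightarrow> real) \<Rightarrow> ('a \<Rightarrow> real) \<Rightarrow> real"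
  assumes comb: "\<And>f g r s. f \<in> V \<Longrightarrow> g \<in> V \<Longrightarrow> (\<lambda>x. r * f x + s * g x) \<in> V"
    and B_comb: "\<And>f g h r s. f \<in> V \<Longrightarrow> g \<in> V \<Longrightarrow> h \<in> V \<Longrightarrow>
      B (\<lambda>x. r * f x + s * g x) h = r * B f h + s * B g h"
    and B_sym: "\<And>f g. f \<in> V \<Longrightarrow> g \<in> V \<Longrightarrow> B f g = B g f"
    and B_nonneg: "\<And>f. f \<in> V \<Longrightarrow> 0 \<le> B f f"
begin

lemma diff: "f \<in> V \<Longrightarrow> g \<in> V \<Longrightarrow> (\<lambda>x. f x - g x) \<in> V"
  using comb[of f g 1 "-1"] by simp

lemma cmult: "f \<in> V \<Longrightarrow> (\<lambda>x. r * f x) \<in> V"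
  using comb[of f f r 0] by simp

lemma B_diff: "f \<in> V \<Longrightarrow> g \<in> V \<Longrightarrow> h \<in> V \<Longrightarrow> B (\<lambda>x. f x - g x) h = B f h - B g h"
  using B_comb[of f g h 1 "-1"] by simp

lemma B_cmult: "f \<in> V \<Longrightarrow> h \<in> V \<Longrightarrow> B (\<lambda>x. r * f x) h = r * B f h"
  using B_comb[of f f h r 0] by simp

lemma B_comb_right:
  assumes "f \<in> V" "g \<in> V" "h \<in> V"
  shows "B h (\<lambda>x. r * f x + s * g x) = r * B h f + s * B h g"
  using B_comb[OF assms] B_sym comb assms by simp

lemma B_diff_right: "f \<in> V \<Longrightarrow> g \<in> V \<Longrightarrow> h \<in> V \<Longrightarrow> B h (\<lambda>x. f x - g x) = B h f - B h g"
  using B_comb_right[of f g h 1 "-1"] by simp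

lemma B_cmult_right: "f \<in> V \<Longrightarrow> h \<in> V \<Longrightarrow> B h (\<lambda>x. r * f x) = r * B h f"
  using B_comb_right[of f f h r 0] by simp

lemma B_quadratic:
  assumes f: "f \<in> V" and g: "g \<in> V"
  shows "B (\<lambda>x. r * f x + s * g x) (\<lambda>x. r * f x + s * g x) = r\<^sup>2 * B f f + 2 * r * s * B f g + s\<^sup>2 * B g g"
  using B_sym[OF f g]
  by (simp add: B_comb[OF f g comb[OF f g]] B_comb_right[OF f g f] B_comb_right[OF f g g] algebra_simps power2_eq_square)

lemma B_quadratic_diff:
  assumes f: "f \<in> V" and g: "g \<in> V"
  shows "B (\<lambda>x. f x - g x) (\<lambda>x. f x - g x) = B f f - 2 * B f g + B g g"
  using B_quadratic[OF assms, of 1 "-1"] by simp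

lemma B_zero_imp:
  assumes f: "f \<in> V" and g: "g \<in> V" and 0: "B f f = 0"
  shows "B f g = 0"
proof (rule ccontr)
  assume nz: "B f g \<noteq> 0"
  have "0 \<le> r\<^sup>2 * B f f + 2 * r * 1 * B f g + 1\<^sup>2 * B g g" for r
    using B_nonneg[OF comb[OF f g]] unfolding B_quadratic[OF f g, symmetric] .
  \<comment> \<open>At this r the cross term equals -(B g g + 1), so the supposedly nonnegative
    value is -1.\<close>
  from this[of "- (B g g + 1) / (2 * B f g)"] show False using nz 0 by (simp add: field_simps)
qed

lemma cauchy_schwarz:
  assumes f: "f \<in> V" and g: "g \<in> V"
  shows "(B f g)\<^sup>2 \<le> B f f * B g g"
proof (cases "B f f = 0")
  case True
  then show ?thesis using B_zero_imp[OF f g] by simp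
next
  case False
  then have pos: "0 < B f f" using B_nonneg[OF f] by simp
  have "0 \<le> (B f g)\<^sup>2 * B f f + 2 * B f g * (- B f f) * B f g + (- B f f)\<^sup>2 * B g g"
    using B_nonneg[OF comb[OF f g]] unfolding B_quadratic[OF f g, symmetric] .
  then have "0 \<le> B f f * (B f f * B g g - (B f g)\<^sup>2)" by (simp add: algebra_simps power2_eq_square)
  then show ?thesis using pos by (simp add: zero_le_mult_iff)
qed

definition N :: "('a \<Rightarrow> real) \<Rightarrow> real" where
  "N f = sqrt (B f f)"

lemma N_nonneg [simp]: "f \<in> V \<Longrightarrow> 0 \<le> N f"
  by (simp add: N_def B_nonneg)

lemma N_sq: "f \<in> V \<Longrightarrow> (N f)\<^sup>2 = B f f"
  by (simp add: N_def B_nonneg)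

lemma B_le_N: "f \<in> V \<Longrightarrow> g \<in> V \<Longrightarrow> \<bar>B f g\<bar> \<le> N f * N g"
  using real_sqrt_le_mono[OF cauchy_schwarz[of f g]] by (simp add: N_def real_sqrt_mult)

lemma N_cmult: "f \<in> V \<Longrightarrow> N (\<lambda>x. r * f x) = \<bar>r\<bar> * N f"
  using B_quadratic[of f f r 0] by (simp add: N_def real_sqrt_mult)

lemma N_comb:
  assumes f: "f \<in> V" and g: "g \<in> V"
  shows "N (\<lambda>x. r * f x + s * g x) \<le> \<bar>r\<bar> * N f + \<bar>s\<bar> * N g"
proof (rule power2_le_imp_le)
  have "r * s * B f g \<le> \<bar>r * s\<bar> * \<bar>B f g\<bar>" by (metis abs_ge_self abs_mult)
  also have "\<dots> \<le> \<bar>r * s\<bar> * (N f * N g)" by (intro mult_left_mono B_le_N f g) simp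
  finally have "r\<^sup>2 * B f f + 2 * r * s * B f g + s\<^sup>2 * B g g \<le> (\<bar>r\<bar> * N f + \<bar>s\<bar> * N g)\<^sup>2"
    using N_sq[OF f] N_sq[OF g] by (simp add: power2_sum power_mult_distrib abs_mult algebra_simps)
  then show "(N (\<lambda>x. r * f x + s * g x))\<^sup>2 \<le> (\<bar>r\<bar> * N f + \<bar>s\<bar> * N g)\<^sup>2"
    unfolding N_sq[OF comb[OF f g]] B_quadratic[OF f g] .
qed (use f g in simp)

lemma N_add: "f \<in> V \<Longrightarrow> g \<in> V \<Longrightarrow> N (\<lambda>x. f x + g x) \<le> N f + N g"
  using N_comb[of f g 1 1] by simp

lemma N_diff: "f \<in> V \<Longrightarrow> g \<in> V \<Longrightarrow> N (\<lambda>x. f x - g x) \<le> N f + N g"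
  using N_comb[of f g 1 "-1"] by simp

lemma N_diff_commute: "f \<in> V \<Longrightarrow> g \<in> V \<Longrightarrow> N (\<lambda>x. f x - g x) = N (\<lambda>x. g x - f x)"
  using N_cmult[OF diff, of f g "-1"] by simp

lemma N_le_diff: "f \<in> V \<Longrightarrow> g \<in> V \<Longrightarrow> N f \<le> N (\<lambda>x. f x - g x) + N g"
  using N_add[OF diff, of f g g] by simp

text \<open>The direct method: minimize J(u) = B u u - 2 l(u). Minimizing sequences are taken from a
  dense subspace \<open>W\<close>, and limits are only asked for Cauchy sequences there, since for
  finitely supported functions limits can be constructed by hand.\<close>

lemma riesz:
  assumes W: "W \<subseteq> V" "W \<noteq> {}" and Wcomb: "\<And>f g r s. f \<in> W \<Longrightarrow> g \<in> W \<Longrightarrow> (\<lambda>x. r * f x + s * g x) \<in> W"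
    and dense: "\<And>u \<epsilon>. u \<in> V \<Longrightarrow> 0 < \<epsilon> \<Longrightarrow> \<exists>w\<in>W. N (\<lambda>x. u x - w x) < \<epsilon>"
    and complete: "\<And>w :: nat \<Rightarrow> 'a \<Rightarrow> real. (\<And>n. w n \<in> W) \<Longrightarrow>
        (\<And>\<epsilon>. 0 < \<epsilon> \<Longrightarrow> \<exists>M. \<forall>i\<ge>M. \<forall>j\<ge>M. N (\<lambda>x. w i x - w j x) < \<epsilon>) \<Longrightarrow>
        \<exists>v\<in>V. (\<lambda>n. N (\<lambda>x. v x - w n x)) \<longlonglongrightarrow> 0"
    and l: "\<And>f g r s. f \<in> V \<Longrightarrow> g \<in> V \<Longrightarrow> l (\<lambda>x. r * f x + s * g x) = r * l f + s * l g"
    and lb: "\<And>f. f \<in> V \<Longrightarrow> \<bar>l f\<bar> \<le> K * N f"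
  shows "\<exists>v\<in>V. \<forall>u\<in>V. B v u = l u"
proof -
  define J where "J u = B u u - 2 * l u" for u
  have Jlow: "- K\<^sup>2 \<le> J u" if "u \<in> V" for u
  proof -
    have "0 \<le> (N u - K)\<^sup>2" by simp
    also have "\<dots> = B u u - 2 * (K * N u) + K\<^sup>2" by (simp add: power2_diff N_sq[OF that] algebra_simps)
    finally show ?thesis using lb[OF that] by (simp add: J_def abs_le_iff)
  qed
  define I where "I = Inf (J ` W)"
  have bdd: "bdd_below (J ` W)" by (rule bdd_belowI2[of _ "- K\<^sup>2"]) (use Jlow W in auto)
  have I: "I \<le> J w" if "w \<in> W" for w unfolding I_def by (rule cINF_lower[OF bdd that])
  have "\<exists>w\<in>W. J w < I + 1 / real (Suc n)" for n
    using cINF_less_iff[OF W(2) bdd, of "I + 1 / real (Suc n)"] unfolding I_def by simp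
  then obtain w where w: "\<And>n. w n \<in> W" "\<And>n. J (w n) < I + 1 / real (Suc n)" by metis
  have wV: "w n \<in> V" for n using w W by auto
  \<comment> \<open>The parallelogram argument: the midpoint of two almost minimizers also has a
    value of at least \<open>I\<close>, which forces them to be close.\<close>
  have par: "B (\<lambda>x. w i x - w j x) (\<lambda>x. w i x - w j x) \<le> 2 / real (Suc i) + 2 / real (Suc j)" for i j
  proof -
    have "I \<le> J (\<lambda>x. 1/2 * w i x + 1/2 * w j x)" by (intro I Wcomb w)
    also have "\<dots> = 1/4 * B (w i) (w i) + 1/2 * B (w i) (w j) + 1/4 * B (w j) (w j) - l (w i) - l (w j)"
      unfolding J_def B_quadratic[OF wV wV] l[OF wV wV] by (simp add: power2_eq_square)
    finally have 1: "I \<le> 1/4 * B (w i) (w i) + 1/2 * B (w i) (w j) + 1/4 * B (w j) (w j) - l (w i) - l (w j)" .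
    have lin: "a - 2 * d + e \<le> 2 * s + 2 * t"
      if "I \<le> 1/4 * a + 1/2 * d + 1/4 * e - p - q" "a - 2 * p < I + s" "e - 2 * q < I + t" for a d e p q s t
      using that by linarith
    show ?thesis
      using lin[OF 1 w(2)[of i, unfolded J_def] w(2)[of j, unfolded J_def]]
      unfolding B_quadratic_diff[OF wV wV] by simp
  qed
  have "\<exists>v\<in>V. (\<lambda>n. N (\<lambda>x. v x - w n x)) \<longlonglongrightarrow> 0"
  proof (rule complete[OF w(1)])
    fix \<epsilon> :: real assume \<epsilon>: "0 < \<epsilon>"
    obtain M where M: "4 / \<epsilon>\<^sup>2 < real M" using reals_Archimedean2 by blast
    have "N (\<lambda>x. w i x - w j x) < \<epsilon>" if "i \<ge> M" "j \<ge> M" for i j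
    proof (rule power2_less_imp_less)
      have "4 / real (Suc M) < \<epsilon>\<^sup>2"
      proof -
        have "4 < real M * \<epsilon>\<^sup>2" using M \<epsilon> by (simp add: field_simps)
        also have "\<dots> \<le> real (Suc M) * \<epsilon>\<^sup>2" by (intro mult_right_mono) auto
        finally show ?thesis by (simp add: pos_divide_less_eq mult.commute del: of_nat_Suc)
      qed
      moreover have "2 / real (Suc i) \<le> 2 / real (Suc M)" "2 / real (Suc j) \<le> 2 / real (Suc M)"
        using that by (auto intro!: divide_left_mono)
      moreover have "2 / real (Suc M) + 2 / real (Suc M) = 4 / real (Suc M)" by (simp add: add_divide_distrib[symmetric])
      ultimately show "(N (\<lambda>x. w i x - w j x))\<^sup>2 < \<epsilon>\<^sup>2"
        using par[of i j] unfolding N_sq[OF diff[OF wV wV]] by linarith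
    qed (use \<epsilon> in simp)
    then show "\<exists>M. \<forall>i\<ge>M. \<forall>j\<ge>M. N (\<lambda>x. w i x - w j x) < \<epsilon>" by blast
  qed
  then obtain v where v: "v \<in> V" and vlim: "(\<lambda>n. N (\<lambda>x. v x - w n x)) \<longlonglongrightarrow> 0" by blast
  have eqW: "B v u = l u" if u: "u \<in> W" for u
  proof -
    have uV: "u \<in> V" using u W by auto
    have lim: "(\<lambda>n. B (w n) u) \<longlonglongrightarrow> B v u"
    proof -
      have "(\<lambda>n. B v u - B (w n) u) \<longlonglongrightarrow> 0"
      proof (rule Lim_null_comparison)
        show "(\<lambda>n. N (\<lambda>x. v x - w n x) * N u) \<longlonglongrightarrow> 0" by (rule tendsto_mult_left_zero[OF vlim])
        show "\<forall>\<^sub>F n in sequentially. norm (B v u - B (w n) u) \<le> N (\<lambda>x. v x - w n x) * N u"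
          using B_le_N[OF diff[OF v wV] uV] by (intro always_eventually) (simp add: B_diff[OF v wV uV])
      qed
      from tendsto_diff[OF tendsto_const[of "B v u"] this] show ?thesis by simp
    qed
    \<comment> \<open>Moving from w(n) by t u cannot lower J by more than 1/(n+1); in the limit a
      quadratic in t that vanishes at 0 is nonnegative, so its slope at 0 must vanish.\<close>
    have q: "0 \<le> t\<^sup>2 * B u u + 2 * t * (B v u - l u)" for t
    proof -
      have ge: "- (1 / real (Suc n)) \<le> t\<^sup>2 * B u u + 2 * t * (B (w n) u - l u)" for n
      proof -
        have "I \<le> J (\<lambda>x. 1 * w n x + t * u x)" by (intro I Wcomb w u)
        also have "\<dots> = J (w n) + (t\<^sup>2 * B u u + 2 * t * (B (w n) u - l u))"
          unfolding J_def B_quadratic[OF wV uV] l[OF wV uV] by (simp add: algebra_simps)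
        finally show ?thesis using w(2)[of n] by linarith
      qed
      have l0: "(\<lambda>n. - (1 / real (Suc n))) \<longlonglongrightarrow> - 0"
        using LIMSEQ_inverse_real_of_nat by (intro tendsto_minus) (simp add: inverse_eq_divide)
      have l1: "(\<lambda>n. t\<^sup>2 * B u u + 2 * t * (B (w n) u - l u)) \<longlonglongrightarrow> t\<^sup>2 * B u u + 2 * t * (B v u - l u)"
        by (intro tendsto_intros lim)
      have "- 0 \<le> t\<^sup>2 * B u u + 2 * t * (B v u - l u)"
        by (rule LIMSEQ_le[OF l0 l1]) (use ge in auto)
      then show ?thesis by simp
    qed
    show ?thesis
    proof (rule ccontr)
      assume ne: "B v u \<noteq> l u"
      define \<delta> where "\<delta> = B v u - l u"
      have \<delta>: "\<delta> \<noteq> 0" using ne by (simp add: \<delta>_def)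
      have Bu: "0 \<le> B u u" by (rule B_nonneg[OF uV])
      \<comment> \<open>Take t = -\<delta>/(B u u + 1), small enough for the linear term to win; the
        +1 keeps the quotient meaningful when B u u = 0.\<close>
      have "0 \<le> (- \<delta> / (B u u + 1))\<^sup>2 * B u u + 2 * (- \<delta> / (B u u + 1)) * \<delta>"
        using q unfolding \<delta>_def .
      also have "\<dots> = \<delta>\<^sup>2 / (B u u + 1)\<^sup>2 * (B u u - 2 * (B u u + 1))"
      proof -
        have "(- \<delta> / s)\<^sup>2 * a + 2 * (- \<delta> / s) * \<delta> = \<delta>\<^sup>2 / s\<^sup>2 * (a - 2 * s)" if "s \<noteq> 0" for a s :: real
          using that by (simp add: field_simps power2_eq_square)
        then show ?thesis using Bu by simp
      qed
      also have "\<dots> < 0" using Bu \<delta> by (intro mult_pos_neg) (auto simp: add_nonneg_eq_0_iff)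
      finally show False by simp
    qed
  qed
  have "B v u = l u" if u: "u \<in> V" for u
  proof -
    have K: "\<bar>B v u - l u\<bar> \<le> (N v + \<bar>K\<bar>) * \<epsilon>" if \<epsilon>: "0 < \<epsilon>" for \<epsilon>
    proof -
      obtain w where w: "w \<in> W" "N (\<lambda>x. u x - w x) < \<epsilon>" using dense[OF u \<epsilon>] by blast
      have wV: "w \<in> V" using w W by auto
      have d: "(\<lambda>x. u x - w x) \<in> V" by (rule diff[OF u wV])
      have "B v u - l u = B v (\<lambda>x. u x - w x) - l (\<lambda>x. u x - w x)"
        using B_diff_right[OF u wV v] l[OF u wV, of 1 "-1"] eqW[OF w(1)] by simp
      also have "\<bar>\<dots>\<bar> \<le> N v * N (\<lambda>x. u x - w x) + \<bar>K\<bar> * N (\<lambda>x. u x - w x)"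
        using B_le_N[OF v d] order_trans[OF lb[OF d] mult_right_mono[OF abs_ge_self[of K] N_nonneg[OF d]]] by linarith
      also have "\<dots> \<le> (N v + \<bar>K\<bar>) * \<epsilon>"
        using mult_left_mono[OF less_imp_le[OF w(2)], of "N v + \<bar>K\<bar>"] v by (simp add: distrib_right)
      finally show ?thesis .
    qed
    have "\<bar>B v u - l u\<bar> \<le> 0 + \<epsilon>" if \<epsilon>: "0 < \<epsilon>" for \<epsilon>
    proof -
      have pos: "0 < N v + \<bar>K\<bar> + 1" using v by (simp add: add_nonneg_pos)
      have "\<bar>B v u - l u\<bar> \<le> (N v + \<bar>K\<bar>) * (\<epsilon> / (N v + \<bar>K\<bar> + 1))" by (rule K) (use \<epsilon> pos in simp)
      also have "\<dots> \<le> (N v + \<bar>K\<bar> + 1) * (\<epsilon> / (N v + \<bar>K\<bar> + 1))"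
        using \<epsilon> pos by (intro mult_right_mono) auto
      also have "\<dots> = \<epsilon>" using pos by simp
      finally show ?thesis by simp
    qed
    then have "\<bar>B v u - l u\<bar> \<le> 0" by (rule field_le_epsilon)
    then show ?thesis by simp
  qed
  then show ?thesis using v by blast
qed

end

section \<open>The energy of a graph as a sum of squares\<close>

lemma square_summable_mult:
  fixes u v :: "'z \<Rightarrow> real"
  assumes "(\<lambda>z. u z * u z) summable_on A" "(\<lambda>z. v z * v z) summable_on A"
  shows "(\<lambda>z. u z * v z) summable_on A"
proof (rule summable_on_dominated(1))
  show "(\<lambda>z. u z * u z + v z * v z) summable_on A" by (rule summable_on_add[OF assms])
  show "norm (u z * v z) \<le> u z * u z + v z * v z" for z
  proof -
    have "2 * (\<bar>u z\<bar> * \<bar>v z\<bar>) \<le> u z * u z + v z * v z"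
      using sum_squares_bound[of "\<bar>u z\<bar>" "\<bar>v z\<bar>"] by (simp add: power2_eq_square mult.assoc)
    moreover have "0 \<le> \<bar>u z\<bar> * \<bar>v z\<bar>" by simp
    ultimately show ?thesis unfolding real_norm_def abs_mult by linarith
  qed
qed

text \<open>The square-summable product pulled back along a linear map \<open>d\<close>. It is used
  with the gradient for the energy and with multiplication by the root of m for the weighted
  pairing.\<close>

lemma ip_space_sum:
  fixes d :: "('a \<Rightarrow> real) \<Rightarrow> 'z \<Rightarrow> real"
  assumes lin: "\<And>f g r s z. d (\<lambda>x. r * f x + s * g x) z = r * d f z + s * d g z"
  shows "ip_space {f. (\<lambda>z. d f z * d f z) summable_on UNIV} (\<lambda>f g. \<Sum>\<^sub>\<infinity>z. d f z * d g z)"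
proof -
  have s: "(\<lambda>z. d f z * d g z) summable_on UNIV"
    if "(\<lambda>z. d f z * d f z) summable_on UNIV" "(\<lambda>z. d g z * d g z) summable_on UNIV" for f g
    by (rule square_summable_mult[OF that])
  show ?thesis
  proof
    fix f g h :: "'a \<Rightarrow> real" and r t :: real
    assume f: "f \<in> {f. (\<lambda>z. d f z * d f z) summable_on UNIV}" and g: "g \<in> {f. (\<lambda>z. d f z * d f z) summable_on UNIV}"
    have "(\<lambda>z. r * r * (d f z * d f z) + 2 * r * t * (d f z * d g z) + t * t * (d g z * d g z)) summable_on UNIV"
      using s[of f f] s[of f g] s[of g g] f g by (intro summable_on_add summable_on_cmult_right) simp_all
    then show "(\<lambda>x. r * f x + t * g x) \<in> {f. (\<lambda>z. d f z * d f z) summable_on UNIV}"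
      by (simp add: lin algebra_simps)
    assume h: "h \<in> {f. (\<lambda>z. d f z * d f z) summable_on UNIV}"
    have "(\<Sum>\<^sub>\<infinity>z. d (\<lambda>x. r * f x + t * g x) z * d h z) = (\<Sum>\<^sub>\<infinity>z. r * (d f z * d h z) + t * (d g z * d h z))"
      by (simp add: lin algebra_simps)
    also have "\<dots> = r * (\<Sum>\<^sub>\<infinity>z. d f z * d h z) + t * (\<Sum>\<^sub>\<infinity>z. d g z * d h z)"
      using f g h by (subst infsum_add) (auto intro!: s summable_on_cmult_right simp: infsum_cmult_right')
    finally show "(\<Sum>\<^sub>\<infinity>z. d (\<lambda>x. r * f x + t * g x) z * d h z) = r * (\<Sum>\<^sub>\<infinity>z. d f z * d h z) + t * (\<Sum>\<^sub>\<infinity>z. d g z * d h z)" .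
  qed (auto simp: mult.commute intro!: infsum_nonneg)
qed

lemma infsum_ennreal:
  fixes f :: "'x \<Rightarrow> real"
  assumes nn: "\<And>x. 0 \<le> f x"
  shows "(\<Sum>\<^sub>\<infinity>x. ennreal (f x)) < \<infinity> \<longleftrightarrow> f summable_on UNIV"
    "f summable_on UNIV \<Longrightarrow> (\<Sum>\<^sub>\<infinity>x. ennreal (f x)) = ennreal (infsum f UNIV)"
proof -
  have eq: "(\<Sum>\<^sub>\<infinity>x. ennreal (f x)) = (SUP F\<in>{F. finite F}. ennreal (sum f F))"
    by (simp add: nonneg_infsum_complete nn)
  show *: "(\<Sum>\<^sub>\<infinity>x. ennreal (f x)) = ennreal (infsum f UNIV)" if "f summable_on UNIV"
    unfolding eq using infsum_nonneg_is_SUPREMUM_ennreal[OF that] nn by simp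
  show "(\<Sum>\<^sub>\<infinity>x. ennreal (f x)) < \<infinity> \<longleftrightarrow> f summable_on UNIV"
  proof
    assume fin: "(\<Sum>\<^sub>\<infinity>x. ennreal (f x)) < \<infinity>"
    show "f summable_on UNIV"
    proof (rule summable_on_finite_bound(1)[OF nn])
      fix F :: "'x set" assume "finite F"
      then have "ennreal (sum f F) \<le> (\<Sum>\<^sub>\<infinity>x. ennreal (f x))" unfolding eq by (intro SUP_upper) simp
      then show "sum f F \<le> enn2real (\<Sum>\<^sub>\<infinity>x. ennreal (f x))"
        using fin by (metis enn2real_ennreal enn2real_mono infinity_ennreal_def nn sum_nonneg)
    qed
  next
    assume "f summable_on UNIV"
    then show "(\<Sum>\<^sub>\<infinity>x. ennreal (f x)) < \<infinity>" using * by simp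
  qed
qed

lemma summable_on_sum_type:
  fixes f :: "'x + 'y \<Rightarrow> 'k::banach"
  shows "f summable_on UNIV \<longleftrightarrow> (\<lambda>x. f (Inl x)) summable_on UNIV \<and> (\<lambda>y. f (Inr y)) summable_on UNIV" (is ?a)
    "f summable_on UNIV \<Longrightarrow> infsum f UNIV = (\<Sum>\<^sub>\<infinity>x. f (Inl x)) + (\<Sum>\<^sub>\<infinity>y. f (Inr y))"
proof -
  have U: "(UNIV :: ('x + 'y) set) = range Inl \<union> range Inr" "range Inl \<inter> range Inr = ({} :: ('x + 'y) set)"
    by (auto simp: UNIV_sum)
  have s: "f summable_on range Inl \<longleftrightarrow> (\<lambda>x. f (Inl x)) summable_on UNIV" "f summable_on range Inr \<longleftrightarrow> (\<lambda>y. f (Inr y)) summable_on UNIV"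
    by (simp_all add: summable_on_reindex comp_def)
  show ?a
  proof
    assume f: "f summable_on UNIV"
    have "f summable_on range Inl" "f summable_on range Inr"
      by (rule summable_on_subset_banach[OF f]; simp)+
    then show "(\<lambda>x. f (Inl x)) summable_on UNIV \<and> (\<lambda>y. f (Inr y)) summable_on UNIV" using s by simp
  next
    assume "(\<lambda>x. f (Inl x)) summable_on UNIV \<and> (\<lambda>y. f (Inr y)) summable_on UNIV"
    then show "f summable_on UNIV" unfolding U(1) using s U(2) by (intro summable_on_Un_disjoint) auto
  qed
  show "infsum f UNIV = (\<Sum>\<^sub>\<infinity>x. f (Inl x)) + (\<Sum>\<^sub>\<infinity>y. f (Inr y))" if f: "f summable_on UNIV"
  proof -
    have "f summable_on range Inl" "f summable_on range Inr"
      by (rule summable_on_subset_banach[OF f]; simp)+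
    then show ?thesis
      unfolding U(1) using U(2) by (subst infsum_Un_disjoint) (simp_all add: infsum_reindex comp_def)
  qed
qed

locale graph =
  fixes b :: "'a \<Rightarrow> 'a \<Rightarrow> real" and c :: "'a \<Rightarrow> real"
  assumes wg: "weighted_graph b c"
begin

lemma b_nonneg [simp]: "0 \<le> b x y" and b_sym: "b x y = b y x" and b_diag [simp]: "b x x = 0"
  and b_summable: "b x summable_on UNIV" and c_nonneg [simp]: "0 \<le> c x"
  using wg by (auto simp: weighted_graph_def)

text \<open>Collects edge and potential terms in one family whose squares sum to the energy. The
  division by 2 accounts for each edge occurring in both orientations.\<close>

definition grad :: "('a \<Rightarrow> real) \<Rightarrow> ('a \<times> 'a) + 'a \<Rightarrow> real" where
  "grad f z = (case z of Inl (x, y) \<Rightarrow> sqrt (b x y / 2) * (f x - f y) | Inr x \<Rightarrow> sqrt (c x) * f x)"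

lemma grad_simps:
  "grad f (Inl (x, y)) = sqrt (b x y / 2) * (f x - f y)" "grad f (Inr x) = sqrt (c x) * f x"
  by (simp_all add: grad_def)

abbreviation Q :: "('a \<Rightarrow> real) \<Rightarrow> ('a \<Rightarrow> real) \<Rightarrow> real" where "Q \<equiv> energy_form b c"

lemma grad_mult: "grad f (Inl (x, y)) * grad g (Inl (x, y)) = b x y * (f x - f y) * (g x - g y) / 2"
  "grad f (Inr x) * grad g (Inr x) = c x * f x * g x"
proof -
  have "grad f (Inl (x, y)) * grad g (Inl (x, y)) = (sqrt (b x y / 2) * sqrt (b x y / 2)) * ((f x - f y) * (g x - g y))"
    by (simp only: grad_simps mult_ac)
  then show "grad f (Inl (x, y)) * grad g (Inl (x, y)) = b x y * (f x - f y) * (g x - g y) / 2" by simp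
  have "grad f (Inr x) * grad g (Inr x) = (sqrt (c x) * sqrt (c x)) * (f x * g x)"
    by (simp only: grad_simps mult_ac)
  then show "grad f (Inr x) * grad g (Inr x) = c x * f x * g x" by simp
qed

lemma grad_lin: "grad (\<lambda>x. r * f x + s * g x) z = r * grad f z + s * grad g z"
  by (auto simp: grad_def algebra_simps split: sum.split)

lemma energy_space_iff: "f \<in> energy_space b c \<longleftrightarrow> (\<lambda>z. grad f z * grad f z) summable_on UNIV"
  and energy_eq: "f \<in> energy_space b c \<Longrightarrow> enn2real (energy b c f) = Q f f"
proof -
  let ?e1 = "\<lambda>(x, y). b x y * \<bar>f x - f y\<bar>\<^sup>2" and ?e2 = "\<lambda>x. c x * \<bar>f x\<bar>\<^sup>2"
  have nn: "0 \<le> ?e1 z" "0 \<le> ?e2 x" for z x by (auto simp: case_prod_unfold)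
  have E: "energy b c f = (\<Sum>\<^sub>\<infinity>z. ennreal (?e1 z)) / 2 + (\<Sum>\<^sub>\<infinity>x. ennreal (?e2 x))"
    by (simp add: energy_def case_prod_unfold)
  have g1: "(\<lambda>z. grad f (Inl z) * grad f (Inl z)) = (\<lambda>z. ?e1 z * (1 / 2))"
    by (auto simp: fun_eq_iff grad_mult power2_eq_square)
  have g2: "(\<lambda>x. grad f (Inr x) * grad f (Inr x)) = ?e2"
    by (auto simp: fun_eq_iff grad_mult power2_eq_square)
  have semigroup_op: "(\<lambda>z. grad f z * grad f z) summable_on UNIV \<longleftrightarrow> ?e1 summable_on UNIV \<and> ?e2 summable_on UNIV"
    unfolding summable_on_sum_type(1) g1 g2 by (subst summable_on_cmult_left') auto
  have fin: "energy b c f < \<infinity> \<longleftrightarrow> (\<Sum>\<^sub>\<infinity>z. ennreal (?e1 z)) < \<infinity> \<and> (\<Sum>\<^sub>\<infinity>x. ennreal (?e2 x)) < \<infinity>"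
    unfolding E by (auto simp: less_top[symmetric] divide_ennreal_def ennreal_mult_eq_top_iff)
  show iff: "f \<in> energy_space b c \<longleftrightarrow> (\<lambda>z. grad f z * grad f z) summable_on UNIV"
    unfolding energy_space_def mem_Collect_eq fin semigroup_op
    using infsum_ennreal(1)[of ?e1, OF nn(1)] infsum_ennreal(1)[of ?e2, OF nn(2)] by blast
  show "enn2real (energy b c f) = Q f f" if "f \<in> energy_space b c"
  proof -
    have s: "?e1 summable_on UNIV" "?e2 summable_on UNIV" using that iff semigroup_op by auto
    have i0: "0 \<le> infsum ?e1 UNIV" "0 \<le> infsum ?e2 UNIV" by (auto intro!: infsum_nonneg)
    have "energy b c f = ennreal (infsum ?e1 UNIV) / ennreal 2 + ennreal (infsum ?e2 UNIV)"
      unfolding E infsum_ennreal(2)[of ?e1, OF nn(1) s(1)] infsum_ennreal(2)[of ?e2, OF nn(2) s(2)] by simp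
    also have "\<dots> = ennreal (infsum ?e1 UNIV / 2 + infsum ?e2 UNIV)"
      using i0 by (subst divide_ennreal) (simp_all add: ennreal_plus[symmetric] del: ennreal_plus)
    finally have "enn2real (energy b c f) = infsum ?e1 UNIV / 2 + infsum ?e2 UNIV"
      using i0 by (simp del: ennreal_plus)
    also have "\<dots> = Q f f" by (simp add: energy_form_def power2_eq_square mult.assoc)
    finally show ?thesis .
  qed
qed

lemma energy_form_grad:
  assumes "f \<in> energy_space b c" "g \<in> energy_space b c"
  shows "Q f g = (\<Sum>\<^sub>\<infinity>z. grad f z * grad g z)"
proof -
  have "(\<lambda>z. grad f z * grad g z) summable_on UNIV"
    by (rule square_summable_mult) (use assms energy_space_iff in auto)
  note sum = summable_on_sum_type(2)[OF this]
  have "(\<lambda>z. grad f (Inl z) * grad g (Inl z)) = (\<lambda>z. (case z of (x, y) \<Rightarrow> b x y * (f x - f y) * (g x - g y)) * (1/2))"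
    by (auto simp: fun_eq_iff grad_mult)
  then show ?thesis
    unfolding sum grad_mult by (simp only: infsum_cmult_left') (simp add: energy_form_def)
qed

sublocale es: ip_space "energy_space b c" "energy_form b c"
proof -
  have V: "energy_space b c = {f. (\<lambda>z. grad f z * grad f z) summable_on UNIV}" using energy_space_iff by auto
  interpret s: ip_space "energy_space b c" "\<lambda>f g. \<Sum>\<^sub>\<infinity>z. grad f z * grad g z"
    unfolding V by (rule ip_space_sum) (rule grad_lin)
  show "ip_space (energy_space b c) (energy_form b c)"
    by unfold_locales (simp_all add: energy_form_grad s.comb s.B_comb s.B_sym s.B_nonneg)
qed

text \<open>Normal contractions reduce the energy. The instances are the absolute value, for the
  gliding hump, and the cut-off to [0,1], for the Markov property.\<close>

lemma energy_mono:
  assumes f: "f \<in> energy_space b c"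
    and le: "\<And>x y. \<bar>g x - g y\<bar> \<le> \<bar>f x - f y\<bar>" "\<And>x. \<bar>g x\<bar> \<le> \<bar>f x\<bar>"
  shows "g \<in> energy_space b c" "Q g g \<le> Q f f"
proof -
  have "\<bar>grad g z\<bar> \<le> \<bar>grad f z\<bar>" for z
    by (auto simp: grad_def abs_mult intro!: mult_left_mono le split: sum.split)
  then have m: "norm (grad g z * grad g z) \<le> grad f z * grad f z" for z
    by (metis abs_mult_self_eq abs_ge_zero abs_mult mult_mono real_norm_def)
  note d = summable_on_dominated[OF f[unfolded energy_space_iff] m]
  show g: "g \<in> energy_space b c" using d(1) by (simp add: energy_space_iff)
  show "Q g g \<le> Q f f"
    unfolding energy_form_grad[OF g g] energy_form_grad[OF f f] using d(3) by (simp add: abs_le_iff)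
qed

text \<open>Lower semicontinuity of the energy under pointwise convergence. It produces limits in
  the energy space from a pointwise limit and a bound.\<close>

lemma energy_fatou:
  assumes \<phi>: "\<And>n. \<phi> n \<in> energy_space b c" and lim: "\<And>x. (\<lambda>n. \<phi> n x) \<longlonglongrightarrow> f x"
    and le: "eventually (\<lambda>n. es.N (\<phi> n) \<le> K) sequentially" and K: "0 \<le> K"
  shows "f \<in> energy_space b c" "es.N f \<le> K"
proof -
  have gl: "(\<lambda>n. grad (\<phi> n) z * grad (\<phi> n) z) \<longlonglongrightarrow> grad f z * grad f z" for z
    by (cases z) (auto simp: grad_def split: prod.split intro!: tendsto_intros lim)
  have le': "eventually (\<lambda>n. (\<Sum>\<^sub>\<infinity>z. grad (\<phi> n) z * grad (\<phi> n) z) \<le> K\<^sup>2) sequentially"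
    using le
  proof eventually_elim
    case (elim n)
    then have "(es.N (\<phi> n))\<^sup>2 \<le> K\<^sup>2" using es.N_nonneg[OF \<phi>] by (intro power_mono) auto
    then show ?case by (simp add: es.N_sq[OF \<phi>] energy_form_grad[OF \<phi> \<phi>])
  qed
  note F = summable_on_fatou[of UNIV "\<lambda>n z. grad (\<phi> n) z * grad (\<phi> n) z", OF _ _ le' gl]
  have s: "(\<lambda>z. grad (\<phi> n) z * grad (\<phi> n) z) summable_on UNIV" for n using \<phi> energy_space_iff by blast
  show f: "f \<in> energy_space b c" unfolding energy_space_iff by (rule F(1)) (use s in auto)
  have "Q f f \<le> K\<^sup>2" unfolding energy_form_grad[OF f f] by (rule F(2)) (use s in auto)
  then show "es.N f \<le> K" using K by (simp add: es.N_def real_le_lsqrt)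
qed

section \<open>From uniform transience to a bound of the supremum by the energy\<close>

lemma edge_bound:
  assumes f: "f \<in> energy_space b c" and xy: "0 < b x y"
  shows "\<bar>f x - f y\<bar> \<le> sqrt (1 / b x y) * es.N f"
proof -
  have ne: "x \<noteq> y" using xy by auto
  \<comment> \<open>The two orientations of the edge contribute one half each.\<close>
  have "(\<Sum>z\<in>{Inl (x, y), Inl (y, x)}. grad f z * grad f z) \<le> Q f f"
    unfolding energy_form_grad[OF f f]
    by (rule finite_sum_le_infsum) (use f in \<open>auto simp: energy_space_iff\<close>)
  also have "(\<Sum>z\<in>{Inl (x, y), Inl (y, x)}. grad f z * grad f z) = b x y * (f x - f y)\<^sup>2"
    using ne by (simp add: grad_mult b_sym[of y x] power2_eq_square algebra_simps)
  finally have "(f x - f y)\<^sup>2 \<le> 1 / b x y * Q f f" using xy by (simp add: field_simps)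
  from real_sqrt_le_mono[OF this] show ?thesis unfolding real_sqrt_mult real_sqrt_abs es.N_def .
qed

text \<open>Differences along the edges of a path add up, so the constant depends on the chosen path
  but not on f. Connectedness enters here.\<close>

lemma path_bound:
  assumes conn: "graph_connected b"
  shows "\<exists>K\<ge>0. \<forall>f\<in>energy_space b c. \<bar>f x - f y\<bar> \<le> K * es.N f"
proof -
  have "(\<lambda>u v. 0 < b u v)\<^sup>*\<^sup>* x y" using conn by (simp add: graph_connected_def)
  then show ?thesis
  proof (induction rule: rtranclp_induct)
    case base
    then show ?case by (intro exI[of _ 0]) simp
  next
    case (step u v)
    then obtain K where K: "0 \<le> K" "\<And>f. f \<in> energy_space b c \<Longrightarrow> \<bar>f x - f u\<bar> \<le> K * es.N f" by blast
    have "\<bar>f x - f v\<bar> \<le> (K + sqrt (1 / b u v)) * es.N f" if "f \<in> energy_space b c" for f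
      using K(2)[OF that] edge_bound[OF that step(2)] by (simp add: distrib_right)
    moreover have "0 \<le> K + sqrt (1 / b u v)" using K(1) by simp
    ultimately show ?case by blast
  qed
qed

lemma indicator_energy: "(\<lambda>x. if x = y then 1 else 0) \<in> energy_space b c"
proof -
  let ?f = "\<lambda>x. if x = y then 1 else (0::real)"
  have s1: "(\<lambda>(u, v). if u = y then b u v else 0) summable_on UNIV"
  proof -
    have "(\<lambda>(u, v). b u v) summable_on (Pair y ` UNIV)"
      using b_summable[of y] by (subst summable_on_reindex) (auto simp: inj_on_def comp_def)
    then show ?thesis by (rule summable_on_cong_neutral[THEN iffD1, rotated -1]) auto
  qed
  have s2: "(\<lambda>(u, v). if v = y then b u v else 0) summable_on UNIV"
  proof -
    have "(\<lambda>(u, v). b u v) summable_on ((\<lambda>u. (u, y)) ` UNIV)"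
      using b_summable[of y] by (subst summable_on_reindex) (auto simp: inj_on_def comp_def b_sym[of _ y])
    then show ?thesis by (rule summable_on_cong_neutral[THEN iffD1, rotated -1]) auto
  qed
  have "(\<lambda>z. grad ?f (Inl z) * grad ?f (Inl z)) summable_on UNIV"
  proof (rule summable_on_dominated(1)[OF summable_on_add[OF s1 s2]])
    fix z :: "'a \<times> 'a"
    obtain u v where z: "z = (u, v)" by (cases z)
    show "norm (grad ?f (Inl z) * grad ?f (Inl z)) \<le>
        (case z of (u, v) \<Rightarrow> if u = y then b u v else 0) + (case z of (u, v) \<Rightarrow> if v = y then b u v else 0)"
      unfolding z grad_mult by auto
  qed
  moreover have "(\<lambda>x. grad ?f (Inr x) * grad ?f (Inr x)) summable_on UNIV"
    by (rule finite_nonzero_values_imp_summable_on) (rule finite_subset[of _ "{y}"], auto simp: grad_simps)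
  ultimately show ?thesis unfolding energy_space_iff summable_on_sum_type(1) by blast
qed

lemma C_c_comb: "f \<in> C_c \<Longrightarrow> g \<in> C_c \<Longrightarrow> (\<lambda>x. r * f x + s * g x) \<in> C_c"
  by (auto simp: C_c_def intro: finite_subset[of _ "{x. f x \<noteq> 0} \<union> {x. g x \<noteq> 0}"])

lemma C_c_zero: "(\<lambda>x. 0) \<in> C_c"
  by (simp add: C_c_def)

lemma C_c_energy: "C_c \<subseteq> energy_space b c"
proof
  fix \<phi> :: "'a \<Rightarrow> real" assume "\<phi> \<in> C_c"
  then have F: "finite {x. \<phi> x \<noteq> 0}" by (simp add: C_c_def)
  have z: "(\<lambda>x. 0) \<in> energy_space b c" using es.cmult[OF indicator_energy, of 0] by simp
  have "(\<lambda>x. \<Sum>y\<in>F. \<phi> y * (if x = y then 1 else 0)) \<in> energy_space b c" if "finite F" for F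
    using that
  proof (induction F)
    case (insert y F)
    then show ?case using es.comb[OF indicator_energy insert(3), of "\<phi> y" y 1] by simp
  qed (use z in simp)
  from this[OF F] show "\<phi> \<in> energy_space b c"
    by (rule back_subst[of "\<lambda>f. f \<in> energy_space b c"])
      (use F in \<open>auto simp: fun_eq_iff if_distrib[where f = "\<lambda>t. _ * t"] cong: if_cong\<close>)
qed

lemma energy_N: "f \<in> energy_space b c \<Longrightarrow> sqrt (enn2real (energy b c f)) = es.N f"
  by (simp add: es.N_def energy_eq)

lemma energy_space_0I:
  assumes f: "f \<in> energy_space b c" and \<phi>: "\<And>n. \<phi> n \<in> C_c"
    and 1: "(\<lambda>n. es.N (\<lambda>x. f x - \<phi> n x)) \<longlonglongrightarrow> 0" and 2: "(\<lambda>n. f r - \<phi> n r) \<longlonglongrightarrow> 0"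
  shows "f \<in> energy_space_0 b c r"
  unfolding energy_space_0_def closure_wrt_def
proof (intro CollectI conjI allI impI f)
  fix \<epsilon> :: real assume \<epsilon>: "0 < \<epsilon>"
  have d: "(\<lambda>x. f x - \<phi> n x) \<in> energy_space b c" for n
    by (rule es.diff[OF f subsetD[OF C_c_energy \<phi>]])
  have "(\<lambda>n. sqrt ((es.N (\<lambda>x. f x - \<phi> n x))\<^sup>2 + \<bar>f r - \<phi> n r\<bar>\<^sup>2)) \<longlonglongrightarrow> sqrt (0\<^sup>2 + \<bar>0\<bar>\<^sup>2)"
    by (intro tendsto_intros 1 2)
  moreover have "energy_norm_at b c r (\<lambda>x. f x - \<phi> n x) = sqrt ((es.N (\<lambda>x. f x - \<phi> n x))\<^sup>2 + \<bar>f r - \<phi> n r\<bar>\<^sup>2)" for n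
    by (simp add: energy_norm_at_def energy_eq[OF d] es.N_sq[OF d])
  ultimately have "(\<lambda>n. energy_norm_at b c r (\<lambda>x. f x - \<phi> n x)) \<longlonglongrightarrow> 0" by simp
  then have "eventually (\<lambda>n. energy_norm_at b c r (\<lambda>x. f x - \<phi> n x) < \<epsilon>) sequentially"
    using \<epsilon> by (rule order_tendstoD)
  then show "\<exists>\<psi>\<in>C_c. energy_norm_at b c r (\<lambda>x. f x - \<psi> x) < \<epsilon>"
    using \<phi> by (auto simp: eventually_sequentially)
qed

lemma C_0_small:
  assumes "f \<in> C_0" "infinite (UNIV :: 'a set)"
  shows "f \<noteq> (\<lambda>x::'a. 1)"
proof
  assume f: "f = (\<lambda>x. 1)"
  obtain \<phi> where \<phi>: "\<phi> \<in> C_c" "sup_norm (\<lambda>x. f x - \<phi> x) < 1"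
    using assms(1) by (auto simp: C_0_def closure_wrt_def dest: spec[of _ 1])
  have fin: "finite {x. \<phi> x \<noteq> 0}" using \<phi>(1) by (simp add: C_c_def)
  then obtain x where x: "\<phi> x = 0" using assms(2) ex_new_if_finite by (metis (mono_tags) mem_Collect_eq)
  have "finite (range (\<lambda>x. f x - \<phi> x))"
    by (rule finite_subset[of _ "insert 1 ((\<lambda>x. f x - \<phi> x) ` {x. \<phi> x \<noteq> 0})"]) (use fin f in auto)
  then have "(\<lambda>x. f x - \<phi> x) \<in> linf" by (simp add: linf_def finite_imp_bounded)
  from sup_norm_ge[OF this, of x] show False using \<phi>(2) x f by simp
qed

text \<open>Otherwise finitely supported functions with value 1 at r have energies tending to 0. By
  connectedness they converge pointwise to 1, so the constant 1 belongs to
  \<open>energy_space_0\<close>; but on an infinite vertex set it is not in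
  \<open>C_0\<close>.\<close>

lemma point_bound:
  assumes conn: "graph_connected b" and inf: "infinite (UNIV :: 'a set)" and D0: "energy_space_0 b c r \<subseteq> C_0"
  shows "\<exists>K. \<forall>\<phi>\<in>C_c. \<bar>\<phi> r\<bar> \<le> K * es.N \<phi>"
proof (rule ccontr)
  assume "\<not> ?thesis"
  then have "\<exists>\<phi>\<in>C_c. real n * es.N \<phi> < \<bar>\<phi> r\<bar>" for n by (meson not_le)
  then obtain \<phi> where \<phi>: "\<And>n. \<phi> n \<in> C_c" "\<And>n. real n * es.N (\<phi> n) < \<bar>\<phi> n r\<bar>" by metis
  have \<phi>e: "\<phi> n \<in> energy_space b c" for n using \<phi> C_c_energy by auto
  have nz: "\<phi> n r \<noteq> 0" for n using le_less_trans[OF mult_nonneg_nonneg[OF of_nat_0_le_iff es.N_nonneg[OF \<phi>e]] \<phi>(2)[of n]] by simp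
  define \<psi> where "\<psi> n x = 1 / \<phi> (Suc n) r * \<phi> (Suc n) x" for n x
  have \<psi>c: "\<psi> n \<in> C_c" for n using C_c_comb[OF \<phi>(1) \<phi>(1), of "1 / \<phi> (Suc n) r" "Suc n" 0] by (simp add: \<psi>_def[abs_def])
  have \<psi>e: "\<psi> n \<in> energy_space b c" for n using \<psi>c C_c_energy by auto
  have \<psi>r: "\<psi> n r = 1" for n using nz by (simp add: \<psi>_def)
  have \<psi>N: "es.N (\<psi> n) \<le> 1 / real (Suc n)" for n
  proof -
    have "es.N (\<psi> n) = \<bar>1 / \<phi> (Suc n) r\<bar> * es.N (\<phi> (Suc n))"
      unfolding \<psi>_def[abs_def] by (rule es.N_cmult[OF \<phi>e])
    also have "\<dots> = es.N (\<phi> (Suc n)) / \<bar>\<phi> (Suc n) r\<bar>" by simp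
    also have "\<dots> \<le> 1 / real (Suc n)"
      using less_imp_le[OF \<phi>(2)[of "Suc n"]] nz[of "Suc n"]
      by (simp add: divide_le_eq pos_le_divide_eq mult.commute del: of_nat_Suc)
    finally show ?thesis .
  qed
  have inv: "(\<lambda>n. 1 / real (Suc n)) \<longlonglongrightarrow> 0" using LIMSEQ_inverse_real_of_nat by (simp add: inverse_eq_divide)
  have N0: "(\<lambda>n. es.N (\<psi> n)) \<longlonglongrightarrow> 0"
    by (rule tendsto_sandwich[OF _ _ tendsto_const inv]) (use \<psi>N \<psi>e in auto)
  have pt: "(\<lambda>n. \<psi> n x) \<longlonglongrightarrow> 1" for x
  proof -
    obtain K where K: "\<And>f. f \<in> energy_space b c \<Longrightarrow> \<bar>f x - f r\<bar> \<le> K * es.N f"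
      using path_bound[OF conn] by blast
    have "(\<lambda>n. \<psi> n x - 1) \<longlonglongrightarrow> 0"
    proof (rule Lim_null_comparison)
      show "(\<lambda>n. K * es.N (\<psi> n)) \<longlonglongrightarrow> 0" by (rule tendsto_mult_right_zero[OF N0])
      show "\<forall>\<^sub>F n in sequentially. norm (\<psi> n x - 1) \<le> K * es.N (\<psi> n)"
        using K[OF \<psi>e] \<psi>r by (intro always_eventually) simp
    qed
    then show ?thesis using LIM_zero_iff by blast
  qed
  have one: "(\<lambda>x. 1) \<in> energy_space b c" and small: "es.N (\<lambda>x. 1) \<le> 0 + \<epsilon>" if "0 < \<epsilon>" for \<epsilon>
  proof -
    have ev: "eventually (\<lambda>n. es.N (\<psi> n) \<le> 0 + \<epsilon>) sequentially"
      using order_tendstoD(2)[OF N0 that] by (auto elim: eventually_mono)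
    show "(\<lambda>x. 1) \<in> energy_space b c" "es.N (\<lambda>x. 1) \<le> 0 + \<epsilon>"
      using energy_fatou[OF \<psi>e pt ev] that by auto
  qed
  have "es.N (\<lambda>x. 1) \<le> 0" by (rule field_le_epsilon[OF small])
  have o: "(\<lambda>x. 1) \<in> energy_space b c" by (rule one[of 1]) simp
  have "(\<lambda>x. 1) \<in> energy_space_0 b c r"
  proof (rule energy_space_0I[OF o \<psi>c])
    show "(\<lambda>n. es.N (\<lambda>x. 1 - \<psi> n x)) \<longlonglongrightarrow> 0"
    proof (rule tendsto_sandwich[OF _ _ tendsto_const N0])
      show "\<forall>\<^sub>F n in sequentially. es.N (\<lambda>x. 1 - \<psi> n x) \<le> es.N (\<psi> n)"
        using es.N_diff[OF o \<psi>e] \<open>es.N (\<lambda>x. 1) \<le> 0\<close> by (intro always_eventually allI) (meson add_le_same_cancel2 order_trans)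
      show "\<forall>\<^sub>F n in sequentially. 0 \<le> es.N (\<lambda>x. 1 - \<psi> n x)"
        using es.N_nonneg[OF es.diff[OF o \<psi>e]] by (intro always_eventually allI)
    qed
  qed (simp add: \<psi>r)
  then show False using C_0_small[OF _ inf] D0 by blast
qed

text \<open>A gliding hump argument: nonnegative finitely supported functions whose energies decay
  geometrically while their suprema blow up sum to an unbounded element of \<open>energy_space_0\<close>.\<close>

lemma sup_energy_bound_exists:
  assumes ut: "uniformly_transient b c" and inf: "infinite (UNIV :: 'a set)"
  shows "\<exists>C. sup_energy_bound b c C"
proof (rule ccontr)
  assume no: "\<not> ?thesis"
  obtain r where conn: "graph_connected b" and D0: "energy_space_0 b c r \<subseteq> C_0"
    using ut by (auto simp: uniformly_transient_def)
  obtain K where K: "\<And>\<phi>. \<phi> \<in> C_c \<Longrightarrow> \<bar>\<phi> r\<bar> \<le> K * es.N \<phi>" using point_bound[OF conn inf D0] by blast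
  have pb: "\<exists>K. \<forall>\<phi>\<in>C_c. \<bar>\<phi> x\<bar> \<le> K * es.N \<phi>" for x
  proof -
    obtain K' where K': "\<And>f. f \<in> energy_space b c \<Longrightarrow> \<bar>f x - f r\<bar> \<le> K' * es.N f"
      using path_bound[OF conn] by blast
    have "\<bar>\<phi> x\<bar> \<le> (K' + K) * es.N \<phi>" if "\<phi> \<in> C_c" for \<phi>
    proof -
      have "\<bar>\<phi> x\<bar> \<le> \<bar>\<phi> x - \<phi> r\<bar> + \<bar>\<phi> r\<bar>" by simp
      also have "\<dots> \<le> K' * es.N \<phi> + K * es.N \<phi>" using K'[of \<phi>] K[OF that] that C_c_energy by (intro add_mono) auto
      finally show ?thesis by (simp add: distrib_right)
    qed
    then show ?thesis by blast
  qed
  then obtain Kx where Kx: "\<And>x \<phi>. \<phi> \<in> C_c \<Longrightarrow> \<bar>\<phi> x\<bar> \<le> Kx x * es.N \<phi>" by metis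
  \<comment> \<open>The ratio 4^n leaves room for both effects: a factor 2^n for the decay of the
    energy norm and a factor 2^n for the growth of the peak.\<close>
  have "\<exists>\<phi>\<in>C_c. \<exists>x. 4 ^ n * es.N \<phi> < \<bar>\<phi> x\<bar>" for n :: nat
  proof (rule ccontr)
    assume "\<not> ?thesis"
    then have le: "\<bar>\<phi> x\<bar> \<le> 4 ^ n * es.N \<phi>" if "\<phi> \<in> C_c" for \<phi> x using that by (meson not_le)
    have "sup_norm \<phi> \<le> 4 ^ n * sqrt (enn2real (energy b c \<phi>))" if "\<phi> \<in> C_c" for \<phi>
      using le[OF that] that C_c_energy by (subst energy_N) (auto intro!: sup_norm_le)
    then have "sup_energy_bound b c (4 ^ n)" by (simp add: sup_energy_bound_def)
    then show False using no by blast
  qed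
  then obtain \<phi> \<xi> where \<phi>: "\<And>n::nat. \<phi> n \<in> C_c" "\<And>n. 4 ^ n * es.N (\<phi> n) < \<bar>\<phi> n (\<xi> n)\<bar>" by metis
  have \<phi>e: "\<phi> n \<in> energy_space b c" for n using \<phi> C_c_energy by auto
  \<comment> \<open>With zero energy the pointwise bound would force \<phi>(n) to vanish at its
    peak; positivity permits the rescaling.\<close>
  have Npos: "0 < es.N (\<phi> n)" for n
  proof (rule ccontr)
    assume "\<not> 0 < es.N (\<phi> n)"
    then have "es.N (\<phi> n) = 0" using es.N_nonneg[OF \<phi>e, of n] by simp
    then show False using Kx[OF \<phi>(1), of n "\<xi> n"] \<phi>(2)[of n] by simp
  qed
  define s where "s n = 1 / (2 ^ n * es.N (\<phi> n))" for n
  have s: "0 < s n" for n using Npos by (simp add: s_def)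
  \<comment> \<open>Absolute values rule out cancellation between the humps, so the sum lies above
    each of them, while the energy does not grow.\<close>
  define \<psi> where "\<psi> n x = s n * \<bar>\<phi> n x\<bar>" for n x
  have absc: "(\<lambda>x. \<bar>\<phi> n x\<bar>) \<in> C_c" for n using \<phi>(1)[of n] by (simp add: C_c_def)
  have \<psi>c: "\<psi> n \<in> C_c" for n
    using C_c_comb[OF absc absc, of "s n" n 0] by (simp add: \<psi>_def[abs_def])
  have \<psi>e: "\<psi> n \<in> energy_space b c" for n using \<psi>c C_c_energy by auto
  have \<psi>0: "0 \<le> \<psi> n x" for n x using s[of n] by (simp add: \<psi>_def)
  have \<psi>N: "es.N (\<psi> n) \<le> (1 / 2) ^ n" for n
  proof -
    have le: "Q (\<lambda>x. \<bar>\<phi> n x\<bar>) (\<lambda>x. \<bar>\<phi> n x\<bar>) \<le> Q (\<phi> n) (\<phi> n)"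
      by (rule energy_mono(2)[OF \<phi>e]) auto
    have "es.N (\<psi> n) = \<bar>s n\<bar> * es.N (\<lambda>x. \<bar>\<phi> n x\<bar>)"
      unfolding \<psi>_def[abs_def] by (rule es.N_cmult) (use absc C_c_energy in auto)
    also have "\<dots> \<le> \<bar>s n\<bar> * es.N (\<phi> n)"
      unfolding es.N_def by (intro mult_left_mono real_sqrt_le_mono le) simp
    also have "\<dots> = (1 / 2) ^ n" using Npos[of n] by (simp add: s_def power_divide abs_mult)
    finally show ?thesis .
  qed
  have big: "2 ^ n < \<psi> n (\<xi> n)" for n
  proof -
    have "s n * (4 ^ n * es.N (\<phi> n)) < s n * \<bar>\<phi> n (\<xi> n)\<bar>" by (rule mult_strict_left_mono[OF \<phi>(2) s])
    moreover have "s n * (4 ^ n * es.N (\<phi> n)) = 2 ^ n"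
      using Npos[of n] by (simp add: s_def field_simps power_mult_distrib[symmetric])
    ultimately show ?thesis by (simp add: \<psi>_def)
  qed
  have sm: "summable (\<lambda>n. \<psi> n x)" for x
  proof (rule summable_comparison_test')
    show "summable (\<lambda>n. \<bar>Kx x\<bar> * (1 / 2) ^ n)" by (intro summable_mult summable_geometric) simp
    fix n :: nat
    have "\<bar>\<psi> n x\<bar> \<le> \<bar>Kx x\<bar> * es.N (\<psi> n)"
      by (rule order_trans[OF Kx[OF \<psi>c] mult_right_mono]) (use es.N_nonneg[OF \<psi>e] in auto)
    also have "\<dots> \<le> \<bar>Kx x\<bar> * (1 / 2) ^ n" by (intro mult_left_mono \<psi>N) simp
    finally show "norm (\<psi> n x) \<le> \<bar>Kx x\<bar> * (1 / 2) ^ n" by simp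
  qed
  define f where "f x = (\<Sum>n. \<psi> n x)" for x
  define S where "S k x = (\<Sum>n<k. \<psi> n x)" for k x
  have Sc: "S k \<in> C_c" for k
  proof (induction k)
    case (Suc k)
    then show ?case using C_c_comb[OF Suc \<psi>c, of 1 1] by (simp add: S_def[abs_def])
  qed (simp add: S_def[abs_def] C_c_zero)
  have Se: "S k \<in> energy_space b c" for k using Sc C_c_energy by auto
  have Slim: "(\<lambda>k. S k x) \<longlonglongrightarrow> f x" for x
    unfolding S_def f_def by (rule summable_LIMSEQ[OF sm])
  \<comment> \<open>Stated with the exact geometric difference so that the induction closes; only
    the bound by 2 (1/2)^k is used afterwards.\<close>
  have SN: "es.N (\<lambda>x. S (k + j) x - S k x) \<le> 2 * (1 / 2) ^ k - 2 * (1 / 2) ^ (k + j)" for k j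
  proof (induction j)
    case 0
    have "es.N (\<lambda>x. 0 * S k x) = 0" using es.N_cmult[OF Se, of 0 k] by simp
    then show ?case by simp
  next
    case (Suc j)
    have "es.N (\<lambda>x. S (k + Suc j) x - S k x) = es.N (\<lambda>x. (S (k + j) x - S k x) + \<psi> (k + j) x)"
      by (simp add: S_def algebra_simps)
    also have "\<dots> \<le> es.N (\<lambda>x. S (k + j) x - S k x) + es.N (\<psi> (k + j))"
      by (rule es.N_add[OF es.diff[OF Se Se] \<psi>e])
    also have "\<dots> \<le> 2 * (1 / 2) ^ k - 2 * (1 / 2) ^ (k + j) + (1 / 2) ^ (k + j)"
      by (intro add_mono Suc \<psi>N)
    finally show ?case by simp
  qed
  have tail: "(\<lambda>x. f x - S k x) \<in> energy_space b c \<and> es.N (\<lambda>x. f x - S k x) \<le> 2 * (1 / 2) ^ k" for k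
  proof -
    have le: "es.N (\<lambda>x. S (k + j) x - S k x) \<le> 2 * (1 / 2) ^ k" for j
      by (rule order_trans[OF SN]) simp
    have lim: "(\<lambda>j. S (k + j) x - S k x) \<longlonglongrightarrow> f x - S k x" for x
      using LIMSEQ_ignore_initial_segment[OF Slim, of k x] by (intro tendsto_intros) (simp add: add.commute)
    show ?thesis
      using energy_fatou[OF es.diff[OF Se Se] lim always_eventually[of "\<lambda>j. es.N (\<lambda>x. S (k + j) x - S k x) \<le> 2 * (1 / 2) ^ k"]] le
      by auto
  qed
  have f0: "f \<in> energy_space_0 b c r"
  proof (rule energy_space_0I[OF _ Sc])
    show "f \<in> energy_space b c" using tail[of 0] by (simp add: S_def)
    show "(\<lambda>k. es.N (\<lambda>x. f x - S k x)) \<longlonglongrightarrow> 0"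
    proof (rule tendsto_sandwich[OF _ _ tendsto_const])
      show "(\<lambda>k. 2 * (1 / 2 :: real) ^ k) \<longlonglongrightarrow> 0" by (intro tendsto_mult_right_zero LIMSEQ_realpow_zero) auto
      show "\<forall>\<^sub>F k in sequentially. 0 \<le> es.N (\<lambda>x. f x - S k x)"
        using tail es.N_nonneg by (intro always_eventually allI) blast
    qed (use tail in auto)
    show "(\<lambda>k. f r - S k r) \<longlonglongrightarrow> 0" using tendsto_diff[OF tendsto_const[of "f r"] Slim[of r]] by simp
  qed
  then have "f \<in> linf" using D0 by (auto simp: C_0_def closure_wrt_def)
  then have M: "norm (f x) \<le> sup_norm f" for x by (rule sup_norm_ge)
  obtain n :: nat where n: "sup_norm f < 2 ^ n" using real_arch_pow[of 2 "sup_norm f"] by auto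
  have "\<psi> n (\<xi> n) \<le> f (\<xi> n)"
    unfolding f_def using sum_le_suminf[OF sm, of "{n}"] \<psi>0 by simp
  then show False using M[of "\<xi> n"] big[of n] n by simp
qed

end

section \<open>Pairings and the Hilbert space structure\<close>

context finite_weights
begin

lemma pairing_L1:
  assumes f: "f \<in> L1" and g: "\<And>x. \<bar>g x\<bar> \<le> K"
  shows "(\<lambda>x. f x * g x * m x) summable_on UNIV" "\<bar>pairing m f g\<bar> \<le> n1 f * K"
proof -
  have s: "(\<lambda>x. K * (norm (f x) * m x)) summable_on UNIV"
    using f by (intro summable_on_cmult_right) (simp add: L1_def)
  have "norm (f x * g x * m x) \<le> K * (norm (f x) * m x)" for x
    using mult_right_mono[OF g[of x], of "norm (f x) * m x"] by (simp add: abs_mult mult_ac)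
  note d = summable_on_dominated[OF s this]
  show "(\<lambda>x. f x * g x * m x) summable_on UNIV" by (rule d)
  show "\<bar>pairing m f g\<bar> \<le> n1 f * K"
    using d(3) by (simp add: pairing_def n1_def infsum_cmult_right' mult.commute)
qed

lemma pairing_commute: "pairing m f g = pairing m g f"
  by (simp add: pairing_def mult_ac)

lemma pairing_comb:
  assumes "(\<lambda>x. f x * h x * m x) summable_on UNIV" "(\<lambda>x. g x * h x * m x) summable_on UNIV"
  shows "pairing m (\<lambda>x. r * f x + s * g x) h = r * pairing m f h + s * pairing m g h"
proof -
  have "pairing m (\<lambda>x. r * f x + s * g x) h = (\<Sum>\<^sub>\<infinity>x. r * (f x * h x * m x) + s * (g x * h x * m x))"
    by (simp add: pairing_def algebra_simps)
  also have "\<dots> = r * pairing m f h + s * pairing m g h"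
    using assms by (simp add: infsum_add summable_on_cmult_right infsum_cmult_right' pairing_def)
  finally show ?thesis .
qed

lemma linf_bound: "f \<in> linf \<Longrightarrow> \<bar>f x\<bar> \<le> sup_norm f"
  using sup_norm_ge[of f x] by simp

lemma pairing_L1_comb:
  assumes "f \<in> L1" "g \<in> L1" "h \<in> linf"
  shows "pairing m (\<lambda>x. r * f x + s * g x) h = r * pairing m f h + s * pairing m g h"
  by (intro pairing_comb pairing_L1(1)[OF _ linf_bound] assms)

lemma pairing_linf_comb:
  assumes "f \<in> linf" "g \<in> linf" "h \<in> L1"
  shows "pairing m h (\<lambda>x. r * f x + s * g x) = r * pairing m h f + s * pairing m h g"
proof -
  have "(\<lambda>x. h x * f x * m x) summable_on UNIV" "(\<lambda>x. h x * g x * m x) summable_on UNIV"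
    by (rule pairing_L1(1)[OF assms(3) linf_bound[OF assms(1)]])
      (rule pairing_L1(1)[OF assms(3) linf_bound[OF assms(2)]])
  then have s: "(\<lambda>x. f x * h x * m x) summable_on UNIV" "(\<lambda>x. g x * h x * m x) summable_on UNIV"
    by (simp_all add: mult_ac)
  show ?thesis using pairing_comb[OF s, of r s] by (simp only: pairing_commute[of h])
qed

lemma pairing_indicator: "pairing m h (\<lambda>x. if x = y then 1 else 0) = h y * m y"
proof -
  have "pairing m h (\<lambda>x. if x = y then 1 else 0) = (\<Sum>\<^sub>\<infinity>x\<in>{y}. h x * m x)"
    unfolding pairing_def by (rule infsum_cong_neutral) auto
  then show ?thesis by simp
qed

sublocale l2: ip_space "lp m 2" "pairing m"
proof -
  define d where "d f x = sqrt (m x) * f x" for f :: "'a \<Rightarrow> real" and x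
  have dd: "d f x * d g x = f x * g x * m x" for f g x
  proof -
    have "d f x * d g x = (sqrt (m x) * sqrt (m x)) * (f x * g x)" by (simp only: d_def mult_ac)
    then show ?thesis by simp
  qed
  have V: "lp m 2 = {f. (\<lambda>z. d f z * d f z) summable_on UNIV}"
    unfolding dd using lp2(1) by auto
  have B: "pairing m = (\<lambda>f g. \<Sum>\<^sub>\<infinity>z. d f z * d g z)" by (simp add: fun_eq_iff pairing_def dd)
  show "ip_space (lp m 2) (pairing m)"
    unfolding V B by (rule ip_space_sum) (simp add: d_def algebra_simps)
qed

lemma l2_N: "f \<in> lp m 2 \<Longrightarrow> l2.N f = lp_norm m 2 f"
  using lp2(2)[of f] lp_norm_nonneg[of f 2] by (simp add: l2.N_def real_sqrt_unique)

lemma l2_zero: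
  assumes f: "f \<in> lp m 2" and 0: "pairing m f f = 0"
  shows "f = (\<lambda>x. 0)"
proof
  fix x
  have "lp_norm m 2 f = 0" using lp2(2)[OF f] 0 by simp
  then show "f x = 0" using lp_point[OF one_le_2 f, of x] by simp
qed

lemma L1_l2: "f \<in> lp m 2 \<Longrightarrow> f \<in> L1" "f \<in> lp m 2 \<Longrightarrow> n1 f \<le> (total + 1) * lp_norm m 2 f"
  using lp_L1[OF one_le_2] by auto

end

section \<open>The resolvent of the Dirichlet form\<close>

text \<open>\<open>C\<close> is an arbitrary admissible constant, because the lower bound of the
  spectrum is claimed for each of them.\<close>

locale transient_graph = finite_weights m + graph b c
  for m :: "'a \<Rightarrow> real" and b :: "'a \<Rightarrow> 'a \<Rightarrow> real" and c :: "'a \<Rightarrow> real" +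
  fixes C :: real
  assumes countable_X: "countable (UNIV :: 'a set)" and C_bound: "sup_energy_bound b c C"
begin

abbreviation D :: "('a \<Rightarrow> real) set" where "D \<equiv> dirichlet_form_domain b c m"

lemma C_nonneg: "0 \<le> C"
  using C_bound by (simp add: sup_energy_bound_def)

lemma C_c_sup:
  assumes "\<phi> \<in> C_c" shows "\<bar>\<phi> x\<bar> \<le> C * es.N \<phi>"
proof -
  have "\<bar>\<phi> x\<bar> \<le> sup_norm \<phi>" by (rule linf_bound[OF C_c_linf[OF assms]])
  also have "\<dots> \<le> C * es.N \<phi>"
    using C_bound assms energy_N[OF subsetD[OF C_c_energy assms]] by (auto simp: sup_energy_bound_def)
  finally show ?thesis .
qed

lemma C_c_diff: "f \<in> C_c \<Longrightarrow> g \<in> C_c \<Longrightarrow> (\<lambda>x. f x - g x) \<in> C_c"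
  using C_c_comb[of f g 1 "-1"] by simp

lemma N_tendsto:
  assumes f: "f \<in> energy_space b c" and \<phi>: "\<And>n. \<phi> n \<in> energy_space b c"
    and lim: "(\<lambda>n. es.N (\<lambda>x. f x - \<phi> n x)) \<longlonglongrightarrow> 0"
  shows "(\<lambda>n. es.N (\<phi> n)) \<longlonglongrightarrow> es.N f"
proof -
  have "(\<lambda>n. es.N (\<phi> n) - es.N f) \<longlonglongrightarrow> 0"
  proof (rule Lim_null_comparison[OF always_eventually lim], rule allI)
    fix n
    show "norm (es.N (\<phi> n) - es.N f) \<le> es.N (\<lambda>x. f x - \<phi> n x)"
      using es.N_le_diff[OF f \<phi>, of n] es.N_le_diff[OF \<phi> f, of n] es.N_diff_commute[OF f \<phi>, of n] by simp
  qed
  then show ?thesis by (simp add: LIM_zero_iff)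
qed

lemma limit_sup:
  assumes f: "f \<in> energy_space b c" and \<phi>: "\<And>n. \<phi> n \<in> C_c"
    and lim: "(\<lambda>n. es.N (\<lambda>x. f x - \<phi> n x)) \<longlonglongrightarrow> 0" and pt: "(\<lambda>n. \<phi> n x) \<longlonglongrightarrow> f x"
  shows "\<bar>f x\<bar> \<le> C * es.N f"
proof (rule LIMSEQ_le)
  show "(\<lambda>n. \<bar>\<phi> n x\<bar>) \<longlonglongrightarrow> \<bar>f x\<bar>" by (intro tendsto_intros pt)
  show "(\<lambda>n. C * es.N (\<phi> n)) \<longlonglongrightarrow> C * es.N f"
    by (intro tendsto_mult_left N_tendsto f lim) (use \<phi> C_c_energy in auto)
qed (use C_c_sup[OF \<phi>] in auto)

text \<open>The Hilbert space part of the form norm comes for free: the energy bounds the supremum,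
  and the weight is finite. The description on the right no longer mentions m.\<close>

lemma D_iff:
  "f \<in> D \<longleftrightarrow> f \<in> energy_space b c \<and>
    (\<exists>\<phi>. (\<forall>n. \<phi> n \<in> C_c) \<and> (\<lambda>n. es.N (\<lambda>x. f x - \<phi> n x)) \<longlonglongrightarrow> 0 \<and> (\<forall>x. (\<lambda>n. \<phi> n x) \<longlonglongrightarrow> f x))"
proof
  assume "f \<in> D"
  then have f: "f \<in> energy_space b c" "f \<in> lp m 2"
    and ap: "\<And>\<epsilon>. 0 < \<epsilon> \<Longrightarrow> \<exists>\<phi>\<in>C_c. form_norm b c m (\<lambda>x. f x - \<phi> x) < \<epsilon>"
    by (auto simp: dirichlet_form_domain_def closure_wrt_def)
  have "\<exists>\<phi>\<in>C_c. form_norm b c m (\<lambda>x. f x - \<phi> x) < 1 / real (Suc n)" for n by (rule ap) simp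
  then obtain \<phi> where \<phi>: "\<And>n. \<phi> n \<in> C_c" "\<And>n. form_norm b c m (\<lambda>x. f x - \<phi> n x) < 1 / real (Suc n)" by metis
  have de: "(\<lambda>x. f x - \<phi> n x) \<in> energy_space b c" for n by (rule es.diff[OF f(1) subsetD[OF C_c_energy \<phi>(1)]])
  have dl: "(\<lambda>x. f x - \<phi> n x) \<in> lp m 2" for n by (rule lp_diff(1)[OF one_le_2 f(2) C_c_lp[OF one_le_2 \<phi>(1)]])
  have inv: "(\<lambda>n. 1 / real (Suc n)) \<longlonglongrightarrow> 0" using LIMSEQ_inverse_real_of_nat by (simp add: inverse_eq_divide)
  have le: "es.N (\<lambda>x. f x - \<phi> n x) \<le> 1 / real (Suc n)" "lp_norm m 2 (\<lambda>x. f x - \<phi> n x) \<le> 1 / real (Suc n)" for n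
  proof -
    have F: "form_norm b c m (\<lambda>x. f x - \<phi> n x) = sqrt ((es.N (\<lambda>x. f x - \<phi> n x))\<^sup>2 + (lp_norm m 2 (\<lambda>x. f x - \<phi> n x))\<^sup>2)"
      by (simp add: form_norm_def energy_eq[OF de] es.N_sq[OF de])
    show "es.N (\<lambda>x. f x - \<phi> n x) \<le> 1 / real (Suc n)"
      by (rule order_trans[OF _ less_imp_le[OF \<phi>(2)[of n]]]) (simp add: F real_le_rsqrt)
    show "lp_norm m 2 (\<lambda>x. f x - \<phi> n x) \<le> 1 / real (Suc n)"
      by (rule order_trans[OF _ less_imp_le[OF \<phi>(2)[of n]]]) (simp add: F real_le_rsqrt)
  qed
  have "(\<lambda>n. es.N (\<lambda>x. f x - \<phi> n x)) \<longlonglongrightarrow> 0"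
    by (rule tendsto_sandwich[OF _ _ tendsto_const inv]) (use le de in auto)
  moreover have "(\<lambda>n. \<phi> n x) \<longlonglongrightarrow> f x" for x
  proof -
    have "(\<lambda>n. \<phi> n x - f x) \<longlonglongrightarrow> 0"
    proof (rule Lim_null_comparison[OF always_eventually], rule allI)
      show "(\<lambda>n. (total + 1) / m x * (1 / real (Suc n))) \<longlonglongrightarrow> 0" by (rule tendsto_mult_right_zero[OF inv])
      fix n
      have "norm (f x - \<phi> n x) \<le> (total + 1) / m x * lp_norm m 2 (\<lambda>x. f x - \<phi> n x)"
        by (rule lp_point[OF one_le_2 dl])
      also have "\<dots> \<le> (total + 1) / m x * (1 / real (Suc n))" by (intro mult_left_mono le) simp
      finally show "norm (\<phi> n x - f x) \<le> (total + 1) / m x * (1 / real (Suc n))" by (simp add: abs_minus_commute)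
    qed
    then show ?thesis by (simp add: LIM_zero_iff)
  qed
  ultimately show "f \<in> energy_space b c \<and>
    (\<exists>\<phi>. (\<forall>n. \<phi> n \<in> C_c) \<and> (\<lambda>n. es.N (\<lambda>x. f x - \<phi> n x)) \<longlonglongrightarrow> 0 \<and> (\<forall>x. (\<lambda>n. \<phi> n x) \<longlonglongrightarrow> f x))"
    using f \<phi>(1) by blast
next
  assume "f \<in> energy_space b c \<and>
    (\<exists>\<phi>. (\<forall>n. \<phi> n \<in> C_c) \<and> (\<lambda>n. es.N (\<lambda>x. f x - \<phi> n x)) \<longlonglongrightarrow> 0 \<and> (\<forall>x. (\<lambda>n. \<phi> n x) \<longlonglongrightarrow> f x))"
  then obtain \<phi> where f: "f \<in> energy_space b c" and \<phi>: "\<And>n. \<phi> n \<in> C_c"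
    and lim: "(\<lambda>n. es.N (\<lambda>x. f x - \<phi> n x)) \<longlonglongrightarrow> 0" and pt: "\<And>x. (\<lambda>n. \<phi> n x) \<longlonglongrightarrow> f x" by blast
  have de: "(\<lambda>x. f x - \<phi> n x) \<in> energy_space b c" for n by (rule es.diff[OF f subsetD[OF C_c_energy \<phi>]])
  \<comment> \<open>For fixed k the functions \<phi>(n) - \<phi>(k) are finitely supported
    approximations of f - \<phi>(k).\<close>
  have sup: "\<bar>f x - \<phi> k x\<bar> \<le> C * es.N (\<lambda>x. f x - \<phi> k x)" for x k
    by (rule limit_sup[where \<phi> = "\<lambda>n x. \<phi> n x - \<phi> k x"])
      (use de lim in \<open>auto intro!: C_c_diff \<phi> tendsto_intros pt\<close>)
  have dl: "(\<lambda>x. f x - \<phi> n x) \<in> lp m 2" "lp_norm m 2 (\<lambda>x. f x - \<phi> n x) \<le> (total + 1) * (C * es.N (\<lambda>x. f x - \<phi> n x))" for n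
    using bounded_lp[OF one_le_2, of "\<lambda>x. f x - \<phi> n x" "C * es.N (\<lambda>x. f x - \<phi> n x)"] sup by auto
  have fl: "f \<in> lp m 2" using lp_add(1)[OF one_le_2 dl(1) C_c_lp[OF one_le_2 \<phi>], of 0 0] by simp
  have llim: "(\<lambda>n. lp_norm m 2 (\<lambda>x. f x - \<phi> n x)) \<longlonglongrightarrow> 0"
  proof (rule tendsto_sandwich[OF _ _ tendsto_const])
    show "(\<lambda>n. (total + 1) * (C * es.N (\<lambda>x. f x - \<phi> n x))) \<longlonglongrightarrow> 0"
      by (intro tendsto_mult_right_zero lim)
  qed (use dl lp_norm_nonneg[OF dl(1)] in auto)
  have "(\<lambda>n. sqrt ((es.N (\<lambda>x. f x - \<phi> n x))\<^sup>2 + (lp_norm m 2 (\<lambda>x. f x - \<phi> n x))\<^sup>2)) \<longlonglongrightarrow> sqrt (0\<^sup>2 + 0\<^sup>2)"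
    by (intro tendsto_intros lim llim)
  then have F: "(\<lambda>n. form_norm b c m (\<lambda>x. f x - \<phi> n x)) \<longlonglongrightarrow> 0"
    by (simp add: form_norm_def energy_eq[OF de] es.N_sq[OF de])
  show "f \<in> D"
    unfolding dirichlet_form_domain_def closure_wrt_def
  proof (intro CollectI conjI IntI allI impI f fl)
    fix \<epsilon> :: real assume "0 < \<epsilon>"
    with F have "eventually (\<lambda>n. form_norm b c m (\<lambda>x. f x - \<phi> n x) < \<epsilon>) sequentially" by (rule order_tendstoD)
    then show "\<exists>\<phi>\<in>C_c. form_norm b c m (\<lambda>x. f x - \<phi> x) < \<epsilon>"
      using \<phi> by (auto simp: eventually_sequentially)
  qed
qed

lemma D_energy: "f \<in> D \<Longrightarrow> f \<in> energy_space b c"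
  using D_iff by blast

lemma D_sup: "f \<in> D \<Longrightarrow> \<bar>f x\<bar> \<le> C * es.N f"
  using D_iff[of f] limit_sup[of f _ x] by blast

lemma D_linf: "f \<in> D \<Longrightarrow> f \<in> linf"
  by (rule linfI[of _ "C * es.N f"]) (simp add: D_sup)

lemma D_L1: "f \<in> D \<Longrightarrow> f \<in> L1"
  by (rule linf_L1[OF D_linf])

lemma D_l2: "f \<in> D \<Longrightarrow> f \<in> lp m 2"
  by (rule linf_lp[OF one_le_2 D_linf])

lemma C_c_D: "C_c \<subseteq> D"
proof
  fix \<phi> :: "'a \<Rightarrow> real" assume \<phi>: "\<phi> \<in> C_c"
  have "es.N (\<lambda>x. \<phi> x - \<phi> x) = 0" using es.N_cmult[of \<phi> 0] \<phi> C_c_energy by auto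
  then show "\<phi> \<in> D" unfolding D_iff using \<phi> C_c_energy by (auto intro!: exI[of _ "\<lambda>n. \<phi>"])
qed

lemma D_comb:
  assumes "f \<in> D" "g \<in> D" shows "(\<lambda>x. r * f x + s * g x) \<in> D"
proof -
  obtain \<phi> where f: "f \<in> energy_space b c" and \<phi>: "\<And>n. \<phi> n \<in> C_c"
    and fl: "(\<lambda>n. es.N (\<lambda>x. f x - \<phi> n x)) \<longlonglongrightarrow> 0" and fp: "\<And>x. (\<lambda>n. \<phi> n x) \<longlonglongrightarrow> f x"
    using assms(1) D_iff by blast
  obtain \<psi> where g: "g \<in> energy_space b c" and \<psi>: "\<And>n. \<psi> n \<in> C_c"
    and gl: "(\<lambda>n. es.N (\<lambda>x. g x - \<psi> n x)) \<longlonglongrightarrow> 0" and gp: "\<And>x. (\<lambda>n. \<psi> n x) \<longlonglongrightarrow> g x"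
    using assms(2) D_iff by blast
  have df: "(\<lambda>x. f x - \<phi> n x) \<in> energy_space b c" and dg: "(\<lambda>x. g x - \<psi> n x) \<in> energy_space b c" for n
    by (intro es.diff f g subsetD[OF C_c_energy] \<phi> \<psi>)+
  have eq: "(\<lambda>x. (r * f x + s * g x) - (r * \<phi> n x + s * \<psi> n x)) = (\<lambda>x. r * (f x - \<phi> n x) + s * (g x - \<psi> n x))" for n
    by (simp add: algebra_simps)
  have "(\<lambda>n. es.N (\<lambda>x. (r * f x + s * g x) - (r * \<phi> n x + s * \<psi> n x))) \<longlonglongrightarrow> 0"
    unfolding eq
  proof (rule tendsto_sandwich[OF _ _ tendsto_const])
    have "(\<lambda>n. \<bar>r\<bar> * es.N (\<lambda>x. f x - \<phi> n x) + \<bar>s\<bar> * es.N (\<lambda>x. g x - \<psi> n x)) \<longlonglongrightarrow> \<bar>r\<bar> * 0 + \<bar>s\<bar> * 0"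
      by (intro tendsto_intros fl gl)
    then show "(\<lambda>n. \<bar>r\<bar> * es.N (\<lambda>x. f x - \<phi> n x) + \<bar>s\<bar> * es.N (\<lambda>x. g x - \<psi> n x)) \<longlonglongrightarrow> 0" by simp
    show "\<forall>\<^sub>F n in sequentially. 0 \<le> es.N (\<lambda>x. r * (f x - \<phi> n x) + s * (g x - \<psi> n x))"
      by (intro always_eventually allI es.N_nonneg es.comb df dg)
  qed (intro always_eventually allI es.N_comb df dg)
  moreover have "(\<lambda>n. r * \<phi> n x + s * \<psi> n x) \<longlonglongrightarrow> r * f x + s * g x" for x by (intro tendsto_intros fp gp)
  ultimately show ?thesis
    unfolding D_iff using es.comb[OF f g] C_c_comb[OF \<phi> \<psi>]
    by (intro conjI exI[of _ "\<lambda>n x. r * \<phi> n x + s * \<psi> n x"]) auto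
qed

text \<open>The parameter \<alpha> = 0 is included: by \<open>pairing_le_energy\<close> the energy
  alone is coercive, which makes L invertible with inverse the Green operator.\<close>

definition form :: "real \<Rightarrow> ('a \<Rightarrow> real) \<Rightarrow> ('a \<Rightarrow> real) \<Rightarrow> real" where
  "form \<alpha> f g = Q f g + \<alpha> * pairing m f g"

lemma ip_form: "0 \<le> \<alpha> \<Longrightarrow> ip_space D (form \<alpha>)"
proof
  assume \<alpha>: "0 \<le> \<alpha>"
  show "(\<lambda>x. r * f x + s * g x) \<in> D" if "f \<in> D" "g \<in> D" for f g r s by (rule D_comb[OF that])
  show "form \<alpha> (\<lambda>x. r * f x + s * g x) h = r * form \<alpha> f h + s * form \<alpha> g h" if "f \<in> D" "g \<in> D" "h \<in> D" for f g h r s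
    using that by (simp add: form_def es.B_comb D_energy l2.B_comb D_l2 algebra_simps)
  show "form \<alpha> f g = form \<alpha> g f" if "f \<in> D" "g \<in> D" for f g
    using that by (simp add: form_def es.B_sym[of f g] D_energy l2.B_sym[of f g] D_l2)
  show "0 \<le> form \<alpha> f f" if "f \<in> D" for f
    using that \<alpha> by (simp add: form_def es.B_nonneg D_energy l2.B_nonneg D_l2)
qed

lemma pairing_le_energy: "f \<in> D \<Longrightarrow> pairing m f f \<le> total * C\<^sup>2 * Q f f"
proof -
  assume f: "f \<in> D"
  have "\<bar>pairing m f f\<bar> \<le> n1 f * (C * es.N f)" by (rule pairing_L1(2)[OF D_L1[OF f] D_sup[OF f]])
  also have "\<dots> \<le> ((C * es.N f) * total) * (C * es.N f)"
    using bounded_L1(2)[of f "C * es.N f"] D_sup[OF f] C_nonneg es.N_nonneg[OF D_energy[OF f]]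
    by (intro mult_right_mono) auto
  also have "\<dots> = total * C\<^sup>2 * (es.N f)\<^sup>2" by (simp add: power2_eq_square)
  finally show ?thesis by (simp add: es.N_sq D_energy[OF f])
qed

text \<open>The supremum bound provides the pointwise limit; \<open>energy_fatou\<close>, applied to
  w(j) - w(i) for fixed i, shows that the convergence also holds in energy.\<close>

lemma D_complete:
  assumes w: "\<And>n :: nat. w n \<in> C_c"
    and cau: "\<And>\<epsilon>. 0 < \<epsilon> \<Longrightarrow> \<exists>M. \<forall>i\<ge>M. \<forall>j\<ge>M. es.N (\<lambda>x. w i x - w j x) < \<epsilon>"
  shows "\<exists>v\<in>D. (\<lambda>n. es.N (\<lambda>x. v x - w n x)) \<longlonglongrightarrow> 0"
proof -
  have we: "w n \<in> energy_space b c" for n using w C_c_energy by auto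
  have cauchy: "Cauchy (\<lambda>n. w n x)" for x
  proof (rule metric_CauchyI)
    fix \<epsilon> :: real assume \<epsilon>: "0 < \<epsilon>"
    obtain M where M: "\<And>i j. i \<ge> M \<Longrightarrow> j \<ge> M \<Longrightarrow> es.N (\<lambda>x. w i x - w j x) < \<epsilon> / (C + 1)"
      using cau[of "\<epsilon> / (C + 1)"] \<epsilon> C_nonneg by auto
    have "dist (w i x) (w j x) < \<epsilon>" if "i \<ge> M" "j \<ge> M" for i j
    proof -
      have "\<bar>w i x - w j x\<bar> \<le> C * es.N (\<lambda>x. w i x - w j x)" by (rule C_c_sup[OF C_c_diff[OF w w]])
      also have "\<dots> \<le> C * (\<epsilon> / (C + 1))" by (intro mult_left_mono less_imp_le[OF M[OF that]] C_nonneg)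
      also have "\<dots> < \<epsilon>" using \<epsilon> C_nonneg by (simp add: field_simps)
      finally show ?thesis by (simp add: dist_real_def)
    qed
    then show "\<exists>M. \<forall>i\<ge>M. \<forall>j\<ge>M. dist (w i x) (w j x) < \<epsilon>" by blast
  qed
  have "\<forall>x. \<exists>l. (\<lambda>n. w n x) \<longlonglongrightarrow> l"
    using Cauchy_convergent[OF cauchy] unfolding convergent_def by blast
  then obtain v where v: "\<And>x. (\<lambda>n. w n x) \<longlonglongrightarrow> v x" by metis
  have tail: "(\<lambda>x. v x - w i x) \<in> energy_space b c \<and> es.N (\<lambda>x. v x - w i x) \<le> \<epsilon>"
    if \<epsilon>: "0 < \<epsilon>" and M: "\<forall>i\<ge>M. \<forall>j\<ge>M. es.N (\<lambda>x. w i x - w j x) < \<epsilon>" and i: "i \<ge> M" for \<epsilon> M i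
  proof -
    have lim: "(\<lambda>j. w j x - w i x) \<longlonglongrightarrow> v x - w i x" for x by (intro tendsto_intros v)
    have ev: "eventually (\<lambda>j. es.N (\<lambda>x. w j x - w i x) \<le> \<epsilon>) sequentially"
      using M i by (auto simp: eventually_sequentially intro!: exI[of _ M] less_imp_le)
    show ?thesis using energy_fatou[OF es.diff[OF we we] lim ev less_imp_le[OF \<epsilon>]] by blast
  qed
  have ve: "v \<in> energy_space b c"
  proof -
    obtain M where "\<forall>i\<ge>M. \<forall>j\<ge>M. es.N (\<lambda>x. w i x - w j x) < 1" using cau[of 1] by auto
    from tail[OF _ this] have "(\<lambda>x. v x - w M x) \<in> energy_space b c" by simp
    from es.comb[OF this we, of 1 1 M] show ?thesis by simp
  qed
  have lim: "(\<lambda>n. es.N (\<lambda>x. v x - w n x)) \<longlonglongrightarrow> 0"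
  proof (rule LIMSEQ_I)
    fix \<epsilon> :: real assume \<epsilon>: "0 < \<epsilon>"
    obtain M where M: "\<forall>i\<ge>M. \<forall>j\<ge>M. es.N (\<lambda>x. w i x - w j x) < \<epsilon> / 2" using cau[of "\<epsilon> / 2"] \<epsilon> by auto
    have "norm (es.N (\<lambda>x. v x - w i x) - 0) < \<epsilon>" if "i \<ge> M" for i
      using tail[OF _ M that] \<epsilon> es.N_nonneg[OF es.diff[OF ve we], of i] by auto
    then show "\<exists>M. \<forall>i\<ge>M. norm (es.N (\<lambda>x. v x - w i x) - 0) < \<epsilon>" by blast
  qed
  then have "v \<in> D" unfolding D_iff using ve w v by blast
  then show ?thesis using lim by blast
qed

lemma form_N:
  assumes \<alpha>: "0 \<le> \<alpha>" and f: "f \<in> D"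
  shows "es.N f \<le> ip_space.N (form \<alpha>) f" "ip_space.N (form \<alpha>) f \<le> sqrt (1 + \<alpha> * (total * C\<^sup>2)) * es.N f"
proof -
  interpret F: ip_space D "form \<alpha>" by (rule ip_form[OF \<alpha>])
  have "Q f f \<le> form \<alpha> f f" using \<alpha> l2.B_nonneg[OF D_l2[OF f]] by (simp add: form_def)
  then show "es.N f \<le> F.N f" unfolding es.N_def F.N_def by (rule real_sqrt_le_mono)
  have "form \<alpha> f f \<le> (1 + \<alpha> * (total * C\<^sup>2)) * Q f f"
    using mult_left_mono[OF pairing_le_energy[OF f] \<alpha>] by (simp add: form_def algebra_simps)
  from real_sqrt_le_mono[OF this] show "F.N f \<le> sqrt (1 + \<alpha> * (total * C\<^sup>2)) * es.N f"
    unfolding es.N_def F.N_def real_sqrt_mult .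
qed

lemma form_dense:
  assumes \<alpha>: "0 \<le> \<alpha>" and u: "u \<in> D" and \<epsilon>: "0 < \<epsilon>"
  shows "\<exists>w\<in>C_c. ip_space.N (form \<alpha>) (\<lambda>x. u x - w x) < \<epsilon>"
proof -
  interpret F: ip_space D "form \<alpha>" by (rule ip_form[OF \<alpha>])
  obtain \<phi> where \<phi>: "\<And>n. \<phi> n \<in> C_c" and lim: "(\<lambda>n. es.N (\<lambda>x. u x - \<phi> n x)) \<longlonglongrightarrow> 0"
    using u D_iff by blast
  have d: "(\<lambda>x. u x - \<phi> n x) \<in> D" for n by (rule F.diff[OF u subsetD[OF C_c_D \<phi>]])
  have "(\<lambda>n. sqrt (1 + \<alpha> * (total * C\<^sup>2)) * es.N (\<lambda>x. u x - \<phi> n x)) \<longlonglongrightarrow> 0"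
    by (rule tendsto_mult_right_zero[OF lim])
  then have "eventually (\<lambda>n. sqrt (1 + \<alpha> * (total * C\<^sup>2)) * es.N (\<lambda>x. u x - \<phi> n x) < \<epsilon>) sequentially"
    using \<epsilon> by (rule order_tendstoD)
  then obtain n where "sqrt (1 + \<alpha> * (total * C\<^sup>2)) * es.N (\<lambda>x. u x - \<phi> n x) < \<epsilon>"
    by (auto simp: eventually_sequentially)
  then show ?thesis using le_less_trans[OF form_N(2)[OF \<alpha> d]] \<phi> by blast
qed

text \<open>Elements of the form domain are bounded, so pairing with any \<open>h\<close> in
  \<open>L1\<close> is a continuous functional, of norm at most C times the norm of h. The weak
  equation is therefore solvable beyond the Hilbert space.\<close>

lemma form_riesz:
  assumes \<alpha>: "0 \<le> \<alpha>" and h: "h \<in> L1"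
  shows "\<exists>v\<in>D. \<forall>u\<in>D. form \<alpha> v u = pairing m h u"
proof -
  interpret F: ip_space D "form \<alpha>" by (rule ip_form[OF \<alpha>])
  show ?thesis
  proof (rule F.riesz[where W = C_c and K = "n1 h * C"])
    show "C_c \<subseteq> D" by (rule C_c_D)
    show "(C_c :: ('a \<Rightarrow> real) set) \<noteq> {}" using C_c_zero by blast
    show "(\<lambda>x. r * f x + s * g x) \<in> C_c" if "f \<in> C_c" "g \<in> C_c" for f g :: "'a \<Rightarrow> real" and r s
      by (rule C_c_comb[OF that])
    show "\<exists>w\<in>C_c. F.N (\<lambda>x. u x - w x) < \<epsilon>" if "u \<in> D" "0 < \<epsilon>" for u \<epsilon> by (rule form_dense[OF \<alpha> that])
    show "pairing m h (\<lambda>x. r * f x + s * g x) = r * pairing m h f + s * pairing m h g"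
      if "f \<in> D" "g \<in> D" for f g r s by (rule pairing_linf_comb[OF D_linf D_linf h]) (use that in auto)
    show "\<bar>pairing m h f\<bar> \<le> n1 h * C * F.N f" if "f \<in> D" for f
    proof -
      have "\<bar>pairing m h f\<bar> \<le> n1 h * (C * es.N f)" by (rule pairing_L1(2)[OF h D_sup[OF that]])
      also have "\<dots> \<le> n1 h * (C * F.N f)" by (intro mult_left_mono form_N(1)[OF \<alpha> that] C_nonneg) simp
      finally show ?thesis by simp
    qed
    fix w :: "nat \<Rightarrow> 'a \<Rightarrow> real"
    assume w: "\<And>n. w n \<in> C_c" and cau: "\<And>\<epsilon>. 0 < \<epsilon> \<Longrightarrow> \<exists>M. \<forall>i\<ge>M. \<forall>j\<ge>M. F.N (\<lambda>x. w i x - w j x) < \<epsilon>"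
    have wD: "w n \<in> D" for n using w C_c_D by auto
    have "\<exists>M. \<forall>i\<ge>M. \<forall>j\<ge>M. es.N (\<lambda>x. w i x - w j x) < \<epsilon>" if "0 < \<epsilon>" for \<epsilon>
      using cau[OF that] le_less_trans[OF form_N(1)[OF \<alpha> F.diff[OF wD wD]]] by meson
    from D_complete[OF w this] obtain v where v: "v \<in> D" "(\<lambda>n. es.N (\<lambda>x. v x - w n x)) \<longlonglongrightarrow> 0" by blast
    have d: "(\<lambda>x. v x - w n x) \<in> D" for n by (rule F.diff[OF v(1) wD])
    have "(\<lambda>n. F.N (\<lambda>x. v x - w n x)) \<longlonglongrightarrow> 0"
    proof (rule tendsto_sandwich[OF _ _ tendsto_const])
      show "(\<lambda>n. sqrt (1 + \<alpha> * (total * C\<^sup>2)) * es.N (\<lambda>x. v x - w n x)) \<longlonglongrightarrow> 0"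
        by (rule tendsto_mult_right_zero[OF v(2)])
    qed (use form_N(2)[OF \<alpha> d] F.N_nonneg[OF d] in auto)
    then show "\<exists>v\<in>D. (\<lambda>n. F.N (\<lambda>x. v x - w n x)) \<longlonglongrightarrow> 0" using v(1) by blast
  qed
qed

lemma form_unique:
  assumes \<alpha>: "0 \<le> \<alpha>" and v: "v \<in> D" "w \<in> D" and eq: "\<And>u. u \<in> D \<Longrightarrow> form \<alpha> v u = form \<alpha> w u"
  shows "v = w"
proof
  fix x
  interpret F: ip_space D "form \<alpha>" by (rule ip_form[OF \<alpha>])
  have d: "(\<lambda>x. v x - w x) \<in> D" by (rule F.diff[OF v])
  have "form \<alpha> (\<lambda>x. v x - w x) (\<lambda>x. v x - w x) = 0" using eq[OF d] by (simp add: F.B_diff[OF v d])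
  then have "F.N (\<lambda>x. v x - w x) = 0" by (simp add: F.N_def)
  then have "es.N (\<lambda>x. v x - w x) = 0" using form_N(1)[OF \<alpha> d] es.N_nonneg[OF D_energy[OF d]] by simp
  then show "v x = w x" using D_sup[OF d, of x] by simp
qed

text \<open>The resolvent of L at -\<alpha>, and the Green operator at \<alpha> = 0, available
  before L itself and on all of \<open>L1\<close>. The choice is unique by
  \<open>form_unique\<close>.\<close>

definition Res :: "real \<Rightarrow> ('a \<Rightarrow> real) \<Rightarrow> 'a \<Rightarrow> real" where
  "Res \<alpha> h = (SOME v. v \<in> D \<and> (\<forall>u\<in>D. form \<alpha> v u = pairing m h u))"

lemma Res:
  assumes "0 \<le> \<alpha>" "h \<in> L1"
  shows "Res \<alpha> h \<in> D" "u \<in> D \<Longrightarrow> form \<alpha> (Res \<alpha> h) u = pairing m h u"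
proof -
  have "\<exists>v. v \<in> D \<and> (\<forall>u\<in>D. form \<alpha> v u = pairing m h u)" using form_riesz[OF assms] by blast
  from someI_ex[OF this] show "Res \<alpha> h \<in> D" "u \<in> D \<Longrightarrow> form \<alpha> (Res \<alpha> h) u = pairing m h u"
    unfolding Res_def by auto
qed

lemma Res_unique:
  assumes "0 \<le> \<alpha>" "h \<in> L1" "v \<in> D" "\<And>u. u \<in> D \<Longrightarrow> form \<alpha> v u = pairing m h u"
  shows "Res \<alpha> h = v"
  using assms Res[OF assms(1,2)] by (intro form_unique[OF assms(1)]) auto

lemma Res_comb:
  assumes \<alpha>: "0 \<le> \<alpha>" and fg: "f \<in> L1" "g \<in> L1"
  shows "Res \<alpha> (\<lambda>x. r * f x + s * g x) = (\<lambda>x. r * Res \<alpha> f x + s * Res \<alpha> g x)"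
proof (rule Res_unique[OF \<alpha>])
  interpret F: ip_space D "form \<alpha>" by (rule ip_form[OF \<alpha>])
  show "(\<lambda>x. r * f x + s * g x) \<in> L1" by (intro L1_add(1) L1_cmult(1) fg)
  show "(\<lambda>x. r * Res \<alpha> f x + s * Res \<alpha> g x) \<in> D" by (intro D_comb Res \<alpha> fg)
  show "form \<alpha> (\<lambda>x. r * Res \<alpha> f x + s * Res \<alpha> g x) u = pairing m (\<lambda>x. r * f x + s * g x) u" if u: "u \<in> D" for u
    using F.B_comb[OF Res(1)[OF \<alpha> fg(1)] Res(1)[OF \<alpha> fg(2)] u] Res(2)[OF \<alpha> fg(1) u] Res(2)[OF \<alpha> fg(2) u]
      pairing_L1_comb[OF fg D_linf[OF u]] by simp
qed

lemma Res_sym: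
  assumes \<alpha>: "0 \<le> \<alpha>" and f: "f \<in> L1" and g: "g \<in> L1"
  shows "pairing m (Res \<alpha> f) g = pairing m f (Res \<alpha> g)"
proof -
  interpret F: ip_space D "form \<alpha>" by (rule ip_form[OF \<alpha>])
  note R = Res(1)[OF \<alpha> f] Res(1)[OF \<alpha> g]
  have "pairing m f (Res \<alpha> g) = form \<alpha> (Res \<alpha> f) (Res \<alpha> g)" using Res(2)[OF \<alpha> f R(2)] by simp
  also have "\<dots> = form \<alpha> (Res \<alpha> g) (Res \<alpha> f)" by (rule F.B_sym[OF R])
  also have "\<dots> = pairing m g (Res \<alpha> f)" by (rule Res(2)[OF \<alpha> g R(1)])
  finally show ?thesis by (simp add: pairing_commute[of g])
qed

text \<open>The constant C enters twice: testing the weak equation with its solution v gives N(v)^2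
  \<le> C n1(h) N(v), and then the supremum of v is at most C N(v).\<close>

lemma Res_bound:
  assumes \<alpha>: "0 \<le> \<alpha>" and h: "h \<in> L1"
  shows "\<bar>Res \<alpha> h x\<bar> \<le> C\<^sup>2 * n1 h"
proof -
  interpret F: ip_space D "form \<alpha>" by (rule ip_form[OF \<alpha>])
  define v where "v = Res \<alpha> h"
  have v: "v \<in> D" unfolding v_def by (rule Res(1)[OF \<alpha> h])
  have N0: "0 \<le> es.N v" using es.N_nonneg[OF D_energy[OF v]] .
  have "(es.N v)\<^sup>2 \<le> (F.N v)\<^sup>2" by (intro power_mono form_N(1)[OF \<alpha> v] N0)
  also have "\<dots> = pairing m h v" unfolding F.N_sq[OF v] using Res(2)[OF \<alpha> h v] by (simp add: v_def)
  also have "\<dots> \<le> n1 h * (C * es.N v)" using pairing_L1(2)[OF h, of v "C * es.N v"] D_sup[OF v] by (simp add: abs_le_iff)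
  finally have "es.N v * es.N v \<le> (C * n1 h) * es.N v" by (simp add: power2_eq_square mult_ac)
  then have "es.N v \<le> C * n1 h"
  proof (cases "es.N v = 0")
    case True
    then show ?thesis using C_nonneg by simp
  next
    case False
    then have "0 < es.N v" using N0 by simp
    then show ?thesis using \<open>es.N v * es.N v \<le> (C * n1 h) * es.N v\<close> by simp
  qed
  from mult_left_mono[OF this C_nonneg] D_sup[OF v, of x] show ?thesis by (simp add: v_def power2_eq_square)
qed

text \<open>With \<open>v = \<alpha> R\<^sub>\<alpha> h\<close>, the square of the form norm of \<open>u - v\<close> is, up to a constant,
  \<open>Q u + \<alpha> \<parallel>u - h\<parallel>\<^sup>2\<close>, which does not increase when \<open>u\<close> is cut off at \<open>0\<close> and \<open>1\<close>.\<close>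

lemma Res_markov:
  assumes \<alpha>: "0 < \<alpha>" and h: "\<And>x. 0 \<le> h x \<and> h x \<le> 1"
  shows "0 \<le> \<alpha> * Res \<alpha> h x \<and> \<alpha> * Res \<alpha> h x \<le> 1"
proof -
  have \<alpha>0: "0 \<le> \<alpha>" using \<alpha> by simp
  interpret F: ip_space D "form \<alpha>" by (rule ip_form[OF \<alpha>0])
  have hL: "h \<in> linf" by (rule linfI[of _ 1]) (use h in auto)
  have h1: "h \<in> L1" by (rule linf_L1[OF hL])
  define v where "v x = \<alpha> * Res \<alpha> h x" for x
  have v: "v \<in> D" unfolding v_def using F.cmult[OF Res(1)[OF \<alpha>0 h1]] .
  have fv: "form \<alpha> v u = \<alpha> * pairing m h u" if "u \<in> D" for u
    unfolding v_def F.B_cmult[OF Res(1)[OF \<alpha>0 h1] that] using Res(2)[OF \<alpha>0 h1 that] by simp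
  define cut where "cut w x = max 0 (min 1 (w x))" for w :: "'a \<Rightarrow> real" and x
  have cutc: "cut w \<in> C_c" if "w \<in> C_c" for w
    using that by (auto simp: C_c_def cut_def intro: rev_finite_subset)
  \<comment> \<open>The cut-off is applied to approximants in \<open>C_c\<close>, a class it visibly
    preserves, and not to the limit v.\<close>
  have le: "F.N (\<lambda>x. cut w x - v x) \<le> F.N (\<lambda>x. w x - v x)" if w: "w \<in> C_c" for w
  proof -
    have wD: "w \<in> D" "cut w \<in> D" using w cutc C_c_D by auto
    have J: "form \<alpha> (\<lambda>x. u x - v x) (\<lambda>x. u x - v x)
        = Q u u + \<alpha> * (pairing m u u - 2 * pairing m h u) + form \<alpha> v v" if "u \<in> D" for u
      using fv[OF that] F.B_sym[OF v that] unfolding F.B_quadratic_diff[OF that v]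
      by (simp add: form_def[of \<alpha> u u] algebra_simps)
    have Qle: "Q (cut w) (cut w) \<le> Q w w"
      by (rule energy_mono(2)) (use w C_c_energy in \<open>auto simp: cut_def max_def min_def\<close>)
    have P: "pairing m u u - 2 * pairing m h u = (\<Sum>\<^sub>\<infinity>x. (u x * u x - 2 * h x * u x) * m x)
        \<and> (\<lambda>x. (u x * u x - 2 * h x * u x) * m x) summable_on UNIV" if u: "u \<in> D" for u
    proof -
      have s: "(\<lambda>x. u x * u x * m x) summable_on UNIV" "(\<lambda>x. h x * u x * m x) summable_on UNIV"
        by (rule pairing_L1(1)[OF D_L1[OF u] linf_bound[OF D_linf[OF u]]])
          (rule pairing_L1(1)[OF h1 linf_bound[OF D_linf[OF u]]])
      have eq: "(\<lambda>x. (u x * u x - 2 * h x * u x) * m x) = (\<lambda>x. u x * u x * m x + (-2) * (h x * u x * m x))"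
        by (simp add: algebra_simps)
      show ?thesis
        unfolding eq using summable_on_add[OF s(1) summable_on_cmult_right[OF s(2)]]
        by (simp only: infsum_add[OF s(1) summable_on_cmult_right[OF s(2)]] infsum_cmult_right' pairing_def) simp
    qed
    have "pairing m (cut w) (cut w) - 2 * pairing m h (cut w) \<le> pairing m w w - 2 * pairing m h w"
      unfolding conjunct1[OF P[OF wD(1)]] conjunct1[OF P[OF wD(2)]]
    proof (rule infsum_mono)
      fix x
      \<comment> \<open>The cut-off is the projection onto [0,1], an interval that contains
        h(x).\<close>
      have "\<bar>cut w x - h x\<bar> \<le> \<bar>w x - h x\<bar>" using h[of x] by (auto simp: cut_def max_def min_def)
      then have "(cut w x - h x)\<^sup>2 \<le> (w x - h x)\<^sup>2" by (simp add: abs_le_square_iff)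
      then have "cut w x * cut w x - 2 * h x * cut w x \<le> w x * w x - 2 * h x * w x"
        by (simp add: power2_diff power2_eq_square algebra_simps)
      then show "(cut w x * cut w x - 2 * h x * cut w x) * m x \<le> (w x * w x - 2 * h x * w x) * m x"
        by (rule mult_right_mono) simp
    qed (use P wD in auto)
    then have "form \<alpha> (\<lambda>x. cut w x - v x) (\<lambda>x. cut w x - v x) \<le> form \<alpha> (\<lambda>x. w x - v x) (\<lambda>x. w x - v x)"
      unfolding J[OF wD(1)] J[OF wD(2)] using Qle \<alpha>0 by (intro add_mono mult_left_mono) auto
    then show ?thesis unfolding F.N_def by (rule real_sqrt_le_mono)
  qed
  have close: "\<exists>c. 0 \<le> c \<and> c \<le> 1 \<and> \<bar>c - v x\<bar> \<le> C * \<epsilon>" if \<epsilon>: "0 < \<epsilon>" for \<epsilon>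
  proof -
    obtain w where w: "w \<in> C_c" "F.N (\<lambda>x. v x - w x) < \<epsilon>" using form_dense[OF \<alpha>0 v \<epsilon>] by blast
    have wD: "w \<in> D" "cut w \<in> D" using w cutc C_c_D by auto
    have d: "(\<lambda>x. cut w x - v x) \<in> D" by (rule F.diff[OF wD(2) v])
    have "\<bar>cut w x - v x\<bar> \<le> C * es.N (\<lambda>x. cut w x - v x)" by (rule D_sup[OF d])
    also have "\<dots> \<le> C * F.N (\<lambda>x. w x - v x)"
      by (intro mult_left_mono order_trans[OF form_N(1)[OF \<alpha>0 d] le[OF w(1)]] C_nonneg)
    also have "\<dots> \<le> C * \<epsilon>"
      using w(2) F.N_diff_commute[OF v wD(1)] by (intro mult_left_mono C_nonneg) simp
    finally have "\<bar>cut w x - v x\<bar> \<le> C * \<epsilon>" .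
    moreover have "0 \<le> cut w x" "cut w x \<le> 1" by (auto simp: cut_def)
    ultimately show ?thesis by blast
  qed
  have "- \<epsilon> \<le> v x \<and> v x \<le> 1 + \<epsilon>" if \<epsilon>: "0 < \<epsilon>" for \<epsilon>
  proof -
    obtain c where "0 \<le> c" "c \<le> 1" "\<bar>c - v x\<bar> \<le> C * (\<epsilon> / (C + 1))" using close[of "\<epsilon> / (C + 1)"] \<epsilon> C_nonneg by auto
    moreover have "C * (\<epsilon> / (C + 1)) \<le> \<epsilon>" using \<epsilon> C_nonneg by (simp add: field_simps)
    ultimately show ?thesis by linarith
  qed
  then have "0 \<le> v x + \<epsilon>" "v x \<le> 1 + \<epsilon>" if "0 < \<epsilon>" for \<epsilon> using that by force+
  then have "0 \<le> v x" "v x \<le> 1" by (auto intro: field_le_epsilon)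
  then show ?thesis by (simp add: v_def)
qed

section \<open>The Green operator and its eigenfunctions\<close>

abbreviation GR :: "('a \<Rightarrow> real) \<Rightarrow> 'a \<Rightarrow> real" where "GR \<equiv> Res 0"

lemma GR_energy:
  assumes "f \<in> L1" "u \<in> D" shows "Q (GR f) u = pairing m f u"
  using Res(2)[of 0 f u] assms by (simp add: form_def)

lemma GR_l2: "f \<in> L1 \<Longrightarrow> GR f \<in> lp m 2"
  by (rule D_l2[OF Res(1)]) simp_all

lemma GR_sym: "f \<in> L1 \<Longrightarrow> g \<in> L1 \<Longrightarrow> pairing m (GR f) g = pairing m f (GR g)"
  by (rule Res_sym) simp_all

lemma GR_nonneg: "f \<in> L1 \<Longrightarrow> 0 \<le> pairing m (GR f) f"
proof -
  assume f: "f \<in> L1"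
  have D: "GR f \<in> D" by (rule Res(1)[OF order_refl f])
  show ?thesis using GR_energy[OF f D] es.B_nonneg[OF D_energy[OF D]]
    by (simp add: pairing_commute[of "GR f"])
qed

lemma indicator_C_c: "(\<lambda>x. if x = y then 1 else 0 :: real) \<in> C_c"
  by (simp add: C_c_def)

lemma GR_inj:
  assumes f: "f \<in> L1" and 0: "GR f = (\<lambda>x. 0)"
  shows "f = (\<lambda>x. 0)"
proof
  fix y
  have D: "(\<lambda>x. if x = y then 1 else 0) \<in> D" by (rule subsetD[OF C_c_D indicator_C_c])
  have "f y * m y = Q (GR f) (\<lambda>x. if x = y then 1 else 0)"
    using GR_energy[OF f D] by (simp add: pairing_indicator)
  also have "\<dots> = 0" unfolding 0 by (simp add: energy_form_def case_prod_unfold)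
  finally show "f y = 0" using m_pos[of y] by simp
qed

lemma GR_pos:
  assumes f: "f \<in> L1" and nz: "f \<noteq> (\<lambda>x. 0)"
  shows "0 < pairing m (GR f) f"
proof (rule ccontr)
  assume "\<not> ?thesis"
  then have "pairing m f (GR f) = 0" using GR_nonneg[OF f] by (simp add: pairing_commute[of f])
  then have "es.N (GR f) = 0" using GR_energy[OF f Res(1)[OF _ f]] by (simp add: es.N_def)
  then have "GR f x = 0" for x using D_sup[OF Res(1)[OF _ f], of 0 x] by simp
  then show False using GR_inj[OF f] nz by auto
qed

lemma GR_diff: "f \<in> L1 \<Longrightarrow> g \<in> L1 \<Longrightarrow> GR (\<lambda>x. f x - g x) = (\<lambda>x. GR f x - GR g x)"
  using Res_comb[of 0 f g 1 "-1"] by simp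

lemma GR_cmult: "f \<in> L1 \<Longrightarrow> GR (\<lambda>x. r * f x) = (\<lambda>x. r * GR f x)"
  using Res_comb[of 0 f f r 0] by simp

text \<open>The supremum of the quadratic form of \<open>GR\<close> over the unit sphere of an invariant subspace is
  attained, because \<open>GR\<close> maps bounded sequences to sequences that converge along a subsequence.\<close>

lemma eigenvector_exists:
  assumes E0: "E0 \<subseteq> lp m 2" "\<And>e. e \<in> E0 \<Longrightarrow> \<exists>\<kappa>. GR e = (\<lambda>x. \<kappa> * e x)"
    and f0: "f0 \<in> lp m 2" "f0 \<noteq> (\<lambda>x. 0)" "\<And>e. e \<in> E0 \<Longrightarrow> pairing m f0 e = 0"
  shows "\<exists>f\<in>lp m 2. pairing m f f = 1 \<and> (\<forall>e\<in>E0. pairing m f e = 0) \<and> (\<exists>\<kappa>>0. GR f = (\<lambda>x. \<kappa> * f x))"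
proof -
  define W where "W = {f \<in> lp m 2. \<forall>e\<in>E0. pairing m f e = 0}"
  have W2: "f \<in> lp m 2" if "f \<in> W" for f using that by (simp add: W_def)
  have W1: "f \<in> L1" if "f \<in> W" for f by (rule L1_l2(1)[OF W2[OF that]])
  have Wcomb: "(\<lambda>x. r * f x + s * g x) \<in> W" if "f \<in> W" "g \<in> W" for f g r s
    using that E0(1) l2.comb[of f g r s] by (auto simp: W_def l2.B_comb)
  have WG: "GR f \<in> W" if f: "f \<in> W" for f
    unfolding W_def
  proof (intro CollectI conjI ballI GR_l2 W1 f)
    fix e assume e: "e \<in> E0"
    then obtain \<kappa> where \<kappa>: "GR e = (\<lambda>x. \<kappa> * e x)" using E0(2) by blast
    have e2: "e \<in> lp m 2" using E0(1) e by auto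
    have "pairing m (GR f) e = pairing m f (\<lambda>x. \<kappa> * e x)" using GR_sym[OF W1[OF f] L1_l2(1)[OF e2]] \<kappa> by simp
    also have "\<dots> = \<kappa> * pairing m f e" by (rule l2.B_cmult_right[OF e2 W2[OF f]])
    finally show "pairing m (GR f) e = 0" using f e by (simp add: W_def)
  qed
  define q where "q f = pairing m (GR f) f" for f
  define S where "S = q ` {f \<in> W. pairing m f f = 1}"
  have cmW: "(\<lambda>x. r * f x) \<in> W" if "f \<in> W" for f r using Wcomb[OF that that, of r 0] by simp
  have qsc: "q (\<lambda>x. r * f x) = r\<^sup>2 * q f" and psc: "pairing m (\<lambda>x. r * f x) (\<lambda>x. r * f x) = r\<^sup>2 * pairing m f f"
    if f: "f \<in> W" for f r
  proof -
    note f2 = W2[OF f]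
    note Gf2 = W2[OF WG[OF f]]
    show "q (\<lambda>x. r * f x) = r\<^sup>2 * q f"
      unfolding q_def GR_cmult[OF W1[OF f]] l2.B_cmult[OF Gf2 l2.cmult[OF f2]] l2.B_cmult_right[OF f2 Gf2]
      by (simp add: power2_eq_square)
    show "pairing m (\<lambda>x. r * f x) (\<lambda>x. r * f x) = r\<^sup>2 * pairing m f f"
      unfolding l2.B_cmult[OF f2 l2.cmult[OF f2]] l2.B_cmult_right[OF f2 f2] by (simp add: power2_eq_square)
  qed
  have normalize: "\<exists>g\<in>W. pairing m g g = 1 \<and> q g = q f / pairing m f f"
    if f: "f \<in> W" and nz: "f \<noteq> (\<lambda>x. 0)" for f
  proof -
    have p: "0 < pairing m f f"
      using l2_zero[OF W2[OF f]] nz l2.B_nonneg[OF W2[OF f]] by (auto simp: less_le)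
    define r where "r = 1 / sqrt (pairing m f f)"
    have r: "r\<^sup>2 = 1 / pairing m f f" using p by (simp add: r_def power_divide)
    have "pairing m (\<lambda>x. r * f x) (\<lambda>x. r * f x) = 1" unfolding psc[OF f] r using p by simp
    moreover have "q (\<lambda>x. r * f x) = q f / pairing m f f" unfolding qsc[OF f] r by simp
    ultimately show ?thesis using cmW[OF f, of r] by blast
  qed
  have f0W: "f0 \<in> W" using f0 by (simp add: W_def)
  have n1W: "n1 f \<le> total + 1" if "f \<in> W" "pairing m f f = 1" for f
  proof -
    have "lp_norm m 2 f = 1"
      using lp2(2)[OF W2[OF that(1)]] that(2) lp_norm_nonneg[OF W2[OF that(1)]] by (simp add: power2_eq_1_iff)
    then show ?thesis using L1_l2(2)[OF W2[OF that(1)]] by simp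
  qed
  define Kb where "Kb = C\<^sup>2 * (total + 1)"
  have Gb: "\<bar>GR f x\<bar> \<le> Kb" if "f \<in> W" "pairing m f f = 1" for f x
    unfolding Kb_def
    by (rule order_trans[OF Res_bound[OF order_refl W1[OF that(1)]]]) (intro mult_left_mono n1W that, simp)
  have Sb: "s \<le> (total + 1) * Kb" if s: "s \<in> S" for s
  proof -
    obtain f where f: "f \<in> W" "pairing m f f = 1" "s = q f" using s by (auto simp: S_def)
    have "\<bar>pairing m f (GR f)\<bar> \<le> n1 f * Kb" by (rule pairing_L1(2)[OF W1[OF f(1)] Gb[OF f(1,2)]])
    also have "\<dots> \<le> (total + 1) * Kb" by (intro mult_right_mono n1W f) (simp add: Kb_def)
    finally show ?thesis by (simp add: f(3) q_def pairing_commute[of _ f] abs_le_iff)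
  qed
  have bdd: "bdd_above S" using Sb by (auto simp: bdd_above_def)
  define M where "M = Sup S"
  obtain g0 where g0: "g0 \<in> W" "pairing m g0 g0 = 1" using normalize[OF f0W f0(2)] by blast
  have Sne: "S \<noteq> {}" using g0 by (auto simp: S_def)
  have qM: "q f \<le> M * pairing m f f" if f: "f \<in> W" for f
  proof (cases "f = (\<lambda>x. 0)")
    case True
    have "pairing m (GR f) f = 0" "pairing m f f = 0" unfolding True by (simp_all add: pairing_def)
    then show ?thesis by (simp add: q_def)
  next
    case False
    obtain g where g: "g \<in> W" "pairing m g g = 1" "q g = q f / pairing m f f" using normalize[OF f False] by blast
    have "q g \<in> S" unfolding S_def using g(1,2) by (intro imageI) simp
    then have "q f / pairing m f f \<le> M" unfolding M_def g(3) by (rule cSup_upper[OF _ bdd])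
    moreover have "0 < pairing m f f"
      using l2_zero[OF W2[OF f]] False l2.B_nonneg[OF W2[OF f]] by (auto simp: less_le)
    ultimately show ?thesis by (simp add: divide_le_eq)
  qed
  have Mpos: "0 < M"
  proof -
    have "0 < q f0" unfolding q_def by (rule GR_pos[OF W1[OF f0W] f0(2)])
    also have "\<dots> \<le> M * pairing m f0 f0" by (rule qM[OF f0W])
    finally show ?thesis using l2.B_nonneg[OF f0(1)] by (simp add: zero_less_mult_iff)
  qed
  \<comment> \<open>As M is the supremum of the quotients, this form is nonnegative on
    \<open>W\<close>; maximizers are its null vectors, so Cauchy-Schwarz in the semi-definite
    setting is what is needed.\<close>
  interpret P: ip_space W "\<lambda>f g. M * pairing m f g - pairing m (GR f) g"
  proof
    fix f g h :: "'a \<Rightarrow> real" and r s :: real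
    assume f: "f \<in> W" and g: "g \<in> W"
    show "(\<lambda>x. r * f x + s * g x) \<in> W" by (rule Wcomb[OF f g])
    show "M * pairing m f g - pairing m (GR f) g = M * pairing m g f - pairing m (GR g) f"
      using GR_sym[OF W1[OF f] W1[OF g]] by (simp add: pairing_commute)
    assume h: "h \<in> W"
    show "M * pairing m (\<lambda>x. r * f x + s * g x) h - pairing m (GR (\<lambda>x. r * f x + s * g x)) h
        = r * (M * pairing m f h - pairing m (GR f) h) + s * (M * pairing m g h - pairing m (GR g) h)"
      unfolding Res_comb[OF order_refl W1[OF f] W1[OF g]]
      by (simp add: l2.B_comb W2 f g h WG algebra_simps)
  next
    show "0 \<le> M * pairing m f f - pairing m (GR f) f" if "f \<in> W" for f
      using qM[OF that] by (simp add: q_def)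
  qed
  define Pf where "Pf f x = M * f x + (- 1) * GR f x" for f :: "'a \<Rightarrow> real" and x
  have PfW: "Pf f \<in> W" if "f \<in> W" for f unfolding Pf_def by (rule Wcomb[OF that WG[OF that]])
  \<comment> \<open>Cauchy-Schwarz for this form, with \<open>Pf f\<close> as second argument: the
    square of p is at most the form at f times the form at \<open>Pf f\<close>, and the latter is at
    most M p. Cancelling p shows that almost maximizers are almost eigenfunctions.\<close>
  have Pf_le: "pairing m (Pf f) (Pf f) \<le> M * (M * pairing m f f - q f)" if f: "f \<in> W" for f
  proof -
    define p where "p = pairing m (Pf f) (Pf f)"
    have p0: "0 \<le> p" unfolding p_def by (rule l2.B_nonneg[OF W2[OF PfW[OF f]]])
    have "p = M * pairing m f (Pf f) + (-1) * pairing m (GR f) (Pf f)"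
      unfolding p_def by (subst (1) Pf_def[abs_def]) (rule l2.B_comb[OF W2[OF f] W2[OF WG[OF f]] W2[OF PfW[OF f]]])
    then have "p = M * pairing m f (Pf f) - pairing m (GR f) (Pf f)" by simp
    then have "p\<^sup>2 \<le> (M * pairing m f f - q f) * (M * p - q (Pf f))"
      using P.cauchy_schwarz[OF f PfW[OF f]] by (simp add: p_def q_def)
    also have "\<dots> \<le> (M * pairing m f f - q f) * (M * p)"
      using qM[OF f] GR_nonneg[OF W1[OF PfW[OF f]]] by (intro mult_left_mono) (simp_all add: q_def)
    finally have "p * p \<le> (M * (M * pairing m f f - q f)) * p" by (simp add: power2_eq_square mult_ac)
    then show ?thesis
      using p0 qM[OF f] Mpos unfolding p_def[symmetric]
      by (cases "p = 0") (simp_all add: mult_le_cancel_right)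
  qed
  have "\<exists>f. f \<in> W \<and> pairing m f f = 1 \<and> M - 1 / real (Suc n) < q f" for n
  proof -
    have "\<exists>s\<in>S. M - 1 / real (Suc n) < s" unfolding M_def by (rule less_cSupD[OF Sne]) simp
    then show ?thesis by (auto simp: S_def)
  qed
  then obtain f where f: "\<And>n. f n \<in> W" "\<And>n. pairing m (f n) (f n) = 1" "\<And>n. M - 1 / real (Suc n) < q (f n)" by metis
  have inv: "(\<lambda>n. 1 / real (Suc n)) \<longlonglongrightarrow> 0" using LIMSEQ_inverse_real_of_nat by (simp add: inverse_eq_divide)
  have Plim: "(\<lambda>n. lp_norm m 2 (Pf (f n))) \<longlonglongrightarrow> 0"
  proof -
    have "(\<lambda>n. pairing m (Pf (f n)) (Pf (f n))) \<longlonglongrightarrow> 0"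
    proof (rule tendsto_sandwich[OF _ _ tendsto_const])
      show "(\<lambda>n. M * (1 / real (Suc n))) \<longlonglongrightarrow> 0" by (rule tendsto_mult_right_zero[OF inv])
      have "pairing m (Pf (f n)) (Pf (f n)) \<le> M * (1 / real (Suc n))" for n
      proof (rule order_trans[OF Pf_le[OF f(1)] mult_left_mono])
        show "M * pairing m (f n) (f n) - q (f n) \<le> 1 / real (Suc n)" using f(2)[of n] f(3)[of n] by simp
      qed (use Mpos in simp)
      then show "\<forall>\<^sub>F n in sequentially. pairing m (Pf (f n)) (Pf (f n)) \<le> M * (1 / real (Suc n))" by simp
      show "\<forall>\<^sub>F n in sequentially. 0 \<le> pairing m (Pf (f n)) (Pf (f n))"
        using l2.B_nonneg[OF W2[OF PfW[OF f(1)]]] by simp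
    qed
    from tendsto_real_sqrt[OF this] show ?thesis
      by (simp add: l2.N_def[symmetric] l2_N[OF W2[OF PfW[OF f(1)]]])
  qed
  obtain k where k: "strict_mono k" "\<And>x. \<exists>l. (\<lambda>n. GR (f (k n)) x) \<longlonglongrightarrow> l"
    using function_convergent_subsequence[OF countable_X, of "\<lambda>n. GR (f n)" Kb] Gb[OF f(1,2)]
    by (metis UNIV_I real_norm_def)
  then obtain h where h: "\<And>x. (\<lambda>n. GR (f (k n)) x) \<longlonglongrightarrow> h x" by metis
  have hb: "norm (h x) \<le> Kb" for x
    by (rule tendsto_upperbound[OF tendsto_norm[OF h]]) (use Gb[OF f(1,2)] in auto)
  have h2: "h \<in> lp m 2" by (rule bounded_lp(1)[OF one_le_2 hb])
  have Glim: "(\<lambda>n. lp_norm m 2 (\<lambda>x. GR (f (k n)) x - h x)) \<longlonglongrightarrow> 0"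
  proof (rule lp_dominated[OF one_le_2 _ _ h])
    show "\<forall>\<^sub>F n in sequentially. \<forall>x. norm (GR (f (k n)) x - h x) \<le> Kb + Kb"
    proof (intro always_eventually allI order_trans[OF norm_triangle_ineq4] add_mono hb)
      show "norm (GR (f (k n)) x) \<le> Kb" for n x using Gb[OF f(1,2)] by simp
    qed
  qed simp
  \<comment> \<open>Since f = (Pf f + GR f)/M, where the first term tends to 0 and the second
    converges to h along the subsequence, the maximizers themselves converge to h/M in norm.\<close>
  define v where "v x = 1 / M * h x" for x
  have v2: "v \<in> lp m 2" unfolding v_def by (rule lp_cmult(1)[OF one_le_2 h2])
  have fk2: "f (k n) \<in> lp m 2" for n by (rule W2[OF f(1)])
  have dv: "(\<lambda>x. f (k n) x - v x) \<in> lp m 2" for n by (rule lp_diff(1)[OF one_le_2 fk2 v2])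
  have vlim: "(\<lambda>n. lp_norm m 2 (\<lambda>x. f (k n) x - v x)) \<longlonglongrightarrow> 0"
  proof (rule tendsto_sandwich[OF _ _ tendsto_const])
    have "(\<lambda>n. 1 / M * (4 * (lp_norm m 2 (Pf (f (k n))) + lp_norm m 2 (\<lambda>x. GR (f (k n)) x - h x)))) \<longlonglongrightarrow> 1 / M * (4 * (0 + 0))"
      by (intro tendsto_intros Glim LIMSEQ_subseq_LIMSEQ[OF Plim k(1), unfolded comp_def])
    then show "(\<lambda>n. 1 / M * (4 * (lp_norm m 2 (Pf (f (k n))) + lp_norm m 2 (\<lambda>x. GR (f (k n)) x - h x)))) \<longlonglongrightarrow> 0" by simp
    have "lp_norm m 2 (\<lambda>x. f (k n) x - v x) \<le> 1 / M * (4 * (lp_norm m 2 (Pf (f (k n))) + lp_norm m 2 (\<lambda>x. GR (f (k n)) x - h x)))" for n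
    proof -
      have Gh: "(\<lambda>x. GR (f (k n)) x - h x) \<in> lp m 2" by (rule lp_diff(1)[OF one_le_2 W2[OF WG[OF f(1)]] h2])
      have Pk: "Pf (f (k n)) \<in> lp m 2" by (rule W2[OF PfW[OF f(1)]])
      have "(\<lambda>x. f (k n) x - v x) = (\<lambda>x. 1 / M * (Pf (f (k n)) x + (GR (f (k n)) x - h x)))"
        using Mpos by (simp add: Pf_def v_def fun_eq_iff field_simps)
      then have "lp_norm m 2 (\<lambda>x. f (k n) x - v x) = norm (1 / M) * lp_norm m 2 (\<lambda>x. Pf (f (k n)) x + (GR (f (k n)) x - h x))"
        using lp_cmult(2)[OF one_le_2 lp_add(1)[OF one_le_2 Pk Gh], of "1 / M"] by simp
      also have "\<dots> \<le> norm (1 / M) * (4 * (lp_norm m 2 (Pf (f (k n))) + lp_norm m 2 (\<lambda>x. GR (f (k n)) x - h x)))"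
        by (intro mult_left_mono lp_add(2)[OF one_le_2 Pk Gh]) simp
      finally show ?thesis using Mpos by simp
    qed
    then show "\<forall>\<^sub>F n in sequentially. lp_norm m 2 (\<lambda>x. f (k n) x - v x) \<le> 1 / M * (4 * (lp_norm m 2 (Pf (f (k n))) + lp_norm m 2 (\<lambda>x. GR (f (k n)) x - h x)))"
      by simp
    show "\<forall>\<^sub>F n in sequentially. 0 \<le> lp_norm m 2 (\<lambda>x. f (k n) x - v x)" using lp_norm_nonneg[OF dv] by simp
  qed
  have plim: "(\<lambda>n. pairing m (f (k n)) e) \<longlonglongrightarrow> pairing m v e" if e: "e \<in> lp m 2" for e
  proof -
    have "(\<lambda>n. pairing m (f (k n)) e - pairing m v e) \<longlonglongrightarrow> 0"
    proof (rule Lim_null_comparison[OF always_eventually], rule allI)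
      show "(\<lambda>n. lp_norm m 2 (\<lambda>x. f (k n) x - v x) * lp_norm m 2 e) \<longlonglongrightarrow> 0" by (rule tendsto_mult_left_zero[OF vlim])
      fix n
      show "norm (pairing m (f (k n)) e - pairing m v e) \<le> lp_norm m 2 (\<lambda>x. f (k n) x - v x) * lp_norm m 2 e"
        using l2.B_le_N[OF dv e, of n] unfolding l2.B_diff[OF fk2 v2 e] l2_N[OF dv] l2_N[OF e] by simp
    qed
    then show ?thesis by (simp add: LIM_zero_iff)
  qed
  have vE: "pairing m v e = 0" if "e \<in> E0" for e
  proof -
    have "e \<in> lp m 2" using that E0(1) by auto
    moreover have "pairing m (f (k n)) e = 0" for n using f(1) that by (simp add: W_def)
    ultimately show ?thesis using plim[of e] LIMSEQ_unique[OF _ tendsto_const] by auto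
  qed
  \<comment> \<open>The convergence is in norm, so the limit stays on the unit sphere and is not
    0.\<close>
  have v1: "pairing m v v = 1"
  proof -
    have fn: "lp_norm m 2 (f n) = 1" for n using f(2)[of n] l2_N[OF W2[OF f(1)], of n] by (simp add: l2.N_def)
    have "(\<lambda>n. lp_norm m 2 (f (k n)) - lp_norm m 2 v) \<longlonglongrightarrow> 0"
    proof (rule Lim_null_comparison[OF always_eventually vlim], rule allI)
      fix n
      have "l2.N (f (k n)) - l2.N v \<le> l2.N (\<lambda>x. f (k n) x - v x)" using l2.N_le_diff[OF fk2 v2, of n] by simp
      moreover have "l2.N v - l2.N (f (k n)) \<le> l2.N (\<lambda>x. f (k n) x - v x)"
        using l2.N_le_diff[OF v2 fk2, of n] l2.N_diff_commute[OF fk2 v2, of n] by simp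
      ultimately show "norm (lp_norm m 2 (f (k n)) - lp_norm m 2 v) \<le> lp_norm m 2 (\<lambda>x. f (k n) x - v x)"
        unfolding l2_N[OF fk2] l2_N[OF v2] l2_N[OF dv] by (simp add: abs_le_iff)
    qed
    then have "(\<lambda>n::nat. 1 - lp_norm m 2 v) \<longlonglongrightarrow> 0" by (simp only: fn)
    then have "lp_norm m 2 v = 1" using LIMSEQ_unique[OF tendsto_const] by fastforce
    then show ?thesis using lp2(2)[OF v2] by simp
  qed
  have Gv: "GR v = h"
  proof
    fix x
    have vL: "v \<in> L1" by (rule L1_l2(1)[OF v2])
    have "(\<lambda>n. GR (f (k n)) x - GR v x) \<longlonglongrightarrow> 0"
    proof (rule Lim_null_comparison[OF always_eventually], rule allI)
      show "(\<lambda>n. C\<^sup>2 * ((total + 1) * lp_norm m 2 (\<lambda>x. f (k n) x - v x))) \<longlonglongrightarrow> 0"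
        by (intro tendsto_mult_right_zero vlim)
      fix n
      have "norm (GR (f (k n)) x - GR v x) = \<bar>GR (\<lambda>x. f (k n) x - v x) x\<bar>"
        by (simp add: GR_diff[OF W1[OF f(1)] vL])
      also have "\<dots> \<le> C\<^sup>2 * n1 (\<lambda>x. f (k n) x - v x)" by (rule Res_bound[OF order_refl L1_l2(1)[OF dv]])
      also have "\<dots> \<le> C\<^sup>2 * ((total + 1) * lp_norm m 2 (\<lambda>x. f (k n) x - v x))"
        by (intro mult_left_mono L1_l2(2)[OF dv]) simp
      finally show "norm (GR (f (k n)) x - GR v x) \<le> C\<^sup>2 * ((total + 1) * lp_norm m 2 (\<lambda>x. f (k n) x - v x))" .
    qed
    then have "(\<lambda>n. GR (f (k n)) x) \<longlonglongrightarrow> GR v x" by (simp add: LIM_zero_iff)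
    then show "GR v x = h x" using h LIMSEQ_unique by blast
  qed
  have "GR v = (\<lambda>x. M * v x)" unfolding Gv using Mpos by (simp add: v_def fun_eq_iff)
  then show ?thesis using v2 v1 vE Mpos by blast
qed

text \<open>Take a maximal orthonormal family of eigenfunctions. If a nonzero function were
  orthogonal to it, \<open>eigenvector_exists\<close> would supply one more eigenfunction in the
  orthogonal complement.\<close>

lemma eigenbasis_exists:
  "\<exists>E. E \<subseteq> lp m 2 \<and> (\<forall>e\<in>E. \<forall>e'\<in>E. pairing m e e' = (if e = e' then 1 else 0)) \<and>
    (\<forall>e\<in>E. \<exists>\<kappa>>0. GR e = (\<lambda>x. \<kappa> * e x)) \<and>
    (\<forall>f\<in>lp m 2. (\<forall>e\<in>E. pairing m f e = 0) \<longrightarrow> f = (\<lambda>x. 0))"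
proof -
  define A where "A = {E. E \<subseteq> lp m 2 \<and> (\<forall>e\<in>E. \<forall>e'\<in>E. pairing m e e' = (if e = e' then 1 else 0)) \<and>
    (\<forall>e\<in>E. \<exists>\<kappa>>0. GR e = (\<lambda>x. \<kappa> * e x))}"
  have "\<exists>M\<in>A. \<forall>X\<in>A. M \<subseteq> X \<longrightarrow> X = M"
  proof (rule subset_Zorn')
    fix Ch assume ch: "subset.chain A Ch"
    then have sub: "Ch \<subseteq> A" by (simp add: subset_chain_def)
    have two: "\<exists>X\<in>Ch. e \<in> X \<and> e' \<in> X" if "e \<in> \<Union>Ch" "e' \<in> \<Union>Ch" for e e'
      using that ch unfolding subset_chain_def by blast
    show "\<Union>Ch \<in> A"
      unfolding A_def
    proof (intro CollectI conjI ballI)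
      show "\<Union>Ch \<subseteq> lp m 2" using sub by (auto simp: A_def)
      show "pairing m e e' = (if e = e' then 1 else 0)" if "e \<in> \<Union>Ch" "e' \<in> \<Union>Ch" for e e'
        using two[OF that] sub unfolding A_def by blast
      show "\<exists>\<kappa>>0. GR e = (\<lambda>x. \<kappa> * e x)" if "e \<in> \<Union>Ch" for e
        using that sub unfolding A_def by blast
    qed
  qed
  then obtain E where E: "E \<in> A" and max: "\<And>X. X \<in> A \<Longrightarrow> E \<subseteq> X \<Longrightarrow> X = E" by blast
  have E2: "E \<subseteq> lp m 2" and orth: "\<And>e e'. e \<in> E \<Longrightarrow> e' \<in> E \<Longrightarrow> pairing m e e' = (if e = e' then 1 else 0)"
    and eig: "\<And>e. e \<in> E \<Longrightarrow> \<exists>\<kappa>>0. GR e = (\<lambda>x. \<kappa> * e x)" using E by (auto simp: A_def)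
  have "f0 = (\<lambda>x. 0)" if f0: "f0 \<in> lp m 2" "\<forall>e\<in>E. pairing m f0 e = 0" for f0
  proof (rule ccontr)
    assume nz: "f0 \<noteq> (\<lambda>x. 0)"
    obtain f \<kappa> where f: "f \<in> lp m 2" "pairing m f f = 1" "\<forall>e\<in>E. pairing m f e = 0" "0 < \<kappa>" "GR f = (\<lambda>x. \<kappa> * f x)"
      using eigenvector_exists[OF E2 _ f0(1) nz] f0(2) eig by blast
    have "insert f E \<in> A"
      unfolding A_def
    proof (intro CollectI conjI ballI)
      show "insert f E \<subseteq> lp m 2" using f E2 by simp
      show "\<exists>\<kappa>>0. GR e = (\<lambda>x. \<kappa> * e x)" if "e \<in> insert f E" for e using that f eig by blast
      show "pairing m e e' = (if e = e' then 1 else 0)" if "e \<in> insert f E" "e' \<in> insert f E" for e e'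
      proof -
        have "pairing m g f = 0" if "g \<in> E" for g using f(3) that pairing_commute[of f g] by auto
        moreover have "f \<notin> E" using f(2,3) by auto
        ultimately show ?thesis using that f(2,3) orth by (cases "e = f"; cases "e' = f") auto
      qed
    qed
    then have "f \<in> E" using max by blast
    then show False using f(2,3) by auto
  qed
  then show ?thesis using E2 orth eig by (intro exI[of _ E] conjI ballI allI impI) simp_all
qed

section \<open>From the eigenfunctions to the Dirichlet operator\<close>

lemma pairing_sum:
  assumes "\<And>i. i \<in> I \<Longrightarrow> f i \<in> lp m 2" "g \<in> lp m 2"
  shows "pairing m (\<lambda>x. \<Sum>i\<in>I. w i * f i x) g = (\<Sum>i\<in>I. w i * pairing m (f i) g)"
  using assms(1)
proof (induction I rule: infinite_finite_induct)
  case (insert i I)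
  have "(\<lambda>x. \<Sum>i\<in>I. w i * f i x) \<in> lp m 2"
    by (intro lp_sum lp_cmult one_le_2) (use insert in auto)
  then have "pairing m (\<lambda>x. w i * f i x + 1 * (\<Sum>i\<in>I. w i * f i x)) g
      = w i * pairing m (f i) g + 1 * pairing m (\<lambda>x. \<Sum>i\<in>I. w i * f i x) g"
    by (intro l2.B_comb assms(2)) (use insert in auto)
  then show ?case using insert by simp
qed (simp_all add: pairing_def)

text \<open>The resolvent identity between the parameters \<alpha> and 0; it transports the
  eigenfunctions of the Green operator to all resolvents.\<close>

lemma Res_GR:
  assumes \<alpha>: "0 \<le> \<alpha>" and f: "f \<in> L1"
  shows "GR (\<lambda>x. 1 * f x + (- \<alpha>) * Res \<alpha> f x) = Res \<alpha> f"
proof (rule Res_unique)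
  note R = Res(1)[OF \<alpha> f]
  show "(\<lambda>x. 1 * f x + (- \<alpha>) * Res \<alpha> f x) \<in> L1" by (intro L1_add(1) L1_cmult(1) f D_L1[OF R])
  show "form 0 (Res \<alpha> f) u = pairing m (\<lambda>x. 1 * f x + (- \<alpha>) * Res \<alpha> f x) u" if u: "u \<in> D" for u
    using Res(2)[OF \<alpha> f u] unfolding pairing_L1_comb[OF f D_L1[OF R] D_linf[OF u]] by (simp add: form_def)
qed (use Res(1)[OF \<alpha> f] in auto)

text \<open>With w the difference of \<phi> and \<alpha> times its resolvent, the weak equation
  gives \<open>form \<alpha>\<close> at w equal to Q(\<phi>, w). This yields an explicit rate at
  which the scaled resolvents approach the identity on \<open>C_c\<close>.\<close>

lemma Res_strong:
  assumes \<phi>: "\<phi> \<in> C_c" and \<alpha>: "0 < \<alpha>"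
  shows "\<alpha> * (lp_norm m 2 (\<lambda>x. \<phi> x - \<alpha> * Res \<alpha> \<phi> x))\<^sup>2 \<le> Q \<phi> \<phi>"
proof -
  have \<alpha>0: "0 \<le> \<alpha>" using \<alpha> by simp
  have pD: "\<phi> \<in> D" using \<phi> C_c_D by auto
  have p1: "\<phi> \<in> L1" by (rule D_L1[OF pD])
  interpret F: ip_space D "form \<alpha>" by (rule ip_form[OF \<alpha>0])
  note R = Res(1)[OF \<alpha>0 p1]
  define v where "v x = \<alpha> * Res \<alpha> \<phi> x" for x
  have v: "v \<in> D" unfolding v_def by (rule F.cmult[OF R])
  have d: "(\<lambda>x. \<phi> x - v x) \<in> D" by (rule F.diff[OF pD v])
  have "form \<alpha> (\<lambda>x. \<phi> x - v x) (\<lambda>x. \<phi> x - v x) = form \<alpha> \<phi> (\<lambda>x. \<phi> x - v x) - form \<alpha> v (\<lambda>x. \<phi> x - v x)"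
    by (rule F.B_diff[OF pD v d])
  also have "form \<alpha> v (\<lambda>x. \<phi> x - v x) = \<alpha> * pairing m \<phi> (\<lambda>x. \<phi> x - v x)"
    using F.B_cmult[OF R d, of \<alpha>] Res(2)[OF \<alpha>0 p1 d] by (simp add: v_def[abs_def])
  finally have eq: "form \<alpha> (\<lambda>x. \<phi> x - v x) (\<lambda>x. \<phi> x - v x) = Q \<phi> (\<lambda>x. \<phi> x - v x)" by (simp add: form_def)
  note e = D_energy[OF pD] D_energy[OF d]
  have N: "(es.N (\<lambda>x. \<phi> x - v x))\<^sup>2 + \<alpha> * pairing m (\<lambda>x. \<phi> x - v x) (\<lambda>x. \<phi> x - v x) \<le> es.N \<phi> * es.N (\<lambda>x. \<phi> x - v x)"
    using eq es.B_le_N[OF e] unfolding es.N_sq[OF e(2)] form_def by (simp add: abs_le_iff)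
  have pn: "0 \<le> \<alpha> * pairing m (\<lambda>x. \<phi> x - v x) (\<lambda>x. \<phi> x - v x)" using \<alpha>0 l2.B_nonneg[OF D_l2[OF d]] by simp
  \<comment> \<open>The energy of w on the right is absorbed by the one on the left.\<close>
  have "2 * (es.N \<phi> * es.N (\<lambda>x. \<phi> x - v x)) \<le> (es.N \<phi>)\<^sup>2 + (es.N (\<lambda>x. \<phi> x - v x))\<^sup>2"
    using sum_squares_bound[of "es.N \<phi>" "es.N (\<lambda>x. \<phi> x - v x)"] by simp
  then have "\<alpha> * pairing m (\<lambda>x. \<phi> x - v x) (\<lambda>x. \<phi> x - v x) \<le> (es.N \<phi>)\<^sup>2"
    using N pn zero_le_power2[of "es.N (\<lambda>x. \<phi> x - v x)"] zero_le_power2[of "es.N \<phi>"] by linarith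
  then show ?thesis by (simp add: lp2(2)[OF D_l2[OF d, unfolded v_def]] es.N_sq[OF e(1)] v_def)
qed

lemma markov_eigenbasis_exists:
  "\<exists>E \<mu>. markov_eigenbasis m E \<mu> (C\<^sup>2) \<and> dirichlet_operator b c m = eigenbasis.green_inv m E \<mu> 1 2"
proof -
  obtain E where E2: "E \<subseteq> lp m 2" and orth: "\<forall>e\<in>E. \<forall>e'\<in>E. pairing m e e' = (if e = e' then 1 else 0)"
    and eig: "\<forall>e\<in>E. \<exists>\<kappa>>0. GR e = (\<lambda>x. \<kappa> * e x)"
    and compl': "\<forall>f\<in>lp m 2. (\<forall>e\<in>E. pairing m f e = 0) \<longrightarrow> f = (\<lambda>x. 0)"
    using eigenbasis_exists by (elim exE conjE) (rule that)
  have compl: "f = (\<lambda>x. 0)" if "f \<in> lp m 2" "\<forall>e\<in>E. pairing m f e = 0" for f using compl' that by simp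
  obtain \<mu> where \<mu>: "\<And>e. e \<in> E \<Longrightarrow> 0 < \<mu> e" "\<And>e. e \<in> E \<Longrightarrow> GR e = (\<lambda>x. \<mu> e * e x)" using bchoice[OF eig] by (elim exE) (rule that, auto)
  have EL: "e \<in> L1" if "e \<in> E" for e using that E2 L1_l2(1) by auto
  have El2: "e \<in> lp m 2" if "e \<in> E" for e using that E2 by auto
  have eq: "e = (\<lambda>x. 1 / \<mu> e * GR e x)" if "e \<in> E" for e using \<mu>[OF that] by (simp add: fun_eq_iff)
  have ED: "e \<in> D" if "e \<in> E" for e
    using D_comb[OF Res(1)[OF order_refl EL[OF that]] Res(1)[OF order_refl EL[OF that]], of "1 / \<mu> e" 0] eq[OF that] by simp
  have Elinf: "e \<in> linf" if "e \<in> E" for e by (rule D_linf[OF ED[OF that]])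
  have GRc: "pairing m (GR f) e = \<mu> e * pairing m f e" if f: "f \<in> L1" and e: "e \<in> E" for f e
  proof -
    have "pairing m (GR f) e = pairing m f (\<lambda>x. \<mu> e * e x)" using GR_sym[OF f EL[OF e]] \<mu>(2)[OF e] by simp
    also have "\<dots> = \<mu> e * pairing m f e"
      using pairing_linf_comb[OF Elinf[OF e] Elinf[OF e] f, of "\<mu> e" 0] by simp
    finally show ?thesis .
  qed
  interpret eb: eigenbasis m E \<mu> "C\<^sup>2"
  proof
    show "countable (UNIV :: 'a set)" by (rule countable_X)
    show "(\<Sum>e\<in>F. \<mu> e * (e x)\<^sup>2) \<le> C\<^sup>2" if F: "finite F" "F \<subseteq> E" for F x
    proof -
      \<comment> \<open>\<open>g\<close> is the truncated expansion of the unit point mass at x and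
        \<open>u\<close> its image under \<open>GR\<close>, a truncated Green function. Hence Q(u) =
        u(x) = s, and the supremum bound at x reads s \<le> C sqrt(s).\<close>
      define g where "g = (\<lambda>y. \<Sum>e\<in>F. e x * e y)"
      define u where "u = (\<lambda>y. \<Sum>e\<in>F. (\<mu> e * e x) * e y)"
      have g2: "g \<in> lp m 2" unfolding g_def by (intro lp_sum lp_cmult one_le_2 El2) (use F in auto)
      have u2: "u \<in> lp m 2" unfolding u_def by (intro lp_sum lp_cmult one_le_2 El2) (use F in auto)
      have gF: "pairing m g e = (if e \<in> F then e x else 0)" "pairing m u e = (if e \<in> F then \<mu> e * e x else 0)" if e: "e \<in> E" for e
      proof -
        have *: "pairing m (\<lambda>y. \<Sum>e\<in>F. w e * e y) e = (if e \<in> F then w e else 0)" for w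
        proof -
          have "pairing m (\<lambda>y. \<Sum>e\<in>F. w e * e y) e = (\<Sum>e'\<in>F. w e' * pairing m e' e)"
            by (rule pairing_sum[of F "\<lambda>e. e"]) (use F El2 e in auto)
          also have "\<dots> = (\<Sum>e'\<in>F. if e' = e then w e else 0)"
            by (intro sum.cong refl) (use F orth e in auto)
          finally show ?thesis using F by simp
        qed
        show "pairing m g e = (if e \<in> F then e x else 0)" "pairing m u e = (if e \<in> F then \<mu> e * e x else 0)"
          unfolding g_def u_def by (rule *)+
      qed
      have g1: "g \<in> L1" by (rule L1_l2(1)[OF g2])
      have "(\<lambda>x. GR g x - u x) = (\<lambda>x. 0)"
      proof (rule compl)
        show "(\<lambda>x. GR g x - u x) \<in> lp m 2" by (rule l2.diff[OF GR_l2[OF g1] u2])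
        show "\<forall>e\<in>E. pairing m (\<lambda>x. GR g x - u x) e = 0"
          by (auto simp: l2.B_diff[OF GR_l2[OF g1] u2 El2] GRc[OF g1] gF)
      qed
      then have Gg: "GR g = u" by (simp add: fun_eq_iff)
      have uD: "u \<in> D" unfolding Gg[symmetric] by (rule Res(1)[OF order_refl g1])
      define s where "s = (\<Sum>e\<in>F. \<mu> e * (e x)\<^sup>2)"
      have s0: "0 \<le> s" unfolding s_def using F \<mu>(1) by (intro sum_nonneg) (auto simp: less_imp_le subset_eq)
      have ux: "u x = s" by (simp add: u_def s_def power2_eq_square mult.assoc)
      have "Q u u = pairing m g u" using GR_energy[OF g1 uD] Gg by simp
      also have "\<dots> = pairing m u g" by (rule pairing_commute)
      also have "\<dots> = (\<Sum>e\<in>F. (\<mu> e * e x) * pairing m e g)"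
        unfolding u_def by (rule pairing_sum[of F "\<lambda>e. e"]) (use F El2 g2 in auto)
      also have "\<dots> = (\<Sum>e\<in>F. (\<mu> e * e x) * e x)"
        by (intro sum.cong refl) (use F gF pairing_commute[of _ g] in auto)
      finally have "Q u u = s" by (simp add: s_def power2_eq_square mult.assoc)
      then have "s \<le> C * sqrt s" using D_sup[OF uD, of x] ux s0 by (simp add: es.N_def)
      then have "s\<^sup>2 \<le> (C * sqrt s)\<^sup>2" using s0 by (intro power_mono)
      then have "s * s \<le> C\<^sup>2 * s" using s0 by (simp add: power_mult_distrib power2_eq_square[of s])
      then show ?thesis using s0 unfolding s_def[symmetric] by (cases "s = 0") (simp_all add: mult_le_cancel_right)
    qed
    show "f = (\<lambda>x. 0)" if f: "f \<in> L1" and 0: "\<And>e. e \<in> E \<Longrightarrow> pairing m f e = 0" for f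
    \<comment> \<open>Completeness in the Hilbert space suffices for \<open>L1\<close>: the image
      under \<open>GR\<close> is square summable, its coefficients vanish too, and \<open>GR\<close>
      is injective.\<close>
    proof (rule GR_inj[OF f compl[OF GR_l2[OF f]]])
      show "\<forall>e\<in>E. pairing m (GR f) e = 0" using GRc[OF f] 0 by simp
    qed
  qed (use \<mu> Elinf orth in auto)
  have G: "eb.G f = GR f" if f: "f \<in> L1" for f
    by (rule eb.T_eqI[OF eb.mult_bound_mu f D_L1[OF Res(1)[OF order_refl f]]]) (simp add: eb.coef_pairing GRc[OF f])
  have Res_coef: "pairing m (Res \<alpha> f) e = eb.res_mult \<alpha> e * pairing m f e"
    if \<alpha>: "0 < \<alpha>" and f: "f \<in> L1" and e: "e \<in> E" for \<alpha> f e
  proof -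
    have \<alpha>0: "0 \<le> \<alpha>" using \<alpha> by simp
    note R = Res(1)[OF \<alpha>0 f]
    have d: "(\<lambda>x. 1 * f x + (- \<alpha>) * Res \<alpha> f x) \<in> L1" by (intro L1_add(1) L1_cmult(1) f D_L1[OF R])
    have "pairing m (Res \<alpha> f) e = \<mu> e * pairing m (\<lambda>x. 1 * f x + (- \<alpha>) * Res \<alpha> f x) e"
      using GRc[OF d e] Res_GR[OF \<alpha>0 f] by simp
    also have "pairing m (\<lambda>x. 1 * f x + (- \<alpha>) * Res \<alpha> f x) e = 1 * pairing m f e + (- \<alpha>) * pairing m (Res \<alpha> f) e"
      by (rule pairing_L1_comb[OF f D_L1[OF R] Elinf[OF e]])
    finally have "(1 + \<alpha> * \<mu> e) * pairing m (Res \<alpha> f) e = \<mu> e * pairing m f e" by (simp add: algebra_simps)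
    moreover have "0 < 1 + \<alpha> * \<mu> e" using \<mu>(1)[OF e] \<alpha> by (simp add: add_pos_pos)
    ultimately show ?thesis by (simp add: eb.res_mult_def field_simps)
  qed
  have mb: "eb.mult_bound \<alpha> (\<lambda>e. \<alpha> * eb.res_mult \<alpha> e)" if "0 < \<alpha>" for \<alpha>
    using eb.mult_bound_res_mult[OF that] that by (auto simp: eb.mult_bound_def abs_mult)
  have TR: "eb.T (\<lambda>e. \<alpha> * eb.res_mult \<alpha> e) f = (\<lambda>x. \<alpha> * Res \<alpha> f x)" if \<alpha>: "0 < \<alpha>" and f: "f \<in> L1" for \<alpha> f
  proof (rule eb.T_eqI[OF mb[OF \<alpha>] f])
    have R: "Res \<alpha> f \<in> L1" using D_L1[OF Res(1)[OF less_imp_le[OF \<alpha>] f]] .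
    show "(\<lambda>x. \<alpha> * Res \<alpha> f x) \<in> L1" by (rule L1_cmult(1)[OF R])
    show "eb.coef (\<lambda>x. \<alpha> * Res \<alpha> f x) e = \<alpha> * eb.res_mult \<alpha> e * eb.coef f e" if e: "e \<in> E" for e
      using eb.coef_cmult[OF R Elinf[OF e], of \<alpha>] Res_coef[OF \<alpha> f e] by (simp add: eb.coef_pairing)
  qed
  have mk: "markov (eb.ker (\<lambda>e. \<alpha> * eb.res_mult \<alpha> e))" if \<alpha>: "0 < \<alpha>" for \<alpha>
    unfolding markov_def
  proof (intro allI impI)
    fix f :: "'a \<Rightarrow> real" and x
    assume f: "\<forall>y. 0 \<le> f y \<and> f y \<le> 1"
    have "f \<in> L1" by (rule bounded_L1(1)[where K = 1]) (use f in auto)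
    then show "0 \<le> eb.T (\<lambda>e. \<alpha> * eb.res_mult \<alpha> e) f x \<and> eb.T (\<lambda>e. \<alpha> * eb.res_mult \<alpha> e) f x \<le> 1"
      using TR[OF \<alpha>] Res_markov[OF \<alpha>, of f x] f by simp
  qed
  \<comment> \<open>With n+1 as parameter, the scaled resolvent v(n) of \<phi> equals
    \<open>G\<close> of the bounded function g(n). It tends to \<phi> pointwise by
    \<open>Res_strong\<close> and is bounded by the supremum of \<phi> by the Markov property, so
    dominated convergence covers every finite exponent.\<close>
  have dense_Cc: "\<exists>g\<in>linf. lp_norm m p (\<lambda>x. \<phi> x - eb.G g x) < \<epsilon>"
    if p: "1 \<le> p" "p \<noteq> \<infinity>" and \<phi>: "\<phi> \<in> C_c" and \<epsilon>: "0 < \<epsilon>" for p \<phi> \<epsilon>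
  proof -
    have pD: "\<phi> \<in> D" using \<phi> C_c_D by auto
    have p1: "\<phi> \<in> L1" by (rule D_L1[OF pD])
    define v where "v n x = real (Suc n) * Res (real (Suc n)) \<phi> x" for n x
    define g where "g n x = real (Suc n) * (\<phi> x - v n x)" for n x
    have RD: "Res (real (Suc n)) \<phi> \<in> D" for n by (rule Res(1)[OF _ p1]) simp
    have vD: "v n \<in> D" for n using D_comb[OF RD RD, of "real (Suc n)" n 0] by (simp add: v_def[abs_def])
    have dD: "(\<lambda>x. \<phi> x - v n x) \<in> D" for n using D_comb[OF pD vD, of 1 "-1" n] by simp
    have gD: "g n \<in> D" for n using D_comb[OF dD dD, of "real (Suc n)" n 0] by (simp add: g_def[abs_def])
    have Gg: "eb.G (g n) = v n" for n
    proof -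
      have "GR (\<lambda>x. real (Suc n) * (1 * \<phi> x + (- real (Suc n)) * Res (real (Suc n)) \<phi> x)) = v n"
        using GR_cmult[OF L1_add(1)[OF L1_cmult(1)[OF p1] L1_cmult(1)[OF D_L1[OF RD]]], of "real (Suc n)" 1 "- real (Suc n)" n]
          Res_GR[OF _ p1, of "real (Suc n)"] by (simp add: v_def[abs_def] del: of_nat_Suc)
      moreover have "(\<lambda>x. real (Suc n) * (1 * \<phi> x + (- real (Suc n)) * Res (real (Suc n)) \<phi> x)) = g n"
        by (simp add: g_def v_def fun_eq_iff del: of_nat_Suc)
      ultimately show ?thesis by (simp add: G[OF D_L1[OF gD]])
    qed
    have nl: "lp_norm m 2 (\<lambda>x. \<phi> x - v n x) \<le> sqrt (Q \<phi> \<phi> * (1 / real (Suc n)))" for n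
    proof (rule real_le_rsqrt)
      show "(lp_norm m 2 (\<lambda>x. \<phi> x - v n x))\<^sup>2 \<le> Q \<phi> \<phi> * (1 / real (Suc n))"
        using Res_strong[OF \<phi>, of "real (Suc n)"] by (simp add: v_def pos_le_divide_eq mult.commute del: of_nat_Suc)
    qed
    have inv: "(\<lambda>n. 1 / real (Suc n)) \<longlonglongrightarrow> 0" using LIMSEQ_inverse_real_of_nat by (simp add: inverse_eq_divide)
    have pt: "(\<lambda>n. v n x) \<longlonglongrightarrow> \<phi> x" for x
    proof -
      have "(\<lambda>n. v n x - \<phi> x) \<longlonglongrightarrow> 0"
      proof (rule Lim_null_comparison[OF always_eventually], rule allI)
        have "(\<lambda>n. (total + 1) / m x * sqrt (Q \<phi> \<phi> * (1 / real (Suc n)))) \<longlonglongrightarrow> (total + 1) / m x * sqrt (Q \<phi> \<phi> * 0)"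
          by (intro tendsto_intros inv)
        then show "(\<lambda>n. (total + 1) / m x * sqrt (Q \<phi> \<phi> * (1 / real (Suc n)))) \<longlonglongrightarrow> 0" by simp
        fix n
        have "norm (\<phi> x - v n x) \<le> (total + 1) / m x * lp_norm m 2 (\<lambda>x. \<phi> x - v n x)"
          by (rule lp_point[OF one_le_2 D_l2[OF dD]])
        also have "\<dots> \<le> (total + 1) / m x * sqrt (Q \<phi> \<phi> * (1 / real (Suc n)))" by (intro mult_left_mono nl) simp
        finally show "norm (v n x - \<phi> x) \<le> (total + 1) / m x * sqrt (Q \<phi> \<phi> * (1 / real (Suc n)))"
          by (simp add: abs_minus_commute)
      qed
      then show ?thesis by (simp add: LIM_zero_iff)
    qed
    have vb: "norm (v n x) \<le> sup_norm \<phi>" for n x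
    proof -
      have \<alpha>: "0 < real (Suc n)" by simp
      have "\<bar>eb.T (\<lambda>e. real (Suc n) * eb.res_mult (real (Suc n)) e) \<phi> x\<bar> \<le> sup_norm \<phi>"
        by (rule markov_sup[OF mk[OF \<alpha>] linf_bound[OF D_linf[OF pD]] eb.ker_kernel_bound[OF mb[OF \<alpha>]]])
      then show ?thesis unfolding TR[OF \<alpha> p1] by (simp add: v_def)
    qed
    have "(\<lambda>n. lp_norm m p (\<lambda>x. v n x - \<phi> x)) \<longlonglongrightarrow> 0"
    proof (rule lp_dominated[OF p _ pt])
      show "\<forall>\<^sub>F n in sequentially. \<forall>x. norm (v n x - \<phi> x) \<le> sup_norm \<phi> + sup_norm \<phi>"
      proof (intro always_eventually allI order_trans[OF norm_triangle_ineq4] add_mono vb)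
        show "norm (\<phi> x) \<le> sup_norm \<phi>" for x using linf_bound[OF D_linf[OF pD]] by simp
      qed
    qed
    then have "eventually (\<lambda>n. lp_norm m p (\<lambda>x. v n x - \<phi> x) < \<epsilon>) sequentially"
      using \<epsilon> by (rule order_tendstoD)
    then obtain n where "lp_norm m p (\<lambda>x. v n x - \<phi> x) < \<epsilon>" by (auto simp: eventually_sequentially)
    then have "lp_norm m p (\<lambda>x. \<phi> x - eb.G (g n) x) < \<epsilon>" unfolding Gg using lp_norm_sub_commute[of p \<phi> "v n"] by simp
    then show ?thesis using D_linf[OF gD] by blast
  qed
  interpret me: markov_eigenbasis m E \<mu> "C\<^sup>2"
  proof
    show "markov (eb.ker (\<lambda>e. \<alpha> * eb.res_mult \<alpha> e))" if "0 < \<alpha>" for \<alpha> by (rule mk[OF that])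
    fix p :: ennreal and f :: "'a \<Rightarrow> real" and \<epsilon> :: real
    assume p: "1 \<le> p" "p \<noteq> \<infinity>" and f: "f \<in> lp m p" and \<epsilon>: "0 < \<epsilon>"
    obtain \<phi> where \<phi>: "\<phi> \<in> C_c" "lp_norm m p (\<lambda>x. f x - \<phi> x) < \<epsilon> / 8"
      using C_c_dense[OF p f, of "\<epsilon> / 8"] \<epsilon> by auto
    obtain g where g: "g \<in> linf" "lp_norm m p (\<lambda>x. \<phi> x - eb.G g x) < \<epsilon> / 8"
      using dense_Cc[OF p \<phi>(1), of "\<epsilon> / 8"] \<epsilon> by auto
    have pl: "\<phi> \<in> lp m p" by (rule C_c_lp[OF p(1) \<phi>(1)])
    have Gl: "eb.G g \<in> lp m p" by (rule linf_lp[OF p(1) eb.T_linf[OF eb.mult_bound_mu linf_L1[OF g(1)]]])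
    have "lp_norm m p (\<lambda>x. f x - eb.G g x) = lp_norm m p (\<lambda>x. (f x - \<phi> x) + (\<phi> x - eb.G g x))" by simp
    also have "\<dots> \<le> 4 * (lp_norm m p (\<lambda>x. f x - \<phi> x) + lp_norm m p (\<lambda>x. \<phi> x - eb.G g x))"
      by (intro lp_add(2) lp_diff(1) p(1) f pl Gl)
    also have "\<dots> < 4 * (\<epsilon> / 8 + \<epsilon> / 8)" by (intro mult_strict_left_mono add_strict_mono \<phi>(2) g(2)) simp
    finally have "lp_norm m p (\<lambda>x. f x - eb.G g x) < \<epsilon>" by simp
    then show "\<exists>g\<in>linf. lp_norm m p (\<lambda>x. f x - eb.G g x) < \<epsilon>" using g(1) by blast
  qed
  have green_inv: "eb.green_inv 1 2 = {(GR g, g) | g. g \<in> lp m 2}"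
    unfolding eb.green_inv_def using G[OF L1_l2(1)] by auto
  have DG: "GR g \<in> D" if "g \<in> lp m 2" for g using Res(1)[OF order_refl L1_l2(1)[OF that]] .
  have "dirichlet_operator b c m = eb.green_inv 1 2"
    unfolding dirichlet_operator_def
  proof (rule the_equality)
    have lin: "linear_operator m 2 (eb.green_inv 1 2)"
      unfolding linear_operator_def
    proof (intro conjI)
      show "eb.green_inv 1 2 \<subseteq> lp m 2 \<times> lp m 2" using GR_l2[OF L1_l2(1)] by (auto simp: green_inv)
      show "single_valued (eb.green_inv 1 2)"
      proof (rule single_valuedI)
        fix f g h assume "(f, g) \<in> eb.green_inv 1 2" "(f, h) \<in> eb.green_inv 1 2"
        then have gh: "g \<in> lp m 2" "h \<in> lp m 2" "GR g = GR h" by (auto simp: green_inv)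
        note L = L1_l2(1)[OF gh(1)] L1_l2(1)[OF gh(2)]
        have "(\<lambda>x. g x - h x) = (\<lambda>x. 0)"
          by (rule GR_inj[OF L1_diff(1)[OF L]]) (simp add: GR_diff[OF L] gh(3))
        then show "g = h" by (simp add: fun_eq_iff)
      qed
      have z: "(\<lambda>x. 0::real) \<in> lp m 2" by (rule lp_zero(1)[OF one_le_2])
      have "GR (\<lambda>x. 0) = (\<lambda>x. 0)" using GR_cmult[OF L1_l2(1)[OF z], of 0] by simp
      then show "(\<lambda>x. 0, \<lambda>x. 0) \<in> eb.green_inv 1 2" using z by (auto simp: green_inv intro!: exI[of _ "\<lambda>x. 0"])
      show "\<forall>(f, g)\<in>eb.green_inv 1 2. \<forall>(f', g')\<in>eb.green_inv 1 2. \<forall>r s.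
          (\<lambda>x. r * f x + s * f' x, \<lambda>x. r * g x + s * g' x) \<in> eb.green_inv 1 2"
        using Res_comb[OF order_refl L1_l2(1) L1_l2(1)] l2.comb by (auto simp: green_inv)
    qed
    have dense: "closure_wrt (lp_norm m 2) (lp m 2) (Domain (eb.green_inv 1 2)) = lp m 2"
    proof -
      have "\<exists>\<phi>\<in>Domain (eb.green_inv 1 2). lp_norm m 2 (\<lambda>x. f x - \<phi> x) < \<epsilon>"
        if f: "f \<in> lp m 2" and \<epsilon>: "0 < \<epsilon>" for f :: "'a \<Rightarrow> real" and \<epsilon>
      proof -
        obtain g where g: "g \<in> linf" "lp_norm m 2 (\<lambda>x. f x - eb.G g x) < \<epsilon>"
          using me.G_dense[OF one_le_2 _ f \<epsilon>] by auto
        have "(eb.G g, g) \<in> eb.green_inv 1 2" using G[OF linf_L1[OF g(1)]] linf_lp[OF one_le_2 g(1)] by (auto simp: green_inv)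
        then show ?thesis using g(2) by blast
      qed
      then show ?thesis by (auto simp: closure_wrt_def)
    qed
    have adj: "adjoint_operator m 2 (eb.green_inv 1 2) = eb.green_inv 1 2"
    proof (intro equalityI subsetI)
      fix u assume "u \<in> adjoint_operator m 2 (eb.green_inv 1 2)"
      then obtain f h where u: "u = (f, h)" and f: "f \<in> lp m 2" and h: "h \<in> lp m 2"
        and *: "\<And>g. g \<in> lp m 2 \<Longrightarrow> pairing m f g = pairing m h (GR g)"
        by (force simp: adjoint_operator_def green_inv)
      note hL = L1_l2(1)[OF h]
      have d: "(\<lambda>x. f x - GR h x) \<in> lp m 2" by (rule l2.diff[OF f GR_l2[OF hL]])
      have "pairing m (\<lambda>x. f x - GR h x) (\<lambda>x. f x - GR h x) = 0"
        using *[OF d] GR_sym[OF hL L1_l2(1)[OF d]] by (simp add: l2.B_diff[OF f GR_l2[OF hL] d])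
      from l2_zero[OF d this] have "f = GR h" by (simp add: fun_eq_iff)
      then show "u \<in> eb.green_inv 1 2" using u h by (auto simp: green_inv)
    next
      fix u assume "u \<in> eb.green_inv 1 2"
      then obtain h where h: "h \<in> lp m 2" "u = (GR h, h)" by (auto simp: green_inv)
      show "u \<in> adjoint_operator m 2 (eb.green_inv 1 2)"
        using h GR_sym[OF L1_l2(1)[OF h(1)] L1_l2(1)] GR_l2[OF L1_l2(1)[OF h(1)]]
        by (auto simp: adjoint_operator_def green_inv)
    qed
    show "selfadjoint m (eb.green_inv 1 2) \<and> (\<forall>(f, g)\<in>eb.green_inv 1 2. 0 \<le> pairing m g f) \<and>
        Domain (eb.green_inv 1 2) \<subseteq> D \<and> (\<forall>(f, g)\<in>eb.green_inv 1 2. \<forall>h\<in>D. pairing m g h = Q f h)"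
      using lin dense adj DG GR_nonneg[OF L1_l2(1)] GR_energy[OF L1_l2(1)]
      by (auto simp: selfadjoint_def green_inv pairing_commute)
    fix A assume A: "selfadjoint m A \<and> (\<forall>(f, g)\<in>A. 0 \<le> pairing m g f) \<and> Domain A \<subseteq> D \<and>
        (\<forall>(f, g)\<in>A. \<forall>h\<in>D. pairing m g h = Q f h)"
    have sub: "A \<subseteq> eb.green_inv 1 2"
    proof
      fix u assume u: "u \<in> A"
      obtain f g where fg: "u = (f, g)" by (cases u)
      have f: "f \<in> D" using A u fg by auto
      have g: "g \<in> lp m 2" using A u fg by (auto simp: selfadjoint_def linear_operator_def)
      have Afg: "pairing m g h = Q f h" if "h \<in> D" for h using A u fg that by fast
      have "GR g = f"
        by (rule Res_unique[OF order_refl L1_l2(1)[OF g] f]) (use Afg in \<open>simp add: form_def\<close>)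
      then show "u \<in> eb.green_inv 1 2" using g fg by (auto simp: green_inv)
    qed
    \<comment> \<open>Taking adjoints reverses the inclusion; both operators are their own
      adjoints.\<close>
    then have "adjoint_operator m 2 (eb.green_inv 1 2) \<subseteq> adjoint_operator m 2 A"
      by (auto simp: adjoint_operator_def)
    then show "A = eb.green_inv 1 2" using A adj sub by (auto simp: selfadjoint_def)
  qed
  then show ?thesis using me.markov_eigenbasis_axioms by blast
qed

end

theorem theorem7p2:
  fixes b :: "'a \<Rightarrow> 'a \<Rightarrow> real" and c m :: "'a \<Rightarrow> real"
    and L :: "(('a \<Rightarrow> real) \<times> ('a \<Rightarrow> real)) set"
  assumes "countable (UNIV :: 'a set)" and "infinite (UNIV :: 'a set)"
    and "weighted_graph b c" and "uniformly_transient b c"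
    and "\<forall>x. 0 < m x" and "m summable_on UNIV"
    and "L = dirichlet_operator b c m"
  shows
    "((\<forall>t>0. trace_class m (exp_neg m L t)) \<and> (\<forall>\<alpha>>0. trace_class m (resolvent m L \<alpha>))) \<and>
     purely_discrete_spectrum m 2 L \<and>
     ((\<exists>C. sup_energy_bound b c C) \<and>
      (\<forall>C. sup_energy_bound b c C \<longrightarrow>
         ereal (1 / (C\<^sup>2 * (\<Sum>\<^sub>\<infinity>x. m x))) \<le> (INF z\<in>spectrum m 2 L. ereal (Re z)))) \<and>
     ((\<forall>p\<ge>1.
         norm_analytic_on m p {0<..} (\<lambda>t. on_lp m p (exp_neg m L t)) \<and>
         norm_analytic_on m p {0<..} (\<lambda>\<alpha>. on_lp m p (resolvent m L \<alpha>)) \<and>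
         (\<forall>t>0. compact_operator m p (on_lp m p (exp_neg m L t))) \<and>
         (\<forall>\<alpha>>0. compact_operator m p (on_lp m p (resolvent m L \<alpha>)))) \<and>
      (\<forall>p\<ge>1. \<forall>q\<ge>1.
         spectrum m p (lp_generator m p (exp_neg m L)) =
         spectrum m q (lp_generator m q (exp_neg m L))))"
proof -
  interpret fw: finite_weights m by unfold_locales (use assms in auto)
  interpret gr: graph b c by unfold_locales (use assms in auto)
  have ex: "\<exists>E \<mu>. markov_eigenbasis m E \<mu> (C\<^sup>2) \<and> L = eigenbasis.green_inv m E \<mu> 1 2" if "sup_energy_bound b c C" for C
  proof -
    interpret transient_graph m b c C by unfold_locales (use assms that in auto)
    show ?thesis using markov_eigenbasis_exists assms(7) by simp
  qed
  obtain C where C: "sup_energy_bound b c C"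
    using gr.sup_energy_bound_exists[OF assms(4,2)] by blast
  obtain E \<mu> where E: "markov_eigenbasis m E \<mu> (C\<^sup>2)" and L: "L = eigenbasis.green_inv m E \<mu> 1 2" using ex[OF C] by blast
  \<comment> \<open>Each admissible constant brings an eigenbasis of its own, with \<open>K0\<close>
    equal to the square of that constant; the spectrum of L is the same in all of them.\<close>
  have low: "ereal (1 / (C\<^sup>2 * (\<Sum>\<^sub>\<infinity>x. m x))) \<le> (INF z\<in>spectrum m 2 L. ereal (Re z))"
    if bd: "sup_energy_bound b c C" for C
  proof -
    obtain E \<mu> where E: "markov_eigenbasis m E \<mu> (C\<^sup>2)" and L: "L = eigenbasis.green_inv m E \<mu> 1 2" using ex[OF bd] by blast
    interpret markov_eigenbasis m E \<mu> "C\<^sup>2" by (rule E)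
    show ?thesis using spectrum_lower_bound by (simp add: L fw.total_def)
  qed
  interpret markov_eigenbasis m E \<mu> "C\<^sup>2" by (rule E)
  show ?thesis using spectral_statements C low unfolding L by blast
qed

end
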